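(* Let $V\in\mathcal{R}\cap L^1(\mathbb{R}^3)$ be real-valued, let $\sigma>0$, and let $\eta:[0,1]\to[0,+\infty)$ be smooth with $\eta(0)=\eta(1)=1$. For $\varepsilon\in(0,1]$ set $V_\varepsilon(x):=\eta(\varepsilon)\varepsilon^{-\sigma}V(x/\varepsilon)$ and let $H_\varepsilon:=-\Delta+V_\varepsilon$ be the lower semi-bounded self-adjoint operator on $L^2(\mathbb{R}^3)$ defined as form sum with form domain $H^1(\mathbb{R}^3)$. (i) Let $\sigma\in[0,3]$. When $\sigma=2$ assume that $-1$ is not an eigenvalue of $u(-\Delta)^{-1}v$, and when $\sigma\in(2,3]$ assume that $V>0$ almost everywhere. Then $H_\varepsilon\to-\Delta$ as $\varepsilon\downarrow0$ in the norm resolvent sense when $\sigma\in[0,2]$, and in the strong resolvent sense when $\sigma\in(2,3]$, where $-\Delta$ is the self-adjoint Laplacian with domain $H^2(\mathbb{R}^3)$. (ii) Let $\sigma=2$, assume $(1+|\cdot|)V\in L^1(\mathbb{R}^3)$ and that $V$ satisfies the zero-energy resonance condition, with eigenfunction $\phi$ normalised by $\int_{\mathbb{R}^3}\mathrm{sign}(V)|\phi|^2\,\mathrm{d}x=-1$ and resonance function $\psi=(-\Delta)^{-1}v\phi$, and set $\alpha:=-\eta'(0)\big/\big|\int_{\mathbb{R}^3}V\psi\,\mathrm{d}x\big|^2$. Then $H_\varepsilon\to-\Delta_\alpha$ as $\varepsilon\downarrow0$ in the norm resolvent sense.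
   Context: $(-\Delta)^{-1}$ is the integral operator with kernel $\frac{1}{4\pi|x-y|}$. The Rollnik class $\mathcal{R}$ consists of measurable $f$ on $\mathbb{R}^3$ with $\iint\frac{|f(x)||f(y)|}{|x-y|^2}\,\mathrm{d}x\,\mathrm{d}y<\infty$. Put $v:=\sqrt{|V|}$, $u:=\mathrm{sign}(V)\sqrt{|V|}$; $u(-\Delta)^{-1}v$ is a compact operator on $L^2(\mathbb{R}^3)$. $V$ satisfies the zero-energy resonance condition if $-1$ is a simple eigenvalue of $u(-\Delta)^{-1}v$, i.e. there is $\phi\in L^2\setminus\{0\}$, unique up to multiples, with $u(-\Delta)^{-1}v\phi=-\phi$, and $\psi:=(-\Delta)^{-1}v\phi\in L^2_{\mathrm{loc}}(\mathbb{R}^3)\setminus L^2(\mathbb{R}^3)$ (equivalently $\int V\psi\ne0$). For $\lambda>0$ let $G_\lambda(x):=\frac{e^{-|x|\sqrt\lambda}}{4\pi|x|}$. For $\alpha\in\mathbb{R}$, $-\Delta_\alpha$ is the self-adjoint point-interaction operator on $L^2(\mathbb{R}^3)$ with domain $\{f+\frac{f(0)}{\alpha+\sqrt\lambda/(4\pi)}G_\lambda: f\in H^2(\mathbb{R}^3)\}$ and $(-\Delta_\alpha+\lambda)(f+\frac{f(0)}{\alpha+\sqrt\lambda/(4\pi)}G_\lambda)=(-\Delta+\lambda)f$ ($\lambda>0$); its resolvent is $(-\Delta+\lambda)^{-1}+\frac{1}{\alpha+\sqrt\lambda/(4\pi)}|G_\lambda\rangle\langle G_\lambda|$. Norm (resp.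 strong) resolvent convergence means $(H_\varepsilon+\lambda)^{-1}\to$ the limiting resolvent in operator norm (resp. strongly) for $\lambda\in\mathbb{C}\setminus\mathbb{R}$. *)

theory Defs
  imports "HOL-Analysis.Analysis"
begin

type_synonym pt = "real^3"
type_synonym cfun = "pt \<Rightarrow> complex"

definition L2 :: "cfun set" where
  "L2 = {f. f \<in> borel_measurable lborel \<and> integrable lborel (\<lambda>x. (cmod (f x))^2)}"

definition L2norm :: "cfun \<Rightarrow> real" where
  "L2norm f = sqrt (integral\<^sup>L lborel (\<lambda>x. (cmod (f x))^2))"

definition L2loc :: "cfun set" where
  "L2loc = {f. f \<in> borel_measurable lborel \<and>
      (\<forall>r. set_integrable lborel (cball 0 r) (\<lambda>x. (cmod (f x))^2))}"

definition has_partial :: "(pt \<Rightarrow> real) \<Rightarrow> 3 \<Rightarrow> (pt \<Rightarrow> real) \<Rightarrow> bool" where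
  "has_partial \<phi> i d \<longleftrightarrow>
     (\<forall>x. ((\<lambda>t. \<phi> (x + t *\<^sub>R axis i 1)) has_real_derivative d x) (at 0))"

text \<open>Smooth compactly supported test functions (coinductive = greatest fixpoint): all iterated partial derivatives exist,
  are continuous, and the function has compact support.\<close>
coinductive smooth_fun :: "(pt \<Rightarrow> real) \<Rightarrow> bool" where
  "continuous_on UNIV \<phi> \<Longrightarrow> (\<forall>i. \<exists>d. has_partial \<phi> i d \<and> smooth_fun d) \<Longrightarrow> smooth_fun \<phi>"

definition test_fun :: "(pt \<Rightarrow> real) \<Rightarrow> bool" where
  "test_fun \<phi> \<longleftrightarrow> smooth_fun \<phi> \<and> bounded {x. \<phi> x \<noteq> 0}"

definition weak_grad :: "cfun \<Rightarrow> (3 \<Rightarrow> cfun) \<Rightarrow> bool" where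
  "weak_grad f D \<longleftrightarrow> (\<forall>\<phi> d i. test_fun \<phi> \<longrightarrow> has_partial \<phi> i d \<longrightarrow>
       integral\<^sup>L lborel (\<lambda>x. f x * of_real (d x)) = - integral\<^sup>L lborel (\<lambda>x. D i x * of_real (\<phi> x)))"

definition H1_grad :: "cfun \<Rightarrow> (3 \<Rightarrow> cfun) \<Rightarrow> bool" where
  "H1_grad f D \<longleftrightarrow> f \<in> L2 \<and> (\<forall>i. D i \<in> L2) \<and> weak_grad f D"

text \<open>f solves the weak resolvent equation (H + lam) f = g for the form sum H = -Delta + W
  with form domain H^1, i.e. f is (a representative of) (H + lam)^{-1} g.\<close>
definition form_resolvent_sol :: "(pt \<Rightarrow> real) \<Rightarrow> complex \<Rightarrow> cfun \<Rightarrow> cfun \<Rightarrow> bool" where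
  "form_resolvent_sol W lam g f \<longleftrightarrow>
     (\<exists>Df. H1_grad f Df \<and>
        (\<forall>h Dh. H1_grad h Dh \<longrightarrow>
           (\<Sum>i\<in>UNIV. integral\<^sup>L lborel (\<lambda>x. Df i x * cnj (Dh i x)))
           + integral\<^sup>L lborel (\<lambda>x. of_real (W x) * f x * cnj (h x))
           + lam * integral\<^sup>L lborel (\<lambda>x. f x * cnj (h x))
           = integral\<^sup>L lborel (\<lambda>x. g x * cnj (h x))))"

definition free_resolvent_sol :: "complex \<Rightarrow> cfun \<Rightarrow> cfun \<Rightarrow> bool" where
  "free_resolvent_sol lam g f \<longleftrightarrow> form_resolvent_sol (\<lambda>_. 0) lam g f"

definition Gk :: "complex \<Rightarrow> cfun" where
  "Gk lam x = exp (- of_real (norm x) * csqrt lam) / of_real (4 * pi * norm x)"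

text \<open>Resolvent of the point interaction -Delta_alpha (analytically continued to lam not real).\<close>
definition point_resolvent_sol :: "real \<Rightarrow> complex \<Rightarrow> cfun \<Rightarrow> cfun \<Rightarrow> bool" where
  "point_resolvent_sol \<alpha> lam g f \<longleftrightarrow>
     (\<exists>f0. free_resolvent_sol lam g f0 \<and>
        (AE x in lborel. f x = f0 x + Gk lam x * integral\<^sup>L lborel (\<lambda>y. Gk lam y * g y)
                                   / (of_real \<alpha> + csqrt lam / of_real (4 * pi))))"

text \<open>Resolvent convergence as eps tends to 0 from above, for all non-real lam.
  The resolvents are given as solution relations (functions up to a.e. equality);
  existence of the resolvents is part of the statement.\<close>
definition resolvents_exist ::
  "(real \<Rightarrow> complex \<Rightarrow> cfun \<Rightarrow> cfun \<Rightarrow> bool) \<Rightarrow> (complex \<Rightarrow> cfun \<Rightarrow> cfun \<Rightarrow> bool) \<Rightarrow> bool" where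
  "resolvents_exist S R \<longleftrightarrow>
     (\<forall>lam g. Im lam \<noteq> 0 \<longrightarrow> g \<in> L2 \<longrightarrow>
        (\<forall>\<epsilon>. 0 < \<epsilon> \<and> \<epsilon> \<le> 1 \<longrightarrow> (\<exists>f. S \<epsilon> lam g f)) \<and> (\<exists>f. R lam g f))"

definition norm_resolvent_conv ::
  "(real \<Rightarrow> complex \<Rightarrow> cfun \<Rightarrow> cfun \<Rightarrow> bool) \<Rightarrow> (complex \<Rightarrow> cfun \<Rightarrow> cfun \<Rightarrow> bool) \<Rightarrow> bool" where
  "norm_resolvent_conv S R \<longleftrightarrow> resolvents_exist S R \<and>
     (\<forall>lam. Im lam \<noteq> 0 \<longrightarrow> (\<forall>e>0. \<exists>\<delta>>0. \<forall>\<epsilon>. 0 < \<epsilon> \<and> \<epsilon> < \<delta> \<and> \<epsilon> \<le> 1 \<longrightarrow>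
        (\<forall>g f f0. g \<in> L2 \<longrightarrow> S \<epsilon> lam g f \<longrightarrow> R lam g f0 \<longrightarrow>
            L2norm (\<lambda>x. f x - f0 x) \<le> e * L2norm g)))"

definition strong_resolvent_conv ::
  "(real \<Rightarrow> complex \<Rightarrow> cfun \<Rightarrow> cfun \<Rightarrow> bool) \<Rightarrow> (complex \<Rightarrow> cfun \<Rightarrow> cfun \<Rightarrow> bool) \<Rightarrow> bool" where
  "strong_resolvent_conv S R \<longleftrightarrow> resolvents_exist S R \<and>
     (\<forall>lam g. Im lam \<noteq> 0 \<longrightarrow> g \<in> L2 \<longrightarrow> (\<forall>e>0. \<exists>\<delta>>0. \<forall>\<epsilon>. 0 < \<epsilon> \<and> \<epsilon> < \<delta> \<and> \<epsilon> \<le> 1 \<longrightarrow>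
        (\<forall>f f0. S \<epsilon> lam g f \<longrightarrow> R lam g f0 \<longrightarrow> L2norm (\<lambda>x. f x - f0 x) \<le> e)))"

definition rollnik :: "(pt \<Rightarrow> real) \<Rightarrow> bool" where
  "rollnik V \<longleftrightarrow> V \<in> borel_measurable lborel \<and>
     (\<integral>\<^sup>+ x. \<integral>\<^sup>+ y. ennreal (\<bar>V x\<bar> * \<bar>V y\<bar> / (dist x y)^2) \<partial>lborel \<partial>lborel) < \<infinity>"

definition vfun :: "(pt \<Rightarrow> real) \<Rightarrow> pt \<Rightarrow> real" where
  "vfun V x = sqrt \<bar>V x\<bar>"

definition ufun :: "(pt \<Rightarrow> real) \<Rightarrow> pt \<Rightarrow> real" where
  "ufun V x = sgn (V x) * sqrt \<bar>V x\<bar>"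

definition inv_lap_v :: "(pt \<Rightarrow> real) \<Rightarrow> cfun \<Rightarrow> cfun" where
  "inv_lap_v V \<phi> x = integral\<^sup>L lborel (\<lambda>y. of_real (vfun V y) * \<phi> y / of_real (4 * pi * dist x y))"

definition BS_eigfun :: "(pt \<Rightarrow> real) \<Rightarrow> cfun \<Rightarrow> bool" where
  "BS_eigfun V \<phi> \<longleftrightarrow> \<phi> \<in> L2 \<and> \<not> (AE x in lborel. \<phi> x = 0) \<and>
     (AE x in lborel. of_real (ufun V x) * inv_lap_v V \<phi> x = - \<phi> x)"

definition Veps :: "(real \<Rightarrow> real) \<Rightarrow> real \<Rightarrow> (pt \<Rightarrow> real) \<Rightarrow> real \<Rightarrow> pt \<Rightarrow> real" where
  "Veps \<eta> \<sigma> V \<epsilon> x = \<eta> \<epsilon> * \<epsilon> powr (-\<sigma>) * V ((1/\<epsilon>) *\<^sub>R x)"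

definition smooth_01 :: "(real \<Rightarrow> real) \<Rightarrow> (nat \<Rightarrow> real \<Rightarrow> real) \<Rightarrow> bool" where
  "smooth_01 \<eta> d \<longleftrightarrow> (\<forall>t\<in>{0..1}. d 0 t = \<eta> t) \<and>
     (\<forall>k. \<forall>t\<in>{0..1}. (d k has_real_derivative d (Suc k) t) (at t within {0..1}))"

end

theory Submission
  imports Defs "HOL-Library.Diagonal_Subsequence"
begin

text \<open>Let \<open>\<kappa>\<close> be the square root of \<open>\<lambda>\<close> with positive real part and \<open>p = u f(\<epsilon> \<cdot>)\<close> the rescaled resolvent.
  The resolvent equation becomes \<open>(1 + \<eta> \<epsilon>\<^bsup>2-\<sigma>\<^esup> K\<^bsub>\<epsilon>\<kappa>\<^esub>) p = Q\<^sub>\<epsilon> g\<close> and \<open>f = G g - \<eta> \<epsilon>\<^bsup>3-\<sigma>\<^esup> P\<^sub>\<epsilon> p\<close>, where \<open>K\<close>, \<open>P\<close>, \<open>Q\<close> are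
  Hilbert--Schmidt, \<open>K\<^sub>0 = u (-\<Delta>)\<^sup>-\<^sup>1 v\<close> and \<open>G\<close> is the free resolvent. If \<open>\<sigma> < 2\<close> the perturbation of the identity is small; if
  \<open>\<sigma> = 2\<close> and there is no resonance, \<open>1 + K\<^sub>0\<close> is bounded below by compactness. Either way \<open>p\<close> stays bounded and \<open>f\<close> tends
  to \<open>G g\<close>. At a resonance \<open>p\<close> has size \<open>1/\<epsilon>\<close>: \<open>\<epsilon> p\<close> is close to \<open>c \<phi>\<close>, and pairing the equation with \<open>sign(V) \<phi>\<close>, which
  annihilates the range of \<open>1 + K\<^sub>0\<close>, gives at order \<open>\<epsilon>\<close> the relation
  \<open>(\<eta>'(0) - \<kappa> |A|^2 / (4 \<pi>)) c = A\<^sup>* (G g)(0)\<close> with \<open>A = \<integral>v \<phi> = - \<integral>V \<psi>\<close>, which is the coefficient of the point interaction.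
  For \<open>\<sigma> > 2\<close> and \<open>V > 0\<close> the quadratic form controls the difference to \<open>G g\<close>, since points have zero capacity.\<close>

text \<open>The form equation speaks of weak gradients only, so the obstacle is to reach integral
  kernels from it. Every Sobolev function is reproduced by pairing its gradient and itself with the
  Green function; testing the form equation with a Green potential then yields the integral equation
  for an arbitrary form solution. The Rollnik class enters through one computation: composing two
  kernels with singularity \<open>1/|x|^2\<close> leaves \<open>1/|x|\<close>, whose square is the
  Rollnik weight. Hence \<open>p -> G (v p)\<close> and \<open>h -> v h\<close> are bounded,
  although \<open>v p\<close> itself need not be square integrable. Solvability rests on compactness
  and on injectivity of \<open>1 + K\<close> and of its adjoint; injectivity is the reality of the
  form at non-real \<open>\<lambda>\<close>. Non-reality also keeps
  \<open>\<eta>'(0) - \<kappa> |A|^2 / (4 \<pi>)\<close> away from 0, so that the limiting resolvent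
  makes sense for either sign of \<open>\<eta>'(0)\<close>. For \<open>\<sigma> > 2\<close> the
  factor \<open>\<epsilon> powr (2 - \<sigma>)\<close> in front of \<open>K\<close> diverges and the
  integral equation gives no bound; positivity of \<open>V\<close> replaces it.\<close>

abbreviation (input) lborel_nn :: "('a::euclidean_space => ennreal) => ennreal" (binder "NINT " 60) where
  "lborel_nn f == nn_integral lborel f"

section \<open>Hilbert spaces\<close>

text \<open>The parallelogram law makes a minimising sequence for the distance to \<open>M\<close>
  Cauchy. Its limit is a nearest point, and minimality along each line in \<open>M\<close> forces
  orthogonality.\<close>

lemma closed_subspace_projection:
  fixes M :: "'a::{real_inner,complete_space} set"
  assumes sub: "subspace M" and cl: "closed M"
  shows "\<exists>m\<in>M. \<forall>y\<in>M. inner (b - m) y = 0"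
proof -
  have ne: "M \<noteq> {}" using subspace_0[OF sub] by auto
  define d where "d = infdist b M"
  have d0: "0 \<le> d" unfolding d_def by (rule infdist_nonneg)
  have "\<exists>y\<in>M. dist b y < d + 1 / Suc n" for n
  proof -
    have "infdist b M < d + 1 / Suc n" by (simp add: d_def)
    then have "(INF a\<in>M. dist b a) < d + 1 / Suc n" using ne by (simp add: infdist_notempty)
    then show ?thesis using cINF_less_iff[of M "dist b" "d + 1/Suc n"] ne by (auto intro: bdd_belowI2[where m=0])
  qed
  then obtain x where xM: "\<And>n. x n \<in> M" and xd: "\<And>n. dist b (x n) < d + 1 / Suc n"
    by metis
  have low: "d \<le> norm (b - y)" if "y \<in> M" for y
    using infdist_le[OF that, of b] by (simp add: d_def dist_norm)
  have par: "(norm (x n - x m))^2 \<le> 8 * (d + 1) * (1 / real (Suc k))" if "k \<le> n" "k \<le> m" for n m k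
  proof -
    \<comment> \<open>The midpoint lies in \<open>M\<close>, hence at distance at least
      \<open>d\<close> from \<open>b\<close>. This lower bound for \<open>p + q\<close> turns the
      parallelogram identity into a Cauchy estimate.\<close>
    have mid: "(1/2) *\<^sub>R (x n + x m) \<in> M"
      by (intro subspace_scale[OF sub] subspace_add[OF sub] xM)
    define p where "p = b - x n"
    define q where "q = b - x m"
    have "(norm (p - q))^2 = 2 * (norm p)^2 + 2 * (norm q)^2 - (norm (p + q))^2"
      by (simp add: power2_norm_eq_inner inner_add_left inner_add_right inner_diff_left inner_diff_right inner_commute)
    moreover have "norm (p + q) = 2 * norm (b - (1/2) *\<^sub>R (x n + x m))"
    proof -
      have "p + q = 2 *\<^sub>R (b - (1/2) *\<^sub>R (x n + x m))"
        by (simp add: p_def q_def algebra_simps scaleR_2)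
      then show ?thesis by simp
    qed
    then have "2 * d \<le> norm (p + q)" using low[OF mid] by simp
    then have "(2*d)^2 \<le> (norm (p + q))^2" using d0 by (intro power_mono) auto
    moreover have kk: "1 / Suc n \<le> 1 / real (Suc k)" "1 / Suc m \<le> 1 / real (Suc k)" using that by (auto intro!: divide_left_mono)
    have "norm p \<le> d + 1 / Suc k" using xd[of n] kk by (simp add: p_def dist_norm)
    then have "(norm p)^2 \<le> (d + 1/Suc k)^2" by (intro power_mono) auto
    moreover have "norm q \<le> d + 1 / Suc k" using xd[of m] kk by (simp add: q_def dist_norm)
    then have "(norm q)^2 \<le> (d + 1/Suc k)^2" by (intro power_mono) auto
    ultimately have "(norm (p - q))^2 \<le> 4 * (d + 1/Suc k)^2 - 4 * d^2" by (simp add: power2_eq_square)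
    also have "4 * (d + 1/Suc k)^2 - 4 * d^2 = 8 * d * (1/Suc k) + 4 * (1/Suc k) * (1/Suc k)"
    proof -
      have "4 * (d + e)^2 - 4 * d^2 = 8 * d * e + 4 * e * e" for e :: real
        by (simp add: power2_eq_square algebra_simps)
      then show ?thesis .
    qed
    also have "\<dots> \<le> 8 * d * (1/Suc k) + 4 * (1/Suc k) * 1" by (intro add_left_mono mult_left_mono) auto
    also have "\<dots> \<le> 8 * (d + 1) * (1/Suc k)"
    proof -
      have *: "8 * d * e + 4 * e * 1 \<le> 8 * (d + 1) * e" if "0 \<le> e" for e :: real
        using that by (simp add: algebra_simps)
      show ?thesis by (rule *) simp
    qed
    finally show ?thesis by (simp add: p_def q_def norm_minus_commute)
  qed
  have "Cauchy x"
  proof (rule metric_CauchyI)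
    fix e :: real assume e: "0 < e"
    obtain k where k: "8 * (d+1) / e^2 < Suc k" using reals_Archimedean2 less_trans
      by (metis of_nat_less_iff lessI)
    have "8 * (d+1) * (1/Suc k) < e^2" using k e by (simp add: field_simps)
    then have "(norm (x n - x m))^2 < e^2" if "n \<ge> k" "m \<ge> k" for n m
      using par[of k n m] that by linarith
    then have "norm (x n - x m) < e" if "n \<ge> k" "m \<ge> k" for n m
      using that e power_less_imp_less_base by (metis less_imp_le)
    then show "\<exists>M. \<forall>m\<ge>M. \<forall>n\<ge>M. dist (x m) (x n) < e" by (auto simp: dist_norm)
  qed
  then obtain m where lim: "x \<longlonglongrightarrow> m" using Cauchy_convergent_iff convergent_def by blast
  have mM: "m \<in> M" using cl lim xM closed_sequentially by blast
  have "norm (b - m) \<le> d"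
  proof (rule LIMSEQ_le)
    show "(\<lambda>n. norm (b - x n)) \<longlonglongrightarrow> norm (b - m)" by (intro tendsto_intros lim)
    show "(\<lambda>n. d + 1 / Suc n) \<longlonglongrightarrow> d"
      using tendsto_add[OF tendsto_const[of d] LIMSEQ_Suc[OF lim_1_over_n]] by simp
    show "\<exists>N. \<forall>n\<ge>N. norm (b - x n) \<le> d + 1 / Suc n" using xd by (auto simp: dist_norm less_imp_le)
  qed
  have "inner (b - m) y = 0" if y: "y \<in> M" for y
  proof (rule ccontr)
    assume n0: "inner (b - m) y \<noteq> 0"
    then have y0: "inner y y > 0" by auto
    \<comment> \<open>The vertex of the parabola given by the squared norm of
      \<open>b - m - t y\<close> as a function of \<open>t\<close>.\<close>
    define t where "t = inner (b - m) y / inner y y"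
    have "d \<le> norm (b - (m + t *\<^sub>R y))" by (intro low subspace_add[OF sub] mM subspace_scale[OF sub] y)
    with \<open>norm (b - m) \<le> d\<close> have "norm (b - m) \<le> norm (b - m - t *\<^sub>R y)" by (simp add: algebra_simps)
    then have "(norm (b - m))^2 \<le> (norm (b - m - t *\<^sub>R y))^2" by (intro power_mono) auto
    also have "\<dots> = (norm (b - m))^2 - 2 * t * inner (b - m) y + t^2 * inner y y"
      unfolding power2_norm_eq_inner
      by (simp add: inner_diff_left inner_diff_right inner_commute power2_eq_square algebra_simps)
    also have "\<dots> = (norm (b - m))^2 - (inner (b - m) y)^2 / inner y y"
      using y0 by (simp add: t_def power2_eq_square field_simps)
    finally show False using n0 y0 by (simp add: field_simps)
  qed
  then show ?thesis using mM by blast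
qed

text \<open>Bounded scalar sequences allow a diagonal choice that converges against each
  \<open>x n\<close>. The vectors against which it converges form a closed subspace containing all
  \<open>x n\<close>, so an arbitrary \<open>b\<close> may be replaced by its projection onto that
  subspace.\<close>

lemma weakly_Cauchy_subseq:
  fixes x :: "nat => 'a::{real_inner,complete_space}"
  assumes bd: "\<And>n. norm (x n) \<le> B"
  shows "\<exists>r. strict_mono r \<and> (\<forall>b. convergent (\<lambda>n. inner (x (r n)) b))"
proof -
  have B0: "0 \<le> B" using bd[of 0] norm_ge_zero order_trans by blast
  interpret S: subseqs "\<lambda>n s. convergent (\<lambda>k. inner (x (s k)) (x n))"
  proof
    fix n and s :: "nat => nat" assume "strict_mono s"
    have "\<bar>inner (x (s k)) (x n)\<bar> \<le> B * B" for k
      using Cauchy_Schwarz_ineq2[of "x (s k)" "x n"] mult_mono[OF bd bd B0 norm_ge_zero] by (metis order_trans)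
    then have "bounded (range (\<lambda>k. inner (x (s k)) (x n)))" by (auto simp: bounded_iff)
    then obtain l r where "strict_mono r" "((\<lambda>k. inner (x (s k)) (x n)) \<circ> r) \<longlonglongrightarrow> l"
      using bounded_imp_convergent_subsequence by blast
    then show "\<exists>r'. strict_mono r' \<and> convergent (\<lambda>k. inner (x ((s \<circ> r') k)) (x n))"
      by (auto simp: convergent_def o_def)
  qed
  define r where "r = S.diagseq"
  have r: "strict_mono r" unfolding r_def by (rule S.subseq_diagseq)
  have conv_x: "convergent (\<lambda>k. inner (x (r k)) (x n))" for n
  proof -
    \<comment> \<open>The diagonal sequence refines the \<open>n\<close>-th extraction only from
      index \<open>Suc n\<close> on, so the convergence is first stated for the shifted
      tail.\<close>
    have "convergent (\<lambda>k. inner (x ((r \<circ> ((+) (Suc n))) k)) (x n))"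
      unfolding r_def
    proof (rule S.diagseq_holds)
      fix t s :: "nat => nat" and n assume "strict_mono t" "convergent (\<lambda>k. inner (x (s k)) (x n))"
      then show "convergent (\<lambda>k. inner (x ((s \<circ> t) k)) (x n))"
        using LIMSEQ_subseq_LIMSEQ[of "\<lambda>k. inner (x (s k)) (x n)" _ t] by (auto simp: convergent_def o_def)
    qed
    then have "convergent (\<lambda>k. inner (x (r (k + Suc n))) (x n))" by (simp add: o_def add.commute)
    then show ?thesis using convergent_ignore_initial_segment[of "\<lambda>k. inner (x (r k)) (x n)" "Suc n"] by simp
  qed
  define C where "C = {b. convergent (\<lambda>k. inner (x (r k)) b)}"
  have subC: "subspace C" unfolding subspace_def C_def
    by (auto simp: inner_add_right convergent_const intro!: convergent_add convergent_mult)
  have clC: "closed C"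
  proof (unfold closed_sequential_limits, intro allI impI, elim conjE)
    fix b l assume b: "\<forall>n. b n \<in> C" and lim: "b \<longlonglongrightarrow> l"
    have "Cauchy (\<lambda>k. inner (x (r k)) l)"
    proof (rule metric_CauchyI)
      fix e :: real assume e: "0 < e"
      have "0 < e / (4 * (B + 1))" using e B0 by simp
      then obtain j where j: "norm (b j - l) < e / (4 * (B + 1))"
        using lim unfolding LIMSEQ_def dist_norm by blast
      have "Cauchy (\<lambda>k. inner (x (r k)) (b j))" using b by (auto simp: C_def convergent_Cauchy)
      then obtain M where M: "\<And>m n. m \<ge> M ==> n \<ge> M ==> dist (inner (x (r m)) (b j)) (inner (x (r n)) (b j)) < e / 2"
        using metric_CauchyD[of _ "e/2"] half_gt_zero[OF e] by blast
      have small: "\<bar>inner (x k) (l - b j)\<bar> \<le> e / 4" for k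
      proof -
        have "\<bar>inner (x k) (l - b j)\<bar> \<le> norm (x k) * norm (l - b j)" by (rule Cauchy_Schwarz_ineq2)
        also have "\<dots> \<le> (B + 1) * (e / (4 * (B + 1)))"
          using j bd[of k] B0 by (intro mult_mono) (auto simp: norm_minus_commute intro: order_trans)
        also have "\<dots> = e / 4" using B0 by (simp add: field_simps)
        finally show ?thesis .
      qed
      have "dist (inner (x (r m)) l) (inner (x (r n)) l) < e" if "m \<ge> M" "n \<ge> M" for m n
        using M[OF that] small[of "r m"] small[of "r n"] unfolding dist_real_def inner_diff_right by linarith
      then show "\<exists>M. \<forall>m\<ge>M. \<forall>n\<ge>M. dist (inner (x (r m)) l) (inner (x (r n)) l) < e" by blast
    qed
    then show "l \<in> C" by (simp add: C_def Cauchy_convergent_iff)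
  qed
  have "convergent (\<lambda>n. inner (x (r n)) b)" for b
  proof -
    obtain m where m: "m \<in> C" "\<forall>y\<in>C. inner (b - m) y = 0" using closed_subspace_projection[OF subC clC] by blast
    have "inner (x k) (b - m) = 0" for k using m(2) conv_x[of k] by (auto simp: C_def inner_commute)
    then have "inner (x k) b = inner (x k) m" for k by (simp add: inner_diff_right)
    then show ?thesis using m(1) by (simp add: C_def)
  qed
  then show ?thesis using r by blast
qed

text \<open>If the bound fails there are unit vectors in \<open>M\<close> with
  \<open>x + K x\<close> tending to 0. Along a weakly Cauchy subsequence \<open>K x\<close>
  converges, hence so does \<open>x\<close>, and the limit is a unit vector of \<open>M\<close>
  annihilated by \<open>1 + K\<close>. Compactness is phrased through weakly Cauchy sequences
  because integral kernels verify it in that form.\<close>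

lemma bounded_below_id_plus_compact:
  fixes K :: "'a::{real_inner,complete_space} => 'a"
  assumes lin: "bounded_linear K"
    and comp: "\<And>x. (\<And>n. norm (x n) \<le> 1) ==> (\<And>b. convergent (\<lambda>n. inner (x n) b)) ==> convergent (\<lambda>n. K (x n))"
    and M: "subspace M" "closed M"
    and inj: "\<And>x. x \<in> M ==> x + K x = 0 ==> x = 0"
  shows "\<exists>c>0. \<forall>x\<in>M. c * norm x \<le> norm (x + K x)"
proof (rule ccontr)
  assume neg: "\<not> ?thesis"
  have "\<exists>x\<in>M. norm x = 1 \<and> norm (x + K x) \<le> 1 / Suc n" for n
  proof -
    have "\<not> (\<forall>x\<in>M. (1/Suc n) * norm x \<le> norm (x + K x))" using neg
      by (metis of_nat_0_less_iff zero_less_Suc zero_less_divide_1_iff)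
    then obtain x where x: "x \<in> M" "norm (x + K x) < (1/Suc n) * norm x" by force
    then have n0: "norm x > 0"
      using norm_ge_zero[of "x + K x"] by (cases "x = 0") auto
    define y where "y = (1 / norm x) *\<^sub>R x"
    have "y + K y = (1/norm x) *\<^sub>R (x + K x)"
      by (simp add: y_def linear_simps[OF lin] scaleR_add_right)
    then have "norm (y + K y) = norm (x + K x) / norm x" by simp
    also have "\<dots> \<le> 1 / Suc n" using x(2) n0 by (simp add: field_simps)
    finally show ?thesis using n0 subspace_scale[OF M(1) x(1)] by (intro bexI[of _ y]) (auto simp: y_def)
  qed
  then have "\<forall>n. \<exists>x. x \<in> M \<and> norm x = 1 \<and> norm (x + K x) \<le> 1 / Suc n" by blast
  then obtain x where "\<forall>n. x n \<in> M \<and> norm (x n) = 1 \<and> norm (x n + K (x n)) \<le> 1 / Suc n"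
    by (rule choice[THEN exE])
  then have xM: "\<And>n. x n \<in> M" and x1: "\<And>n. norm (x n) = 1"
    and xK: "\<And>n. norm (x n + K (x n)) \<le> 1 / Suc n" by blast+
  obtain r where r: "strict_mono r" "\<And>b. convergent (\<lambda>n. inner (x (r n)) b)"
    using weakly_Cauchy_subseq[of x 1] x1 by auto
  obtain z where z: "(\<lambda>n. K (x (r n))) \<longlonglongrightarrow> z"
    using comp[of "\<lambda>n. x (r n)"] x1 r(2) by (auto simp: convergent_def)
  have t0: "(\<lambda>n. x n + K (x n)) \<longlonglongrightarrow> 0"
    by (rule tendsto_norm_zero_cancel, rule real_tendsto_sandwich[OF _ _ tendsto_const LIMSEQ_Suc[OF lim_1_over_n]])
       (use xK in auto)
  have t1: "(\<lambda>n. x (r n) + K (x (r n))) \<longlonglongrightarrow> 0"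
    using LIMSEQ_subseq_LIMSEQ[OF t0 r(1)] by (simp add: o_def)
  have xl: "(\<lambda>n. x (r n)) \<longlonglongrightarrow> - z"
    using tendsto_diff[OF t1 z] by simp
  have zM: "- z \<in> M" using closed_sequentially[OF M(2) _ xl] xM by auto
  have "(\<lambda>n. K (x (r n))) \<longlonglongrightarrow> K (- z)"
    by (rule bounded_linear.tendsto[OF lin xl])
  then have "K (- z) = z" using z LIMSEQ_unique by blast
  then have "- z = 0" by (intro inj[OF zM]) simp
  moreover have "norm (- z) = 1"
    using tendsto_norm[OF xl] x1 by (simp add: LIMSEQ_const_iff)
  ultimately show False by simp
qed

text \<open>The normal equation \<open>T\<^sup>* T x = T\<^sup>* y\<close> is solved by a contraction.\<close>

lemma surj_of_bounded_below_adjoint_inj: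
  fixes T S :: "'a::{real_inner,complete_space} => 'a"
  assumes T: "bounded_linear T" and S: "bounded_linear S"
    and adj: "\<And>x y. inner (T x) y = inner x (S y)"
    and c: "0 < c" "\<And>x. c * norm x \<le> norm (T x)"
    and inj: "\<And>y. S y = 0 ==> y = 0"
  shows "\<exists>x. T x = y"
proof -
  have lin: "bounded_linear (\<lambda>x. S (T x))" by (rule bounded_linear_compose[OF S T])
  obtain C where C: "C > 0" "\<And>x. norm (S (T x)) \<le> norm x * C"
    using bounded_linear.pos_bounded[OF lin] by blast
  define M where "M = max C c"
  have M: "M > 0" "c \<le> M" "\<And>x. norm (S (T x)) \<le> M * norm x"
    using C c(1) by (auto simp: M_def mult.commute[of _ "norm _"] intro!: order_trans[OF C(2)] mult_left_mono)
  \<comment> \<open>This step size minimises \<open>1 - 2 t c^2 + t^2 M^2\<close> and leaves the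
    value \<open>1 - c^4 / M^2\<close>.\<close>
  define t where "t = c^2 / M^2"
  define g where "g x = x - t *\<^sub>R (S (T x) - S y)" for x
  define q where "q = sqrt (1 - c^4 / M^2)"
  have est: "(norm (x - t *\<^sub>R S (T x)))^2 \<le> (1 - c^4 / M^2) * (norm x)^2" for x
  proof -
    have "(norm (x - t *\<^sub>R S (T x)))^2 = (norm x)^2 - 2 * t * inner x (S (T x)) + t^2 * (norm (S (T x)))^2"
      unfolding power2_norm_eq_inner by (simp add: inner_diff_left inner_diff_right inner_commute power2_eq_square algebra_simps)
    also have "inner x (S (T x)) = (norm (T x))^2" by (simp add: adj[symmetric] power2_norm_eq_inner)
    also have "(norm x)^2 - 2 * t * (norm (T x))^2 + t^2 * (norm (S (T x)))^2
        \<le> (norm x)^2 - 2 * t * (c * norm x)^2 + t^2 * (M * norm x)^2"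
      using c M(3)[of x] by (intro add_mono diff_mono mult_left_mono power_mono) (auto simp: t_def)
    also have "\<dots> = (1 - c^4 / M^2) * (norm x)^2"
      using M(1) by (simp add: t_def field_simps power2_eq_square power4_eq_xxxx)
    finally show ?thesis .
  qed
  have "\<exists>!x. g x = x"
  proof (rule banach_fix_type)
    \<comment> \<open>The \<open>max 0\<close> keeps the contraction constant meaningful without
      comparing \<open>c^4\<close> with \<open>M^2\<close>.\<close>
    show "0 \<le> sqrt (max 0 (1 - c^4 / M^2))" by simp
    show "sqrt (max 0 (1 - c^4 / M^2)) < 1" using c M by simp
    show "\<forall>x x'. dist (g x) (g x') \<le> sqrt (max 0 (1 - c^4 / M^2)) * dist x x'"
    proof (intro allI)
      fix x x'
      have e: "g x - g x' = (x - x') - t *\<^sub>R S (T (x - x'))"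
        by (simp add: g_def linear_simps[OF T] linear_simps[OF S] algebra_simps)
      have "(norm (g x - g x'))^2 \<le> max 0 (1 - c^4 / M^2) * (norm (x - x'))^2"
        unfolding e by (rule order_trans[OF est]) (intro mult_right_mono, auto)
      then have "norm (g x - g x') \<le> sqrt (max 0 (1 - c^4 / M^2) * (norm (x - x'))^2)"
        by (rule real_le_rsqrt)
      then show "dist (g x) (g x') \<le> sqrt (max 0 (1 - c^4 / M^2)) * dist x x'"
        by (simp add: real_sqrt_mult dist_norm)
    qed
  qed
  then obtain x where "g x = x" by blast
  then have "S (T x) - S y = 0" using c M by (simp add: g_def t_def)
  then have "S (T x - y) = 0" by (simp add: linear_simps[OF S])
  then show ?thesis using inj by fastforce
qed

section \<open>Square integrable functions\<close>

text \<open>Integrability on the product is supplied by a finite iterated integral of the modulus,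
  the form in which the kernel estimates below arrive.\<close>

lemma lborel_Fubini:
  fixes F :: "'a::euclidean_space => 'b::euclidean_space => complex"
  assumes meas: "case_prod F \<in> borel_measurable (lborel \<Otimes>\<^sub>M lborel)"
    and fin: "(NINT x. NINT y. ennreal (cmod (F x y))) < \<infinity>"
  shows "(LBINT x. LBINT y. F x y) = (LBINT y. LBINT x. F x y)"
    and "AE x in lborel. integrable lborel (F x)"
    and "AE y in lborel. integrable lborel (\<lambda>x. F x y)"
    and "integrable lborel (\<lambda>x. LBINT y. F x y)"
    and "integrable lborel (\<lambda>y. LBINT x. F x y)"
proof -
  note meas[measurable]
  have int: "integrable (lborel \<Otimes>\<^sub>M lborel) (case_prod F)"
  proof (rule integrableI_bounded)
    have "(\<integral>\<^sup>+p. ennreal (norm (case_prod F p)) \<partial>(lborel \<Otimes>\<^sub>M lborel))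
        = (NINT x. NINT y. ennreal (norm (case_prod F (x, y))))"
      by (rule lborel.nn_integral_fst[symmetric]) measurable
    then show "(\<integral>\<^sup>+p. ennreal (norm (case_prod F p)) \<partial>(lborel \<Otimes>\<^sub>M lborel)) < \<infinity>"
      using fin by simp
  qed (rule meas)
  show "(LBINT x. LBINT y. F x y) = (LBINT y. LBINT x. F x y)"
    using lborel_pair.Fubini_integral[OF int] by simp
  show "AE x in lborel. integrable lborel (F x)"
    using lborel_pair.AE_integrable_fst[OF int] .
  show "AE y in lborel. integrable lborel (\<lambda>x. F x y)"
    using lborel_pair.AE_integrable_snd[OF int] .
  show "integrable lborel (\<lambda>x. LBINT y. F x y)"
    using lborel_pair.integrable_fst[OF int] .
  show "integrable lborel (\<lambda>y. LBINT x. F x y)"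
    using lborel_pair.integrable_snd[OF int] .
qed

lemma lborel_Tonelli:
  assumes "(\<lambda>(x, y). F x y) \<in> borel_measurable (lborel \<Otimes>\<^sub>M lborel)"
  shows "(NINT x. NINT y. F x y)
    = (NINT y. NINT x. F (x::'a::euclidean_space) (y::'b::euclidean_space))"
proof -
  show ?thesis using lborel_pair.Fubini'[of F] assms by simp
qed

text \<open>The squared norm as an extended number. Inequalities can be proved for it before square
  integrability is known and finiteness read off afterwards, whereas \<open>L2norm\<close> of a
  function whose square is not integrable is 0.\<close>

definition n2 :: "cfun => ennreal" where
  "n2 f = (NINT x. (ennreal (cmod (f x)))^2)"

lemma L2_iff: "f \<in> L2 \<longleftrightarrow> f \<in> borel_measurable borel \<and> n2 f < \<infinity>"
proof -
  have "integrable lborel (\<lambda>x. (cmod (f x))^2) \<longleftrightarrow> n2 f < \<infinity>" if [measurable]: "f \<in> borel_measurable borel"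
    by (simp add: integrable_iff_bounded n2_def ennreal_power)
  then show ?thesis by (auto simp: L2_def)
qed

lemma L2_meas[measurable_dest]: "f \<in> L2 ==> f \<in> borel_measurable borel"
  by (simp add: L2_iff)

lemma L2_n2: "f \<in> L2 ==> n2 f < \<infinity>"
  by (simp add: L2_iff)

lemma L2_sq_integrable: "f \<in> L2 ==> integrable lborel (\<lambda>x. (cmod (f x))^2)"
  by (simp add: L2_def)

lemma n2_eq: "f \<in> L2 ==> n2 f = ennreal ((L2norm f)^2)"
  unfolding n2_def L2norm_def
  by (simp add: ennreal_power nn_integral_eq_integral L2_sq_integrable integral_nonneg)

lemma L2norm_nonneg[simp]: "0 \<le> L2norm f"
  by (simp add: L2norm_def integral_nonneg)

lemma L2norm_sq: "(L2norm f)^2 = (LBINT x. (cmod (f x))^2)"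
  by (simp add: L2norm_def integral_nonneg)

lemma n2_mono: "(\<And>x. cmod (f x) \<le> cmod (g x)) ==> n2 f \<le> n2 g"
  unfolding n2_def by (intro nn_integral_mono power_mono ennreal_leI) auto

lemma n2_cong_AE: "AE x in lborel. f x = g x ==> n2 f = n2 g"
  unfolding n2_def by (intro nn_integral_cong_AE) auto

lemma L2norm_cong_AE:
  assumes "AE x in lborel. f x = g x" "f \<in> borel_measurable borel" "g \<in> borel_measurable borel"
  shows "L2norm f = L2norm g"
  unfolding L2norm_def using assms by (intro arg_cong[where f=sqrt] integral_cong_AE) auto

lemma L2_cong_AE:
  assumes "f \<in> L2" "g \<in> borel_measurable borel" "AE x in lborel. f x = g x"
  shows "g \<in> L2"
  using assms n2_cong_AE[OF assms(3)] by (simp add: L2_iff)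

lemma L2norm_le:
  assumes "f \<in> L2" "n2 f \<le> ennreal (c^2)" "0 \<le> c"
  shows "L2norm f \<le> c"
proof -
  have "ennreal ((L2norm f)^2) \<le> ennreal (c^2)" using assms n2_eq by simp
  then have "(L2norm f)^2 \<le> c^2" by simp
  then show ?thesis using assms(3) by (rule power2_le_imp_le)
qed

lemma ennreal_add_sq_le: "(a + b)^2 \<le> 2 * a^2 + 2 * (b::ennreal)^2"
proof (cases "a = \<infinity> \<or> b = \<infinity>")
  case True then show ?thesis by (auto simp: power2_eq_square ennreal_mult_top ennreal_top_mult)
next
  case False
  then obtain x y where xy: "a = ennreal x" "b = ennreal y" "0 \<le> x" "0 \<le> y"
    by (metis ennreal_cases infinity_ennreal_def)
  have "(x + y)^2 \<le> 2 * x^2 + 2 * y^2" using sum_squares_bound[of x y] by (simp add: power2_eq_square algebra_simps)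
  then have "ennreal ((x + y)^2) \<le> ennreal (2 * x^2 + 2 * y^2)" by (rule ennreal_leI)
  also have "ennreal (2 * x^2 + 2 * y^2) = 2 * ennreal (x^2) + 2 * ennreal (y^2)" by (simp add: ennreal_mult)
  also have "ennreal ((x + y)^2) = (a + b)^2" using xy by (simp flip: ennreal_plus add: ennreal_power)
  finally show ?thesis using xy by (simp add: ennreal_power)
qed

lemma ennreal_sq_le_imp_le:
  assumes "x^2 \<le> (ennreal c)^2" "0 \<le> c" shows "x \<le> ennreal c"
proof (cases x)
  case (real r)
  then have "ennreal (r^2) \<le> ennreal (c^2)" using assms by (simp add: ennreal_power)
  then have "r^2 \<le> c^2" by simp
  then show ?thesis using real power2_le_imp_le assms(2) by (auto intro: ennreal_leI)
next
  case top
  have "(top::ennreal)^2 = top" by (simp add: power2_eq_square)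
  then have "top \<le> ennreal (c^2)" using assms top by (simp add: ennreal_power)
  then show ?thesis by (simp add: top_unique)
qed

lemma L2_add: assumes "f \<in> L2" "g \<in> L2" shows "(\<lambda>x. f x + g x) \<in> L2"
proof -
  note [measurable] = L2_meas[OF assms(1)] L2_meas[OF assms(2)]
  have "n2 (\<lambda>x. f x + g x) \<le> (NINT x. 2 * (ennreal (cmod (f x)))^2 + 2 * (ennreal (cmod (g x)))^2)"
    unfolding n2_def
  proof (rule nn_integral_mono)
    fix x
    have "(ennreal (cmod (f x + g x)))^2 \<le> (ennreal (cmod (f x)) + ennreal (cmod (g x)))^2"
      by (intro power_mono) (simp_all add: ennreal_plus[symmetric] norm_triangle_ineq del: ennreal_plus)
    then show "(ennreal (cmod (f x + g x)))^2 \<le> 2 * (ennreal (cmod (f x)))^2 + 2 * (ennreal (cmod (g x)))^2"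
      using ennreal_add_sq_le order_trans by blast
  qed
  also have "\<dots> = 2 * n2 f + 2 * n2 g" by (simp add: nn_integral_add nn_integral_cmult n2_def)
  also have "\<dots> < \<infinity>" using assms by (simp add: L2_iff ennreal_mult_less_top)
  finally show ?thesis by (simp add: L2_iff)
qed

lemma n2_cmult: assumes [measurable]: "f \<in> borel_measurable borel"
  shows "n2 (\<lambda>x. c * f x) = ennreal ((cmod c)^2) * n2 f"
  unfolding n2_def
  by (simp add: norm_mult ennreal_mult power_mult_distrib nn_integral_cmult ennreal_power)

lemma L2_cmult: assumes "f \<in> L2" shows "(\<lambda>x. c * f x) \<in> L2"
proof -
  note [measurable] = L2_meas[OF assms(1)]
  show ?thesis using assms n2_cmult[of f c] by (auto simp: L2_iff ennreal_mult_less_top)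
qed

lemma L2norm_cmult: "L2norm (\<lambda>x. c * f x) = cmod c * L2norm f"
  by (simp add: L2norm_def norm_mult power_mult_distrib real_sqrt_mult)

lemma L2_zero[simp]: "(\<lambda>x. 0) \<in> L2"
  by (simp add: L2_iff n2_def)

lemma L2_uminus: "f \<in> L2 ==> (\<lambda>x. - f x) \<in> L2"
  using L2_cmult[of f "-1"] by simp

lemma L2_diff: assumes "f \<in> L2" "g \<in> L2" shows "(\<lambda>x. f x - g x) \<in> L2"
  using L2_add[OF assms(1) L2_uminus[OF assms(2)]] by simp

lemma L2_cnj: "f \<in> L2 ==> (\<lambda>x. cnj (f x)) \<in> L2"
  unfolding L2_def by (auto intro: borel_measurable_continuous_on[OF continuous_on_cnj[OF continuous_on_id]])

lemma L2_sum: "(\<And>i. i \<in> I ==> f i \<in> L2) ==> (\<lambda>x. \<Sum>i\<in>I. f i x) \<in> L2"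
  by (induction I rule: infinite_finite_induct) (auto intro: L2_add)

lemma L2_bound:
  assumes "g \<in> L2" "f \<in> borel_measurable borel" "\<And>x. cmod (f x) \<le> cmod (g x)"
  shows "f \<in> L2"
  using assms n2_mono[of f g] by (auto simp: L2_iff)

lemma L2_mult_CS:
  assumes "f \<in> L2" "g \<in> L2"
  shows "integrable lborel (\<lambda>x. f x * g x)"
    and "(LBINT x. cmod (f x) * cmod (g x)) \<le> L2norm f * L2norm g"
    and "cmod (LBINT x. f x * g x) \<le> L2norm f * L2norm g"
    and "(NINT x. ennreal (cmod (f x) * cmod (g x))) \<le> ennreal (L2norm f * L2norm g)"
proof -
  note [measurable] = L2_meas[OF assms(1)] L2_meas[OF assms(2)]
  have "(NINT x. ennreal (cmod (f x)) * ennreal (cmod (g x)))^2 \<le> n2 f * n2 g"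
    unfolding n2_def by (rule Cauchy_Schwarz_nn_integral) measurable
  also have "n2 f * n2 g = (ennreal (L2norm f * L2norm g))^2"
    using assms by (simp add: n2_eq ennreal_mult power_mult_distrib ennreal_power)
  finally have *: "(NINT x. ennreal (cmod (f x) * cmod (g x))) \<le> ennreal (L2norm f * L2norm g)"
    using ennreal_sq_le_imp_le[of "NINT x. ennreal (cmod (f x)) * ennreal (cmod (g x))" "L2norm f * L2norm g"]
    by (simp add: ennreal_mult)
  then show "(NINT x. ennreal (cmod (f x) * cmod (g x))) \<le> ennreal (L2norm f * L2norm g)" .
  show int: "integrable lborel (\<lambda>x. f x * g x)"
  proof (rule integrableI_bounded)
    show "(NINT x. ennreal (norm (f x * g x))) < \<infinity>"
      using * by (simp add: norm_mult) (metis ennreal_less_top le_less_trans)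
  qed measurable
  have i2: "integrable lborel (\<lambda>x. cmod (f x) * cmod (g x))"
    using integrable_norm[OF int] by (simp add: norm_mult)
  show le: "(LBINT x. cmod (f x) * cmod (g x)) \<le> L2norm f * L2norm g"
    using * by (simp add: nn_integral_eq_integral[OF i2])
  have "cmod (LBINT x. f x * g x) \<le> (LBINT x. cmod (f x * g x))" by (rule integral_norm_bound)
  also have "\<dots> \<le> L2norm f * L2norm g" using le by (simp add: norm_mult)
  finally show "cmod (LBINT x. f x * g x) \<le> L2norm f * L2norm g" .
qed

lemma L2norm_cnj: "L2norm (\<lambda>x. cnj (f x)) = L2norm f"
  by (simp add: L2norm_def)

lemma L2_mult_cnj:
  assumes "f \<in> L2" "g \<in> L2"
  shows "integrable lborel (\<lambda>x. f x * cnj (g x))"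
    and "cmod (LBINT x. f x * cnj (g x)) \<le> L2norm f * L2norm g"
  using L2_mult_CS[OF assms(1) L2_cnj[OF assms(2)]] by (simp_all add: L2norm_cnj)

lemma L2_self: "f \<in> L2 ==> (LBINT x. f x * cnj (f x)) = of_real ((L2norm f)^2)"
  by (simp add: L2norm_sq complex_norm_square[symmetric] flip: of_real_power)

lemma L2norm_triangle:
  assumes "f \<in> L2" "g \<in> L2" shows "L2norm (\<lambda>x. f x + g x) \<le> L2norm f + L2norm g"
proof -
  note [measurable] = L2_meas[OF assms(1)] L2_meas[OF assms(2)]
  have i: "integrable lborel (\<lambda>x. cmod (f x) * cmod (g x))"
    using integrable_norm[OF L2_mult_CS(1)[OF assms]] by (simp add: norm_mult)
  have "(L2norm (\<lambda>x. f x + g x))^2 \<le> (LBINT x. (cmod (f x))^2 + (2 * (cmod (f x) * cmod (g x)) + (cmod (g x))^2))"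
    unfolding L2norm_sq
  proof (rule integral_mono)
    show "(cmod (f x + g x))^2 \<le> (cmod (f x))^2 + (2 * (cmod (f x) * cmod (g x)) + (cmod (g x))^2)" for x
      using power_mono[OF norm_triangle_ineq[of "f x" "g x"], of 2] by (simp add: power2_sum)
  qed (use assms i L2_add in \<open>auto intro!: L2_sq_integrable Bochner_Integration.integrable_add\<close>)
  also have "\<dots> = (L2norm f)^2 + (2 * (LBINT x. cmod (f x) * cmod (g x)) + (L2norm g)^2)"
    using i assms by (simp add: L2norm_sq L2_sq_integrable)
  also have "\<dots> \<le> (L2norm f + L2norm g)^2"
    using L2_mult_CS(2)[OF assms] by (simp add: power2_sum)
  finally show ?thesis by (rule power2_le_imp_le) simp
qed

lemma L2norm_triangle_diff:
  assumes "f \<in> L2" "g \<in> L2" shows "L2norm (\<lambda>x. f x - g x) \<le> L2norm f + L2norm g"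
  using L2norm_triangle[OF assms(1) L2_uminus[OF assms(2)]] L2norm_cmult[of "-1" g] by simp

lemma L2norm_zero_iff: assumes "f \<in> L2" shows "L2norm f = 0 \<longleftrightarrow> (AE x in lborel. f x = 0)"
proof -
  note [measurable] = L2_meas[OF assms(1)]
  have "L2norm f = 0 \<longleftrightarrow> (LBINT x. (cmod (f x))^2) = 0" by (simp add: L2norm_def)
  also have "\<dots> \<longleftrightarrow> (AE x in lborel. (cmod (f x))^2 = 0)"
    by (rule integral_nonneg_eq_0_iff_AE) (use assms L2_sq_integrable in auto)
  finally show ?thesis by simp
qed

section \<open>The Hilbert space of classes of square integrable functions\<close>

definition l2eq :: "cfun => cfun => bool" where
  "l2eq f g \<longleftrightarrow> f \<in> L2 \<and> g \<in> L2 \<and> (AE x in lborel. f x = g x)"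

lemma part_equivp_l2eq: "part_equivp l2eq"
proof (rule part_equivpI)
  show "\<exists>x. l2eq x x" unfolding l2eq_def by (rule exI[of _ "\<lambda>x. 0"]) simp
  show "symp l2eq" by (auto simp: symp_def l2eq_def)
  show "transp l2eq" unfolding transp_def l2eq_def by (auto elim: AE_mp)
qed

quotient_type l2 = cfun / partial: l2eq
  morphisms rep_l2 abs_l2
  by (rule part_equivp_l2eq)

text \<open>Only the real structure is kept: the inner product is the real part of the complex
  pairing. Complex conditions are recovered by testing with a function and with its multiple by the
  imaginary unit.\<close>

instantiation l2 :: real_inner
begin

lift_definition zero_l2 :: l2 is "\<lambda>x. 0" by (simp add: l2eq_def)
lift_definition plus_l2 :: "l2 => l2 => l2" is "\<lambda>f g x. f x + g x"
  by (auto simp: l2eq_def intro: L2_add elim: eventually_elim2)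
lift_definition minus_l2 :: "l2 => l2 => l2" is "\<lambda>f g x. f x - g x"
  by (auto simp: l2eq_def intro: L2_diff elim: eventually_elim2)
lift_definition uminus_l2 :: "l2 => l2" is "\<lambda>f x. - f x"
  by (auto simp: l2eq_def intro: L2_uminus)
lift_definition scaleR_l2 :: "real => l2 => l2" is "\<lambda>c f x. of_real c * f x"
  by (auto simp: l2eq_def intro: L2_cmult)
lift_definition inner_l2 :: "l2 => l2 => real" is "\<lambda>f g. Re (LBINT x. f x * cnj (g x))"
  unfolding l2eq_def
proof (elim conjE)
  fix f1 f2 g1 g2 assume a: "f1 \<in> L2" "f2 \<in> L2" "g1 \<in> L2" "g2 \<in> L2"
    "AE x in lborel. f1 x = f2 x" "AE x in lborel. g1 x = g2 x"
  have "(LBINT x. f1 x * cnj (g1 x)) = (LBINT x. f2 x * cnj (g2 x))"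
    by (rule integral_cong_AE) (use a L2_mult_cnj(1)[THEN borel_measurable_integrable] in auto)
  then show "Re (LBINT x. f1 x * cnj (g1 x)) = Re (LBINT x. f2 x * cnj (g2 x))" by simp
qed

definition norm_l2 :: "l2 => real" where "norm_l2 x = sqrt (inner x x)"
definition dist_l2 :: "l2 => l2 => real" where "dist_l2 x y = norm (x - y)"
definition sgn_l2 :: "l2 => l2" where "sgn_l2 x = scaleR (inverse (norm x)) x"
definition uniformity_l2 :: "(l2 \<times> l2) filter"
  where "uniformity_l2 = (INF e\<in>{0 <..}. principal {(x, y). dist x y < e})"
definition open_l2 :: "l2 set => bool"
  where "open_l2 U = (\<forall>x\<in>U. eventually (\<lambda>(x', y). x' = x --> y \<in> U) uniformity)"

instance
proof
  fix x y z :: l2 and a b :: real and U :: "l2 set"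
  show "x + y + z = x + (y + z)" by transfer (auto simp: l2eq_def add.assoc intro: L2_add)
  show "x + y = y + x" by transfer (auto simp: l2eq_def add.commute intro: L2_add)
  show "0 + x = x" by transfer (auto simp: l2eq_def)
  show "- x + x = 0" by transfer (auto simp: l2eq_def)
  show "x - y = x + - y" by transfer (auto simp: l2eq_def intro: L2_diff)
  show "a *\<^sub>R (x + y) = a *\<^sub>R x + a *\<^sub>R y" 
    by transfer (auto simp: l2eq_def distrib_left intro: L2_add L2_cmult)
  show "(a + b) *\<^sub>R x = a *\<^sub>R x + b *\<^sub>R x"
    by transfer (auto simp: l2eq_def distrib_right intro: L2_add L2_cmult)
  show "a *\<^sub>R b *\<^sub>R x = (a * b) *\<^sub>R x"
    by transfer (auto simp: l2eq_def mult.assoc intro!: L2_cmult)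
  show "1 *\<^sub>R x = x" by transfer (auto simp: l2eq_def)
  show "dist x y = norm (x - y)" by (rule dist_l2_def)
  show "sgn x = inverse (norm x) *\<^sub>R x" by (rule sgn_l2_def)
  show "uniformity = (INF e\<in>{0 <..}. principal {(x::l2, y). dist x y < e})" by (rule uniformity_l2_def)
  show "open U = (\<forall>x\<in>U. \<forall>\<^sub>F (x', y) in uniformity. x' = x --> y \<in> U)" by (rule open_l2_def)
  show "inner x y = inner y x"
  proof transfer
    fix f g assume "l2eq f f" "l2eq g g"
    have "(LBINT x. g x * cnj (f x)) = (LBINT x. cnj (f x * cnj (g x)))" by (simp add: mult.commute)
    also have "\<dots> = cnj (LBINT x. f x * cnj (g x))" by (rule Bochner_Integration.integral_cnj)
    finally show "Re (LBINT x. f x * cnj (g x)) = Re (LBINT x. g x * cnj (f x))" by simp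
  qed
  show "inner (x + y) z = inner x z + inner y z"
    by transfer (auto simp: l2eq_def distrib_right L2_mult_cnj)
  show "inner (a *\<^sub>R x) y = a * inner x y"
    by transfer (auto simp: l2eq_def mult.assoc)
  show "0 \<le> inner x x"
    by transfer (auto simp: l2eq_def L2_self simp flip: of_real_power)
  show "inner x x = 0 \<longleftrightarrow> x = 0"
    by transfer (auto simp: l2eq_def L2_self L2norm_zero_iff simp flip: of_real_power)
  show "norm x = sqrt (inner x x)" by (rule norm_l2_def)
qed

end

lemma l2eq_refl: "f \<in> L2 ==> l2eq f f" by (simp add: l2eq_def)

lemma rep_l2_L2[simp, intro]: "rep_l2 x \<in> L2"
  using Quotient_rep_reflp[OF Quotient_l2, of x] by (simp add: l2eq_def)

lemma abs_rep_l2[simp]: "abs_l2 (rep_l2 x) = x"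
  using Quotient_abs_rep[OF Quotient_l2] .

lemma l2_cases: obtains f where "f \<in> L2" "x = abs_l2 f"
  using rep_l2_L2[of x] abs_rep_l2[of x] by metis

lemma rep_abs_l2: "f \<in> L2 ==> AE x in lborel. rep_l2 (abs_l2 f) x = f x"
  using Quotient_rep_abs[OF Quotient_l2, of f] by (simp add: l2eq_def)

lemma abs_l2_eq_iff: "f \<in> L2 ==> g \<in> L2 ==> abs_l2 f = abs_l2 g \<longleftrightarrow> (AE x in lborel. f x = g x)"
  using Quotient_rel[OF Quotient_l2, of f g] by (auto simp: l2eq_def)

lemma abs_l2_zero: "abs_l2 (\<lambda>x. 0) = 0" by (simp add: zero_l2.abs_eq)

lemma abs_l2_eq_0: "f \<in> L2 ==> abs_l2 f = 0 \<longleftrightarrow> (AE x in lborel. f x = 0)"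
  using abs_l2_eq_iff[OF _ L2_zero] by (simp add: abs_l2_zero)

lemma abs_l2_add: "f \<in> L2 ==> g \<in> L2 ==> abs_l2 f + abs_l2 g = abs_l2 (\<lambda>x. f x + g x)"
  by (simp add: plus_l2.abs_eq l2eq_refl)

lemma abs_l2_diff: "f \<in> L2 ==> g \<in> L2 ==> abs_l2 f - abs_l2 g = abs_l2 (\<lambda>x. f x - g x)"
  by (simp add: minus_l2.abs_eq l2eq_refl)

lemma abs_l2_scale: "f \<in> L2 ==> c *\<^sub>R abs_l2 f = abs_l2 (\<lambda>x. of_real c * f x)"
  by (simp add: scaleR_l2.abs_eq l2eq_refl)

lemma inner_abs_l2: "f \<in> L2 ==> g \<in> L2 ==> inner (abs_l2 f) (abs_l2 g) = Re (LBINT x. f x * cnj (g x))"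
  by (simp add: inner_l2.abs_eq l2eq_refl)

lemma norm_abs_l2: "f \<in> L2 ==> norm (abs_l2 f) = L2norm f"
  by (simp add: norm_l2_def inner_abs_l2 L2_self flip: of_real_power)

lemma norm_rep_l2: "L2norm (rep_l2 x) = norm x"
  using norm_abs_l2[OF rep_l2_L2] by simp

lemma n2_diff_l2: "n2 (\<lambda>x. rep_l2 a x - rep_l2 b x) = ennreal ((dist a b)^2)"
proof -
  have "dist a b = norm (abs_l2 (rep_l2 a) - abs_l2 (rep_l2 b))" by (simp add: dist_norm)
  also have "\<dots> = L2norm (\<lambda>x. rep_l2 a x - rep_l2 b x)" by (subst abs_l2_diff) (auto simp: norm_abs_l2 L2_diff)
  finally show ?thesis by (simp add: n2_eq L2_diff)
qed

text \<open>Riesz--Fischer: a rapidly Cauchy subsequence converges almost everywhere, because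
  \<open>\<Sum>k. 2^k |g (k+1) - g k|^2\<close> is integrable.\<close>

instance l2 :: complete_space
proof
  fix X :: "nat => l2" assume X: "Cauchy X"
  have "\<exists>M. \<forall>m\<ge>M. \<forall>n\<ge>M. dist (X m) (X n) < (1/2)^k" for k
    using metric_CauchyD[OF X, of "(1/2)^k"] by simp
  then obtain M where M: "\<And>k m n. m \<ge> M k ==> n \<ge> M k ==> dist (X m) (X n) < (1/2)^k" by metis
  \<comment> \<open>Summing the thresholds makes \<open>N m\<close> dominate \<open>M k\<close> for
    every \<open>k\<close> up to \<open>m\<close>, so all later members of the subsequence are
    admissible at level \<open>k\<close>.\<close>
  define N where "N k = (\<Sum>j\<le>k. M j)" for k
  have N_M: "M k \<le> N m" if "k \<le> m" for k m
    unfolding N_def using that by (intro member_le_sum[of k "{..m}" M]) auto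
  define g where "g k = rep_l2 (X (N k))" for k
  have gL2: "g k \<in> L2" for k by (simp add: g_def)
  note [measurable] = L2_meas[OF gL2]
  have sqb: "ennreal ((dist (X m) (X n))^2) \<le> ennreal ((1/4)^k)" if "m \<ge> M k" "n \<ge> M k" for k m n
  proof (rule ennreal_leI)
    have "(dist (X m) (X n))^2 \<le> ((1/2)^k)^2" using M[OF that] by (intro power_mono) auto
    also have "\<dots> = (1/4)^k" by (simp add: power2_eq_square flip: power_mult_distrib)
    finally show "(dist (X m) (X n))^2 \<le> (1/4)^k" .
  qed
  \<comment> \<open>The squared differences have integral at most \<open>4^-k\<close>; the weight
    leaves the summable \<open>2^-k\<close>. Where the sum is finite, the differences are bounded by
    a geometric sequence with ratio \<open>1 / sqrt 2\<close>.\<close>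
  define D where "D k x = ennreal (2^k) * (ennreal (cmod (g (Suc k) x - g k x)))^2" for k x
  have [measurable]: "D k \<in> borel_measurable borel" for k unfolding D_def by measurable
  have "(NINT x. (\<Sum>k. D k x)) = (\<Sum>k. NINT x. D k x)"
    by (rule nn_integral_suminf) measurable
  also have "\<dots> = (\<Sum>k. ennreal (2^k) * n2 (\<lambda>x. g (Suc k) x - g k x))"
    unfolding D_def n2_def by (subst nn_integral_cmult) auto
  also have "\<dots> \<le> (\<Sum>k. ennreal ((1/2)^k))"
  proof (rule suminf_le)
    fix k
    have "ennreal (2^k) * n2 (\<lambda>x. g (Suc k) x - g k x) \<le> ennreal (2^k) * ennreal ((1/4)^k)"
      unfolding g_def n2_diff_l2 by (intro mult_left_mono sqb N_M) auto
    also have "\<dots> = ennreal ((1/2)^k)" by (simp add: ennreal_mult[symmetric] power_divide[symmetric] flip: power_mult_distrib)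
    finally show "ennreal (2^k) * n2 (\<lambda>x. g (Suc k) x - g k x) \<le> ennreal ((1/2)^k)" .
  qed auto
  also have "\<dots> = ennreal 2" by (subst suminf_ennreal2) (auto simp: suminf_geometric)
  finally have fin: "(NINT x. (\<Sum>k. D k x)) \<noteq> \<infinity>" by (auto simp: top_unique)
  have "AE x in lborel. (\<Sum>k. D k x) \<noteq> \<infinity>"
    by (rule nn_integral_noteq_infinite[OF _ fin]) measurable
  then have conv: "AE x in lborel. convergent (\<lambda>n. g n x)"
  proof (rule eventually_mono)
    fix x assume "(\<Sum>k. D k x) \<noteq> \<infinity>"
    then obtain C where C: "(\<Sum>k. D k x) = ennreal C" "0 \<le> C" by (cases "\<Sum>k. D k x") auto
    have "cmod (g (Suc k) x - g k x) \<le> sqrt C * (1 / sqrt 2)^k" for k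
    proof -
      have "D k x \<le> ennreal C" unfolding C(1)[symmetric] using sum_le_suminf[of "\<lambda>k. D k x" "{k}"] by auto
      then have "2^k * (cmod (g (Suc k) x - g k x))^2 \<le> C"
        using C(2) by (simp add: D_def ennreal_mult[symmetric] ennreal_power)
      then have "(cmod (g (Suc k) x - g k x))^2 \<le> C / 2^k" by (simp add: field_simps)
      then have "cmod (g (Suc k) x - g k x) \<le> sqrt (C / 2^k)" by (rule real_le_rsqrt)
      then show ?thesis by (simp add: real_sqrt_divide real_sqrt_power power_divide)
    qed
    note a = this
    have b: "summable (\<lambda>k. sqrt C * (1 / sqrt 2)^k)"
      by (intro summable_mult summable_geometric) (simp add: real_less_rsqrt)
    have "summable (\<lambda>k. cmod (g (Suc k) x - g k x))"
      by (rule summable_comparison_test'[OF b]) (simp only: real_norm_def abs_norm_cancel a)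
    then have "summable (\<lambda>k. g (Suc k) x - g k x)" by (rule summable_norm_cancel)
    then have "convergent (\<lambda>n. (g n x - g 0 x))"
      by (simp add: summable_iff_convergent sum_lessThan_telescope[of "\<lambda>i. g i x"])
    then obtain l where "(\<lambda>n. (g n x - g 0 x) + g 0 x) \<longlonglongrightarrow> l + g 0 x"
      unfolding convergent_def using tendsto_add[OF _ tendsto_const] by blast
    then show "convergent (\<lambda>n. g n x)" by (auto simp: convergent_def)
  qed
  define f where "f x = lim (\<lambda>n. g n x)" for x
  have fm[measurable]: "f \<in> borel_measurable borel" unfolding f_def by measurable
  \<comment> \<open>Fatou's lemma carries the Cauchy bound over from \<open>g m\<close> to the
    pointwise limit.\<close>
  have fin2: "n2 (\<lambda>x. rep_l2 (X n) x - f x) \<le> ennreal ((1/4)^k)" if n: "n \<ge> N k" for n k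
  proof -
    have [measurable]: "rep_l2 (X n) \<in> borel_measurable borel" by (rule L2_meas[OF rep_l2_L2])
    have "n2 (\<lambda>x. rep_l2 (X n) x - f x) = (NINT x. liminf (\<lambda>m. (ennreal (cmod (rep_l2 (X n) x - g m x)))^2))"
      unfolding n2_def
    proof (rule nn_integral_cong_AE, rule AE_mp[OF conv], rule AE_I2, rule impI)
      fix x assume "convergent (\<lambda>n. g n x)"
      then have "(\<lambda>m. g m x) \<longlonglongrightarrow> f x" by (simp add: f_def convergent_LIMSEQ_iff)
      then have "(\<lambda>m. ennreal ((cmod (rep_l2 (X n) x - g m x))^2)) \<longlonglongrightarrow> ennreal ((cmod (rep_l2 (X n) x - f x))^2)"
        by (intro tendsto_intros)
      then show "(ennreal (cmod (rep_l2 (X n) x - f x)))^2 = liminf (\<lambda>m. (ennreal (cmod (rep_l2 (X n) x - g m x)))^2)"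
        using lim_imp_Liminf[OF trivial_limit_sequentially, symmetric] by (fastforce simp: ennreal_power)
    qed
    also have "\<dots> \<le> liminf (\<lambda>m. n2 (\<lambda>x. rep_l2 (X n) x - g m x))"
      unfolding n2_def by (rule nn_integral_liminf) measurable
    also have "\<dots> \<le> ennreal ((1/4)^k)"
    proof -
      have "eventually (\<lambda>m. n2 (\<lambda>x. rep_l2 (X n) x - g m x) \<le> ennreal ((1/4)^k)) sequentially"
      proof (rule eventually_sequentiallyI)
        fix m assume "k \<le> m"
        then show "n2 (\<lambda>x. rep_l2 (X n) x - g m x) \<le> ennreal ((1/4)^k)"
          unfolding g_def n2_diff_l2 using n N_M[of k k] by (intro sqb N_M) auto
      qed
      then have "liminf (\<lambda>m. n2 (\<lambda>x. rep_l2 (X n) x - g m x)) \<le> liminf (\<lambda>m::nat. ennreal ((1/4)^k))"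
        by (rule Liminf_mono)
      then show ?thesis by (simp add: Liminf_const)
    qed
    finally show ?thesis .
  qed
  have fL2: "f \<in> L2"
  proof -
    have [measurable]: "rep_l2 (X (N 0)) \<in> borel_measurable borel" by (rule L2_meas[OF rep_l2_L2])
    have "(\<lambda>x. rep_l2 (X (N 0)) x - f x) \<in> L2"
      using fin2[of 0 "N 0"] by (auto simp: L2_iff intro: le_less_trans)
    from L2_diff[OF _ this, of "rep_l2 (X (N 0))"] show ?thesis by simp
  qed
  have lim: "X \<longlonglongrightarrow> abs_l2 f"
  proof (rule metric_LIMSEQ_I)
    fix e :: real assume e: "0 < e"
    obtain k where k: "(1/2::real)^k < e" using real_arch_pow_inv[of e "1/2"] e by auto
    have "dist (X n) (abs_l2 f) < e" if n: "n \<ge> N k" for n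
    proof -
      have "dist (X n) (abs_l2 f) = norm (abs_l2 (rep_l2 (X n)) - abs_l2 f)" by (simp add: dist_norm)
      also have "\<dots> = L2norm (\<lambda>x. rep_l2 (X n) x - f x)"
        by (subst abs_l2_diff) (auto simp: norm_abs_l2 L2_diff fL2)
      also have "\<dots> \<le> (1/2)^k"
        by (rule L2norm_le) (use fin2[OF n] in \<open>auto simp: L2_diff fL2 power_mult[symmetric] power_divide mult.commute[of k] power_mult[of 2 2]\<close>)
      finally show ?thesis using k by simp
    qed
    then show "\<exists>no. \<forall>n\<ge>no. dist (X n) (abs_l2 f) < e" by blast
  qed
  then show "convergent X" by (auto simp: convergent_def)
qed

section \<open>Hilbert--Schmidt operators\<close>

definition hs :: "(pt => pt => complex) => ennreal" where
  "hs k = (NINT x. NINT y. (ennreal (cmod (k x y)))^2)"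

definition HSk :: "(pt => pt => complex) => bool" where
  "HSk k \<longleftrightarrow> (\<lambda>(x, y). k x y) \<in> borel_measurable (lborel \<Otimes>\<^sub>M lborel) \<and> hs k < \<infinity>"

text \<open>\<open>enn2real\<close> sends an infinite value to 0, so this is the Hilbert-Schmidt
  norm only for kernels satisfying \<open>HSk\<close>.\<close>

definition hsn :: "(pt => pt => complex) => real" where
  "hsn k = sqrt (enn2real (hs k))"

text \<open>Where the integrand is not integrable the integral is 0, so the pointwise bound by the
  norm of the section holds at every \<open>x\<close>. Additivity in \<open>p\<close> or in the
  kernel is available almost everywhere only.\<close>

definition kop :: "(pt => pt => complex) => cfun => cfun" where
  "kop k p = (\<lambda>x. LBINT y. k x y * p y)"

lemma HSk_meas: "HSk k ==> (\<lambda>(x, y). k x y) \<in> borel_measurable (lborel \<Otimes>\<^sub>M lborel)"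
  by (simp add: HSk_def)

lemma hsn_nonneg[simp]: "0 \<le> hsn k" by (simp add: hsn_def)

lemma hs_eq: "HSk k ==> hs k = ennreal ((hsn k)^2)"
  by (simp add: hsn_def HSk_def less_top)

lemma meas_section:
  "(\<lambda>(x, y). k x y) \<in> borel_measurable (lborel \<Otimes>\<^sub>M lborel) ==> k x \<in> borel_measurable (borel :: 'a::euclidean_space measure)"
  using measurable_Pair2[of "\<lambda>(x, y). k x y" "lborel :: 'b::euclidean_space measure" "lborel :: 'a measure" borel x] by simp

lemma norm_integral_le_nn:
  fixes f :: "'a => 'b::{banach,second_countable_topology}"
  shows "ennreal (norm (\<integral>x. f x \<partial>M)) \<le> (\<integral>\<^sup>+x. ennreal (norm (f x)) \<partial>M)"
  by (cases "integrable M f") (auto simp: integral_norm_bound_ennreal not_integrable_integral_eq)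

lemma kop_pointwise:
  assumes "HSk k" "p \<in> L2"
  shows "(NINT y. ennreal (cmod (k x y * p y)))^2 \<le> (NINT y. (ennreal (cmod (k x y)))^2) * n2 p"
    and "(ennreal (cmod (kop k p x)))^2 \<le> (NINT y. (ennreal (cmod (k x y)))^2) * n2 p"
proof -
  note [measurable] = meas_section[OF HSk_meas[OF assms(1)]] L2_meas[OF assms(2)]
  have "(NINT y. ennreal (cmod (k x y)) * ennreal (cmod (p y)))^2 \<le> (NINT y. (ennreal (cmod (k x y)))^2) * n2 p"
    unfolding n2_def by (rule Cauchy_Schwarz_nn_integral) measurable
  then show 1: "(NINT y. ennreal (cmod (k x y * p y)))^2 \<le> (NINT y. (ennreal (cmod (k x y)))^2) * n2 p"
    by (simp add: norm_mult ennreal_mult)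
  have "(ennreal (cmod (kop k p x)))^2 \<le> (NINT y. ennreal (cmod (k x y * p y)))^2"
    unfolding kop_def by (intro power_mono norm_integral_le_nn) simp
  also note 1
  finally show "(ennreal (cmod (kop k p x)))^2 \<le> (NINT y. (ennreal (cmod (k x y)))^2) * n2 p" .
qed

lemma hs_section_finite:
  assumes "HSk k" shows "AE x in lborel. (NINT y. (ennreal (cmod (k x y)))^2) < \<infinity>"
proof -
  note [measurable] = HSk_meas[OF assms]
  have "AE x in lborel. (NINT y. (ennreal (cmod (k x y)))^2) \<noteq> \<infinity>"
    by (rule nn_integral_noteq_infinite, measurable) (use assms in \<open>auto simp: HSk_def hs_def\<close>)
  then show ?thesis by (simp add: less_top)
qed

lemma kop_integrable:
  assumes "HSk k" "p \<in> L2"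
  shows "AE x in lborel. integrable lborel (\<lambda>y. k x y * p y)"
  using hs_section_finite[OF assms(1)]
proof (rule eventually_mono)
  note [measurable] = meas_section[OF HSk_meas[OF assms(1)]] L2_meas[OF assms(2)]
  fix x assume "(NINT y. (ennreal (cmod (k x y)))^2) < \<infinity>"
  then have "(NINT y. ennreal (cmod (k x y * p y)))^2 < \<infinity>"
    using kop_pointwise(1)[OF assms, of x] L2_n2[OF assms(2)] by (auto simp: ennreal_mult_less_top intro: le_less_trans)
  then show "integrable lborel (\<lambda>y. k x y * p y)"
    by (intro integrableI_bounded) (auto simp: power_less_top_ennreal)
qed

lemma kop_meas:
  assumes "HSk k" "p \<in> L2" shows "kop k p \<in> borel_measurable borel"
proof -
  note [measurable] = HSk_meas[OF assms(1)] L2_meas[OF assms(2)]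
  have "(\<lambda>x. LBINT y. k x y * p y) \<in> borel_measurable lborel"
    by (rule lborel.borel_measurable_lebesgue_integral) measurable
  then show ?thesis by (simp add: kop_def)
qed

lemma n2_kop:
  assumes "HSk k" "p \<in> L2" shows "n2 (kop k p) \<le> hs k * n2 p"
proof -
  note [measurable] = HSk_meas[OF assms(1)] L2_meas[OF assms(2)]
  have "n2 (kop k p) \<le> (NINT x. (NINT y. (ennreal (cmod (k x y)))^2) * n2 p)"
    unfolding n2_def[of "kop k p"] by (intro nn_integral_mono kop_pointwise(2)[OF assms])
  also have "\<dots> = hs k * n2 p" unfolding hs_def by (rule nn_integral_multc) measurable
  finally show ?thesis .
qed

lemma kop_L2: assumes "HSk k" "p \<in> L2" shows "kop k p \<in> L2"
  using n2_kop[OF assms] assms kop_meas[OF assms] L2_n2[OF assms(2)]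
  by (auto simp: L2_iff HSk_def ennreal_mult_less_top intro: le_less_trans)

lemma L2norm_kop: assumes "HSk k" "p \<in> L2" shows "L2norm (kop k p) \<le> hsn k * L2norm p"
proof (rule L2norm_le[OF kop_L2[OF assms]])
  show "n2 (kop k p) \<le> ennreal ((hsn k * L2norm p)^2)"
    using n2_kop[OF assms] by (simp add: hs_eq[OF assms(1)] n2_eq[OF assms(2)] ennreal_mult power_mult_distrib)
qed simp

lemma kop_cong_AE:
  assumes "AE y in lborel. p y = q y" "p \<in> borel_measurable borel" "q \<in> borel_measurable borel" "HSk k"
  shows "kop k p x = kop k q x"
proof -
  note [measurable] = meas_section[OF HSk_meas[OF assms(4)]] assms(2,3)
  show ?thesis unfolding kop_def using assms(1) by (intro integral_cong_AE) auto
qed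

lemma kop_add:
  assumes "HSk k" "p \<in> L2" "q \<in> L2"
  shows "AE x in lborel. kop k (\<lambda>y. p y + q y) x = kop k p x + kop k q x"
  using kop_integrable[OF assms(1,2)] kop_integrable[OF assms(1,3)]
  by eventually_elim (simp add: kop_def distrib_left)

lemma kop_diff:
  assumes "HSk k" "p \<in> L2" "q \<in> L2"
  shows "AE x in lborel. kop k (\<lambda>y. p y - q y) x = kop k p x - kop k q x"
  using kop_integrable[OF assms(1,2)] kop_integrable[OF assms(1,3)]
  by eventually_elim (simp add: kop_def right_diff_distrib)

lemma kop_cmult: "kop k (\<lambda>y. c * p y) x = c * kop k p x"
  unfolding kop_def by (subst integral_mult_right_zero[symmetric]) (simp add: ac_simps)

lemma kop_kernel_diff:
  assumes "HSk k" "HSk l" "p \<in> L2"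
  shows "AE x in lborel. kop (\<lambda>x y. k x y - l x y) p x = kop k p x - kop l p x"
  using kop_integrable[OF assms(1,3)] kop_integrable[OF assms(2,3)]
  by eventually_elim (simp add: kop_def left_diff_distrib)

lemma HSk_diff:
  assumes "HSk k" "HSk l" shows "HSk (\<lambda>x y. k x y - l x y)"
proof -
  note [measurable] = HSk_meas[OF assms(1)] HSk_meas[OF assms(2)]
  have "hs (\<lambda>x y. k x y - l x y) \<le> (NINT x. NINT y. 2 * (ennreal (cmod (k x y)))^2 + 2 * (ennreal (cmod (l x y)))^2)"
    unfolding hs_def
  proof (intro nn_integral_mono)
    fix x y
    have "(ennreal (cmod (k x y - l x y)))^2 \<le> (ennreal (cmod (k x y)) + ennreal (cmod (l x y)))^2"
      by (intro power_mono) (simp_all add: ennreal_plus[symmetric] norm_triangle_ineq4 del: ennreal_plus)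
    then show "(ennreal (cmod (k x y - l x y)))^2 \<le> 2 * (ennreal (cmod (k x y)))^2 + 2 * (ennreal (cmod (l x y)))^2"
      using ennreal_add_sq_le order_trans by blast
  qed
  also have "\<dots> = 2 * hs k + 2 * hs l" by (simp add: nn_integral_add nn_integral_cmult hs_def)
  also have "\<dots> < \<infinity>" using assms by (simp add: HSk_def ennreal_mult_less_top)
  finally show ?thesis by (simp add: HSk_def)
qed

lemma HSk_cmult: assumes "HSk k" shows "HSk (\<lambda>x y. c * k x y)"
proof -
  note [measurable] = HSk_meas[OF assms]
  have "hs (\<lambda>x y. c * k x y) = ennreal ((cmod c)^2) * hs k"
    unfolding hs_def by (simp add: norm_mult ennreal_mult power_mult_distrib nn_integral_cmult ennreal_power)
  then show ?thesis using assms by (simp add: HSk_def ennreal_mult_less_top)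
qed

lemma HSk_adj: assumes "HSk k" shows "HSk (\<lambda>x y. cnj (k y x))"
proof -
  note [measurable] = HSk_meas[OF assms]
  have m: "(\<lambda>(x, y). cnj (k y x)) \<in> borel_measurable (lborel \<Otimes>\<^sub>M lborel)"
  proof -
    have "(\<lambda>z. (snd z, fst z)) \<in> lborel \<Otimes>\<^sub>M lborel \<rightarrow>\<^sub>M lborel \<Otimes>\<^sub>M (lborel :: pt measure)" by measurable
    from measurable_compose[OF this HSk_meas[OF assms]]
    have "(\<lambda>z. k (snd z) (fst z)) \<in> borel_measurable (lborel \<Otimes>\<^sub>M lborel)" by simp
    from borel_measurable_continuous_on[OF continuous_on_cnj[OF continuous_on_id] this]
    show ?thesis by (simp add: case_prod_unfold)
  qed
  have "hs (\<lambda>x y. cnj (k y x)) = hs k"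
    unfolding hs_def complex_mod_cnj by (rule lborel_Tonelli[symmetric]) measurable
  then show ?thesis using assms m by (simp add: HSk_def)
qed

text \<open>Cauchy-Schwarz in \<open>y\<close> and then in \<open>x\<close>. The finiteness licenses
  the exchange of integrals for the adjoint; the quantitative form is reused for the quadratic form
  of the Rollnik kernel.\<close>

lemma kop_triple_bound:
  assumes "HSk k" "p \<in> L2" "q \<in> L2"
  shows "(NINT x. NINT y. ennreal (cmod (k x y * p y * q x)))^2 \<le> hs k * n2 p * n2 q"
    and "(NINT x. NINT y. ennreal (cmod (k x y * p y * q x))) < \<infinity>"
proof -
  note [measurable] = HSk_meas[OF assms(1)] L2_meas[OF assms(2)] L2_meas[OF assms(3)]
  define H where "H x = (NINT y. ennreal (cmod (k x y * p y)))" for x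
  have [measurable]: "H \<in> borel_measurable borel" unfolding H_def by measurable
  have "(NINT x. NINT y. ennreal (cmod (k x y * p y * q x))) = (NINT x. H x * ennreal (cmod (q x)))"
    unfolding H_def
    by (intro nn_integral_cong, subst nn_integral_multc[symmetric]) (auto simp: norm_mult ennreal_mult)
  also have "(\<dots>)^2 \<le> (NINT x. (H x)^2) * n2 q"
    unfolding n2_def by (rule Cauchy_Schwarz_nn_integral) measurable
  also have "\<dots> \<le> (hs k * n2 p) * n2 q"
  proof (rule mult_right_mono)
    have "(NINT x. (H x)^2) \<le> (NINT x. (NINT y. (ennreal (cmod (k x y)))^2) * n2 p)"
      unfolding H_def by (intro nn_integral_mono kop_pointwise(1)[OF assms(1,2)])
    also have "\<dots> = hs k * n2 p" unfolding hs_def by (rule nn_integral_multc) measurable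
    finally show "(NINT x. (H x)^2) \<le> hs k * n2 p" .
  qed simp
  finally show 1: "(NINT x. NINT y. ennreal (cmod (k x y * p y * q x)))^2 \<le> hs k * n2 p * n2 q" .
  also have "\<dots> < \<infinity>" using assms L2_n2 by (auto simp: HSk_def ennreal_mult_less_top)
  finally show "(NINT x. NINT y. ennreal (cmod (k x y * p y * q x))) < \<infinity>"
    by (simp add: power_less_top_ennreal)
qed

lemma kop_adjoint:
  assumes "HSk k" "p \<in> L2" "q \<in> L2"
  shows "(LBINT x. kop k p x * cnj (q x)) = (LBINT y. p y * cnj (kop (\<lambda>x y. cnj (k y x)) q y))"
proof -
  note [measurable] = HSk_meas[OF assms(1)] L2_meas[OF assms(2)] L2_meas[OF L2_cnj[OF assms(3)]]
  have "(LBINT x. kop k p x * cnj (q x)) = (LBINT x. LBINT y. k x y * p y * cnj (q x))"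
    unfolding kop_def by simp
  also have "\<dots> = (LBINT y. LBINT x. k x y * p y * cnj (q x))"
  proof (rule lborel_Fubini(1))
    show "(NINT x. NINT y. ennreal (cmod (k x y * p y * cnj (q x)))) < \<infinity>"
      using kop_triple_bound(2)[OF assms(1,2) L2_cnj[OF assms(3)]] .
  qed measurable
  also have "\<dots> = (LBINT y. p y * cnj (LBINT x. cnj (k x y) * q x))"
    by (subst Bochner_Integration.integral_cnj[symmetric], subst integral_mult_right_zero[symmetric])
       (simp add: ac_simps)
  finally show ?thesis by (simp add: kop_def)
qed

section \<open>Integral operators on the Hilbert space: compactness and solvability\<close>

definition opl :: "(pt => pt => complex) => l2 => l2" where
  "opl k x = abs_l2 (kop k (rep_l2 x))"

lemma opl_abs:
  assumes "HSk k" "p \<in> L2" shows "opl k (abs_l2 p) = abs_l2 (kop k p)"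
proof -
  have "kop k (rep_l2 (abs_l2 p)) = kop k p"
    by (intro ext kop_cong_AE assms) (use rep_abs_l2[OF assms(2)] L2_meas[OF assms(2)] L2_meas[OF rep_l2_L2] in auto)
  then show ?thesis by (simp add: opl_def)
qed

lemma bounded_linear_opl: assumes k: "HSk k" shows "bounded_linear (opl k)"
proof (rule bounded_linear_intro[where K="hsn k"])
  fix x y :: l2 and r :: real
  obtain p where p: "p \<in> L2" "x = abs_l2 p" by (rule l2_cases)
  obtain q where q: "q \<in> L2" "y = abs_l2 q" by (rule l2_cases)
  have "opl k (x + y) = abs_l2 (kop k (\<lambda>x. p x + q x))" by (simp add: p q abs_l2_add opl_abs k L2_add)
  also have "\<dots> = abs_l2 (\<lambda>x. kop k p x + kop k q x)"
    by (subst abs_l2_eq_iff) (auto simp: p q k kop_L2 L2_add kop_add)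
  finally show "opl k (x + y) = opl k x + opl k y" by (simp add: p q opl_abs k abs_l2_add kop_L2)
  have "opl k (r *\<^sub>R x) = abs_l2 (kop k (\<lambda>x. of_real r * p x))" by (simp add: p abs_l2_scale opl_abs k L2_cmult)
  also have "kop k (\<lambda>x. of_real r * p x) = (\<lambda>x. of_real r * kop k p x)" by (rule ext) (rule kop_cmult)
  finally show "opl k (r *\<^sub>R x) = r *\<^sub>R opl k x" by (simp add: p opl_abs k abs_l2_scale kop_L2)
  show "norm (opl k x) \<le> norm x * hsn k" using L2norm_kop[OF k p(1)] by (simp add: p opl_abs k norm_abs_l2 kop_L2 mult.commute)
qed

lemma opl_adjoint:
  assumes "HSk k" shows "inner (opl k x) y = inner x (opl (\<lambda>x y. cnj (k y x)) y)"
proof -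
  obtain p where p: "p \<in> L2" "x = abs_l2 p" by (rule l2_cases)
  obtain q where q: "q \<in> L2" "y = abs_l2 q" by (rule l2_cases)
  show ?thesis using kop_adjoint[OF assms p(1) q(1)]
    by (simp add: p q opl_abs assms HSk_adj inner_abs_l2 kop_L2)
qed

text \<open>Almost every section of the kernel is square integrable, so weak convergence gives
  convergence of the images at such a point. Their squares are dominated by the integrable squared
  norm of the section, and dominated convergence upgrades this to convergence in norm.\<close>

lemma opl_weak_to_strong:
  fixes p :: "nat => l2"
  assumes k: "HSk k" and p1: "\<And>n. norm (p n) \<le> 1" and w: "\<And>b. convergent (\<lambda>n. inner (p n) b)"
  shows "convergent (\<lambda>n. opl k (p n))"
proof -
  define F where "F n = kop k (rep_l2 (p n))" for n
  have FL2: "F n \<in> L2" for n by (simp add: F_def kop_L2 k)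
  note [measurable] = L2_meas[OF FL2] HSk_meas[OF k]
  define H where "H x = (NINT y. (ennreal (cmod (k x y)))^2)" for x
  have [measurable]: "H \<in> borel_measurable borel" unfolding H_def by measurable
  have n21: "n2 (rep_l2 (p n)) \<le> 1" for n
    using p1[of n] by (simp add: n2_eq norm_rep_l2 power_le_one)
  have FH: "(ennreal (cmod (F n x)))^2 \<le> H x" for n x
    using order_trans[OF kop_pointwise(2)[OF k rep_l2_L2, of "p n" x] mult_left_mono[OF n21[of n]]] by (simp add: F_def H_def)
  have conv: "AE x in lborel. convergent (\<lambda>n. F n x)"
    using hs_section_finite[OF k]
  proof (rule eventually_mono)
    fix x assume fin: "(NINT y. (ennreal (cmod (k x y)))^2) < \<infinity>"
    have kx: "k x \<in> L2" using fin meas_section[OF HSk_meas[OF k], of x] by (simp add: L2_iff n2_def)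
    have inn: "inner (p n) (abs_l2 (\<lambda>y. cnj (c * k x y))) = Re (c * F n x)" for n c
    proof -
      have "inner (p n) (abs_l2 (\<lambda>y. cnj (c * k x y))) = inner (abs_l2 (rep_l2 (p n))) (abs_l2 (\<lambda>y. cnj (c * k x y)))" by simp
      also have "\<dots> = Re (LBINT y. rep_l2 (p n) y * (c * k x y))"
        by (subst inner_abs_l2) (auto intro!: L2_cnj L2_cmult kx simp del: complex_cnj_mult)
      also have "(LBINT y. rep_l2 (p n) y * (c * k x y)) = c * F n x"
        unfolding F_def kop_def by (subst integral_mult_right_zero[symmetric]) (simp add: ac_simps)
      finally show ?thesis .
    qed
    \<comment> \<open>The real inner product sees one part at a time: the factors \<open>1\<close>
      and \<open>-\<i>\<close> select the real and the imaginary part.\<close>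
    have "convergent (\<lambda>n. Re (F n x))" using w[of "abs_l2 (\<lambda>y. cnj (1 * k x y))"] unfolding inn by simp
    moreover have "convergent (\<lambda>n. Im (F n x))" using w[of "abs_l2 (\<lambda>y. cnj (-\<i> * k x y))"] unfolding inn by simp
    ultimately obtain a b where "(\<lambda>n. Re (F n x)) \<longlonglongrightarrow> a" "(\<lambda>n. Im (F n x)) \<longlonglongrightarrow> b" by (auto simp: convergent_def)
    then have "(\<lambda>n. F n x) \<longlonglongrightarrow> Complex a b" by (simp add: tendsto_complex_iff)
    then show "convergent (\<lambda>n. F n x)" by (auto simp: convergent_def)
  qed
  define S where "S x = lim (\<lambda>n. F n x)" for x
  have Sm[measurable]: "S \<in> borel_measurable borel" unfolding S_def by measurable
  have lim: "AE x in lborel. (\<lambda>n. F n x) \<longlonglongrightarrow> S x"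
    using conv by eventually_elim (simp add: S_def convergent_LIMSEQ_iff)
  have SH: "AE x in lborel. (ennreal (cmod (S x)))^2 \<le> H x"
    using lim
  proof (rule eventually_mono)
    fix x assume "(\<lambda>n. F n x) \<longlonglongrightarrow> S x"
    then have "(\<lambda>n. ennreal ((cmod (F n x))^2)) \<longlonglongrightarrow> ennreal ((cmod (S x))^2)" by (intro tendsto_intros)
    then show "(ennreal (cmod (S x)))^2 \<le> H x"
      by (intro LIMSEQ_le_const2[where X="\<lambda>n. ennreal ((cmod (F n x))^2)"]) (use FH[of _ x] in \<open>auto simp: ennreal_power\<close>)
  qed
  have Hfin: "(NINT x. H x) < \<infinity>" using k by (simp add: HSk_def hs_def H_def)
  have SL2: "S \<in> L2"
    using le_less_trans[OF nn_integral_mono_AE[OF SH] Hfin] by (simp add: L2_iff n2_def)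
  have lim0: "(\<lambda>n. n2 (\<lambda>x. F n x - S x)) \<longlonglongrightarrow> (\<integral>\<^sup>+x. 0 \<partial>(lborel :: pt measure))"
    unfolding n2_def
  proof (rule nn_integral_dominated_convergence[where w="\<lambda>x. 4 * H x"])
    show "(NINT x. 4 * H x) < \<infinity>" using Hfin by (simp add: nn_integral_cmult ennreal_mult_less_top)
    show "AE x in lborel. (ennreal (cmod (F n x - S x)))^2 \<le> 4 * H x" for n
      using SH
    proof (rule eventually_mono)
      fix x assume a: "(ennreal (cmod (S x)))^2 \<le> H x"
      have "(ennreal (cmod (F n x - S x)))^2 \<le> (ennreal (cmod (F n x)) + ennreal (cmod (S x)))^2"
        by (intro power_mono) (simp_all add: ennreal_plus[symmetric] norm_triangle_ineq4 del: ennreal_plus)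
      also have "\<dots> \<le> 2 * (ennreal (cmod (F n x)))^2 + 2 * (ennreal (cmod (S x)))^2" by (rule ennreal_add_sq_le)
      also have "\<dots> \<le> 2 * H x + 2 * H x" by (intro add_mono mult_left_mono FH a) auto
      also have "\<dots> = 4 * H x" by (simp flip: distrib_right)
      finally show "(ennreal (cmod (F n x - S x)))^2 \<le> 4 * H x" .
    qed
    show "AE x in lborel. (\<lambda>n. (ennreal (cmod (F n x - S x)))^2) \<longlonglongrightarrow> 0"
      using lim
    proof (rule eventually_mono)
      fix x assume "(\<lambda>n. F n x) \<longlonglongrightarrow> S x"
      then have "(\<lambda>n. ennreal ((cmod (F n x - S x))^2)) \<longlonglongrightarrow> ennreal ((cmod (S x - S x))^2)" by (intro tendsto_intros)
      then show "(\<lambda>n. (ennreal (cmod (F n x - S x)))^2) \<longlonglongrightarrow> 0" by (simp add: ennreal_power)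
    qed
  qed measurable
  have "(\<lambda>n. opl k (p n)) \<longlonglongrightarrow> abs_l2 S"
  proof (rule tendsto_dist_iff[THEN iffD2])
    have "(\<lambda>n. enn2real (n2 (\<lambda>x. F n x - S x))) \<longlonglongrightarrow> 0"
      using lim0 by (intro tendsto_enn2real) simp_all
    moreover have "enn2real (n2 (\<lambda>x. F n x - S x)) = (dist (opl k (p n)) (abs_l2 S))^2" for n
      by (simp add: dist_norm opl_def F_def[symmetric] abs_l2_diff FL2 SL2 norm_abs_l2 L2_diff n2_eq)
    ultimately have "(\<lambda>n. (dist (opl k (p n)) (abs_l2 S))^2) \<longlonglongrightarrow> 0" by simp
    then show "(\<lambda>n. dist (opl k (p n)) (abs_l2 S)) \<longlonglongrightarrow> 0"
      using tendsto_real_sqrt by fastforce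
  qed
  then show ?thesis by (auto simp: convergent_def)
qed

lemma id_plus_kop_eq_0_iff:
  assumes "HSk k" "p \<in> L2"
  shows "abs_l2 p + opl k (abs_l2 p) = 0 \<longleftrightarrow> (AE x in lborel. p x + kop k p x = 0)"
  using assms by (simp add: opl_abs abs_l2_add kop_L2 abs_l2_eq_0 L2_add)

text \<open>The complex side condition becomes two real ones and cuts out a closed real subspace.
  With \<open>w = 0\<close> it is void; at a resonance \<open>w\<close> is the function dual to the
  eigenfunction, and the condition removes the kernel of \<open>1 + K\<close>.\<close>

lemma id_plus_kop_bounded_below:
  assumes k: "HSk k" and w: "w \<in> L2"
    and inj: "\<And>p. p \<in> L2 ==> (LBINT x. w x * p x) = 0 ==> AE x in lborel. p x + kop k p x = 0
      ==> AE x in lborel. p x = 0"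
  shows "\<exists>c>0. \<forall>p\<in>L2. (LBINT x. w x * p x) = 0 --> c * L2norm p \<le> L2norm (\<lambda>x. p x + kop k p x)"
proof -
  define a where "a = abs_l2 (\<lambda>x. cnj (w x))"
  define b where "b = abs_l2 (\<lambda>x. cnj (- \<i> * w x))"
  have ip: "inner (abs_l2 p) (abs_l2 (\<lambda>x. cnj (c * w x))) = Re (c * (LBINT x. w x * p x))" if "p \<in> L2" for p c
  proof -
    have "inner (abs_l2 p) (abs_l2 (\<lambda>x. cnj (c * w x))) = Re (LBINT x. p x * (c * w x))"
      by (subst inner_abs_l2) (auto intro!: L2_cnj L2_cmult w that simp del: complex_cnj_mult)
    also have "(LBINT x. p x * (c * w x)) = c * (LBINT x. w x * p x)"
      by (subst integral_mult_right_zero[symmetric]) (simp add: ac_simps)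
    finally show ?thesis .
  qed
  define M where "M = {x. inner x a = 0 \<and> inner x b = 0}"
  have M_iff: "abs_l2 p \<in> M \<longleftrightarrow> (LBINT x. w x * p x) = 0" if "p \<in> L2" for p
    using ip[OF that, of 1] ip[OF that, of "-\<i>"] by (simp add: M_def a_def b_def complex_eq_iff)
  have "subspace M" unfolding subspace_def M_def by (auto simp: inner_add_left)
  moreover have "closed M" unfolding M_def
    by (intro closed_Collect_conj closed_Collect_eq continuous_intros)
  ultimately have "\<exists>c>0. \<forall>x\<in>M. c * norm x \<le> norm (x + opl k x)"
  proof (intro bounded_below_id_plus_compact bounded_linear_opl k opl_weak_to_strong)
    fix x assume x: "x \<in> M" "x + opl k x = 0"
    obtain p where p: "p \<in> L2" "x = abs_l2 p" by (rule l2_cases)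
    show "x = 0" using x inj[OF p(1)] by (simp add: p M_iff id_plus_kop_eq_0_iff k abs_l2_eq_0)
  qed
  then obtain c where c: "c > 0" "\<And>x. x \<in> M ==> c * norm x \<le> norm (x + opl k x)" by blast
  have "c * L2norm p \<le> L2norm (\<lambda>x. p x + kop k p x)" if "p \<in> L2" "(LBINT x. w x * p x) = 0" for p
    using c(2)[of "abs_l2 p"] that by (simp add: M_iff opl_abs k abs_l2_add kop_L2 norm_abs_l2 L2_add)
  then show ?thesis using c(1) by blast
qed

text \<open>The Fredholm alternative in the shape needed: compactness and injectivity bound
  \<open>1 + K\<close> from below, and with an injective adjoint the normal equation produces a
  preimage.\<close>

lemma id_plus_kop_surj:
  assumes k: "HSk k" and b: "b \<in> L2"
    and inj: "\<And>p. p \<in> L2 ==> AE x in lborel. p x + kop k p x = 0 ==> AE x in lborel. p x = 0"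
    and adj_inj: "\<And>p. p \<in> L2 ==> AE x in lborel. p x + kop (\<lambda>x y. cnj (k y x)) p x = 0 ==> AE x in lborel. p x = 0"
  shows "\<exists>p\<in>L2. AE x in lborel. p x + kop k p x = b x"
proof -
  define k' where "k' = (\<lambda>x y. cnj (k y x))"
  have k': "HSk k'" unfolding k'_def by (rule HSk_adj[OF k])
  have "\<exists>c>0. \<forall>x\<in>UNIV. c * norm x \<le> norm (x + opl k x)"
  proof (intro bounded_below_id_plus_compact bounded_linear_opl k opl_weak_to_strong)
    fix x assume x: "x + opl k x = 0"
    obtain p where p: "p \<in> L2" "x = abs_l2 p" by (rule l2_cases)
    show "x = 0" using x inj[OF p(1)] by (simp add: p id_plus_kop_eq_0_iff k abs_l2_eq_0)
  qed auto
  then obtain c where c: "c > 0" "\<And>x. c * norm x \<le> norm (x + opl k x)" by blast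
  have "\<exists>x. x + opl k x = abs_l2 b"
  proof (rule surj_of_bounded_below_adjoint_inj[where S="\<lambda>x. x + opl k' x" and c=c])
    show "bounded_linear (\<lambda>x. x + opl k x)" by (intro bounded_linear_add bounded_linear_ident bounded_linear_opl k)
    show "bounded_linear (\<lambda>x. x + opl k' x)" by (intro bounded_linear_add bounded_linear_ident bounded_linear_opl k')
    show "inner (x + opl k x) y = inner x (y + opl k' y)" for x y
      by (simp add: inner_add_left inner_add_right opl_adjoint[OF k] k'_def)
    show "y = 0" if y: "y + opl k' y = 0" for y
    proof -
      obtain p where p: "p \<in> L2" "y = abs_l2 p" by (rule l2_cases)
      show "y = 0" using y adj_inj[OF p(1)] by (simp add: p id_plus_kop_eq_0_iff k' abs_l2_eq_0 k'_def[symmetric])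
    qed
  qed (use c in auto)
  then obtain x where x: "x + opl k x = abs_l2 b" by blast
  obtain p where p: "p \<in> L2" "x = abs_l2 p" by (rule l2_cases)
  have "AE x in lborel. p x + kop k p x = b x"
    using x by (simp add: p opl_abs k abs_l2_add kop_L2 abs_l2_eq_iff b L2_add)
  then show ?thesis using p(1) by blast
qed

section \<open>Radial integrals\<close>

lemma measurable_pt_index[measurable]: "(\<lambda>x::pt. x $ i) \<in> borel_measurable borel"
  by (intro borel_measurable_continuous_onI continuous_intros)

text \<open>The image of Lebesgue measure under the norm and the measure with density
  \<open>4 \<pi> r^2\<close> agree on the half-lines \<open>{..a}\<close>, by the volume of the ball
  and the fundamental theorem of calculus. These half-lines are closed under intersection and
  generate the Borel sets.\<close>

lemma nn_integral_radial:
  assumes [measurable]: "F \<in> borel_measurable borel"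
  shows "(NINT x. F (norm (x::pt))) = (NINT r. F r * (ennreal (4 * pi * r^2) * indicator {0..} r))"
proof -
  define D where "D = density lborel (\<lambda>r::real. ennreal (4 * pi * r^2) * indicator {0..} r)"
  have "distr lborel borel (norm :: pt => real) = D"
  proof (rule measure_eqI_generator_eq[where E="range atMost" and \<Omega>=UNIV and A="\<lambda>n. {..real n}"])
    show "Int_stable (range (atMost :: real => _))"
      by (auto simp: Int_stable_def intro!: image_eqI[where x="min _ _"])
    show "sets (distr lborel borel (norm :: pt => real)) = sigma_sets UNIV (range atMost)"
      by (simp add: borel_eq_atMost)
    show "sets D = sigma_sets UNIV (range atMost)"
      by (simp add: D_def borel_eq_atMost)
    show "(\<Union>n. {..real n}) = UNIV" by (auto intro: real_arch_simple)
    have meas: "emeasure (distr lborel borel (norm :: pt => real)) {..a} = ennreal (4/3 * pi * (max 0 a)^3)" for a :: real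
    proof -
      have "norm -` {..a} = (if a < 0 then {} else cball (0::pt) a)"
        by (auto simp: not_less) (metis norm_ge_zero order_le_less_trans not_less)+
      then show ?thesis
        by (subst emeasure_distr) (auto simp: emeasure_cball unit_ball_vol_3 not_less max_def)
    qed
    have "emeasure D {..a} = ennreal (4/3 * pi * (max 0 a)^3)" for a :: real
    proof -
      have "emeasure D {..a} = (NINT r. ennreal (4 * pi * r^2) * indicator {0..} r * indicator {..a} r)"
        unfolding D_def by (rule emeasure_density) auto
      also have "\<dots> = (NINT r. ennreal (4 * pi * r^2) * indicator {0..a} r)"
        by (intro nn_integral_cong) (auto split: split_indicator)
      also have "\<dots> = ennreal (4/3 * pi * (max 0 a)^3)"
      proof (cases "0 \<le> a")
        case True
        have "(NINT r. ennreal (4 * pi * r^2) * indicator {0..a} r) = ennreal (4/3 * pi * a^3) - ennreal (4/3 * pi * 0^3)"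
          by (subst nn_integral_FTC_Icc[where F="\<lambda>r. 4/3 * pi * r^3"])
             (use True in \<open>auto intro!: derivative_eq_intros simp: ennreal_minus\<close>)
        then show ?thesis using True by simp
      qed (auto simp: max_def)
      finally show ?thesis .
    qed
    then show "\<And>X. X \<in> range atMost ==> emeasure (distr lborel borel (norm :: pt => real)) X = emeasure D X"
      using meas by auto
    show "emeasure (distr lborel borel (norm :: pt => real)) {..real n} \<noteq> \<infinity>" for n
      by (simp add: meas)
  qed auto
  then have "(\<integral>\<^sup>+r. F r \<partial>distr lborel borel (norm :: pt => real)) = (\<integral>\<^sup>+r. F r \<partial>D)" by simp
  then show ?thesis
    by (simp add: nn_integral_distr D_def nn_integral_density mult.commute)
qed

section \<open>Affine changes of variables\<close>

lemma nn_integral_lborel_affine: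
  assumes "f \<in> borel_measurable borel" "c \<noteq> 0"
  shows "(NINT x. f (t + c *\<^sub>R (x::pt))) * ennreal (\<bar>c\<bar>^3) = (NINT x. f x)"
proof -
  note [measurable] = assms(1)
  have [measurable]: "(\<lambda>x::pt. t + c *\<^sub>R x) \<in> borel \<rightarrow>\<^sub>M borel" by measurable
  have "(NINT x. f x) = (\<integral>\<^sup>+x. f x \<partial>density (distr lborel borel (\<lambda>x. t + c *\<^sub>R x)) (\<lambda>_. \<bar>c\<bar>^DIM(pt)))"
    using lborel_affine[OF assms(2), of t] by simp
  also have "\<dots> = (NINT x. ennreal (\<bar>c\<bar>^3) * f (t + c *\<^sub>R x))"
    by (subst nn_integral_density) (auto simp: nn_integral_distr)
  also have "\<dots> = ennreal (\<bar>c\<bar>^3) * (NINT x. f (t + c *\<^sub>R x))"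
    by (rule nn_integral_cmult) measurable
  finally show ?thesis by (simp add: mult.commute)
qed

lemma nn_integral_translate:
  assumes "f \<in> borel_measurable borel"
  shows "(NINT x. f (x - (y::pt))) = (NINT x. f x)"
    and "(NINT x. f ((y::pt) - x)) = (NINT x. f x)"
  using nn_integral_lborel_affine[OF assms, of 1 "-y"] nn_integral_lborel_affine[OF assms, of "-1" y] by simp_all

lemma integral_lborel_affine:
  fixes f :: "pt => complex"
  assumes "f \<in> borel_measurable borel" "c \<noteq> 0"
  shows "(LBINT x. f x) = of_real (\<bar>c\<bar>^3) * (LBINT x. f (t + c *\<^sub>R x))"
proof -
  note [measurable] = assms(1)
  have [measurable]: "(\<lambda>x::pt. t + c *\<^sub>R x) \<in> borel \<rightarrow>\<^sub>M borel" by measurable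
  have "(LBINT x. f x) = (\<integral>x. f x \<partial>density (distr lborel borel (\<lambda>x. t + c *\<^sub>R x)) (\<lambda>_. ennreal (\<bar>c\<bar>^DIM(pt))))"
    using lborel_affine[OF assms(2), of t] by (simp add: ennreal_power)
  also have "\<dots> = (LBINT x. (\<bar>c\<bar>^3) *\<^sub>R f (t + c *\<^sub>R x))"
    by (subst integral_density) (auto simp: integral_distr)
  also have "\<dots> = of_real (\<bar>c\<bar>^3) * (LBINT x. f (t + c *\<^sub>R x))"
    by (subst integral_mult_right_zero[symmetric]) (simp add: scaleR_conv_of_real)
  finally show ?thesis .
qed

lemma AE_lborel_affine:
  assumes "AE x in lborel. P (x::pt)" "c \<noteq> 0"
  shows "AE x in lborel. P (t + c *\<^sub>R x)"
proof -
  obtain N where N: "{x. \<not> P x} \<subseteq> N" "N \<in> sets lborel" "emeasure lborel N = 0"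
    using assms(1) by (auto elim!: AE_E)
  have m: "(\<lambda>x::pt. t + c *\<^sub>R x) \<in> borel \<rightarrow>\<^sub>M borel" by measurable
  have Nb: "N \<in> sets borel" using N(2) by simp
  have m2: "(\<lambda>x::pt. t + c *\<^sub>R x) -` N \<in> sets borel" using measurable_sets[OF m Nb] by simp
  have "(NINT x. indicator N (t + c *\<^sub>R x)) * ennreal (\<bar>c\<bar>^3) = (NINT x. indicator N x)"
    by (rule nn_integral_lborel_affine[OF _ assms(2)]) (use Nb in measurable)
  then have "(NINT x. indicator N (t + c *\<^sub>R x)) = 0"
    using N Nb assms(2) by simp
  also have "(\<lambda>x. indicator N (t + c *\<^sub>R x) :: ennreal) = indicator ((\<lambda>x. t + c *\<^sub>R x) -` N)"
    by (auto simp: fun_eq_iff split: split_indicator)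
  finally have "emeasure lborel ((\<lambda>x. t + c *\<^sub>R x) -` N) = 0" using m2 by simp
  then show ?thesis by (intro AE_I[where N="(\<lambda>x. t + c *\<^sub>R x) -` N"]) (use N m2 in auto)
qed

lemma AE_pt_neq: "AE x in lborel. (x::pt) \<noteq> y"
  by (rule AE_lborel_singleton)

lemma AE_real_pos: "AE r in lborel. r \<noteq> (0::real)"
  by (rule AE_lborel_singleton)

lemma exp_poly_tendsto:
  assumes "0 < (a::real)"
  shows "((\<lambda>r. (r + 1) / a * exp (- a * r) + exp (- a * r) / a^2) \<longlongrightarrow> 0) at_top"
proof -
  have "filterlim (\<lambda>r. a * r) at_top at_top"
    by (rule filterlim_tendsto_pos_mult_at_top[OF tendsto_const assms filterlim_ident])
  then have 1: "((\<lambda>r. (a * r) ^ k / exp (a * r)) \<longlongrightarrow> 0) at_top" for k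
    using filterlim_compose[OF tendsto_power_div_exp_0] by blast
  have "((\<lambda>r. ((a * r)^1 / exp (a * r) / a + (a * r)^0 / exp (a * r)) / a + (a * r)^0 / exp (a * r) / a^2) \<longlongrightarrow> (0 / a + 0) / a + 0 / a^2) at_top"
    by (intro tendsto_intros 1) (use assms in auto)
  moreover have "((a * r)^1 / exp (a * r) / a + (a * r)^0 / exp (a * r)) / a + (a * r)^0 / exp (a * r) / a^2
     = (r + 1) / a * exp (- a * r) + exp (- a * r) / a^2" for r
    using assms by (simp add: exp_minus field_simps)
  ultimately show ?thesis by simp
qed

lemma nn_integral_exp_finite:
  assumes "0 < (a::real)"
  shows "(NINT r. ennreal ((r + 1) * exp (- a * r)) * indicator {0..} r) < \<infinity>"
proof -
  have "(NINT r. ennreal ((r + 1) * exp (- a * r)) * indicator {0..} r)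
     = ennreal (0 - (- ((0 + 1) / a * exp (- a * 0) + exp (- a * 0) / a^2)))"
  proof (rule nn_integral_FTC_atLeast)
    show "((\<lambda>r. - ((r + 1) / a * exp (- a * r) + exp (- a * r) / a^2)) has_real_derivative (x + 1) * exp (- a * x)) (at x)" for x
      using assms by (auto intro!: derivative_eq_intros simp: field_simps power2_eq_square)
    show "((\<lambda>r. - ((r + 1) / a * exp (- a * r) + exp (- a * r) / a^2)) \<longlongrightarrow> 0) at_top"
      using tendsto_minus[OF exp_poly_tendsto[OF assms]] by simp
  qed auto
  then show ?thesis by simp
qed

text \<open>A common majorant, up to constants, of the Green function with singularity
  \<open>1/|z|\<close> and of its gradient with singularity \<open>1/|z|^2\<close>. It is integrable
  in three dimensions but not square integrable.\<close>

definition Nk :: "real => pt => real" where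
  "Nk a z = exp (- a * norm z) * (1 / norm z + 1 / (norm z)^2)"

lemma Nk_nonneg[simp]: "0 \<le> Nk a z" by (simp add: Nk_def)

lemma Nk_meas[measurable]: "Nk a \<in> borel_measurable borel"
  unfolding Nk_def[abs_def] by measurable

lemma Nk_minus[simp]: "Nk a (x - y) = Nk a (y - x)"
  by (simp add: Nk_def norm_minus_commute)

lemma Nk_integral: assumes "0 < a" shows "(NINT z. ennreal (Nk a z)) < \<infinity>"
proof -
  have "(NINT z. ennreal (Nk a z)) = (NINT r. ennreal (exp (- a * r) * (1 / r + 1 / r^2)) * (ennreal (4 * pi * r^2) * indicator {0..} r))"
    unfolding Nk_def by (rule nn_integral_radial) measurable
  also have "\<dots> = (NINT r. ennreal (4 * pi) * (ennreal ((r + 1) * exp (- a * r)) * indicator {0..} r))"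
  proof (intro nn_integral_cong_AE, use AE_real_pos in eventually_elim)
    fix r :: real assume "r \<noteq> 0"
    then have "exp (- a * r) * (1 / r + 1 / r^2) * (4 * pi * r^2) = 4 * pi * ((r + 1) * exp (- a * r))"
      by (simp add: field_simps power2_eq_square)
    then have "0 \<le> r ==> ennreal (exp (- a * r) * (1 / r + 1 / r^2)) * ennreal (4 * pi * r^2) = ennreal (4 * pi) * ennreal ((r + 1) * exp (- a * r))"
      by (subst (1 2) ennreal_mult[symmetric]) (simp_all only: zero_le_mult_iff zero_le_power2 exp_ge_zero add_nonneg_nonneg zero_le_divide_1_iff zero_le_one pi_ge_zero zero_le_numeral simp_thms mult_nonneg_nonneg)
    then show "ennreal (exp (- a * r) * (1 / r + 1 / r^2)) * (ennreal (4 * pi * r^2) * indicator {0..} r) = ennreal (4 * pi) * (ennreal ((r + 1) * exp (- a * r)) * indicator {0..} r)"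
      by (simp split: split_indicator)
  qed
  also have "\<dots> = ennreal (4 * pi) * (NINT r. ennreal ((r + 1) * exp (- a * r)) * indicator {0..} r)"
    by (rule nn_integral_cmult) measurable
  also have "\<dots> < \<infinity>" using nn_integral_exp_finite[OF assms] by (simp add: ennreal_mult_less_top)
  finally show ?thesis .
qed

lemma Yuk_sq_integral: assumes "0 < a" shows "(NINT z. (ennreal (exp (- a * norm (z::pt)) / norm z))^2) < \<infinity>"
proof -
  have "(\<integral>\<^sup>+z. (ennreal (exp (- a * norm z) / norm z))^2 \<partial>(lborel :: pt measure)) = (NINT r. (ennreal (exp (- a * r) / r))^2 * (ennreal (4 * pi * r^2) * indicator {0..} r))"
    by (rule nn_integral_radial) measurable
  also have "\<dots> \<le> (NINT r. ennreal (4 * pi) * (ennreal ((r + 1) * exp (- (2 * a) * r)) * indicator {0..} r))"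
  proof (intro nn_integral_mono_AE, use AE_real_pos in eventually_elim)
    fix r :: real assume r: "r \<noteq> 0"
    show "(ennreal (exp (- a * r) / r))^2 * (ennreal (4 * pi * r^2) * indicator {0..} r)
      \<le> ennreal (4 * pi) * (ennreal ((r + 1) * exp (- (2 * a) * r)) * indicator {0..} r)"
    proof (cases "0 \<le> r")
      case True
      have "(exp (- a * r) / r)^2 * (4 * pi * r^2) = 4 * pi * exp (- (2 * a) * r)"
        using r by (simp add: power_divide power2_eq_square flip: exp_add)
      also have "\<dots> \<le> 4 * pi * ((r + 1) * exp (- (2 * a) * r))" using True by simp
      finally show ?thesis using True by (simp add: ennreal_power ennreal_mult[symmetric])
    qed simp
  qed
  also have "\<dots> = ennreal (4 * pi) * (NINT r. ennreal ((r + 1) * exp (- (2 * a) * r)) * indicator {0..} r)"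
    by (rule nn_integral_cmult) measurable
  also have "\<dots> < \<infinity>" using nn_integral_exp_finite[of "2 * a"] assms by (simp add: ennreal_mult_less_top)
  finally show ?thesis .
qed

lemma nn_integral_quartic_finite: "(NINT z. ennreal (1 / (1 + (norm (z::pt))^2)^2)) < \<infinity>"
proof -
  have "(\<integral>\<^sup>+z. ennreal (1 / (1 + (norm z)^2)^2) \<partial>(lborel :: pt measure)) = (NINT r. ennreal (1 / (1 + r^2)^2) * (ennreal (4 * pi * r^2) * indicator {0..} r))"
    by (rule nn_integral_radial) measurable
  also have "\<dots> \<le> (NINT r. ennreal (4 * pi / (1 + r^2)) * indicator {0..} r)"
  proof (intro nn_integral_mono)
    fix r :: real
    have "1 / (1 + r^2)^2 * (4 * pi * r^2) = 4 * pi / (1 + r^2) * (r^2 / (1 + r^2))"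
      by (simp add: power2_eq_square)
    also have "\<dots> \<le> 4 * pi / (1 + r^2) * 1"
      by (intro mult_left_mono) (auto simp: divide_le_eq add_pos_nonneg intro!: divide_nonneg_pos)
    finally show "ennreal (1 / (1 + r^2)^2) * (ennreal (4 * pi * r^2) * indicator {0..} r) \<le> ennreal (4 * pi / (1 + r^2)) * indicator {0..} r"
      by (auto split: split_indicator simp: ennreal_mult[symmetric] ennreal_leI)
  qed
  also have "\<dots> = ennreal (4 * pi * (pi / 2) - 4 * pi * arctan 0)"
  proof (rule nn_integral_FTC_atLeast)
    show "((\<lambda>r. 4 * pi * arctan r) has_real_derivative 4 * pi / (1 + x^2)) (at x)" for x
      by (auto intro!: derivative_eq_intros simp: divide_simps)
    show "((\<lambda>r. 4 * pi * arctan r) \<longlongrightarrow> 4 * pi * (pi / 2)) at_top"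
      by (intro tendsto_intros tendsto_arctan_at_top)
  qed auto
  finally show ?thesis by (auto intro: le_less_trans)
qed

text \<open>The integrand is the limiting profile, at unit scale, of the approximate delta function
  constructed below; its mass 1 is what identifies the limit. In radial form the primitive is
  \<open>(r / sqrt (r^2 + 1))^3\<close>.\<close>

lemma nn_integral_bubble: "(NINT z. ennreal (3 / (4 * pi * (sqrt ((norm (z::pt))^2 + 1))^5))) = 1"
proof -
  have pos: "sqrt (r^2 + 1) > 0" for r :: real by (simp add: add_nonneg_pos)
  have "(\<integral>\<^sup>+z. ennreal (3 / (4 * pi * (sqrt ((norm z)^2 + 1))^5)) \<partial>(lborel :: pt measure))
    = (NINT r. ennreal (3 / (4 * pi * (sqrt (r^2 + 1))^5)) * (ennreal (4 * pi * r^2) * indicator {0..} r))"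
    by (rule nn_integral_radial) measurable
  also have "\<dots> = (NINT r. ennreal (3 * r^2 / (sqrt (r^2 + 1))^5) * indicator {0..} r)"
    by (intro nn_integral_cong) (auto split: split_indicator simp: ennreal_mult[symmetric])
  also have "\<dots> = ennreal (1 - (0 / sqrt (0^2 + 1))^3)"
  proof (rule nn_integral_FTC_atLeast)
    fix x :: real
    have s2: "(sqrt (x^2 + 1))^2 = x^2 + 1" by simp
    have d1: "((\<lambda>r. sqrt (r^2 + 1)) has_real_derivative x / sqrt (x^2 + 1)) (at x)"
      using pos[of x] by (auto intro!: derivative_eq_intros simp: field_simps add_nonneg_pos)
    have d2: "((\<lambda>r. r / sqrt (r^2 + 1)) has_real_derivative 1 / (sqrt (x^2 + 1))^3) (at x)"
    proof -
      have "((\<lambda>r. r / sqrt (r^2 + 1)) has_real_derivative (1 * sqrt (x^2 + 1) - x * (x / sqrt (x^2 + 1))) / (sqrt (x^2 + 1) * sqrt (x^2 + 1))) (at x)"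
        by (rule DERIV_divide[OF DERIV_ident d1]) (use pos[of x] in simp)
      moreover have *: "(1 * s - x * (x / s)) / (s * s) = 1 / s^3" if "s > 0" "s^2 = x^2 + 1" for s
      proof -
        have "1 * s - x * (x / s) = (s^2 - x^2) / s" using that(1) by (simp add: field_simps power2_eq_square)
        then show ?thesis using that by (simp add: power3_eq_cube)
      qed
      ultimately show ?thesis by (simp only: *[OF pos s2])
    qed
    show "((\<lambda>r. (r / sqrt (r^2 + 1))^3) has_real_derivative 3 * x^2 / (sqrt (x^2 + 1))^5) (at x)"
    proof -
      have "((\<lambda>r. (r / sqrt (r^2 + 1))^3) has_real_derivative of_nat 3 * (1 / (sqrt (x^2 + 1))^3 * (x / sqrt (x^2 + 1))^(3 - Suc 0))) (at x)"
        by (rule DERIV_power[OF d2])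
      moreover have "of_nat 3 * (1 / s^3 * (x / s)^(3 - Suc 0)) = 3 * x^2 / s^5" if "s > 0" for s :: real
        using that by (simp add: power_divide field_simps flip: power_add)
      ultimately show ?thesis using pos[of x] by simp
    qed
    show "0 \<le> 3 * x^2 / (sqrt (x^2 + 1))^5" by simp
  next
    have "((\<lambda>r::real. sqrt (1 / (1 + (1 / r)^2))) \<longlongrightarrow> sqrt (1 / (1 + 0^2))) at_top"
      by (intro tendsto_intros tendsto_divide_0[OF tendsto_const filterlim_at_top_imp_at_infinity[OF filterlim_ident]]) auto
    moreover have "eventually (\<lambda>r::real. sqrt (1 / (1 + (1 / r)^2)) = r / sqrt (r^2 + 1)) at_top"
      using eventually_gt_at_top[of 0]
    proof eventually_elim
      fix r :: real assume r: "0 < r"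
      have "1 / (1 + (1 / r)^2) = r^2 / (r^2 + 1)" using r by (simp add: field_simps power2_eq_square)
      then show "sqrt (1 / (1 + (1 / r)^2)) = r / sqrt (r^2 + 1)" using r by (simp add: real_sqrt_divide)
    qed
    ultimately have "((\<lambda>r::real. r / sqrt (r^2 + 1)) \<longlongrightarrow> 1) at_top"
      using filterlim_cong[OF refl refl] by (force simp: tendsto_cong)
    from tendsto_power[OF this, of 3] show "((\<lambda>r::real. (r / sqrt (r^2 + 1))^3) \<longlongrightarrow> 1) at_top" by simp
  qed measurable
  finally show ?thesis by simp
qed

text \<open>The integral is split at \<open>r = c/2\<close>, where the two entries of the minimum
  agree; either side contributes at most \<open>8 \<pi> / c\<close>.\<close>

lemma nn_integral_min_inverse_sq:
  assumes c: "0 < c"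
  shows "(NINT z. ennreal (min (4 / c^2) (1 / (norm z)^2) / (norm (z::pt))^2)) \<le> ennreal (16 * pi / c)"
proof -
  have "(\<integral>\<^sup>+z. ennreal (min (4 / c^2) (1 / (norm z)^2) / (norm z)^2) \<partial>(lborel :: pt measure))
      = (NINT r. ennreal (min (4 / c^2) (1 / r^2) / r^2) * (ennreal (4 * pi * r^2) * indicator {0..} r))"
    by (rule nn_integral_radial) measurable
  also have "\<dots> \<le> (NINT r. ennreal (16 * pi / c^2) * indicator {0..c/2} r + ennreal (4 * pi / r^2) * indicator {c/2..} r)"
  proof (intro nn_integral_mono_AE, use AE_real_pos in eventually_elim)
    fix r :: real assume r: "r \<noteq> 0"
    have e: "min (4 / c^2) (1 / r^2) / r^2 * (4 * pi * r^2) = 4 * pi * min (4 / c^2) (1 / r^2)" using r by simp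
    show "ennreal (min (4 / c^2) (1 / r^2) / r^2) * (ennreal (4 * pi * r^2) * indicator {0..} r)
      \<le> ennreal (16 * pi / c^2) * indicator {0..c/2} r + ennreal (4 * pi / r^2) * indicator {c/2..} r"
    proof (cases "r < 0")
      case False
      then have r0: "r > 0" using r by simp
      have "ennreal (min (4 / c^2) (1 / r^2) / r^2) * ennreal (4 * pi * r^2) = ennreal (4 * pi * min (4 / c^2) (1 / r^2))"
        by (subst ennreal_mult[symmetric]) (simp_all add: e[simplified])
      also have "\<dots> \<le> ennreal (if r \<le> c/2 then 16 * pi / c^2 else 4 * pi / r^2)"
      proof (rule ennreal_leI)
        have "4 * pi * min (4 / c^2) (1 / r^2) \<le> 4 * pi * (4 / c^2)" "4 * pi * min (4 / c^2) (1 / r^2) \<le> 4 * pi * (1 / r^2)"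
          by (intro mult_left_mono; simp)+
        then show "4 * pi * min (4 / c^2) (1 / r^2) \<le> (if r \<le> c/2 then 16 * pi / c^2 else 4 * pi / r^2)" by simp
      qed
      finally show ?thesis using r0 c by (auto split: split_indicator simp: not_le intro: order_trans)
    qed (simp split: split_indicator)
  qed
  also have "\<dots> = (NINT r. ennreal (16 * pi / c^2) * indicator {0..c/2} r) + (NINT r. ennreal (4 * pi / r^2) * indicator {c/2..} r)"
    by (rule nn_integral_add) measurable
  also have "(NINT r. ennreal (16 * pi / c^2) * indicator {0..c/2} r) = ennreal (8 * pi / c)"
    using c by (simp add: nn_integral_cmult_indicator ennreal_mult[symmetric] power2_eq_square)
  also have "(NINT r. ennreal (4 * pi / r^2) * indicator {c/2..} r) = ennreal (0 - (- (4 * pi) / (c/2)))"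
  proof (rule nn_integral_FTC_atLeast)
    show "((\<lambda>r. - (4 * pi) / r) has_real_derivative 4 * pi / x^2) (at x)" if "c/2 \<le> x" for x
      using that c by (auto intro!: derivative_eq_intros simp: power2_eq_square)
    show "((\<lambda>r::real. - (4 * pi) / r) \<longlongrightarrow> 0) at_top"
      by (intro tendsto_divide_0[OF tendsto_const filterlim_at_top_imp_at_infinity[OF filterlim_ident]])
  qed auto
  also have "ennreal (8 * pi / c) + ennreal (0 - (- (4 * pi) / (c/2))) = ennreal (16 * pi / c)"
    using c by (simp add: ennreal_plus[symmetric] del: ennreal_plus)
  finally show ?thesis .
qed

text \<open>One of \<open>|x|\<close>, \<open>|x - y|\<close> is at least \<open>|y|/2\<close>.\<close>

lemma riesz_composition:
  assumes y: "y \<noteq> (0::pt)"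
  shows "(NINT x. ennreal (1 / ((norm x)^2 * (norm (x - y))^2))) \<le> ennreal (32 * pi / norm y)"
proof -
  define c where "c = norm y"
  have c: "0 < c" using y by (simp add: c_def)
  define h where "h z = ennreal (min (4 / c^2) (1 / (norm z)^2) / (norm z)^2)" for z :: pt
  have [measurable]: "h \<in> borel_measurable borel" unfolding h_def[abs_def] by measurable
  have key: "ennreal (1 / (p^2 * q^2)) \<le> ennreal (min (4 / c^2) (1 / p^2) / p^2)" if pq: "p \<le> q" "c \<le> p + q" "0 \<le> p" for p q :: real
  proof (cases "p = 0")
    case False
    then have p: "0 < p" using pq by simp
    have "c/2 \<le> q" using pq by simp
    then have "(c/2)^2 \<le> q^2" using c by (intro power_mono) auto
    then have "1 / q^2 \<le> 1 / (c/2)^2" using c p pq by (intro divide_left_mono) auto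
    moreover have "1 / q^2 \<le> 1 / p^2" using p pq by (intro divide_left_mono power_mono mult_pos_pos) auto
    ultimately have "1 / q^2 \<le> min (4 / c^2) (1 / p^2)" by (simp add: power_divide)
    then have "1 / q^2 / p^2 \<le> min (4 / c^2) (1 / p^2) / p^2" by (intro divide_right_mono) auto
    then show ?thesis by (intro ennreal_leI) (simp add: mult.commute)
  qed simp
  have "(NINT x. ennreal (1 / ((norm x)^2 * (norm (x - y))^2))) \<le> (NINT x. h x + h (x - y))"
  proof (rule nn_integral_mono)
    fix x :: pt
    have t: "c \<le> norm x + norm (x - y)" unfolding c_def by (metis norm_minus_commute norm_triangle_sub)
    show "ennreal (1 / ((norm x)^2 * (norm (x - y))^2)) \<le> h x + h (x - y)"
    proof (cases "norm x \<le> norm (x - y)")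
      case True
      then have "ennreal (1 / ((norm x)^2 * (norm (x - y))^2)) \<le> h x" unfolding h_def using t by (intro key) auto
      then show ?thesis using add_increasing2 by (metis zero_le)
    next
      case False
      then have "ennreal (1 / ((norm (x - y))^2 * (norm x)^2)) \<le> h (x - y)" unfolding h_def using t by (intro key) auto
      then show ?thesis using add_increasing by (metis zero_le mult.commute)
    qed
  qed
  also have "\<dots> = (NINT x. h x) + (NINT x. h (x - y))"
    by (rule nn_integral_add) measurable
  also have "\<dots> = 2 * (NINT x. h x)" by (simp add: nn_integral_translate mult_2)
  also have "\<dots> \<le> 2 * ennreal (16 * pi / c)"
    unfolding h_def by (intro mult_left_mono nn_integral_min_inverse_sq c) auto
  also have "\<dots> = ennreal (32 * pi / norm y)" using c by (simp add: c_def ennreal_mult'[symmetric] flip: ennreal_numeral)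
  finally show ?thesis .
qed

lemma Nk_le: assumes "0 < a" "z \<noteq> 0" shows "Nk a z \<le> (1 / a + 1) / (norm z)^2"
proof -
  define r where "r = norm z"
  have r: "0 < r" using assms by (simp add: r_def)
  have "a * r \<le> exp (a * r)" using exp_ge_add_one_self[of "a * r"] by linarith
  then have 1: "exp (- a * r) * r \<le> 1 / a" using assms(1) by (simp add: exp_minus field_simps)
  have 2: "exp (- a * r) \<le> 1" using assms r by simp
  have "Nk a z = (exp (- a * r) * r + exp (- a * r)) / r^2"
    using r by (simp add: Nk_def r_def[symmetric] field_simps power2_eq_square)
  also have "\<dots> \<le> (1 / a + 1) / r^2" using 1 2 by (intro divide_right_mono add_mono) auto
  finally show ?thesis by (simp add: r_def)
qed

text \<open>Each factor is at most a multiple of \<open>1/|z|^2\<close>, and the composition of two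
  such kernels is of order \<open>1/|y - y'|\<close>. Its square is the weight in the Rollnik
  condition, which is how that condition controls the Green operator.\<close>

lemma Nk_composition:
  assumes a: "0 < a" and y: "y \<noteq> y'"
  shows "(NINT x. ennreal (Nk a (x - y) * Nk a (x - y'))) \<le> ennreal ((1 / a + 1)^2 * (32 * pi) / norm (y - y'))"
proof -
  define C where "C = (1 / a + 1)^2"
  have "(NINT x. ennreal (Nk a (x - y) * Nk a (x - y')))
     \<le> (NINT x. ennreal C * ennreal (1 / ((norm (x - y))^2 * (norm (x - y - (y' - y)))^2)))"
  proof (intro nn_integral_mono_AE, use AE_pt_neq[of y] AE_pt_neq[of y'] in eventually_elim)
    fix x assume x: "x \<noteq> y" "x \<noteq> y'"
    have "Nk a (x - y) * Nk a (x - y') \<le> (1 / a + 1) / (norm (x - y))^2 * ((1 / a + 1) / (norm (x - y'))^2)"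
      using x a by (intro mult_mono Nk_le) auto
    also have "\<dots> = C * (1 / ((norm (x - y))^2 * (norm (x - y'))^2))" by (simp add: C_def power2_eq_square)
    finally show "ennreal (Nk a (x - y) * Nk a (x - y')) \<le> ennreal C * ennreal (1 / ((norm (x - y))^2 * (norm (x - y - (y' - y)))^2))"
      by (subst ennreal_mult[symmetric]) (auto simp: C_def intro!: ennreal_leI)
  qed
  also have "\<dots> = ennreal C * (NINT x. ennreal (1 / ((norm (x - y))^2 * (norm (x - y - (y' - y)))^2)))"
    by (rule nn_integral_cmult) measurable
  also have "(NINT x. ennreal (1 / ((norm (x - y))^2 * (norm (x - y - (y' - y)))^2)))
      = (NINT x. ennreal (1 / ((norm x)^2 * (norm (x - (y' - y)))^2)))"
    by (rule nn_integral_translate(1)[of "\<lambda>x. ennreal (1 / ((norm x)^2 * (norm (x - (y' - y)))^2))"]) measurable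
  also have "ennreal C * \<dots> \<le> ennreal C * ennreal (32 * pi / norm (y' - y))"
    using y by (intro mult_left_mono riesz_composition) auto
  also have "\<dots> = ennreal ((1 / a + 1)^2 * (32 * pi) / norm (y - y'))"
    by (subst ennreal_mult[symmetric]) (auto simp: C_def norm_minus_commute)
  finally show ?thesis .
qed

section \<open>Smooth functions\<close>

text \<open>A finite-order counterpart of the coinductive \<open>smooth_fun\<close>. Closure under
  sums, products and compositions is proved by induction on the order, and smoothness is recovered
  from all orders together.\<close>

primrec Ck :: "nat => (pt => real) => bool" where
  "Ck 0 f = continuous_on UNIV f"
| "Ck (Suc n) f = (continuous_on UNIV f \<and> (\<forall>i. \<exists>d. has_partial f i d \<and> Ck n d))"

lemma Ck_cont: "Ck n f ==> continuous_on UNIV f"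
  by (cases n) auto

lemma Ck_Suc_D: "Ck (Suc n) f ==> Ck n f"
proof (induction n arbitrary: f)
  case (Suc n)
  then show ?case by (metis Ck.simps(2))
qed simp

lemma Ck_Suc_I: "continuous_on UNIV f ==> (\<And>i. has_partial f i (d i)) ==> (\<And>i. Ck n (d i)) ==> Ck (Suc n) f"
  by auto

lemma has_partial_unique: "has_partial f i d ==> has_partial f i d' ==> d = d'"
  unfolding has_partial_def using DERIV_unique by blast

text \<open>Partial derivatives are unique, so the derivatives that witness the various orders
  coincide; one and the same function then serves the coinduction step.\<close>

lemma smooth_fun_Ck: "(\<And>n. Ck n f) ==> smooth_fun f"
proof (coinduction arbitrary: f rule: smooth_fun.coinduct)
  case (smooth_fun f)
  have "\<exists>d. has_partial f i d \<and> (\<forall>n. Ck n d)" for i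
  proof -
    have ex: "\<exists>d. has_partial f i d \<and> Ck n d" for n using smooth_fun Ck.simps(2) by blast
    obtain d where d: "has_partial f i d" using ex by blast
    have "Ck n d" for n using ex[of n] has_partial_unique[OF d] by blast
    then show ?thesis using d by blast
  qed
  then show ?case using Ck_cont smooth_fun by blast
qed

lemma Ck_const[simp]: "Ck n (\<lambda>x. c)"
proof (induction n arbitrary: c)
  case (Suc n)
  then show ?case by (intro Ck_Suc_I[where d="\<lambda>i x. 0"]) (auto simp: has_partial_def)
qed simp

lemma Ck_SucE:
  assumes "Ck (Suc n) f"
  obtains d where "\<And>i. has_partial f i (d i)" "\<And>i. Ck n (d i)"
  using assms by simp metis

lemma Ck_coord: "Ck n (\<lambda>x. x $ i)"
proof (cases n)
  case (Suc m)
  have "has_partial (\<lambda>x. x $ i) j (\<lambda>x. if i = j then 1 else 0)" for j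
    unfolding has_partial_def by (auto intro!: derivative_eq_intros simp: axis_def)
  then show ?thesis unfolding Suc
    by (intro Ck_Suc_I[where d="\<lambda>j x. if i = j then 1 else 0"] continuous_intros) auto
qed (auto intro!: continuous_intros)

lemma Ck_add: "Ck n f ==> Ck n g ==> Ck n (\<lambda>x. f x + g x)"
proof (induction n arbitrary: f g)
  case (Suc n)
  obtain df where df: "\<And>i. has_partial f i (df i)" "\<And>i. Ck n (df i)" using Ck_SucE[OF Suc.prems(1)] by blast
  obtain dg where dg: "\<And>i. has_partial g i (dg i)" "\<And>i. Ck n (dg i)" using Ck_SucE[OF Suc.prems(2)] by blast
  have "has_partial (\<lambda>x. f x + g x) i (\<lambda>x. df i x + dg i x)" for i
    using df(1)[of i] dg(1)[of i] unfolding has_partial_def by (auto intro: DERIV_add)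
  then show ?case using Suc df dg Ck_cont
    by (intro Ck_Suc_I[where d="\<lambda>i x. df i x + dg i x"] continuous_intros) auto
qed (auto intro: continuous_intros)

lemma Ck_mult: "Ck n f ==> Ck n g ==> Ck n (\<lambda>x. f x * g x)"
proof (induction n arbitrary: f g)
  case (Suc n)
  obtain df where df: "\<And>i. has_partial f i (df i)" "\<And>i. Ck n (df i)" using Ck_SucE[OF Suc.prems(1)] by blast
  obtain dg where dg: "\<And>i. has_partial g i (dg i)" "\<And>i. Ck n (dg i)" using Ck_SucE[OF Suc.prems(2)] by blast
  have "has_partial (\<lambda>x. f x * g x) i (\<lambda>x. df i x * g x + dg i x * f x)" for i
    unfolding has_partial_def
  proof
    fix x
    from DERIV_mult[OF df(1)[of i, unfolded has_partial_def, rule_format, of x] dg(1)[of i, unfolded has_partial_def, rule_format, of x]]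
    show "((\<lambda>t. f (x + t *\<^sub>R axis i 1) * g (x + t *\<^sub>R axis i 1)) has_real_derivative df i x * g x + dg i x * f x) (at 0)"
      by simp
  qed
  moreover have "continuous_on UNIV (\<lambda>x. f x * g x)"
    by (intro continuous_intros Ck_cont[OF Suc.prems(1)] Ck_cont[OF Suc.prems(2)])
  moreover have "Ck n (\<lambda>x. df i x * g x + dg i x * f x)" for i
    by (intro Ck_add Suc.IH df dg Ck_Suc_D[OF Suc.prems(1)] Ck_Suc_D[OF Suc.prems(2)])
  ultimately show ?case by (intro Ck_Suc_I[where d="\<lambda>i x. df i x * g x + dg i x * f x"])
qed (auto intro: continuous_intros)

lemma Ck_uminus: "Ck n f ==> Ck n (\<lambda>x. - f x)"
  using Ck_mult[OF Ck_const[of n "-1"], of f] by simp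

lemma Ck_diff: "Ck n f ==> Ck n g ==> Ck n (\<lambda>x. f x - g x)"
  using Ck_add[OF _ Ck_uminus, of n f g] by simp

lemma Ck_sum: "(\<And>i. i \<in> I ==> Ck n (f i)) ==> Ck n (\<lambda>x. \<Sum>i\<in>I. f i x)"
  by (induction I rule: infinite_finite_induct) (auto intro: Ck_add)

text \<open>The requirement on \<open>g'\<close> concerns the composition with \<open>f\<close>,
  which is exactly what the induction hypothesis delivers when the derivatives of \<open>g\<close>
  stay within the family under consideration.\<close>

lemma Ck_chain:
  assumes f: "Ck (Suc n) f"
    and g: "\<And>x. (g has_real_derivative g' (f x)) (at (f x))"
    and g': "Ck n (\<lambda>x. g' (f x))"
  shows "Ck (Suc n) (\<lambda>x. g (f x))"
proof -
  obtain df where df: "\<And>i. has_partial f i (df i)" "\<And>i. Ck n (df i)" using Ck_SucE[OF f] by blast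
  have "has_partial (\<lambda>x. g (f x)) i (\<lambda>x. g' (f x) * df i x)" for i
    unfolding has_partial_def
  proof
    fix x
    have "(g has_real_derivative g' (f x)) (at (f (x + 0 *\<^sub>R axis i 1)))" using g by simp
    from DERIV_chain2[OF this df(1)[of i, unfolded has_partial_def, rule_format, of x]]
    show "((\<lambda>t. g (f (x + t *\<^sub>R axis i 1))) has_real_derivative g' (f x) * df i x) (at 0)" .
  qed
  moreover have "continuous_on UNIV (\<lambda>x. g (f x))"
    unfolding continuous_on_eq_continuous_at[OF open_UNIV]
  proof
    fix x
    have "isCont f x" using Ck_cont[OF f] by (simp add: continuous_on_eq_continuous_at)
    then show "isCont (\<lambda>x. g (f x)) x" by (rule isCont_o2) (rule DERIV_isCont[OF g])
  qed
  ultimately show ?thesis using df g'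
    by (intro Ck_Suc_I[where d="\<lambda>i x. g' (f x) * df i x"] Ck_mult) auto
qed

lemma Ck_exp: "Ck n f ==> Ck n (\<lambda>x. exp (f x))"
proof (induction n arbitrary: f)
  case (Suc n)
  show ?case by (rule Ck_chain[where g=exp and f=f and g'=exp, OF Suc.prems DERIV_exp])
    (rule Suc.IH[OF Ck_Suc_D[OF Suc.prems]])
qed (auto intro: continuous_intros)

lemma Ck_sin_cos: "Ck n f ==> Ck n (\<lambda>x. sin (f x)) \<and> Ck n (\<lambda>x. cos (f x))"
proof (induction n arbitrary: f)
  case (Suc n)
  note IH = Suc.IH[OF Ck_Suc_D[OF Suc.prems]]
  have "Ck (Suc n) (\<lambda>x. sin (f x))"
    by (rule Ck_chain[where g=sin and f=f and g'=cos, OF Suc.prems DERIV_sin conjunct2[OF IH]])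
  moreover have "Ck (Suc n) (\<lambda>x. cos (f x))"
    by (rule Ck_chain[where g=cos and f=f and g'="\<lambda>x. - sin x", OF Suc.prems DERIV_cos Ck_uminus[OF conjunct1[OF IH]]])
  ultimately show ?case by blast
qed (auto intro: continuous_intros)

lemma Ck_inverse: "Ck n f ==> (\<And>x. f x > 0) ==> Ck n (\<lambda>x. inverse (f x))"
proof (induction n arbitrary: f)
  case (Suc n)
  have "f x \<noteq> 0" for x using Suc.prems(2)[of x] by simp
  show ?case
  proof (rule Ck_chain[where g=inverse and f=f and g'="\<lambda>s. - (inverse s * inverse s)"])
    show "(inverse has_real_derivative - (inverse (f x) * inverse (f x))) (at (f x))" for x
      using \<open>f x \<noteq> 0\<close> by (auto intro!: derivative_eq_intros)
    show "Ck n (\<lambda>x. - (inverse (f x) * inverse (f x)))"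
      by (intro Ck_uminus Ck_mult Suc.IH Ck_Suc_D[OF Suc.prems(1)] Suc.prems(2))
  qed (rule Suc.prems(1))
next
  case 0
  have "f x \<noteq> 0" for x using 0(2)[of x] by simp
  then show ?case using 0 by (auto intro: continuous_intros)
qed

lemma Ck_sqrt: "Ck n f ==> (\<And>x. f x > 0) ==> Ck n (\<lambda>x. sqrt (f x))"
proof (induction n arbitrary: f)
  case (Suc n)
  show ?case
  proof (rule Ck_chain[where g=sqrt and f=f and g'="\<lambda>s. inverse (sqrt s) / 2"])
    show "(sqrt has_real_derivative inverse (sqrt (f x)) / 2) (at (f x))" for x
      using Suc.prems(2) by (rule DERIV_real_sqrt)
    have "0 < sqrt (f x)" for x using Suc.prems(2) by simp
    then have "Ck n (\<lambda>x. inverse (sqrt (f x)) * (1/2))"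
      by (intro Ck_mult Ck_inverse Suc.IH Ck_Suc_D[OF Suc.prems(1)] Suc.prems(2) Ck_const)
    then show "Ck n (\<lambda>x. inverse (sqrt (f x)) / 2)" by simp
  qed (rule Suc.prems(1))
qed (auto intro: continuous_intros)

text \<open>The flat functions \<open>s^-k exp (-1/s)\<close>, extended by 0. Differentiation maps
  the family into its own linear combinations, so all orders of smoothness follow at once.\<close>

definition \<theta> :: "nat => real => real" where
  "\<theta> k s = (if s > 0 then (1 / s) ^ k * exp (- (1 / s)) else 0)"

lemma \<theta>_tendsto_0: "(\<theta> k \<longlongrightarrow> 0) (at 0)"
proof -
  have "((\<lambda>s::real. (1 / s) ^ k / exp (1 / s)) \<longlongrightarrow> 0) (at_right 0)"
    by (rule filterlim_compose[OF tendsto_power_div_exp_0])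
       (simp add: filterlim_inverse_at_top_right flip: inverse_eq_divide)
  moreover have "eventually (\<lambda>s. (1 / s) ^ k / exp (1 / s) = \<theta> k s) (at_right 0)"
    unfolding eventually_at_right_field by (auto simp: \<theta>_def exp_minus field_simps intro!: exI[of _ 1])
  ultimately have "(\<theta> k \<longlongrightarrow> 0) (at_right 0)" by (rule Lim_transform_eventually)
  moreover have "(\<theta> k \<longlongrightarrow> 0) (at_left 0)"
  proof (rule Lim_transform_eventually[OF tendsto_const])
    show "eventually (\<lambda>s. 0 = \<theta> k s) (at_left 0)"
      unfolding eventually_at_left_field by (auto simp: \<theta>_def intro!: exI[of _ "-1"])
  qed
  ultimately show ?thesis by (simp add: filterlim_at_split)
qed

text \<open>At 0 the difference quotient of \<open>\<theta> k\<close> is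
  \<open>\<theta> (k + 1)\<close>, which tends to 0. To the right of 0 the formula is the product
  rule, to the left everything vanishes.\<close>

lemma \<theta>_deriv: "(\<theta> k has_real_derivative \<theta> (k + 2) s - real k * \<theta> (k + 1) s) (at s)"
proof (cases s "0::real" rule: linorder_cases)
  case less
  have "((\<lambda>s::real. 0) has_real_derivative 0) (at s)" by simp
  then have "(\<theta> k has_real_derivative 0) (at s)"
    by (rule has_field_derivative_transform_within[where d="-s"]) (use less in \<open>auto simp: \<theta>_def dist_real_def\<close>)
  then show ?thesis using less by (simp add: \<theta>_def)
next
  case equal
  have "((\<lambda>h. (\<theta> k (0 + h) - \<theta> k 0) / h) \<longlongrightarrow> 0) (at 0)"
  proof (rule Lim_transform_eventually[OF \<theta>_tendsto_0[of "k + 1"]])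
    show "eventually (\<lambda>h. \<theta> (k + 1) h = (\<theta> k (0 + h) - \<theta> k 0) / h) (at 0)"
      by (auto simp: \<theta>_def eventually_at_filter)
  qed
  then show ?thesis by (simp add: equal DERIV_def \<theta>_def)
next
  case greater
  have "((\<lambda>s. (1 / s) ^ k * exp (- (1 / s))) has_real_derivative
     (1 / s)^k * ((1/s)^2 * exp (- (1/s))) - real k * ((1/s)^(k+1) * exp (- (1/s)))) (at s)"
  proof (cases k)
    case 0
    then show ?thesis using greater by (auto intro!: derivative_eq_intros simp: field_simps power2_eq_square)
  next
    case (Suc m)
    show ?thesis unfolding Suc using greater
      by (auto intro!: derivative_eq_intros simp del: power_Suc simp: power_Suc[of _ "Suc m"] power2_eq_square)
         (simp add: field_simps power2_eq_square)
  qed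
  then have "(\<theta> k has_real_derivative
     (1 / s)^k * ((1/s)^2 * exp (- (1/s))) - real k * ((1/s)^(k+1) * exp (- (1/s)))) (at s)"
    by (rule has_field_derivative_transform_within[where d=s]) (use greater in \<open>auto simp: \<theta>_def dist_real_def\<close>)
  then show ?thesis using greater by (simp add: \<theta>_def power_add mult.assoc power2_eq_square)
qed

lemma \<theta>_cont: "continuous_on UNIV (\<theta> k)"
  using \<theta>_deriv by (intro continuous_at_imp_continuous_on) (blast intro: DERIV_isCont)

lemma Ck_\<theta>: "Ck n f ==> Ck n (\<lambda>x. \<theta> k (f x))"
proof (induction n arbitrary: f k)
  case (Suc n)
  show ?case
    by (rule Ck_chain[where g="\<theta> k" and f=f and g'="\<lambda>s. \<theta> (k + 2) s - real k * \<theta> (k + 1) s", OF Suc.prems \<theta>_deriv])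
       (intro Ck_diff Ck_mult Ck_const Suc.IH Ck_Suc_D[OF Suc.prems])
qed (auto intro: continuous_on_compose2[OF \<theta>_cont])

lemma \<theta>_bounds: "0 \<le> \<theta> k s" "s \<le> 1 ==> \<theta> 0 s \<le> exp (- 1)" "\<theta> 2 s \<le> 2"
proof -
  show "0 \<le> \<theta> k s" by (simp add: \<theta>_def)
  show "\<theta> 0 s \<le> exp (- 1)" if "s \<le> 1" using that by (auto simp: \<theta>_def field_simps)
  have "x^2 * exp (- x) \<le> 2" if "0 \<le> x" for x :: real
  proof -
    have "1 + x + x^2 / 2 \<le> exp x" using exp_lower_Taylor_quadratic[OF that] .
    then have "x^2 \<le> 2 * exp x" using that by simp
    then show ?thesis by (simp add: exp_minus field_simps)
  qed
  from this[of "1/s"] show "\<theta> 2 s \<le> 2" by (simp add: \<theta>_def)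
qed

text \<open>A radial cutoff, normalised to 1 at the origin, whose support has radius
  \<open>1 / sqrt c\<close> for positive \<open>c\<close>. Letting \<open>c\<close> tend to 0
  exhausts space and letting it grow isolates the origin; both regimes occur.\<close>

definition bump :: "real => pt => real" where
  "bump c x = exp 1 * \<theta> 0 (1 - c * (x \<bullet> x))"

definition dbump :: "real => 3 => pt => real" where
  "dbump c i x = exp 1 * \<theta> 2 (1 - c * (x \<bullet> x)) * (- 2 * c * (x $ i))"

lemma Ck_inner_self: "Ck n (\<lambda>x. x \<bullet> x)"
  by (simp add: inner_vec_def Ck_sum Ck_mult Ck_coord)

lemma Ck_bump: "Ck n (bump c)"
  unfolding bump_def[abs_def] by (intro Ck_mult Ck_\<theta> Ck_diff Ck_const Ck_inner_self)

lemma Ck_dbump: "Ck n (dbump c i)"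
  unfolding dbump_def[abs_def] by (intro Ck_mult Ck_\<theta> Ck_diff Ck_const Ck_inner_self Ck_coord)

lemma inner_line_deriv: "((\<lambda>t. (x + t *\<^sub>R axis i 1) \<bullet> (x + t *\<^sub>R axis i 1)) has_real_derivative 2 * (x $ i)) (at 0)" for x :: pt
proof -
  have "(x + t *\<^sub>R axis i 1) \<bullet> (x + t *\<^sub>R axis i 1) = x \<bullet> x + 2 * t * (x $ i) + t^2" for t
    by (simp add: inner_add_left inner_add_right inner_axis inner_axis' inner_axis_axis power2_eq_square algebra_simps)
  moreover have "((\<lambda>t. x \<bullet> x + 2 * t * (x $ i) + t^2) has_real_derivative 2 * (x $ i)) (at 0)"
    by (auto intro!: derivative_eq_intros)
  ultimately show ?thesis by simp
qed

lemma has_partial_bump: "has_partial (bump c) i (dbump c i)"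
  unfolding has_partial_def
proof
  fix x :: pt
  have d: "((\<lambda>t. 1 - c * ((x + t *\<^sub>R axis i 1) \<bullet> (x + t *\<^sub>R axis i 1))) has_real_derivative 0 - c * (2 * (x $ i))) (at 0)"
    by (intro DERIV_diff DERIV_const DERIV_cmult inner_line_deriv)
  have "((\<lambda>t. \<theta> 0 (1 - c * ((x + t *\<^sub>R axis i 1) \<bullet> (x + t *\<^sub>R axis i 1)))) has_real_derivative
     (\<theta> (0 + 2) (1 - c * ((x + 0 *\<^sub>R axis i 1) \<bullet> (x + 0 *\<^sub>R axis i 1))) - real 0 * \<theta> (0 + 1) (1 - c * ((x + 0 *\<^sub>R axis i 1) \<bullet> (x + 0 *\<^sub>R axis i 1)))) * (0 - c * (2 * (x $ i)))) (at 0)"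
    by (rule DERIV_chain2[OF \<theta>_deriv d])
  from DERIV_cmult[OF this, of "exp 1"]
  show "((\<lambda>t. bump c (x + t *\<^sub>R axis i 1)) has_real_derivative dbump c i x) (at 0)"
    unfolding bump_def dbump_def by (simp add: ac_simps numeral_2_eq_2)
qed

lemma bump_bounds: assumes "0 \<le> c" shows "0 \<le> bump c x" "bump c x \<le> 1" "bump c 0 = 1" "bump 0 x = 1"
proof -
  show "0 \<le> bump c x" by (simp add: bump_def \<theta>_bounds)
  have "\<theta> 0 (1 - c * (x \<bullet> x)) \<le> exp (-1)" using assms by (intro \<theta>_bounds(2)) simp
  then show "bump c x \<le> 1" by (simp add: bump_def exp_minus field_simps)
qed (simp_all add: bump_def \<theta>_def exp_minus)

lemma bump_support: assumes "0 < c" "bump c x \<noteq> 0 \<or> dbump c i x \<noteq> 0" shows "norm x < 1 / sqrt c"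
proof -
  have "1 - c * (x \<bullet> x) > 0" using assms(2) by (auto simp: bump_def dbump_def \<theta>_def split: if_splits)
  then have "(norm x)^2 < (1 / sqrt c)^2" using assms(1) by (simp add: power2_norm_eq_inner power_divide field_simps)
  then show ?thesis by (rule power_less_imp_less_base) (use assms in simp)
qed

text \<open>On the support \<open>|x $ i|\<close> is below \<open>1 / sqrt c\<close>, so the inner
  derivative is of order \<open>sqrt c\<close>, while \<open>\<theta> 2\<close> is at most
  2.\<close>

lemma dbump_bound: assumes "0 < c" shows "\<bar>dbump c i x\<bar> \<le> 4 * exp 1 * sqrt c"
proof (cases "dbump c i x = 0")
  case False
  then have n: "norm x < 1 / sqrt c" using bump_support[OF assms] by blast
  have "\<bar>dbump c i x\<bar> = exp 1 * \<theta> 2 (1 - c * (x \<bullet> x)) * (2 * c * \<bar>x $ i\<bar>)"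
    using assms by (simp add: dbump_def abs_mult \<theta>_bounds)
  also have "\<dots> \<le> exp 1 * 2 * (2 * c * (1 / sqrt c))"
    using assms n component_le_norm_cart[of x i] by (intro mult_mono \<theta>_bounds mult_left_mono) (auto simp: \<theta>_bounds)
  also have "\<dots> = 4 * exp 1 * (c / sqrt c)" by simp
  also have "\<dots> = 4 * exp 1 * sqrt c" using assms by (simp only: real_div_sqrt less_imp_le)
  finally show ?thesis .
qed (use assms in simp)

section \<open>Complex-valued smooth functions and integration by parts\<close>

definition csmooth :: "cfun => bool" where
  "csmooth F \<longleftrightarrow> (\<forall>n. Ck n (\<lambda>x. Re (F x)) \<and> Ck n (\<lambda>x. Im (F x)))"

definition cpartial :: "cfun => 3 => cfun => bool" where
  "cpartial F i D \<longleftrightarrow> (\<forall>x. ((\<lambda>t. F (x + t *\<^sub>R axis i 1)) has_vector_derivative D x) (at 0))"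

lemma csmooth_const: "csmooth (\<lambda>x. c)" by (simp add: csmooth_def)
lemma csmooth_of_real: "(\<And>n. Ck n f) ==> csmooth (\<lambda>x. of_real (f x))" by (simp add: csmooth_def)
lemma csmooth_add: "csmooth F ==> csmooth G ==> csmooth (\<lambda>x. F x + G x)"
  by (simp add: csmooth_def Ck_add)
lemma csmooth_mult: "csmooth F ==> csmooth G ==> csmooth (\<lambda>x. F x * G x)"
  by (simp add: csmooth_def Ck_add Ck_mult Ck_diff)
lemma csmooth_power: "csmooth F ==> csmooth (\<lambda>x. F x ^ m)"
  by (induction m) (auto intro: csmooth_mult csmooth_const)
lemma csmooth_uminus: "csmooth F ==> csmooth (\<lambda>x. - F x)"
  by (simp add: csmooth_def Ck_uminus)
lemma csmooth_exp: "csmooth F ==> csmooth (\<lambda>x. exp (F x))"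
  by (simp add: csmooth_def Re_exp Im_exp Ck_mult Ck_exp Ck_sin_cos)

lemma csmooth_cont: assumes "csmooth F" shows "continuous_on UNIV F"
proof -
  have "continuous_on UNIV (\<lambda>x. Re (F x))" "continuous_on UNIV (\<lambda>x. Im (F x))"
    using assms Ck_cont unfolding csmooth_def by blast+
  then have "continuous_on UNIV (\<lambda>x. of_real (Re (F x)) + \<i> * of_real (Im (F x)))"
    by (intro continuous_on_add continuous_on_mult continuous_on_const bounded_linear.continuous_on[OF bounded_linear_of_real])
  then show ?thesis by (simp only: complex_eq[symmetric])
qed

lemma cpartial_parts: "cpartial F i D ==> has_partial (\<lambda>x. Re (F x)) i (\<lambda>x. Re (D x)) \<and> has_partial (\<lambda>x. Im (F x)) i (\<lambda>x. Im (D x))"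
  unfolding cpartial_def has_partial_def has_real_derivative_iff_has_vector_derivative
  by (auto intro: bounded_linear.has_vector_derivative[OF bounded_linear_Re] bounded_linear.has_vector_derivative[OF bounded_linear_Im])

lemma cpartial_of_real: "has_partial f i d ==> cpartial (\<lambda>x. of_real (f x)) i (\<lambda>x. of_real (d x))"
  unfolding cpartial_def has_partial_def has_real_derivative_iff_has_vector_derivative
  by (auto intro: bounded_linear.has_vector_derivative[OF bounded_linear_of_real])

lemma cpartial_mult: "cpartial F i D ==> cpartial G i E ==> cpartial (\<lambda>x. F x * G x) i (\<lambda>x. F x * E x + D x * G x)"
  unfolding cpartial_def
proof
  fix x assume a: "\<forall>x. ((\<lambda>t. F (x + t *\<^sub>R axis i 1)) has_vector_derivative D x) (at 0)"
    "\<forall>x. ((\<lambda>t. G (x + t *\<^sub>R axis i 1)) has_vector_derivative E x) (at 0)"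
  from has_vector_derivative_mult[OF spec[OF a(1), of x] spec[OF a(2), of x]]
  show "((\<lambda>t. F (x + t *\<^sub>R axis i 1) * G (x + t *\<^sub>R axis i 1)) has_vector_derivative F x * E x + D x * G x) (at 0)"
    by simp
qed

lemma cpartial_translate: "cpartial F i D ==> cpartial (\<lambda>x. F (x - y)) i (\<lambda>x. D (x - y))"
  unfolding cpartial_def by (metis (no_types, lifting) add_diff_eq diff_add_eq ext)

lemma continuous_bounded_on_cball:
  assumes "continuous_on UNIV (F :: cfun)"
  obtains B where "0 \<le> B" "\<And>x. norm x \<le> R ==> cmod (F x) \<le> B"
proof -
  have "bounded (F ` cball 0 R)"
    by (intro compact_imp_bounded compact_continuous_image continuous_on_subset[OF assms]) auto
  then obtain B where B: "\<forall>y\<in>F ` cball 0 R. norm y \<le> B" by (auto simp only: bounded_iff)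
  have "cmod (F x) \<le> max B 0" if "norm x \<le> R" for x
    using bspec[OF B, of "F x"] that by (simp add: le_max_iff_disj)
  then show ?thesis using that[of "max B 0"] by simp
qed

lemma L2_cont_bounded_support:
  assumes "continuous_on UNIV F" "\<And>x. F x \<noteq> 0 ==> norm x \<le> R"
  shows "F \<in> L2"
proof -
  have m: "F \<in> borel_measurable borel" by (rule borel_measurable_continuous_onI[OF assms(1)])
  obtain B where B: "0 \<le> B" "\<And>x. norm x \<le> R ==> cmod (F x) \<le> B"
    using continuous_bounded_on_cball[OF assms(1)] by blast
  have "n2 F \<le> (NINT x. (ennreal \<bar>B\<bar>)^2 * indicator (cball 0 R :: pt set) x)"
    unfolding n2_def
  proof (rule nn_integral_mono)
    fix x
    show "(ennreal (cmod (F x)))^2 \<le> (ennreal \<bar>B\<bar>)^2 * indicator (cball 0 R) x"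
      using assms(2)[of x] B(1) B(2)[of x] by (cases "F x = 0") (auto intro!: power_mono ennreal_leI split: split_indicator)
  qed
  also have "\<dots> = (ennreal \<bar>B\<bar>)^2 * emeasure lborel (cball 0 R :: pt set)"
    by (rule nn_integral_cmult_indicator) simp
  also have "\<dots> < \<infinity>" using emeasure_bounded_finite[OF bounded_cball, of 0 R]
    by (auto simp: ennreal_power ennreal_mult_less_top)
  finally show ?thesis using m by (simp add: L2_iff)
qed

text \<open>At a point outside the closed ball the function vanishes on a whole interval of the
  coordinate line, so the derivative is 0 there.\<close>

lemma has_partial_support:
  assumes "has_partial f i d" "\<And>x. f x \<noteq> 0 ==> norm x \<le> R" "d x \<noteq> 0"
  shows "norm x \<le> R"
proof (rule ccontr)
  assume n: "\<not> norm x \<le> R"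
  have "((\<lambda>t. f (x + t *\<^sub>R axis i 1)) has_real_derivative 0) (at 0)"
  proof (rule has_field_derivative_transform_within[where d="norm x - R"])
    show "((\<lambda>t::real. 0::real) has_real_derivative 0) (at 0)" by simp
    show "0 < norm x - R" using n by simp
    show "(0::real) \<in> UNIV" by simp
    fix t :: real assume "dist t 0 < norm x - R"
    then have "norm (t *\<^sub>R axis i 1 :: pt) < norm x - R" by (simp add: norm_axis_1)
    then have "R < norm (x + t *\<^sub>R axis i 1)" using norm_triangle_ineq4[of "x + t *\<^sub>R axis i 1" "t *\<^sub>R axis i 1"] by simp
    then show "0 = f (x + t *\<^sub>R axis i 1)" using assms(2)[of "x + t *\<^sub>R axis i 1"] by force
  qed
  then have "d x = 0" using assms(1) DERIV_unique unfolding has_partial_def by blast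
  then show False using assms(3) by simp
qed

lemma test_fun_D:
  assumes "test_fun \<phi>" "has_partial \<phi> i d"
  obtains R where "continuous_on UNIV \<phi>" "continuous_on UNIV d" "\<And>x. \<phi> x \<noteq> 0 ==> norm x \<le> R" "\<And>x. d x \<noteq> 0 ==> norm x \<le> R"
proof -
  have sm: "smooth_fun \<phi>" and bd: "bounded {x. \<phi> x \<noteq> 0}" using assms(1) by (auto simp: test_fun_def)
  obtain R where R: "\<And>x. \<phi> x \<noteq> 0 ==> norm x \<le> R" using bd by (auto simp: bounded_iff)
  from sm obtain d' where d': "continuous_on UNIV \<phi>" "has_partial \<phi> i d'" "smooth_fun d'" by (cases rule: smooth_fun.cases) blast
  have "d = d'" using has_partial_unique[OF assms(2) d'(2)] .
  moreover have "continuous_on UNIV d'" using d'(3) by (cases rule: smooth_fun.cases) blast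
  ultimately show ?thesis using that d'(1) R has_partial_support[OF assms(2) R] by blast
qed

lemma test_fun_L2:
  assumes "test_fun \<phi>" "has_partial \<phi> i d"
  shows "(\<lambda>x. of_real (\<phi> x)) \<in> L2" "(\<lambda>x. of_real (d x)) \<in> L2"
proof -
  obtain R where R: "continuous_on UNIV \<phi>" "continuous_on UNIV d" "\<And>x. \<phi> x \<noteq> 0 ==> norm x \<le> R" "\<And>x. d x \<noteq> 0 ==> norm x \<le> R"
    using test_fun_D[OF assms] by blast
  show "(\<lambda>x. of_real (\<phi> x)) \<in> L2" "(\<lambda>x. of_real (d x)) \<in> L2"
    using R by (auto intro!: L2_cont_bounded_support[where R=R] continuous_intros)
qed

text \<open>Weak gradients are tested with real functions; the real and imaginary parts of a complex
  test function are each admissible and are recombined. The complex form is needed because the Green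
  function is complex.\<close>

lemma weak_grad_complex:
  assumes g: "H1_grad f D" and s: "csmooth \<Phi>" and p: "cpartial \<Phi> i \<Phi>'"
    and supp: "\<And>x. \<Phi> x \<noteq> 0 ==> norm x \<le> R"
  shows "(LBINT x. f x * \<Phi>' x) = - (LBINT x. D i x * \<Phi> x)"
proof -
  have fL: "f \<in> L2" and DL: "D i \<in> L2" and wg: "weak_grad f D" using g by (auto simp: H1_grad_def)
  have tf: "test_fun (\<lambda>x. Re (\<Phi> x))" "test_fun (\<lambda>x. Im (\<Phi> x))"
    using s supp by (auto simp: test_fun_def csmooth_def bounded_iff intro!: smooth_fun_Ck exI[of _ R]) (force)+
  have hp: "has_partial (\<lambda>x. Re (\<Phi> x)) i (\<lambda>x. Re (\<Phi>' x))" "has_partial (\<lambda>x. Im (\<Phi> x)) i (\<lambda>x. Im (\<Phi>' x))"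
    using cpartial_parts[OF p] by auto
  note L = test_fun_L2[OF tf(1) hp(1)] test_fun_L2[OF tf(2) hp(2)]
  have split: "(LBINT x. w x * G x) = (LBINT x. w x * of_real (Re (G x))) + \<i> * (LBINT x. w x * of_real (Im (G x)))"
    if "w \<in> L2" "(\<lambda>x. of_real (Re (G x))) \<in> L2" "(\<lambda>x. of_real (Im (G x))) \<in> L2" for w G :: cfun
  proof -
    have "w x * G x = w x * of_real (Re (G x)) + \<i> * (w x * of_real (Im (G x)))" for x
      by (subst complex_eq[of "G x"]) (simp add: algebra_simps)
    then have "(LBINT x. w x * G x) = (LBINT x. w x * of_real (Re (G x)) + \<i> * (w x * of_real (Im (G x))))" by simp
    also have "\<dots> = (LBINT x. w x * of_real (Re (G x))) + \<i> * (LBINT x. w x * of_real (Im (G x)))"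
      by (subst Bochner_Integration.integral_add) (use L2_mult_CS(1) that in auto)
    finally show ?thesis .
  qed
  have "(LBINT x. f x * of_real (Re (\<Phi>' x))) = - (LBINT x. D i x * of_real (Re (\<Phi> x)))"
    using wg tf(1) hp(1) unfolding weak_grad_def by blast
  moreover have "(LBINT x. f x * of_real (Im (\<Phi>' x))) = - (LBINT x. D i x * of_real (Im (\<Phi> x)))"
    using wg tf(2) hp(2) unfolding weak_grad_def by blast
  ultimately show ?thesis by (simp add: split[OF fL L(2) L(4)] split[OF DL L(1) L(3)])
qed

text \<open>Translation invariance of the integral gives \<open>\<integral>\<partial>\<^sub>i\<Psi> = 0\<close>.\<close>

lemma integral_cpartial_eq_0:
  assumes p: "cpartial \<Psi> i \<Psi>'" and c: "continuous_on UNIV \<Psi>" "continuous_on UNIV \<Psi>'"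
    and supp: "\<And>x. \<Psi> x \<noteq> 0 ==> norm x \<le> R" "\<And>x. \<Psi>' x \<noteq> 0 ==> norm x \<le> R"
  shows "(LBINT x. \<Psi>' x) = 0"
proof -
  define e where "e = (axis i 1 :: pt)"
  have e1: "norm e = 1" by (simp add: e_def norm_axis_1)
  note [measurable] = borel_measurable_continuous_onI[OF c(1)] borel_measurable_continuous_onI[OF c(2)]
  obtain B where Bn: "0 \<le> B" and B0: "\<And>x. norm x \<le> R ==> cmod (\<Psi>' x) \<le> B"
    using continuous_bounded_on_cball[OF c(2)] by blast
  obtain B1 where B1: "0 \<le> B1" "\<And>x. norm x \<le> R ==> cmod (\<Psi> x) \<le> B1"
    using continuous_bounded_on_cball[OF c(1)] by blast
  have B: "cmod (\<Psi>' x) \<le> B" for x using B0[of x] supp(2)[of x] Bn by (cases "\<Psi>' x = 0") auto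
  have der: "((\<lambda>t. \<Psi> (x + t *\<^sub>R e)) has_vector_derivative \<Psi>' (x + t *\<^sub>R e)) (at t)" for x t
  proof -
    have "((\<lambda>s. \<Psi> (x + t *\<^sub>R e + s *\<^sub>R e)) has_vector_derivative \<Psi>' (x + t *\<^sub>R e)) (at 0)"
      using p by (simp add: cpartial_def e_def)
    then have "((\<lambda>s. \<Psi> (x + t *\<^sub>R e + s *\<^sub>R e)) has_vector_derivative \<Psi>' (x + t *\<^sub>R e)) (at (t - t))" by simp
    moreover have "((\<lambda>u. u - t) has_vector_derivative 1) (at t)"
      by (auto intro!: derivative_eq_intros simp flip: has_real_derivative_iff_has_vector_derivative)
    ultimately have "((\<lambda>u. \<Psi> (x + t *\<^sub>R e + (u - t) *\<^sub>R e)) has_vector_derivative \<Psi>' (x + t *\<^sub>R e)) (at t)"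
      using vector_diff_chain_at[of "\<lambda>u. u - t" 1 t] by (fastforce simp: o_def)
    then show ?thesis by (simp add: algebra_simps)
  qed
  \<comment> \<open>The mean value inequality along the line bounds every difference quotient by
    \<open>B\<close>. With steps of length at most 1 this gives a majorant supported in the ball of
    radius \<open>R + 1\<close>.\<close>
  have lip: "cmod (\<Psi> (x + t *\<^sub>R e) - \<Psi> x) \<le> B * \<bar>t\<bar>" for x t
  proof -
    have "cmod (\<Psi> (x + t *\<^sub>R e) - \<Psi> (x + 0 *\<^sub>R e)) \<le> B * norm (t - 0)"
    proof (rule differentiable_bound[where S=UNIV and f'="\<lambda>t h. h *\<^sub>R \<Psi>' (x + t *\<^sub>R e)"])
      show "((\<lambda>t. \<Psi> (x + t *\<^sub>R e)) has_derivative (\<lambda>h. h *\<^sub>R \<Psi>' (x + s *\<^sub>R e))) (at s within UNIV)" for s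
        using der[of x s] by (simp add: has_vector_derivative_def)
      show "onorm (\<lambda>h. h *\<^sub>R \<Psi>' (x + s *\<^sub>R e)) \<le> B" for s
        by (rule onorm_bound[OF Bn]) (simp add: mult.commute[of B] mult_left_mono B)
    qed auto
    then show ?thesis by simp
  qed
  have int: "integrable lborel \<Psi>" and int': "integrable lborel (indicator (cball 0 (R + 1)) :: pt => real)"
  proof -
    show "integrable lborel (indicator (cball 0 (R + 1)) :: pt => real)" using emeasure_bounded_finite[OF bounded_cball, of "0::pt" "R+1"] by simp
    have i: "integrable lborel (\<lambda>x::pt. B1 * indicator (cball 0 R) x)"
      using emeasure_bounded_finite[OF bounded_cball, of "0::pt" R] by simp
    show "integrable lborel \<Psi>"
    proof (rule Bochner_Integration.integrable_bound[OF i])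
      show "AE x in lborel. norm (\<Psi> x) \<le> norm (B1 * indicator (cball 0 R) x)"
        using supp(1) B1 by (intro AE_I2) (auto split: split_indicator)
    qed measurable
  qed
  define t where "t n = 1 / real (Suc n)" for n
  have t: "0 < t n" "t n \<le> 1" for n by (auto simp: t_def)
  have tl: "t \<longlonglongrightarrow> 0" unfolding t_def by (rule LIMSEQ_Suc[OF lim_1_over_n])
  have "(\<lambda>n. LBINT x. (\<Psi> (x + t n *\<^sub>R e) - \<Psi> x) /\<^sub>R t n) \<longlonglongrightarrow> (LBINT x. \<Psi>' x)"
  proof (rule integral_dominated_convergence[where w="\<lambda>x. B * indicator (cball 0 (R + 1)) x"])
    show "AE x in lborel. (\<lambda>n. (\<Psi> (x + t n *\<^sub>R e) - \<Psi> x) /\<^sub>R t n) \<longlonglongrightarrow> \<Psi>' x"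
    proof (rule AE_I2)
      fix x
      have a: "((\<lambda>s. cmod (\<Psi> (x + s *\<^sub>R e) - \<Psi> x - s *\<^sub>R \<Psi>' x) / norm s) \<longlongrightarrow> 0) (at 0)"
        using der[of x 0] by (simp add: has_vector_derivative_def has_derivative_at)
      have "((\<lambda>s. (\<Psi> (x + s *\<^sub>R e) - \<Psi> x) /\<^sub>R s - \<Psi>' x) \<longlongrightarrow> 0) (at 0)"
      proof (rule tendsto_norm_zero_cancel, rule Lim_transform_eventually[OF a])
        have "cmod (\<Psi> (x + s *\<^sub>R e) - \<Psi> x - s *\<^sub>R \<Psi>' x) / norm s = norm ((\<Psi> (x + s *\<^sub>R e) - \<Psi> x) /\<^sub>R s - \<Psi>' x)" if "s \<noteq> 0" for s
        proof -
          have "(\<Psi> (x + s *\<^sub>R e) - \<Psi> x) /\<^sub>R s - \<Psi>' x = (\<Psi> (x + s *\<^sub>R e) - \<Psi> x - s *\<^sub>R \<Psi>' x) /\<^sub>R s"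
            using that by (simp add: scaleR_diff_right)
          then show ?thesis by (simp add: divide_inverse mult.commute)
        qed
        then show "\<forall>\<^sub>F s in at 0. cmod (\<Psi> (x + s *\<^sub>R e) - \<Psi> x - s *\<^sub>R \<Psi>' x) / norm s = norm ((\<Psi> (x + s *\<^sub>R e) - \<Psi> x) /\<^sub>R s - \<Psi>' x)"
          by (simp add: eventually_at_filter)
      qed
      then have "((\<lambda>s. (\<Psi> (x + s *\<^sub>R e) - \<Psi> x) /\<^sub>R s) \<longlongrightarrow> \<Psi>' x) (at 0)" by (rule LIM_zero_cancel)
      then show "(\<lambda>n. (\<Psi> (x + t n *\<^sub>R e) - \<Psi> x) /\<^sub>R t n) \<longlonglongrightarrow> \<Psi>' x"
        using tl t(1) by (auto simp: tendsto_at_iff_sequentially o_def less_le dest!: spec[of _ t])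
    qed
    show "AE x in lborel. norm ((\<Psi> (x + t n *\<^sub>R e) - \<Psi> x) /\<^sub>R t n) \<le> B * indicator (cball 0 (R + 1)) x" for n
    proof (rule AE_I2)
      fix x
      show "norm ((\<Psi> (x + t n *\<^sub>R e) - \<Psi> x) /\<^sub>R t n) \<le> B * indicator (cball 0 (R + 1)) x"
      proof (cases "norm x \<le> R + 1")
        case True
        have "norm ((\<Psi> (x + t n *\<^sub>R e) - \<Psi> x) /\<^sub>R t n) = cmod (\<Psi> (x + t n *\<^sub>R e) - \<Psi> x) / t n"
          using t[of n] by (simp only: norm_scaleR) (simp add: divide_inverse mult.commute)
        also have "\<dots> \<le> B" using lip[of x "t n"] t[of n] by (simp add: divide_le_eq)
        finally show ?thesis using True by simp
      next
        case False
        have "norm (x + t n *\<^sub>R e) > R" using norm_triangle_ineq4[of "x + t n *\<^sub>R e" "t n *\<^sub>R e"] e1 t[of n] False by simp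
        then have "\<Psi> (x + t n *\<^sub>R e) = 0" "\<Psi> x = 0" using supp(1)[of x] supp(1)[of "x + t n *\<^sub>R e"] False by force+
        then show ?thesis using Bn by simp
      qed
    qed
  qed (use int' in auto)
  moreover have "(LBINT x. (\<Psi> (x + t n *\<^sub>R e) - \<Psi> x) /\<^sub>R t n) = 0" for n
  proof -
    have tr: "(LBINT x. \<Psi> x) = (LBINT x. \<Psi> (x + t n *\<^sub>R e))"
      using integral_lborel_affine[of \<Psi> 1 "t n *\<^sub>R e"] by (simp add: add.commute)
    have "integrable (distr lborel borel ((+) (t n *\<^sub>R e))) \<Psi>" unfolding lborel_distr_plus using int .
    then have "integrable lborel (\<lambda>x. \<Psi> (x + t n *\<^sub>R e))"
      by (subst (asm) integrable_distr_eq) (auto simp: add.commute)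
    then show ?thesis using int tr by simp
  qed
  ultimately have "(\<lambda>n::nat. 0) \<longlonglongrightarrow> (LBINT x. \<Psi>' x)" by (simp only:)
  then show ?thesis by (simp add: LIMSEQ_const_iff)
qed

section \<open>The regularised Helmholtz kernel\<close>

text \<open>The kernel \<open>exp (- \<kappa> s) / (4 \<pi> s)\<close> is regularised by \<open>s = sqrt (|z|^2 + \<delta>^2)\<close>; the case \<open>\<delta> = 0\<close> is
  the Green function itself, and \<open>Jd\<close> is the approximate delta function \<open>(\<kappa>^2 - \<Delta>) Fd\<close>.\<close>

definition sd :: "real => pt => real" where
  "sd \<delta> z = sqrt ((norm z)^2 + \<delta>^2)"

text \<open>For the radial profile \<open>exp (- \<kappa> s) / (4 \<pi> s)\<close> this is the
  derivative divided by \<open>s\<close>, so that the gradient of the kernel is \<open>mc\<close>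
  times \<open>z\<close>; \<open>mc'\<close> is the derivative of \<open>mc\<close>.\<close>

definition mc :: "complex => real => complex" where
  "mc \<kappa> s = - ((\<kappa> / of_real s ^ 2 + 1 / of_real s ^ 3) * exp (- (\<kappa> * of_real s))) / of_real (4 * pi)"

definition mc' :: "complex => real => complex" where
  "mc' \<kappa> s = (\<kappa>^2 / of_real s ^ 2 + 3 * \<kappa> / of_real s ^ 3 + 3 / of_real s ^ 4) * exp (- (\<kappa> * of_real s)) / of_real (4 * pi)"

definition Fd :: "complex => real => pt => complex" where
  "Fd \<kappa> \<delta> z = exp (- (\<kappa> * of_real (sd \<delta> z))) / of_real (4 * pi * sd \<delta> z)"

definition dFd :: "complex => real => 3 => pt => complex" where
  "dFd \<kappa> \<delta> i z = mc \<kappa> (sd \<delta> z) * of_real (z $ i)"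

definition ddFd :: "complex => real => 3 => pt => complex" where
  "ddFd \<kappa> \<delta> i z = mc' \<kappa> (sd \<delta> z) * of_real ((z $ i)^2 / sd \<delta> z) + mc \<kappa> (sd \<delta> z)"

definition Jd :: "complex => real => pt => complex" where
  "Jd \<kappa> \<delta> z = of_real (\<delta>^2 / sd \<delta> z) * mc' \<kappa> (sd \<delta> z)"

definition Yk :: "real => pt => real" where
  "Yk a z = exp (- a * norm z) / norm z"

lemma sd_meas[measurable]: "sd \<delta> \<in> borel_measurable borel"
  unfolding sd_def[abs_def] by measurable

lemma kernel_meas[measurable]:
  "Fd \<kappa> \<delta> \<in> borel_measurable borel" "dFd \<kappa> \<delta> i \<in> borel_measurable borel"
  "ddFd \<kappa> \<delta> i \<in> borel_measurable borel" "Jd \<kappa> \<delta> \<in> borel_measurable borel" "Yk a \<in> borel_measurable borel"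
  unfolding Fd_def[abs_def] dFd_def[abs_def] ddFd_def[abs_def] Jd_def[abs_def] mc_def mc'_def Yk_def[abs_def] by measurable

lemma sd_0[simp]: "sd 0 z = norm z" by (simp add: sd_def)

lemma sd_ge: "norm z \<le> sd \<delta> z" "\<bar>\<delta>\<bar> \<le> sd \<delta> z"
  by (simp_all add: sd_def real_le_rsqrt)

lemma sd_pos: "\<delta> > 0 ==> sd \<delta> z > 0" "z \<noteq> 0 ==> sd \<delta> z > 0"
  using sd_ge(2)[of \<delta> z] sd_ge(1)[of z \<delta>] zero_less_norm_iff[of z] by linarith+

lemma sd_sq: "(sd \<delta> z)^2 = (norm z)^2 + \<delta>^2"
  by (simp add: sd_def)

lemma cmod_exp_kappa: "cmod (exp (- (\<kappa> * of_real s))) = exp (- Re \<kappa> * s)"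
  by (simp add: norm_exp_eq_Re)

lemma div_4pi: "0 \<le> x ==> x / (4 * pi) \<le> x"
  using pi_gt3 by (simp add: divide_le_eq mult_left_mono[of 1 "4 * pi" x, simplified])

section \<open>Pointwise bounds for the regularised kernels\<close>

lemma mc_bound: assumes "0 < s" shows "cmod (mc \<kappa> s) \<le> (cmod \<kappa> / s^2 + 1 / s^3) * exp (- Re \<kappa> * s)"
proof -
  have "cmod (mc \<kappa> s) = cmod (\<kappa> / of_real s ^ 2 + 1 / of_real s ^ 3) * exp (- Re \<kappa> * s) / (4 * pi)"
    by (simp only: mc_def norm_divide norm_minus_cancel norm_mult cmod_exp_kappa) (simp add: norm_mult)
  also have "\<dots> \<le> cmod (\<kappa> / of_real s ^ 2 + 1 / of_real s ^ 3) * exp (- Re \<kappa> * s)"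
    by (rule div_4pi) simp
  also have "\<dots> \<le> (cmod (\<kappa> / of_real s ^ 2) + cmod (1 / of_real s ^ 3)) * exp (- Re \<kappa> * s)"
    by (intro mult_right_mono norm_triangle_ineq) simp
  also have "\<dots> = (cmod \<kappa> / s^2 + 1 / s^3) * exp (- Re \<kappa> * s)"
    using assms by (simp add: norm_divide norm_power)
  finally show ?thesis .
qed

lemma mc'_bound: assumes "0 < s" shows "cmod (mc' \<kappa> s) \<le> ((cmod \<kappa>)^2 / s^2 + 3 * cmod \<kappa> / s^3 + 3 / s^4) * exp (- Re \<kappa> * s)"
proof -
  let ?t = "\<kappa>^2 / of_real s ^ 2 + 3 * \<kappa> / of_real s ^ 3 + 3 / of_real s ^ 4"
  have "cmod (mc' \<kappa> s) = cmod ?t * exp (- Re \<kappa> * s) / (4 * pi)"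
    by (simp only: mc'_def norm_divide norm_mult cmod_exp_kappa) (simp add: norm_mult)
  also have "\<dots> \<le> cmod ?t * exp (- Re \<kappa> * s)"
    by (rule div_4pi) simp
  also have "\<dots> \<le> (cmod (\<kappa>^2 / of_real s ^ 2) + cmod (3 * \<kappa> / of_real s ^ 3) + cmod (3 / of_real s ^ 4)) * exp (- Re \<kappa> * s)"
    by (intro mult_right_mono norm_triangle_mono norm_triangle_ineq order_refl) simp
  also have "\<dots> = ((cmod \<kappa>)^2 / s^2 + 3 * cmod \<kappa> / s^3 + 3 / s^4) * exp (- Re \<kappa> * s)"
    using assms by (simp add: norm_divide norm_power norm_mult)
  finally show ?thesis .
qed

lemma exp_sd_le: assumes "0 < a" shows "exp (- a * sd \<delta> z) \<le> exp (- a * norm z)"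
  using sd_ge(1)[of z \<delta>] assms by simp

lemma Fd_bound: assumes "0 < Re \<kappa>" "z \<noteq> 0"
  shows "cmod (Fd \<kappa> \<delta> z) \<le> Yk (Re \<kappa>) z / (4 * pi)" "cmod (Fd \<kappa> \<delta> z) \<le> Yk (Re \<kappa>) z" "cmod (Fd \<kappa> \<delta> z) \<le> Nk (Re \<kappa>) z"
proof -
  have n: "0 < norm z" using assms by simp
  have s: "0 < sd \<delta> z" using sd_pos assms by blast
  have "cmod (Fd \<kappa> \<delta> z) = exp (- Re \<kappa> * sd \<delta> z) / (4 * pi * sd \<delta> z)"
    using s by (simp only: Fd_def norm_divide cmod_exp_kappa) (simp add: norm_mult)
  also have "\<dots> \<le> exp (- Re \<kappa> * norm z) / (4 * pi * norm z)"
    using n sd_ge(1)[of z \<delta>] exp_sd_le[OF assms(1)] by (intro frac_le mult_left_mono) auto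
  finally show 1: "cmod (Fd \<kappa> \<delta> z) \<le> Yk (Re \<kappa>) z / (4 * pi)" by (simp add: Yk_def mult.commute)
  also have "\<dots> \<le> Yk (Re \<kappa>) z" by (rule div_4pi) (simp add: Yk_def)
  finally show 2: "cmod (Fd \<kappa> \<delta> z) \<le> Yk (Re \<kappa>) z" .
  also have "\<dots> \<le> Nk (Re \<kappa>) z" by (simp add: Yk_def Nk_def distrib_left)
  finally show "cmod (Fd \<kappa> \<delta> z) \<le> Nk (Re \<kappa>) z" .
qed

text \<open>A coordinate is at most \<open>sd \<delta> z\<close> and absorbs one power of it. Since
  \<open>sd \<delta> z\<close> is at least \<open>|z|\<close>, the bound is uniform in
  \<open>\<delta>\<close> and covers \<open>\<delta> = 0\<close>, which makes it a majorant for the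
  limit.\<close>

lemma dFd_bound: assumes "0 < Re \<kappa>" "z \<noteq> 0"
  shows "cmod (dFd \<kappa> \<delta> i z) \<le> (1 + cmod \<kappa>) * Nk (Re \<kappa>) z"
proof -
  have n: "0 < norm z" using assms by simp
  define s where "s = sd \<delta> z"
  have s: "0 < s" "norm z \<le> s" using sd_pos assms sd_ge by (auto simp: s_def)
  have "cmod (dFd \<kappa> \<delta> i z) = cmod (mc \<kappa> s) * \<bar>z $ i\<bar>" by (simp add: dFd_def norm_mult s_def)
  also have "\<dots> \<le> ((cmod \<kappa> / s^2 + 1 / s^3) * exp (- Re \<kappa> * s)) * s"
    using s component_le_norm_cart[of z i] by (intro mult_mono mc_bound) (auto intro: order_trans)
  also have "\<dots> = (cmod \<kappa> / s + 1 / s^2) * exp (- Re \<kappa> * s)"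
    using s by (simp add: field_simps power2_eq_square power3_eq_cube)
  also have "\<dots> \<le> (cmod \<kappa> / norm z + 1 / (norm z)^2) * exp (- Re \<kappa> * norm z)"
    using s n assms(1) by (intro mult_mono add_mono divide_left_mono power_mono mult_pos_pos zero_less_power s(1)) auto
  also have "\<dots> \<le> ((1 + cmod \<kappa>) * (1 / norm z) + (1 + cmod \<kappa>) * (1 / (norm z)^2)) * exp (- Re \<kappa> * norm z)"
    using n by (intro mult_right_mono add_mono) (auto simp: divide_simps)
  also have "\<dots> = (1 + cmod \<kappa>) * Nk (Re \<kappa>) z" by (simp add: Nk_def algebra_simps)
  finally show ?thesis .
qed

text \<open>For fixed positive \<open>\<delta>\<close> the length \<open>s\<close> stays above
  \<open>\<delta>\<close>, so surplus powers of \<open>1/s\<close> become constants and a single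
  factor \<open>exp (- Re \<kappa> s) / s\<close> remains. This majorant, unlike \<open>Nk\<close>,
  is square integrable; the constants obtained degenerate as \<open>\<delta>\<close> tends to
  0.\<close>

lemma reg_kernel_bounds: assumes "0 < Re \<kappa>" "0 < \<delta>"
  shows "\<exists>C\<ge>0. \<forall>z. z \<noteq> 0 --> cmod (dFd \<kappa> \<delta> i z) \<le> C * Yk (Re \<kappa>) z \<and> cmod (ddFd \<kappa> \<delta> i z) \<le> C * Yk (Re \<kappa>) z
     \<and> cmod (Jd \<kappa> \<delta> z) \<le> C * Yk (Re \<kappa>) z"
proof -
  define k where "k = cmod \<kappa>"
  define C1 where "C1 = k + 1 / \<delta>"
  define C2 where "C2 = k^2 + 3 * k / \<delta> + 3 / \<delta>^2"
  define C3 where "C3 = k / \<delta> + 1 / \<delta>^2"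
  have k: "0 \<le> k" by (simp add: k_def)
  have C: "0 \<le> C1" "0 \<le> C2" "0 \<le> C3" using k assms by (auto simp: C1_def C2_def C3_def)
  have "cmod (dFd \<kappa> \<delta> i z) \<le> (C1 + C2 + C3) * Yk (Re \<kappa>) z \<and> cmod (ddFd \<kappa> \<delta> i z) \<le> (C1 + C2 + C3) * Yk (Re \<kappa>) z
     \<and> cmod (Jd \<kappa> \<delta> z) \<le> (C1 + C2 + C3) * Yk (Re \<kappa>) z" if z: "z \<noteq> 0" for z
  proof -
    have n: "0 < norm z" using z by simp
    define s where "s = sd \<delta> z"
    define e where "e = exp (- Re \<kappa> * s)"
    have e: "0 \<le> e" by (simp add: e_def)
    have s: "0 < s" "norm z \<le> s" "\<delta> \<le> s" using sd_pos z sd_ge(1)[of z \<delta>] sd_ge(2)[of \<delta> z] assms by (auto simp: s_def)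
    have es: "e / s \<le> Yk (Re \<kappa>) z"
      unfolding Yk_def e_def using s n exp_sd_le[OF assms(1), of \<delta> z] by (intro frac_le) (auto simp: s_def)
    have Y: "0 \<le> Yk (Re \<kappa>) z" by (simp add: Yk_def)
    have up: "x * e / s \<le> D * Yk (Re \<kappa>) z" if "x \<le> D" "0 \<le> D" for x D
    proof -
      have "x * e / s = x * (e / s)" by simp
      also have "\<dots> \<le> D * (e / s)" using that s e by (intro mult_right_mono) auto
      also have "\<dots> \<le> D * Yk (Re \<kappa>) z" using es that by (intro mult_left_mono)
      finally show ?thesis .
    qed
    have i1: "1 / s \<le> 1 / \<delta>" using s assms by (intro divide_left_mono) auto
    have i2: "1 / s^2 \<le> 1 / \<delta>^2" using s assms by (intro divide_left_mono power_mono) auto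
    have i1k: "k / s \<le> k / \<delta>" using mult_left_mono[OF i1 k] by simp
    have zi: "\<bar>z $ i\<bar> \<le> s" using component_le_norm_cart[of z i] s by linarith
    have m1: "cmod (mc \<kappa> s) \<le> (k / s^2 + 1 / s^3) * e" unfolding k_def e_def by (rule mc_bound[OF s(1)])
    have m2: "cmod (mc' \<kappa> s) \<le> (k^2 / s^2 + 3 * k / s^3 + 3 / s^4) * e" unfolding k_def e_def by (rule mc'_bound[OF s(1)])
    have b3: "cmod (mc \<kappa> s) \<le> C3 * Yk (Re \<kappa>) z"
    proof -
      have "(k / s^2 + 1 / s^3) * e = (k / s + 1 / s^2) * e / s"
        using s by (simp add: field_simps power2_eq_square power3_eq_cube)
      also have "\<dots> \<le> C3 * Yk (Re \<kappa>) z" using i1k i2 C by (intro up) (auto simp: C3_def)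
      finally show ?thesis using m1 by simp
    qed
    have b1: "cmod (dFd \<kappa> \<delta> i z) \<le> C1 * Yk (Re \<kappa>) z"
    proof -
      have "cmod (dFd \<kappa> \<delta> i z) = cmod (mc \<kappa> s) * \<bar>z $ i\<bar>" by (simp add: dFd_def norm_mult s_def)
      also have "\<dots> \<le> ((k / s^2 + 1 / s^3) * e) * s"
        using zi m1 s e k by (intro mult_mono) auto
      also have "\<dots> = (k + 1 / s) * e / s"
        using s by (simp add: field_simps power2_eq_square power3_eq_cube)
      also have "\<dots> \<le> C1 * Yk (Re \<kappa>) z" using i1 C by (intro up) (auto simp: C1_def)
      finally show ?thesis .
    qed
    have b2: "cmod (mc' \<kappa> s) * s \<le> C2 * Yk (Re \<kappa>) z"
    proof -
      have "cmod (mc' \<kappa> s) * s \<le> ((k^2 / s^2 + 3 * k / s^3 + 3 / s^4) * e) * s"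
        using m2 s by (intro mult_right_mono) auto
      also have "\<dots> = (k^2 + 3 * (k / s) + 3 * (1 / s^2)) * e / s"
        using s by (simp add: field_simps power2_eq_square power3_eq_cube power4_eq_xxxx)
      also have "\<dots> \<le> C2 * Yk (Re \<kappa>) z"
        using i1k i2 C by (intro up) (auto simp: C2_def intro!: add_mono)
      finally show ?thesis .
    qed
    have b4: "cmod (ddFd \<kappa> \<delta> i z) \<le> C2 * Yk (Re \<kappa>) z + C3 * Yk (Re \<kappa>) z"
    proof -
      have "(z $ i)^2 / s \<le> s"
        using zi s power_mono[OF zi, of 2] by (simp add: divide_le_eq power2_eq_square)
      then have "cmod (mc' \<kappa> s * of_real ((z $ i)^2 / s)) \<le> cmod (mc' \<kappa> s) * s"
        using s by (simp only: norm_mult norm_of_real) (intro mult_left_mono, auto)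
      then have "cmod (mc' \<kappa> s * of_real ((z $ i)^2 / s)) \<le> C2 * Yk (Re \<kappa>) z" using b2 by simp
      then show ?thesis unfolding ddFd_def s_def[symmetric]
        using b3 by (intro order_trans[OF norm_triangle_ineq] add_mono)
    qed
    have b5: "cmod (Jd \<kappa> \<delta> z) \<le> C2 * Yk (Re \<kappa>) z"
    proof -
      have "\<delta>^2 / s \<le> s"
        using s assms power_mono[of \<delta> s 2] by (simp add: divide_le_eq power2_eq_square)
      then have "cmod (Jd \<kappa> \<delta> z) \<le> s * cmod (mc' \<kappa> s)"
        unfolding Jd_def s_def[symmetric]
        using s by (simp only: norm_mult norm_of_real) (intro mult_right_mono, auto)
      then show ?thesis using b2 by (simp add: mult.commute)
    qed
    have "0 \<le> C1 * Yk (Re \<kappa>) z" "0 \<le> C2 * Yk (Re \<kappa>) z" "0 \<le> C3 * Yk (Re \<kappa>) z" using C Y by auto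
    then show ?thesis using b1 b4 b5 by (simp add: distrib_right)
  qed
  then show ?thesis using C by (intro exI[of _ "C1 + C2 + C3"]) auto
qed

section \<open>Derivatives of the regularised kernels\<close>

lemma sd_line_deriv: assumes "0 < sd \<delta> x"
  shows "((\<lambda>t. sd \<delta> (x + t *\<^sub>R axis i 1)) has_vector_derivative (x $ i) / sd \<delta> x) (at 0)"
proof -
  have p: "0 < (norm x)^2 + \<delta>^2" using assms by (simp add: sd_def)
  have "((\<lambda>t. (x + t *\<^sub>R axis i 1) \<bullet> (x + t *\<^sub>R axis i 1) + \<delta>^2) has_real_derivative 2 * (x $ i) + 0) (at 0)"
    by (intro DERIV_add inner_line_deriv DERIV_const)
  from DERIV_chain2[OF DERIV_real_sqrt this] p
  have "((\<lambda>t. sqrt ((x + t *\<^sub>R axis i 1) \<bullet> (x + t *\<^sub>R axis i 1) + \<delta>^2)) has_real_derivative inverse (sqrt (x \<bullet> x + \<delta>^2)) / 2 * (2 * (x $ i) + 0)) (at 0)"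
    by (simp add: power2_norm_eq_inner)
  then show ?thesis
    unfolding has_real_derivative_iff_has_vector_derivative[symmetric] sd_def power2_norm_eq_inner
    by (simp add: field_simps)
qed

lemma Fd_radial_deriv: assumes "0 < s"
  shows "((\<lambda>s. exp (- (\<kappa> * of_real s)) / of_real (4 * pi * s)) has_vector_derivative mc \<kappa> s * of_real s) (at s)"
proof -
  have "((\<lambda>w. exp (- (\<kappa> * w)) / (4 * of_real pi * w)) has_field_derivative mc \<kappa> s * of_real s) (at (of_real s))"
    using assms unfolding mc_def
    by (auto intro!: derivative_eq_intros simp: field_simps power2_eq_square power3_eq_cube)
  from has_vector_derivative_real_field[OF this] show ?thesis by simp
qed

lemma mc_deriv: assumes "0 < s"
  shows "(mc \<kappa> has_vector_derivative mc' \<kappa> s) (at s)"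
proof -
  have "((\<lambda>w. - ((\<kappa> / w ^ 2 + 1 / w ^ 3) * exp (- (\<kappa> * w))) / of_real (4 * pi)) has_field_derivative mc' \<kappa> s) (at (of_real s))"
    using assms unfolding mc'_def
    by (auto intro!: derivative_eq_intros simp: field_simps) (simp add: field_simps eval_nat_numeral)
  from has_vector_derivative_real_field[OF this] show ?thesis by (simp add: mc_def[abs_def])
qed

lemma cpartial_Fd: assumes "0 < \<delta>" shows "cpartial (Fd \<kappa> \<delta>) i (dFd \<kappa> \<delta> i)"
  unfolding cpartial_def
proof
  fix x :: pt
  have s: "0 < sd \<delta> x" using sd_pos(1)[OF assms] .
  have "(((\<lambda>s. exp (- (\<kappa> * of_real s)) / of_real (4 * pi * s)) \<circ> (\<lambda>t. sd \<delta> (x + t *\<^sub>R axis i 1))) has_vector_derivative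
     ((x $ i) / sd \<delta> x) *\<^sub>R (mc \<kappa> (sd \<delta> x) * of_real (sd \<delta> x))) (at 0)"
    by (rule vector_diff_chain_at[OF sd_line_deriv[OF s]]) (use Fd_radial_deriv[OF s] in simp)
  moreover have "((x $ i) / sd \<delta> x) *\<^sub>R (mc \<kappa> (sd \<delta> x) * of_real (sd \<delta> x)) = dFd \<kappa> \<delta> i x"
    using s by (simp add: dFd_def scaleR_conv_of_real)
  ultimately show "((\<lambda>t. Fd \<kappa> \<delta> (x + t *\<^sub>R axis i 1)) has_vector_derivative dFd \<kappa> \<delta> i x) (at 0)"
    by (simp add: o_def Fd_def)
qed

lemma cpartial_dFd: assumes "0 < \<delta>" shows "cpartial (dFd \<kappa> \<delta> i) i (ddFd \<kappa> \<delta> i)"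
  unfolding cpartial_def
proof
  fix x :: pt
  have s: "0 < sd \<delta> x" using sd_pos(1)[OF assms] .
  have "((mc \<kappa> \<circ> (\<lambda>t. sd \<delta> (x + t *\<^sub>R axis i 1))) has_vector_derivative
     ((x $ i) / sd \<delta> x) *\<^sub>R mc' \<kappa> (sd \<delta> x)) (at 0)"
    by (rule vector_diff_chain_at[OF sd_line_deriv[OF s]]) (use mc_deriv[OF s] in simp)
  then have 1: "((\<lambda>t. mc \<kappa> (sd \<delta> (x + t *\<^sub>R axis i 1))) has_vector_derivative ((x $ i) / sd \<delta> x) *\<^sub>R mc' \<kappa> (sd \<delta> x)) (at 0)"
    by (simp add: o_def)
  have "((\<lambda>t. x $ i + t) has_real_derivative 1) (at 0)" by (auto intro!: derivative_eq_intros)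
  then have "((\<lambda>t. (x + t *\<^sub>R axis i 1) $ i) has_vector_derivative 1) (at 0)"
    by (simp add: axis_def has_real_derivative_iff_has_vector_derivative)
  from bounded_linear.has_vector_derivative[OF bounded_linear_of_real this]
  have 2: "((\<lambda>t. complex_of_real ((x + t *\<^sub>R axis i 1) $ i)) has_vector_derivative 1) (at 0)" by simp
  from has_vector_derivative_mult[OF 1 2]
  have "((\<lambda>t. dFd \<kappa> \<delta> i (x + t *\<^sub>R axis i 1)) has_vector_derivative
     mc \<kappa> (sd \<delta> x) * 1 + (((x $ i) / sd \<delta> x) *\<^sub>R mc' \<kappa> (sd \<delta> x)) * of_real (x $ i)) (at 0)"
    by (simp add: dFd_def)
  moreover have "mc \<kappa> (sd \<delta> x) * 1 + (((x $ i) / sd \<delta> x) *\<^sub>R mc' \<kappa> (sd \<delta> x)) * of_real (x $ i) = ddFd \<kappa> \<delta> i x"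
    by (simp add: ddFd_def scaleR_conv_of_real power2_eq_square)
  ultimately show "((\<lambda>t. dFd \<kappa> \<delta> i (x + t *\<^sub>R axis i 1)) has_vector_derivative ddFd \<kappa> \<delta> i x) (at 0)" by simp
qed

text \<open>As \<open>|z|^2 = s^2 - \<delta>^2\<close>, the Laplacian is \<open>s mc' + 3 mc\<close>
  minus \<open>(\<delta>^2 / s) mc'\<close>. The first part is \<open>\<kappa>^2\<close> times the
  kernel because the unregularised profile solves the modified Helmholtz equation; the defect is
  \<open>Jd\<close>.\<close>

lemma ddFd_sum: assumes "0 < \<delta>" shows "(\<Sum>i\<in>UNIV. ddFd \<kappa> \<delta> i z) = \<kappa>^2 * Fd \<kappa> \<delta> z - Jd \<kappa> \<delta> z"
proof -
  define s where "s = sd \<delta> z"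
  have s: "0 < s" using sd_pos(1)[OF assms] by (simp add: s_def)
  have n: "(\<Sum>i\<in>UNIV. (z $ i)^2) = s^2 - \<delta>^2"
    by (simp add: s_def sd_sq norm_vec_def L2_set_def sum_nonneg)
  have "(\<Sum>i\<in>UNIV. ddFd \<kappa> \<delta> i z) = mc' \<kappa> s * of_real ((\<Sum>i\<in>UNIV. (z $ i)^2) / s) + 3 * mc \<kappa> s"
    by (simp add: ddFd_def s_def[symmetric] sum.distrib sum_divide_distrib of_real_sum)
       (simp add: sum_distrib_left)
  also have "\<dots> = mc' \<kappa> s * of_real s + 3 * mc \<kappa> s - Jd \<kappa> \<delta> z"
    unfolding n using s by (simp add: Jd_def s_def[symmetric] power2_eq_square diff_divide_distrib algebra_simps)
  also have "mc' \<kappa> s * of_real s + 3 * mc \<kappa> s = \<kappa>^2 * Fd \<kappa> \<delta> z"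
    using s by (simp add: mc_def mc'_def Fd_def s_def[symmetric] field_simps eval_nat_numeral)
  finally show ?thesis .
qed

lemma csmooth_dFd: assumes "0 < \<delta>" shows "csmooth (dFd \<kappa> \<delta> i)"
proof -
  have p: "0 < z \<bullet> z + \<delta>^2" for z :: pt using assms by (simp add: add_nonneg_pos)
  have s: "Ck n (sd \<delta>)" for n
    unfolding sd_def[abs_def] power2_norm_eq_inner by (intro Ck_sqrt Ck_add Ck_inner_self Ck_const p)
  have si: "Ck n (\<lambda>z. inverse (sd \<delta> z))" for n
    by (intro Ck_inverse s sd_pos(1) assms)
  define r where "r z = inverse (sd \<delta> z)" for z
  have r: "Ck n r" for n unfolding r_def[abs_def] by (rule si)
  have "dFd \<kappa> \<delta> i z = (- ((\<kappa> * of_real (r z) ^ 2 + of_real (r z) ^ 3) * exp (- (\<kappa> * of_real (sd \<delta> z))))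
     * inverse (of_real (4 * pi))) * of_real (z $ i)" for z
    unfolding dFd_def mc_def r_def by (simp only: divide_inverse of_real_inverse power_inverse mult_1_left)
  then have "dFd \<kappa> \<delta> i = (\<lambda>z. (- ((\<kappa> * of_real (r z) ^ 2 + of_real (r z) ^ 3) * exp (- (\<kappa> * of_real (sd \<delta> z))))
     * inverse (of_real (4 * pi))) * of_real (z $ i))" by (rule ext)
  moreover have "csmooth \<dots>"
    by (intro csmooth_mult csmooth_uminus csmooth_add csmooth_power csmooth_exp csmooth_const csmooth_of_real s r Ck_coord)
  ultimately show ?thesis by simp
qed

lemma continuous_Fd: assumes "0 < \<delta>" shows "continuous_on UNIV (Fd \<kappa> \<delta>)"
  unfolding Fd_def[abs_def] sd_def using assms
  by (intro continuous_intros) (auto simp: add_nonneg_eq_0_iff)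

section \<open>Testing weak gradients with the regularised kernels\<close>

lemma L2_bound_AE:
  assumes "g \<in> L2" "f \<in> borel_measurable borel" "AE x in lborel. cmod (f x) \<le> cmod (g x)"
  shows "f \<in> L2"
proof -
  have "n2 f \<le> n2 g" unfolding n2_def using assms(3)
    by (intro nn_integral_mono_AE) (auto elim!: eventually_mono intro!: power_mono ennreal_leI)
  then show ?thesis using assms by (auto simp: L2_iff)
qed

lemma L2_translate: assumes "f \<in> L2" shows "(\<lambda>x. f (x - y)) \<in> L2" "(\<lambda>x. f (y - x)) \<in> L2"
proof -
  note [measurable] = L2_meas[OF assms]
  have "n2 (\<lambda>x. f (x - y)) = n2 f" unfolding n2_def
    by (rule nn_integral_translate(1)[of "\<lambda>x. (ennreal (cmod (f x)))^2"]) measurable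
  then show "(\<lambda>x. f (x - y)) \<in> L2" using assms by (simp add: L2_iff)
  have "n2 (\<lambda>x. f (y - x)) = n2 f" unfolding n2_def
    by (rule nn_integral_translate(2)[of "\<lambda>x. (ennreal (cmod (f x)))^2"]) measurable
  then show "(\<lambda>x. f (y - x)) \<in> L2" using assms by (simp add: L2_iff)
qed

lemma Yk_L2: assumes "0 < a" shows "(\<lambda>z. of_real (C * Yk a z)) \<in> L2"
proof -
  have "(\<lambda>z. of_real (Yk a z)) \<in> L2"
    using Yuk_sq_integral[OF assms] by (simp add: L2_iff n2_def Yk_def norm_divide)
  from L2_cmult[OF this, of "of_real C"] show ?thesis by simp
qed

lemma Fd_L2: assumes "0 < Re \<kappa>" shows "Fd \<kappa> \<delta> \<in> L2"
  by (rule L2_bound_AE[OF Yk_L2[OF assms, of 1]], measurable)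
     (use AE_pt_neq[of 0] in eventually_elim, use Fd_bound(2)[OF assms] in \<open>auto simp: Yk_def norm_divide\<close>)

lemma reg_kernel_L2: assumes "0 < Re \<kappa>" "0 < \<delta>"
  shows "dFd \<kappa> \<delta> i \<in> L2" "ddFd \<kappa> \<delta> i \<in> L2" "Jd \<kappa> \<delta> \<in> L2"
proof -
  obtain C where C: "0 \<le> C" "\<And>z. z \<noteq> 0 ==> cmod (dFd \<kappa> \<delta> i z) \<le> C * Yk (Re \<kappa>) z \<and> cmod (ddFd \<kappa> \<delta> i z) \<le> C * Yk (Re \<kappa>) z
     \<and> cmod (Jd \<kappa> \<delta> z) \<le> C * Yk (Re \<kappa>) z" using reg_kernel_bounds[OF assms] by blast
  have Y: "cmod (of_real (C * Yk (Re \<kappa>) z)) = C * Yk (Re \<kappa>) z" for z using C(1) by (simp add: Yk_def norm_mult norm_divide)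
  show "dFd \<kappa> \<delta> i \<in> L2" by (rule L2_bound_AE[OF Yk_L2[OF assms(1), of C]], measurable)
     (use AE_pt_neq[of 0] in eventually_elim, unfold Y, use C(2) in auto)
  show "ddFd \<kappa> \<delta> i \<in> L2" by (rule L2_bound_AE[OF Yk_L2[OF assms(1), of C]], measurable)
     (use AE_pt_neq[of 0] in eventually_elim, unfold Y, use C(2) in auto)
  show "Jd \<kappa> \<delta> \<in> L2" by (rule L2_bound_AE[OF Yk_L2[OF assms(1), of C]], measurable)
     (use AE_pt_neq[of 0] in eventually_elim, unfold Y, use C(2) in auto)
qed

text \<open>The kernel is not compactly supported, so it is cut off by \<open>bump c\<close> and \<open>c\<close> tends to zero.\<close>

lemma weak_grad_dFd:
  assumes h: "H1_grad h D" and k: "0 < Re \<kappa>" and d: "0 < \<delta>"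
  shows "(LBINT x. h x * ddFd \<kappa> \<delta> i (x - y)) = - (LBINT x. D i x * dFd \<kappa> \<delta> i (x - y))"
proof -
  have hL: "h \<in> L2" and DL: "D i \<in> L2" using h by (auto simp: H1_grad_def)
  note L = L2_translate(1)[OF reg_kernel_L2(1)[OF k d], of i y] L2_translate(1)[OF reg_kernel_L2(2)[OF k d], of i y]
  note [measurable] = L2_meas[OF hL] L2_meas[OF DL]
  define c where "c n = (1 / real (Suc n))" for n
  have c: "0 < c n" "c n \<le> 1" for n by (auto simp: c_def)
  have cl: "c \<longlonglongrightarrow> 0" unfolding c_def by (rule LIMSEQ_Suc[OF lim_1_over_n])
  have [measurable]: "bump a \<in> borel_measurable borel" "dbump a i \<in> borel_measurable borel" for a
    using Ck_bump[of 0 a] Ck_dbump[of 0 a i] by (auto intro: borel_measurable_continuous_onI)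
  have eq: "(LBINT x. h x * (of_real (bump (c n) x) * ddFd \<kappa> \<delta> i (x - y) + of_real (dbump (c n) i x) * dFd \<kappa> \<delta> i (x - y)))
     = - (LBINT x. D i x * (of_real (bump (c n) x) * dFd \<kappa> \<delta> i (x - y)))" for n
  proof (rule weak_grad_complex[OF h])
    have "csmooth (\<lambda>x. dFd \<kappa> \<delta> i (x - y))"
    proof -
      have sh: "Ck n f ==> Ck n (\<lambda>x. f (x - y))" for n f
      proof (induction n arbitrary: f)
        case (Suc n)
        obtain df where df: "\<And>i. has_partial f i (df i)" "\<And>i. Ck n (df i)" using Ck_SucE[OF Suc.prems] by blast
        have "has_partial (\<lambda>x. f (x - y)) i (\<lambda>x. df i (x - y))" for i
          unfolding has_partial_def
        proof
          fix x
          have "((\<lambda>t. f ((x - y) + t *\<^sub>R axis i 1)) has_real_derivative df i (x - y)) (at 0)"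
            using df(1)[of i] unfolding has_partial_def by blast
          then show "((\<lambda>t. f (x + t *\<^sub>R axis i 1 - y)) has_real_derivative df i (x - y)) (at 0)"
            by (simp add: diff_add_eq)
        qed
        moreover have "continuous_on UNIV (\<lambda>x. f (x - y))"
          by (intro continuous_on_compose2[OF Ck_cont[OF Suc.prems]] continuous_intros) auto
        ultimately show ?case using Suc.IH df by (intro Ck_Suc_I[where d="\<lambda>i x. df i (x - y)"]) auto
      next
        case 0
        then have "continuous_on UNIV f" by simp
        then have "continuous_on UNIV (\<lambda>x. f (x - y))"
          by (rule continuous_on_compose2) (auto intro!: continuous_intros)
        then show ?case by simp
      qed
      show ?thesis using csmooth_dFd[OF d, of \<kappa> i] unfolding csmooth_def by (auto intro!: sh[where f="\<lambda>x. Re (dFd \<kappa> \<delta> i x)"] sh[where f="\<lambda>x. Im (dFd \<kappa> \<delta> i x)"])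
    qed
    then show "csmooth (\<lambda>x. of_real (bump (c n) x) * dFd \<kappa> \<delta> i (x - y))"
      by (intro csmooth_mult csmooth_of_real Ck_bump)
    show "cpartial (\<lambda>x. of_real (bump (c n) x) * dFd \<kappa> \<delta> i (x - y)) i
       (\<lambda>x. of_real (bump (c n) x) * ddFd \<kappa> \<delta> i (x - y) + of_real (dbump (c n) i x) * dFd \<kappa> \<delta> i (x - y))"
      by (intro cpartial_mult cpartial_of_real has_partial_bump cpartial_translate cpartial_dFd d)
    show "norm x \<le> 1 / sqrt (c n)" if "of_real (bump (c n) x) * dFd \<kappa> \<delta> i (x - y) \<noteq> 0" for x
      using bump_support[OF c(1)[of n], of x i] that by (auto simp: less_imp_le)
  qed
  have bump_lim: "(\<lambda>n. bump (c n) x) \<longlonglongrightarrow> 1" for x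
  proof -
    have "(\<lambda>n. exp 1 * \<theta> 0 (1 - c n * (x \<bullet> x))) \<longlonglongrightarrow> exp 1 * \<theta> 0 (1 - 0 * (x \<bullet> x))"
      by (intro tendsto_intros isCont_tendsto_compose[of _ "\<theta> 0"] DERIV_isCont[OF \<theta>_deriv] cl)
    moreover have "exp 1 * \<theta> 0 (1 - 0 * (x \<bullet> x)) = 1" using bump_bounds(4)[of 0 x] by (simp add: bump_def)
    ultimately show ?thesis by (simp only: bump_def)
  qed
  have dbump_lim: "(\<lambda>n. dbump (c n) i x) \<longlonglongrightarrow> 0" for x
  proof (rule Lim_null_comparison[OF always_eventually])
    show "\<forall>n. norm (dbump (c n) i x) \<le> 4 * exp 1 * sqrt (c n)" using dbump_bound[OF c(1)] by simp
    have "(\<lambda>n. 4 * exp 1 * sqrt (c n)) \<longlonglongrightarrow> 4 * exp 1 * sqrt 0" by (intro tendsto_intros cl)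
    then show "(\<lambda>n. 4 * exp 1 * sqrt (c n)) \<longlonglongrightarrow> 0" by simp
  qed
  have int: "integrable lborel (\<lambda>x. cmod (h x * ddFd \<kappa> \<delta> i (x - y)))" "integrable lborel (\<lambda>x. cmod (h x * dFd \<kappa> \<delta> i (x - y)))"
    "integrable lborel (\<lambda>x. cmod (D i x * dFd \<kappa> \<delta> i (x - y)))"
    using L2_mult_CS(1)[OF hL L(2)] L2_mult_CS(1)[OF hL L(1)] L2_mult_CS(1)[OF DL L(1)] by (auto intro: integrable_norm)
  have "(\<lambda>n. LBINT x. h x * (of_real (bump (c n) x) * ddFd \<kappa> \<delta> i (x - y) + of_real (dbump (c n) i x) * dFd \<kappa> \<delta> i (x - y)))
     \<longlonglongrightarrow> (LBINT x. h x * (of_real 1 * ddFd \<kappa> \<delta> i (x - y) + of_real 0 * dFd \<kappa> \<delta> i (x - y)))"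
  proof (rule integral_dominated_convergence[where w="\<lambda>x. cmod (h x * ddFd \<kappa> \<delta> i (x - y)) + 4 * exp 1 * cmod (h x * dFd \<kappa> \<delta> i (x - y))"])
    show "AE x in lborel. (\<lambda>n. h x * (of_real (bump (c n) x) * ddFd \<kappa> \<delta> i (x - y) + of_real (dbump (c n) i x) * dFd \<kappa> \<delta> i (x - y)))
       \<longlonglongrightarrow> h x * (of_real 1 * ddFd \<kappa> \<delta> i (x - y) + of_real 0 * dFd \<kappa> \<delta> i (x - y))"
      by (intro AE_I2 tendsto_intros bump_lim dbump_lim)
    show "AE x in lborel. norm (h x * (of_real (bump (c n) x) * ddFd \<kappa> \<delta> i (x - y) + of_real (dbump (c n) i x) * dFd \<kappa> \<delta> i (x - y)))
        \<le> cmod (h x * ddFd \<kappa> \<delta> i (x - y)) + 4 * exp 1 * cmod (h x * dFd \<kappa> \<delta> i (x - y))" for n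
    proof (rule AE_I2)
      fix x
      have b1: "\<bar>bump (c n) x\<bar> \<le> 1" using bump_bounds(1,2)[of "c n" x] c(1)[of n] by simp
      have b2: "\<bar>dbump (c n) i x\<bar> \<le> 4 * exp 1"
      proof -
        have "4 * exp 1 * sqrt (c n) \<le> 4 * exp 1 * 1" using c(2)[of n] by (intro mult_left_mono) auto
        then show ?thesis using dbump_bound[OF c(1)[of n], of i x] by linarith
      qed
      have "norm (h x * (of_real (bump (c n) x) * ddFd \<kappa> \<delta> i (x - y) + of_real (dbump (c n) i x) * dFd \<kappa> \<delta> i (x - y)))
        \<le> norm (of_real (bump (c n) x) * (h x * ddFd \<kappa> \<delta> i (x - y))) + norm (of_real (dbump (c n) i x) * (h x * dFd \<kappa> \<delta> i (x - y)))"
        by (rule order_trans[OF _ norm_triangle_ineq]) (simp add: algebra_simps)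
      also have "\<dots> = \<bar>bump (c n) x\<bar> * cmod (h x * ddFd \<kappa> \<delta> i (x - y)) + \<bar>dbump (c n) i x\<bar> * cmod (h x * dFd \<kappa> \<delta> i (x - y))"
        by (simp add: norm_mult)
      also have "\<dots> \<le> 1 * cmod (h x * ddFd \<kappa> \<delta> i (x - y)) + 4 * exp 1 * cmod (h x * dFd \<kappa> \<delta> i (x - y))"
        by (intro add_mono mult_right_mono b1 b2) auto
      finally show "norm (h x * (of_real (bump (c n) x) * ddFd \<kappa> \<delta> i (x - y) + of_real (dbump (c n) i x) * dFd \<kappa> \<delta> i (x - y)))
        \<le> cmod (h x * ddFd \<kappa> \<delta> i (x - y)) + 4 * exp 1 * cmod (h x * dFd \<kappa> \<delta> i (x - y))" by simp
    qed
    show "integrable lborel (\<lambda>x. cmod (h x * ddFd \<kappa> \<delta> i (x - y)) + 4 * exp 1 * cmod (h x * dFd \<kappa> \<delta> i (x - y)))"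
      by (intro Bochner_Integration.integrable_add integrable_mult_right int)
  qed measurable
  moreover have "(\<lambda>n. LBINT x. D i x * (of_real (bump (c n) x) * dFd \<kappa> \<delta> i (x - y)))
     \<longlonglongrightarrow> (LBINT x. D i x * (of_real 1 * dFd \<kappa> \<delta> i (x - y)))"
  proof (rule integral_dominated_convergence[where w="\<lambda>x. cmod (D i x * dFd \<kappa> \<delta> i (x - y))"])
    show "AE x in lborel. (\<lambda>n. D i x * (of_real (bump (c n) x) * dFd \<kappa> \<delta> i (x - y))) \<longlonglongrightarrow> D i x * (of_real 1 * dFd \<kappa> \<delta> i (x - y))"
      by (intro AE_I2 tendsto_intros bump_lim)
    show "AE x in lborel. norm (D i x * (of_real (bump (c n) x) * dFd \<kappa> \<delta> i (x - y))) \<le> cmod (D i x * dFd \<kappa> \<delta> i (x - y))" for n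
    proof (rule AE_I2)
      fix x
      have b1: "\<bar>bump (c n) x\<bar> \<le> 1" using bump_bounds(1,2)[of "c n" x] c(1)[of n] by simp
      have "norm (D i x * (of_real (bump (c n) x) * dFd \<kappa> \<delta> i (x - y))) = \<bar>bump (c n) x\<bar> * cmod (D i x * dFd \<kappa> \<delta> i (x - y))"
        by (simp add: norm_mult)
      also have "\<dots> \<le> 1 * cmod (D i x * dFd \<kappa> \<delta> i (x - y))" by (intro mult_right_mono b1) auto
      finally show "norm (D i x * (of_real (bump (c n) x) * dFd \<kappa> \<delta> i (x - y))) \<le> cmod (D i x * dFd \<kappa> \<delta> i (x - y))" by simp
    qed
  qed (measurable, rule int(3))
  ultimately have "(LBINT x. h x * (of_real 1 * ddFd \<kappa> \<delta> i (x - y) + of_real 0 * dFd \<kappa> \<delta> i (x - y)))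
     = - (LBINT x. D i x * (of_real 1 * dFd \<kappa> \<delta> i (x - y)))"
    unfolding eq by (intro LIMSEQ_unique[OF _ tendsto_minus])
  then show ?thesis by simp
qed

text \<open>Adding the weak identities over the coordinates brings in the Laplacian of the kernel,
  and the modified Helmholtz operator applied to \<open>Fd\<close> leaves only the average of
  \<open>h\<close> against the approximate delta function.\<close>

lemma regularised_representation:
  assumes h: "H1_grad h D" and k: "0 < Re \<kappa>" and d: "0 < \<delta>"
  shows "(\<Sum>i\<in>UNIV. LBINT x. D i x * dFd \<kappa> \<delta> i (x - y)) + \<kappa>^2 * (LBINT x. h x * Fd \<kappa> \<delta> (x - y))
     = (LBINT x. h x * Jd \<kappa> \<delta> (x - y))"
proof -
  have hL: "h \<in> L2" using h by (auto simp: H1_grad_def)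
  have I: "integrable lborel (\<lambda>x. h x * ddFd \<kappa> \<delta> i (x - y))" "integrable lborel (\<lambda>x. h x * Jd \<kappa> \<delta> (x - y))" 
    "integrable lborel (\<lambda>x. h x * Fd \<kappa> \<delta> (x - y))" for i
    by (intro L2_mult_CS(1) hL L2_translate reg_kernel_L2 Fd_L2 k d)+
  have "(\<Sum>i\<in>UNIV. LBINT x. D i x * dFd \<kappa> \<delta> i (x - y)) = - (\<Sum>i\<in>UNIV. LBINT x. h x * ddFd \<kappa> \<delta> i (x - y))"
    by (simp add: weak_grad_dFd[OF h k d] sum_negf)
  also have "(\<Sum>i\<in>UNIV. LBINT x. h x * ddFd \<kappa> \<delta> i (x - y)) = (LBINT x. (\<Sum>i\<in>UNIV. h x * ddFd \<kappa> \<delta> i (x - y)))"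
    by (rule Bochner_Integration.integral_sum[symmetric]) (rule I)
  also have "\<dots> = (LBINT x. \<kappa>^2 * (h x * Fd \<kappa> \<delta> (x - y)) - h x * Jd \<kappa> \<delta> (x - y))"
    by (simp add: sum_distrib_left[symmetric] ddFd_sum[OF d] algebra_simps)
  also have "\<dots> = \<kappa>^2 * (LBINT x. h x * Fd \<kappa> \<delta> (x - y)) - (LBINT x. h x * Jd \<kappa> \<delta> (x - y))"
    by (subst Bochner_Integration.integral_diff) (use I in auto)
  finally show ?thesis by simp
qed

section \<open>Representation of Sobolev functions by the Green function\<close>

lemma indicator_L2:
  assumes "A \<in> sets borel" "bounded A" shows "(\<lambda>x. indicator A x) \<in> L2"
proof -
  have "n2 (\<lambda>x. indicator A x) = (NINT x. indicator A x)"
    unfolding n2_def by (intro nn_integral_cong) (auto split: split_indicator)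
  also have "\<dots> < \<infinity>" using assms emeasure_bounded_finite[OF assms(2)] by simp
  finally show ?thesis using assms(1) by (simp add: L2_iff)
qed

text \<open>The positive and negative parts, taken as densities, define measures that agree on all
  boxes. Boxes are closed under intersection and generate the Borel sets, so the measures coincide
  and the densities agree almost everywhere.\<close>

lemma L2_box_zero_real:
  fixes w :: "pt => real"
  assumes w: "(\<lambda>x. of_real (w x)) \<in> L2"
    and z: "\<And>a b. (LBINT x. indicator (box a b) x * w x) = 0"
  shows "AE x in lborel. w x = 0"
proof -
  have wm[measurable]: "w \<in> borel_measurable borel"
  proof -
    have "(\<lambda>x. Re (of_real (w x))) \<in> borel_measurable borel" using L2_meas[OF w] by measurable
    then show ?thesis by simp
  qed
  have int: "integrable lborel (\<lambda>x. indicator (box a b) x * w x)" for a b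
  proof -
    have "integrable lborel (\<lambda>x. (indicator (box a b) x :: complex) * of_real (w x))"
      by (rule L2_mult_CS(1)[OF indicator_L2 w]) (auto simp: bounded_box)
    from integrable_Re[OF this] have "integrable lborel (\<lambda>x. Re ((indicator (box a b) x :: complex) * of_real (w x)))" .
    moreover have "Re ((indicator (box a b) x :: complex) * of_real (w x)) = indicator (box a b) x * w x" for x
      by (simp split: split_indicator)
    ultimately show ?thesis by (simp only:)
  qed
  have eq: "(NINT x. ennreal (w x) * indicator (box a b) x) = (NINT x. ennreal (- w x) * indicator (box a b) x)"
    and fin: "(NINT x. ennreal (w x) * indicator (box a b) x) < \<infinity>" for a b
  proof -
    have i1: "integrable lborel (\<lambda>x. max 0 (indicator (box a b) x * w x))"
      and i2: "integrable lborel (\<lambda>x. max 0 (- (indicator (box a b) x * w x)))"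
      using int[of a b] by (intro Bochner_Integration.integrable_max integrable_zero; simp)+
    have e1: "(NINT x. ennreal (w x) * indicator (box a b) x) = ennreal (LBINT x. max 0 (indicator (box a b) x * w x))"
      by (subst nn_integral_eq_integral[OF i1, symmetric]) (auto intro!: nn_integral_cong split: split_indicator simp: max_def ennreal_neg)
    have e2: "(NINT x. ennreal (- w x) * indicator (box a b) x) = ennreal (LBINT x. max 0 (- (indicator (box a b) x * w x)))"
      by (subst nn_integral_eq_integral[OF i2, symmetric]) (auto intro!: nn_integral_cong split: split_indicator simp: max_def ennreal_neg)
    have "(LBINT x. max 0 (indicator (box a b) x * w x)) - (LBINT x. max 0 (- (indicator (box a b) x * w x)))
       = (LBINT x. indicator (box a b) x * w x)"
      by (subst Bochner_Integration.integral_diff[OF i1 i2, symmetric]) (auto intro!: Bochner_Integration.integral_cong simp: max_def)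
    then show "(NINT x. ennreal (w x) * indicator (box a b) x) = (NINT x. ennreal (- w x) * indicator (box a b) x)"
      using z e1 e2 by simp
    show "(NINT x. ennreal (w x) * indicator (box a b) x) < \<infinity>" using e1 by simp
  qed
  have "density lborel (\<lambda>x. ennreal (w x)) = density lborel (\<lambda>x. ennreal (- w x))"
  proof (rule measure_eqI_generator_eq)
    let ?E = "range (\<lambda>(a, b). box a b::pt set)"
    let ?A = "\<lambda>n::nat. box (- (real n *\<^sub>R One)) (real n *\<^sub>R One) :: pt set"
    show "Int_stable ?E" by (auto simp: Int_stable_def box_Int_box)
    show "?E \<subseteq> Pow UNIV" "sets (density lborel (\<lambda>x. ennreal (w x))) = sigma_sets UNIV ?E"
      "sets (density lborel (\<lambda>x. ennreal (- w x))) = sigma_sets UNIV ?E"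
      by (simp_all add: borel_eq_box)
    show "range ?A \<subseteq> ?E" "(\<Union>i. ?A i) = UNIV" unfolding UN_box_eq_UNIV by auto
    show "emeasure (density lborel (\<lambda>x. ennreal (w x))) (?A i) \<noteq> \<infinity>" for i
      using fin by (auto simp: emeasure_density less_top)
    show "emeasure (density lborel (\<lambda>x. ennreal (w x))) X = emeasure (density lborel (\<lambda>x. ennreal (- w x))) X" if "X \<in> ?E" for X
      using that eq by (auto simp: emeasure_density)
  qed
  then have "AE x in lborel. ennreal (w x) = ennreal (- w x)"
    by (intro sigma_finite_measure.density_unique[OF lborel.sigma_finite_measure_axioms]) auto
  then show ?thesis
  proof eventually_elim
    fix x assume "ennreal (w x) = ennreal (- w x)"
    then show "w x = 0" by (cases "0 \<le> w x") (auto simp: ennreal_neg)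
  qed
qed

lemma L2_box_zero:
  assumes w: "w \<in> L2" and z: "\<And>a b. (LBINT x. indicator (box a b) x * w x) = 0"
  shows "AE x in lborel. w x = 0"
proof -
  have int: "integrable lborel (\<lambda>x. indicator (box a b) x * w x)" for a b
    by (rule L2_mult_CS(1)[OF indicator_L2 w]) (auto simp: bounded_box)
  have R: "(\<lambda>x. of_real (Re (w x))) \<in> L2" "(\<lambda>x. of_real (Im (w x))) \<in> L2"
    using L2_meas[OF w] abs_Re_le_cmod abs_Im_le_cmod by (auto intro!: L2_bound[OF w])
  have "(LBINT x. indicator (box a b) x * Re (w x)) = Re (LBINT x. indicator (box a b) x * w x)" for a b
    by (subst integral_Re[OF int, symmetric]) (auto intro!: Bochner_Integration.integral_cong split: split_indicator)
  then have 1: "AE x in lborel. Re (w x) = 0" using z by (intro L2_box_zero_real R) simp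
  have "(LBINT x. indicator (box a b) x * Im (w x)) = Im (LBINT x. indicator (box a b) x * w x)" for a b
    by (subst integral_Im[OF int, symmetric]) (auto intro!: Bochner_Integration.integral_cong split: split_indicator)
  then have 2: "AE x in lborel. Im (w x) = 0" using z by (intro L2_box_zero_real R) simp
  show ?thesis using 1 2 by eventually_elim (simp add: complex_eq_iff)
qed

text \<open>Young's inequality for an \<open>L^1\<close> kernel acting on \<open>L^2\<close>: the
  kernel is split into two square roots, one of which is spent on Cauchy-Schwarz before the
  integrals are exchanged.\<close>

lemma young_nn:
  fixes N :: "pt => real" and g :: "pt => ennreal"
  assumes [measurable]: "N \<in> borel_measurable borel" "g \<in> borel_measurable borel" and N0: "\<And>z. 0 \<le> N z"
  shows "(NINT x. (NINT y. ennreal (N (x - y)) * g y)^2) \<le> (NINT z. ennreal (N z))^2 * (NINT y. (g y)^2)"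
proof -
  define I where "I = (NINT z. ennreal (N z))"
  have sq: "ennreal (N z) = (ennreal (sqrt (N z)))^2" for z by (simp add: ennreal_power N0)
  have I1: "(NINT y. ennreal (N (x - y))) = I" for x
    unfolding I_def by (rule nn_integral_translate(2)) measurable
  have I2: "(NINT x. ennreal (N (x - y))) = I" for y
    unfolding I_def by (rule nn_integral_translate(1)) measurable
  have "(NINT y. ennreal (N (x - y)) * g y)^2 \<le> I * (NINT y. ennreal (N (x - y)) * (g y)^2)" for x
  proof -
    have "(NINT y. ennreal (N (x - y)) * g y)^2 = (NINT y. ennreal (sqrt (N (x - y))) * (ennreal (sqrt (N (x - y))) * g y))^2"
      by (simp add: sq power2_eq_square mult.assoc)
    also have "\<dots> \<le> (NINT y. (ennreal (sqrt (N (x - y))))^2) * (NINT y. (ennreal (sqrt (N (x - y))) * g y)^2)"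
      by (rule Cauchy_Schwarz_nn_integral) measurable
    finally show ?thesis by (simp add: sq[symmetric] I1 power_mult_distrib)
  qed
  then have "(NINT x. (NINT y. ennreal (N (x - y)) * g y)^2) \<le> (NINT x. I * (NINT y. ennreal (N (x - y)) * (g y)^2))"
    by (rule nn_integral_mono)
  also have "\<dots> = I * (NINT x. (NINT y. ennreal (N (x - y)) * (g y)^2))"
    by (rule nn_integral_cmult) measurable
  also have "(NINT x. (NINT y. ennreal (N (x - y)) * (g y)^2)) = (NINT y. (NINT x. ennreal (N (x - y)) * (g y)^2))"
    by (rule lborel_Tonelli) measurable
  also have "\<dots> = (NINT y. I * (g y)^2)"
    by (simp add: nn_integral_multc I2)
  also have "\<dots> = I * (NINT y. (g y)^2)"
    by (rule nn_integral_cmult) measurable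
  finally show ?thesis by (simp add: I_def power2_eq_square mult.assoc)
qed

text \<open>Kept extended-valued: for the functions of interest it is finite almost everywhere, and
  finiteness at a point is carried as a hypothesis where a pointwise argument needs it.\<close>

definition conv :: "real => cfun => pt => ennreal" where
  "conv a g x = (NINT y. ennreal (Nk a (x - y) * cmod (g y)))"

lemma conv_meas: assumes [measurable]: "g \<in> borel_measurable borel" shows "conv a g \<in> borel_measurable borel"
  unfolding conv_def[abs_def] by measurable

lemma conv_L2: assumes "0 < a" "g \<in> L2" shows "(NINT x. (conv a g x)^2) < \<infinity>"
proof -
  note [measurable] = L2_meas[OF assms(2)]
  have "(NINT x. (conv a g x)^2) \<le> (NINT z. ennreal (Nk a z))^2 * n2 g"
    unfolding conv_def n2_def using young_nn[of "Nk a" "\<lambda>y. ennreal (cmod (g y))"] by (simp add: ennreal_mult)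
  also have "\<dots> < \<infinity>" using Nk_integral[OF assms(1)] L2_n2[OF assms(2)] by (simp add: ennreal_mult_less_top power_less_top_ennreal)
  finally show ?thesis .
qed

lemma nn_CS_finite:
  assumes [measurable]: "f \<in> borel_measurable lborel" "g \<in> borel_measurable lborel"
    and fin: "(NINT x. (f x)^2) < \<infinity>" "(NINT x. (g x)^2) < \<infinity>"
  shows "(NINT x. f x * g x) < \<infinity>"
proof -
  have "(NINT x. f x * g x)^2 \<le> (NINT x. (f x)^2) * (NINT x. (g x)^2)"
    by (rule Cauchy_Schwarz_nn_integral) measurable
  also have "\<dots> < \<infinity>" using fin by (simp add: ennreal_mult_less_top)
  finally show ?thesis by (simp add: power_less_top_ennreal)
qed

lemma sq_finite_AE:
  assumes [measurable]: "f \<in> borel_measurable lborel" and fin: "(NINT x. (f x)^2) < \<infinity>"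
  shows "AE x in lborel. f x < \<infinity>"
proof -
  have "AE x in lborel. (f x)^2 \<noteq> \<infinity>"
    by (rule nn_integral_noteq_infinite) (use fin in auto)
  then show ?thesis by eventually_elim (auto simp: less_top power_less_top_ennreal)
qed

lemma Fd_tendsto: assumes "z \<noteq> 0" "t \<longlonglongrightarrow> 0"
  shows "(\<lambda>n. Fd \<kappa> (t n) z) \<longlonglongrightarrow> Fd \<kappa> 0 z" "(\<lambda>n. dFd \<kappa> (t n) i z) \<longlonglongrightarrow> dFd \<kappa> 0 i z"
proof -
  have "(\<lambda>n. sd (t n) z) \<longlonglongrightarrow> sqrt ((norm z)^2 + 0^2)"
    unfolding sd_def by (intro tendsto_intros assms)
  then have s: "(\<lambda>n. sd (t n) z) \<longlonglongrightarrow> norm z" by simp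
  show "(\<lambda>n. Fd \<kappa> (t n) z) \<longlonglongrightarrow> Fd \<kappa> 0 z"
    unfolding Fd_def sd_0 using assms(1) by (intro tendsto_intros s) auto
  show "(\<lambda>n. dFd \<kappa> (t n) i z) \<longlonglongrightarrow> dFd \<kappa> 0 i z"
    unfolding dFd_def mc_def sd_0 using assms(1) by (intro tendsto_intros s) auto
qed

text \<open>The approximate delta function brought to unit width, with the Jacobian of the rescaling
  included.\<close>

definition qd :: "complex => real => pt => complex" where
  "qd \<kappa> \<delta> z = of_real (\<delta>^3) * Jd \<kappa> \<delta> (\<delta> *\<^sub>R z)"

lemma qd_eq: assumes "0 < \<delta>"
  shows "qd \<kappa> \<delta> z = (of_real (\<delta>^2) * \<kappa>^2 / of_real (sd 1 z ^ 3) + 3 * \<kappa> * of_real \<delta> / of_real (sd 1 z ^ 4) + 3 / of_real (sd 1 z ^ 5))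
    * exp (- (\<kappa> * of_real (\<delta> * sd 1 z))) / of_real (4 * pi)"
proof -
  have "sd \<delta> (\<delta> *\<^sub>R z) = sqrt (\<delta>^2 * ((norm z)^2 + 1^2))" using assms by (simp add: sd_def power_mult_distrib algebra_simps)
  then have s: "sd \<delta> (\<delta> *\<^sub>R z) = \<delta> * sd 1 z" using assms by (simp add: sd_def real_sqrt_mult)
  define s1 where "s1 = sd 1 z"
  have s1: "s1 \<noteq> 0" using sd_pos(1)[of 1 z] by (simp add: s1_def)
  have d: "complex_of_real \<delta> \<noteq> 0" using assms by simp
  show ?thesis unfolding qd_def Jd_def mc'_def s s1_def[symmetric]
    using s1 d by (simp add: field_simps eval_nat_numeral)
qed

text \<open>The slowest term decays like \<open>s^-3\<close> only, but
  \<open>\<delta> s exp (- Re \<kappa> \<delta> s)\<close> is at most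
  \<open>1 / Re \<kappa>\<close>, which supplies the missing power of \<open>1/s\<close>. The result
  is an integrable majorant independent of \<open>\<delta>\<close>.\<close>

lemma qd_bound: assumes "0 < Re \<kappa>" "0 < \<delta>" "\<delta> \<le> 1"
  shows "cmod (qd \<kappa> \<delta> z) \<le> ((cmod \<kappa>)^2 / Re \<kappa> + 3 * cmod \<kappa> + 3) * (1 / (1 + (norm z)^2)^2)"
proof -
  define s where "s = sd 1 z"
  have s2: "s^2 = 1 + (norm z)^2" by (simp add: s_def sd_sq)
  have s1: "1 \<le> s" using sd_ge(2)[of 1 z] by (simp add: s_def)
  have s4: "s^4 = (1 + (norm z)^2)^2" using s2 by (metis power2_eq_square power4_eq_xxxx mult.assoc)
  define e where "e = exp (- Re \<kappa> * (\<delta> * s))"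
  have e0: "0 \<le> e" by (simp add: e_def)
  have e1: "e \<le> 1" using assms s1 by (simp add: e_def)
  have e2: "\<delta> * s * e \<le> 1 / Re \<kappa>"
  proof -
    have "Re \<kappa> * (\<delta> * s) \<le> exp (Re \<kappa> * (\<delta> * s))" using exp_ge_add_one_self[of "Re \<kappa> * (\<delta> * s)"] by linarith
    then show ?thesis using assms(1) by (simp add: e_def exp_minus field_simps)
  qed
  let ?T = "of_real (\<delta>^2) * \<kappa>^2 / of_real (s ^ 3) + 3 * \<kappa> * of_real \<delta> / of_real (s ^ 4) + 3 / of_real (s ^ 5) :: complex"
  have "cmod (qd \<kappa> \<delta> z) = cmod ?T * e / (4 * pi)"
    unfolding qd_eq[OF assms(2)] s_def[symmetric] e_def
    by (simp only: norm_divide norm_mult[of ?T] cmod_exp_kappa) (simp add: norm_mult)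
  also have "\<dots> \<le> cmod ?T * e" by (rule div_4pi) (use e0 in simp)
  also have "\<dots> \<le> (cmod (of_real (\<delta>^2) * \<kappa>^2 / of_real (s ^ 3)) + cmod (3 * \<kappa> * of_real \<delta> / of_real (s ^ 4)) + cmod (3 / of_real (s ^ 5) :: complex)) * e"
    by (intro mult_right_mono norm_triangle_mono norm_triangle_ineq order_refl e0)
  also have "\<dots> = (\<delta>^2 * (cmod \<kappa>)^2 / s^3 + 3 * cmod \<kappa> * \<delta> / s^4 + 3 / s^5) * e"
    using s1 assms(2) by (simp add: norm_divide norm_power norm_mult)
  also have "\<dots> = \<delta> * (cmod \<kappa>)^2 * (\<delta> * s * e) / s^4 + 3 * cmod \<kappa> * (\<delta> * e) / s^4 + 3 * (e / s) / s^4"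
    using s1 by (simp add: field_simps eval_nat_numeral)
  also have "\<dots> \<le> 1 * (cmod \<kappa>)^2 * (1 / Re \<kappa>) / s^4 + 3 * cmod \<kappa> * (1 * 1) / s^4 + 3 * (1 / 1) / s^4"
    using e2 e1 e0 s1 assms
    by (intro add_mono divide_right_mono mult_mono frac_le) auto
  also have "\<dots> = ((cmod \<kappa>)^2 / Re \<kappa> + 3 * cmod \<kappa> + 3) * (1 / s^4)"
    by (simp add: add_divide_distrib distrib_right)
  finally show ?thesis by (simp add: s4)
qed

lemma qd_tendsto: assumes "\<And>n. 0 < t n" "t \<longlonglongrightarrow> 0"
  shows "(\<lambda>n. qd \<kappa> (t n) z) \<longlonglongrightarrow> of_real (3 / (4 * pi * (sqrt ((norm z)^2 + 1))^5))"
proof -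
  have s: "sd 1 z \<noteq> 0" using sd_pos(1)[of 1 z] by simp
  have "(\<lambda>n. (of_real ((t n)^2) * \<kappa>^2 / of_real (sd 1 z ^ 3) + 3 * \<kappa> * of_real (t n) / of_real (sd 1 z ^ 4) + 3 / of_real (sd 1 z ^ 5))
    * exp (- (\<kappa> * of_real (t n * sd 1 z))) / of_real (4 * pi)) \<longlonglongrightarrow>
    (of_real (0^2) * \<kappa>^2 / of_real (sd 1 z ^ 3) + 3 * \<kappa> * of_real 0 / of_real (sd 1 z ^ 4) + 3 / of_real (sd 1 z ^ 5))
    * exp (- (\<kappa> * of_real (0 * sd 1 z))) / of_real (4 * pi)"
    using s by (intro tendsto_intros assms) auto
  then show ?thesis using assms(1) by (simp add: qd_eq sd_def mult.commute)
qed

text \<open>Off the boundary of the box, a null set, the indicator is locally constant.\<close>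

lemma indicator_translate_tendsto:
  assumes t: "t \<longlonglongrightarrow> (0::real)"
  shows "AE x in lborel. (\<lambda>n. indicator (box a b) (x - t n *\<^sub>R z) :: complex) \<longlonglongrightarrow> indicator (box a b) (x::pt)"
proof -
  have "emeasure lborel (cbox a b - box a b) = emeasure lborel (cbox a b) - emeasure lborel (box a b)"
    by (rule emeasure_Diff) (auto simp: box_subset_cbox emeasure_lborel_box_eq)
  also have "\<dots> = 0" by (simp add: emeasure_lborel_box_eq emeasure_lborel_cbox_eq)
  finally have "cbox a b - box a b \<in> null_sets lborel" by (auto intro: null_setsI)
  then have "AE x in lborel. x \<notin> cbox a b - box a b" by (rule AE_not_in)
  then show ?thesis
  proof eventually_elim
    fix x :: pt assume x: "x \<notin> cbox a b - box a b"
    have lim: "(\<lambda>n. x - t n *\<^sub>R z) \<longlonglongrightarrow> x - 0 *\<^sub>R z" by (intro tendsto_intros t)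
    show "(\<lambda>n. indicator (box a b) (x - t n *\<^sub>R z) :: complex) \<longlonglongrightarrow> indicator (box a b) x"
    proof (cases "x \<in> box a b")
      case True
      then have "eventually (\<lambda>n. x - t n *\<^sub>R z \<in> box a b) sequentially"
        using topological_tendstoD[OF lim open_box] by simp
      then have "eventually (\<lambda>n. indicator (box a b) x = (indicator (box a b) (x - t n *\<^sub>R z) :: complex)) sequentially"
        by eventually_elim (use True in simp)
      then show ?thesis by (rule Lim_transform_eventually[OF tendsto_const])
    next
      case False
      then have "x \<in> - cbox a b" using x by auto
      then have "eventually (\<lambda>n. x - t n *\<^sub>R z \<in> - cbox a b) sequentially"
        using topological_tendstoD[OF lim, of "- cbox a b"] open_Compl[OF closed_cbox, of a b] by simp
      then have "eventually (\<lambda>n. indicator (box a b) x = (indicator (box a b) (x - t n *\<^sub>R z) :: complex)) sequentially"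
        by eventually_elim (use False subsetD[OF box_subset_cbox[of a b]] in \<open>auto split: split_indicator\<close>)
      then show ?thesis by (rule Lim_transform_eventually[OF tendsto_const])
    qed
  qed
qed

text \<open>The translation is moved onto the indicator, which converges pointwise almost everywhere
  although \<open>h\<close> has no continuity. Steps of length at most 1 confine all translated
  boxes to one ball.\<close>

lemma translate_pairing_tendsto:
  assumes t: "t \<longlonglongrightarrow> (0::real)" "\<And>n. 0 < t n" "\<And>n. t n \<le> 1" and h: "h \<in> L2"
  shows "(\<lambda>n. LBINT y. indicator (box a b) y * h (y + t n *\<^sub>R z)) \<longlonglongrightarrow> (LBINT y. indicator (box a b) y * h y)"
proof -
  note [measurable] = L2_meas[OF h]
  have eq: "(LBINT y. indicator (box a b) y * h (y + t n *\<^sub>R z)) = (LBINT x. indicator (box a b) (x - t n *\<^sub>R z) * h x)" for n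
    using integral_lborel_affine[of "\<lambda>x. indicator (box a b) (x - t n *\<^sub>R z) * h x" 1 "t n *\<^sub>R z"] by (simp add: add.commute)
  obtain R where R: "\<And>x. x \<in> box a b ==> norm x \<le> R" using bounded_box[of a b] by (auto simp: bounded_iff)
  have "(\<lambda>n. LBINT x. indicator (box a b) (x - t n *\<^sub>R z) * h x) \<longlonglongrightarrow> (LBINT y. indicator (box a b) y * h y)"
  proof (rule integral_dominated_convergence[where w="\<lambda>x. cmod (indicator (cball 0 (R + norm z)) x * h x)"])
    show "AE x in lborel. (\<lambda>n. indicator (box a b) (x - t n *\<^sub>R z) * h x) \<longlonglongrightarrow> indicator (box a b) x * h x"
      using indicator_translate_tendsto[OF t(1), of a b z] by eventually_elim (intro tendsto_intros)
    show "AE x in lborel. norm (indicator (box a b) (x - t n *\<^sub>R z) * h x) \<le> cmod (indicator (cball 0 (R + norm z)) x * h x)" for n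
    proof (rule AE_I2)
      fix x
      have "norm x \<le> R + norm z" if "x - t n *\<^sub>R z \<in> box a b"
      proof -
        have "norm x \<le> norm (x - t n *\<^sub>R z) + norm (t n *\<^sub>R z)" using norm_triangle_ineq[of "x - t n *\<^sub>R z" "t n *\<^sub>R z"] by simp
        also have "\<dots> \<le> R + norm z" using R[OF that] t(2)[of n] t(3)[of n] by (intro add_mono) (auto intro: mult_left_le_one_le)
        finally show ?thesis .
      qed
      then show "norm (indicator (box a b) (x - t n *\<^sub>R z) * h x) \<le> cmod (indicator (cball 0 (R + norm z)) x * h x)"
        by (auto split: split_indicator)
    qed
    show "integrable lborel (\<lambda>x. cmod (indicator (cball 0 (R + norm z)) x * h x))"
      by (intro integrable_norm L2_mult_CS(1) indicator_L2 h) auto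
  qed measurable
  then show ?thesis by (simp add: eq)
qed

text \<open>The substitution \<open>x = y + t z\<close> replaces the shrinking kernel by
  \<open>qd\<close>. After Fubini the integrand in \<open>z\<close> is \<open>qd\<close> times a
  translation pairing, dominated by a quartically decaying profile; the limiting profile has mass
  1.\<close>

lemma Jd_limit:
  assumes k: "0 < Re \<kappa>" and t: "t \<longlonglongrightarrow> (0::real)" "\<And>n. 0 < t n" "\<And>n. t n \<le> 1" and h: "h \<in> L2"
  shows "(\<lambda>n. LBINT y. indicator (box a b) y * (LBINT x. h x * Jd \<kappa> (t n) (x - y))) \<longlonglongrightarrow> (LBINT y. indicator (box a b) y * h y)"
proof -
  note [measurable] = L2_meas[OF h]
  have [measurable]: "qd \<kappa> (t n) \<in> borel_measurable borel" for n unfolding qd_def[abs_def] by measurable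
  have BL: "(\<lambda>x. indicator (box a b) x) \<in> L2" by (rule indicator_L2) (auto simp: bounded_box)
  define M where "M = L2norm (\<lambda>x. indicator (box a b) x) * L2norm h"
  define C where "C = (cmod \<kappa>)^2 / Re \<kappa> + 3 * cmod \<kappa> + 3"
  have C: "0 \<le> C" using k by (simp add: C_def)
  have htL: "(\<lambda>y. h (y + w)) \<in> L2" and htn: "L2norm (\<lambda>y. h (y + w)) = L2norm h" for w
  proof -
    have "n2 (\<lambda>y. h (y - (- w))) = n2 h" unfolding n2_def
      by (rule nn_integral_translate(1)[of "\<lambda>x. (ennreal (cmod (h x)))^2"]) measurable
    then have e: "n2 (\<lambda>y. h (y + w)) = n2 h" by simp
    show l: "(\<lambda>y. h (y + w)) \<in> L2" using L2_translate(1)[OF h, of "- w"] by simp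
    show "L2norm (\<lambda>y. h (y + w)) = L2norm h" using e n2_eq[OF h] n2_eq[OF l] by simp
  qed
  have bnd: "(NINT y. ennreal (cmod (indicator (box a b) y) * cmod (h (y + w)))) \<le> ennreal M" for w
    using L2_mult_CS(4)[OF BL htL[of w]] by (simp only: htn M_def)
  have qb: "cmod (qd \<kappa> (t n) z) \<le> C * (1 / (1 + (norm z)^2)^2)" for n z
    unfolding C_def by (rule qd_bound[OF k t(2,3)])
  have i4: "integrable lborel (\<lambda>z::pt. 1 / (1 + (norm z)^2)^2)"
    by (rule integrableI_bounded) (use nn_integral_quartic_finite in auto)
  have sub: "(LBINT x. h x * Jd \<kappa> (t n) (x - y)) = (LBINT z. h (y + t n *\<^sub>R z) * qd \<kappa> (t n) z)" for n y
  proof -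
    have "(LBINT x. h x * Jd \<kappa> (t n) (x - y)) = of_real (\<bar>t n\<bar>^3) * (LBINT z. h (y + t n *\<^sub>R z) * Jd \<kappa> (t n) (y + t n *\<^sub>R z - y))"
      using t(2)[of n] by (intro integral_lborel_affine) auto
    also have "\<dots> = (LBINT z. h (y + t n *\<^sub>R z) * qd \<kappa> (t n) z)"
      using t(2)[of n] by (subst integral_mult_right_zero[symmetric]) (simp add: qd_def ac_simps)
    finally show ?thesis .
  qed
  have fub: "(LBINT y. indicator (box a b) y * (LBINT x. h x * Jd \<kappa> (t n) (x - y)))
     = (LBINT z. qd \<kappa> (t n) z * (LBINT y. indicator (box a b) y * h (y + t n *\<^sub>R z)))" for n
  proof -
    have "(LBINT y. indicator (box a b) y * (LBINT x. h x * Jd \<kappa> (t n) (x - y)))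
      = (LBINT y. LBINT z. qd \<kappa> (t n) z * (indicator (box a b) y * h (y + t n *\<^sub>R z)))"
      unfolding sub by (subst integral_mult_right_zero[symmetric]) (simp add: ac_simps)
    also have "\<dots> = (LBINT z. LBINT y. qd \<kappa> (t n) z * (indicator (box a b) y * h (y + t n *\<^sub>R z)))"
    proof (rule lborel_Fubini(1))
      have "(NINT y. NINT z. ennreal (cmod (qd \<kappa> (t n) z * (indicator (box a b) y * h (y + t n *\<^sub>R z)))))
         = (NINT z. NINT y. ennreal (cmod (qd \<kappa> (t n) z * (indicator (box a b) y * h (y + t n *\<^sub>R z)))))"
        by (rule lborel_Tonelli) measurable
      also have "\<dots> = (NINT z. ennreal (cmod (qd \<kappa> (t n) z)) * (NINT y. ennreal (cmod (indicator (box a b) y) * cmod (h (y + t n *\<^sub>R z)))))"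
        by (intro nn_integral_cong, subst nn_integral_cmult[symmetric]) (auto simp: norm_mult ennreal_mult)
      also have "\<dots> \<le> (NINT z. ennreal (C * (1 / (1 + (norm (z::pt))^2)^2)) * ennreal M)"
        by (intro nn_integral_mono mult_mono bnd ennreal_leI qb) auto
      also have "\<dots> = (NINT z. ennreal (C * (1 / (1 + (norm (z::pt))^2)^2))) * ennreal M"
        by (rule nn_integral_multc) measurable
      also have "(NINT z. ennreal (C * (1 / (1 + (norm (z::pt))^2)^2))) = ennreal C * (NINT z. ennreal (1 / (1 + (norm (z::pt))^2)^2))"
        using C by (subst nn_integral_cmult[symmetric]) (auto simp: ennreal_mult[symmetric])
      also have "\<dots> * ennreal M < \<infinity>" using nn_integral_quartic_finite by (simp add: ennreal_mult_less_top)
      finally show "(NINT y. NINT z. ennreal (cmod (qd \<kappa> (t n) z * (indicator (box a b) y * h (y + t n *\<^sub>R z))))) < \<infinity>" .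
    qed measurable
    finally show ?thesis by simp
  qed
  have "(\<lambda>n. LBINT z. qd \<kappa> (t n) z * (LBINT y. indicator (box a b) y * h (y + t n *\<^sub>R z)))
     \<longlonglongrightarrow> (LBINT z. of_real (3 / (4 * pi * (sqrt ((norm (z::pt))^2 + 1))^5)) * (LBINT y. indicator (box a b) y * h y))"
  proof (rule integral_dominated_convergence[where w="\<lambda>z. C * (1 / (1 + (norm z)^2)^2) * M"])
    show "AE z in lborel. (\<lambda>n. qd \<kappa> (t n) z * (LBINT y. indicator (box a b) y * h (y + t n *\<^sub>R z)))
      \<longlonglongrightarrow> of_real (3 / (4 * pi * (sqrt ((norm z)^2 + 1))^5)) * (LBINT y. indicator (box a b) y * h y)"
      by (intro AE_I2 tendsto_mult qd_tendsto t translate_pairing_tendsto h)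
    show "AE z in lborel. norm (qd \<kappa> (t n) z * (LBINT y. indicator (box a b) y * h (y + t n *\<^sub>R z))) \<le> C * (1 / (1 + (norm z)^2)^2) * M" for n
    proof (rule AE_I2)
      fix z
      have "cmod (LBINT y. indicator (box a b) y * h (y + t n *\<^sub>R z)) \<le> M"
        using L2_mult_CS(3)[OF BL htL[of "t n *\<^sub>R z"]] by (simp only: htn M_def)
      then show "norm (qd \<kappa> (t n) z * (LBINT y. indicator (box a b) y * h (y + t n *\<^sub>R z))) \<le> C * (1 / (1 + (norm z)^2)^2) * M"
        unfolding norm_mult using C by (intro mult_mono qb) auto
    qed
    show "integrable lborel (\<lambda>z::pt. C * (1 / (1 + (norm z)^2)^2) * M)"
      using i4 by (intro integrable_mult_left integrable_mult_right)
  qed measurable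
  moreover have "(LBINT z. of_real (3 / (4 * pi * (sqrt ((norm (z::pt))^2 + 1))^5)) * (LBINT y. indicator (box a b) y * h y))
     = (LBINT y. indicator (box a b) y * h y)"
  proof -
    have "has_bochner_integral lborel (\<lambda>z::pt. 3 / (4 * pi * (sqrt ((norm z)^2 + 1))^5)) 1"
      by (rule has_bochner_integral_nn_integral) (auto simp: nn_integral_bubble)
    from has_bochner_integral_bounded_linear[OF bounded_linear_of_real this]
    have "(LBINT z. of_real (3 / (4 * pi * (sqrt ((norm (z::pt))^2 + 1))^5))) = (of_real 1 :: complex)"
      by (rule has_bochner_integral_integral_eq)
    then show ?thesis by (subst integral_mult_left_zero) simp
  qed
  ultimately show ?thesis by (simp only: fub)
qed

section \<open>Singular kernels acting on functions, as limits of regularised ones\<close>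

lemma kernel_pairing_integrable:
  assumes K[measurable]: "K \<in> borel_measurable borel" and Kb: "\<And>z. z \<noteq> 0 ==> cmod (K z) \<le> C * Nk a z"
    and C: "0 \<le> C" and gm[measurable]: "g \<in> borel_measurable borel" and fin: "conv a g y < \<infinity>"
  shows "integrable lborel (\<lambda>x. C * (Nk a (x - y) * cmod (g x)))"
    and "integrable lborel (\<lambda>x. g x * K (x - y))" and "integrable lborel (\<lambda>x. K (y - x) * g x)"
    and "ennreal (cmod (LBINT x. g x * K (x - y))) \<le> ennreal C * conv a g y"
    and "ennreal (cmod (LBINT x. K (y - x) * g x)) \<le> ennreal C * conv a g y"
    and "AE x in lborel. cmod (g x * K (x - y)) \<le> C * (Nk a (x - y) * cmod (g x))"
proof -
  have eqc: "(NINT x. ennreal (C * (Nk a (x - y) * cmod (g x)))) = ennreal C * conv a g y"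
    unfolding conv_def using C by (subst nn_integral_cmult[symmetric]) (auto simp: ennreal_mult Nk_minus[of a y])
  show i: "integrable lborel (\<lambda>x. C * (Nk a (x - y) * cmod (g x)))"
    by (rule integrableI_nonneg) (use C fin eqc in \<open>auto simp: ennreal_mult_less_top\<close>)
  show 1: "AE x in lborel. cmod (g x * K (x - y)) \<le> C * (Nk a (x - y) * cmod (g x))"
    using AE_pt_neq[of y]
  proof eventually_elim
    fix x assume "x \<noteq> y"
    then have "cmod (g x) * cmod (K (x - y)) \<le> cmod (g x) * (C * Nk a (x - y))" by (intro mult_left_mono Kb) auto
    then show "cmod (g x * K (x - y)) \<le> C * (Nk a (x - y) * cmod (g x))" by (simp add: norm_mult ac_simps)
  qed
  have 2: "AE x in lborel. cmod (K (y - x) * g x) \<le> C * (Nk a (x - y) * cmod (g x))"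
    using AE_pt_neq[of y]
  proof eventually_elim
    fix x assume "x \<noteq> y"
    then have "cmod (g x) * cmod (K (y - x)) \<le> cmod (g x) * (C * Nk a (y - x))" by (intro mult_left_mono Kb) auto
    then show "cmod (K (y - x) * g x) \<le> C * (Nk a (x - y) * cmod (g x))" by (simp add: norm_mult ac_simps Nk_minus[of a y])
  qed
  show "integrable lborel (\<lambda>x. g x * K (x - y))"
    by (rule Bochner_Integration.integrable_bound[OF i]) (use 1 C in auto)
  show "integrable lborel (\<lambda>x. K (y - x) * g x)"
    by (rule Bochner_Integration.integrable_bound[OF i]) (use 2 C in auto)
  have "(NINT x. ennreal (cmod (g x * K (x - y)))) \<le> ennreal C * conv a g y"
    unfolding eqc[symmetric] using 1 by (intro nn_integral_mono_AE) (auto elim!: eventually_mono intro: ennreal_leI)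
  then show "ennreal (cmod (LBINT x. g x * K (x - y))) \<le> ennreal C * conv a g y"
    by (rule order_trans[OF norm_integral_le_nn])
  have "(NINT x. ennreal (cmod (K (y - x) * g x))) \<le> ennreal C * conv a g y"
    unfolding eqc[symmetric] using 2 by (intro nn_integral_mono_AE) (auto elim!: eventually_mono intro: ennreal_leI)
  then show "ennreal (cmod (LBINT x. K (y - x) * g x)) \<le> ennreal C * conv a g y"
    by (rule order_trans[OF norm_integral_le_nn])
qed

text \<open>The sources on which the Green operator acts into \<open>L2\<close>. They include all of
  \<open>L2\<close> and also the products \<open>v p\<close> with \<open>p\<close> in
  \<open>L2\<close>, which need not be square integrable; the perturbation produces sources of the
  latter kind.\<close>

definition Good :: "real => cfun => bool" where
  "Good a b \<longleftrightarrow> b \<in> borel_measurable borel \<and> (NINT x. (conv a b x)^2) < \<infinity>"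

lemma Good_meas: "Good a b ==> b \<in> borel_measurable borel" by (simp add: Good_def)

lemma Good_L2: "0 < a ==> b \<in> L2 ==> Good a b"
  using conv_L2[of a b] by (simp add: Good_def L2_meas)

lemma Good_AE: assumes "Good a b" shows "AE x in lborel. conv a b x < \<infinity>"
  using assms conv_meas[of b a] by (intro sq_finite_AE) (auto simp: Good_def)

lemma kernel_apply_L2:
  assumes K[measurable]: "K \<in> borel_measurable borel" and Kb: "\<And>z. z \<noteq> 0 ==> cmod (K z) \<le> C * Nk a z"
    and C: "0 \<le> C" and g: "Good a g"
  shows "(\<lambda>y. LBINT x. g x * K (x - y)) \<in> L2" and "(\<lambda>y. LBINT x. K (y - x) * g x) \<in> L2"
proof -
  note [measurable] = Good_meas[OF g] conv_meas[OF Good_meas[OF g], of a]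
  have fin: "(NINT y. (ennreal C * conv a g y)^2) < \<infinity>"
    using g C by (simp add: power_mult_distrib nn_integral_cmult Good_def ennreal_mult_less_top ennreal_power)
  have "n2 (\<lambda>y. LBINT x. g x * K (x - y)) \<le> (NINT y. (ennreal C * conv a g y)^2)"
    unfolding n2_def using Good_AE[OF g]
    by (intro nn_integral_mono_AE, eventually_elim) (intro power_mono kernel_pairing_integrable(4)[OF K Kb C Good_meas[OF g]], auto)
  then show "(\<lambda>y. LBINT x. g x * K (x - y)) \<in> L2" using fin by (auto simp: L2_iff intro: le_less_trans)
  have "n2 (\<lambda>y. LBINT x. K (y - x) * g x) \<le> (NINT y. (ennreal C * conv a g y)^2)"
    unfolding n2_def using Good_AE[OF g]
    by (intro nn_integral_mono_AE, eventually_elim) (intro power_mono kernel_pairing_integrable(5)[OF K Kb C Good_meas[OF g]], auto)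
  then show "(\<lambda>y. LBINT x. K (y - x) * g x) \<in> L2" using fin by (auto simp: L2_iff intro: le_less_trans)
qed

lemma kernel_limit_AE:
  fixes K :: "nat => cfun"
  assumes K[measurable]: "\<And>n. K n \<in> borel_measurable borel" "K0 \<in> borel_measurable borel"
    and Kb: "\<And>n z. z \<noteq> 0 ==> cmod (K n z) \<le> C * Nk a z"
    and lim: "\<And>z. z \<noteq> 0 ==> (\<lambda>n. K n z) \<longlonglongrightarrow> K0 z" and C: "0 \<le> C" and g: "Good a g"
  shows "AE y in lborel. (\<lambda>n. LBINT x. g x * K n (x - y)) \<longlonglongrightarrow> (LBINT x. g x * K0 (x - y))"
  using Good_AE[OF g]
proof eventually_elim
  note [measurable] = Good_meas[OF g]
  fix y assume fin: "conv a g y < \<infinity>"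
  note KP = kernel_pairing_integrable[OF K(1) Kb C Good_meas[OF g] fin]
  show "(\<lambda>n. LBINT x. g x * K n (x - y)) \<longlonglongrightarrow> (LBINT x. g x * K0 (x - y))"
  proof (rule integral_dominated_convergence[OF _ _ KP(1)])
    show "AE x in lborel. (\<lambda>n. g x * K n (x - y)) \<longlonglongrightarrow> g x * K0 (x - y)"
      using AE_pt_neq[of y] by eventually_elim (intro tendsto_intros lim, simp)
    show "AE x in lborel. norm (g x * K n (x - y)) \<le> C * (Nk a (x - y) * cmod (g x))" for n
      using KP(6) .
  qed measurable
qed

lemma kernel_limit_box:
  fixes K :: "nat => cfun"
  assumes K[measurable]: "\<And>n. K n \<in> borel_measurable borel" "K0 \<in> borel_measurable borel"
    and Kb: "\<And>n z. z \<noteq> 0 ==> cmod (K n z) \<le> C * Nk a z"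
    and lim: "\<And>z. z \<noteq> 0 ==> (\<lambda>n. K n z) \<longlonglongrightarrow> K0 z" and C: "0 \<le> C" and g: "Good a g"
  shows "(\<lambda>n. LBINT y. indicator (box c d) y * (LBINT x. g x * K n (x - y)))
    \<longlonglongrightarrow> (LBINT y. indicator (box c d) y * (LBINT x. g x * K0 (x - y)))"
proof -
  note [measurable] = Good_meas[OF g] conv_meas[OF Good_meas[OF g], of a]
  have cL: "(\<lambda>y. of_real (enn2real (conv a g y))) \<in> L2"
  proof -
    have "n2 (\<lambda>y. of_real (enn2real (conv a g y))) \<le> (NINT x. (conv a g x)^2)"
      unfolding n2_def by (intro nn_integral_mono power_mono) (auto simp: ennreal_enn2real_if)
    then show ?thesis using g by (auto simp: L2_iff Good_def intro: le_less_trans)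
  qed
  have BL: "(\<lambda>x. indicator (box c d) x) \<in> L2" by (rule indicator_L2) (auto simp: bounded_box)
  show ?thesis
  proof (rule integral_dominated_convergence[where w="\<lambda>y. C * cmod (indicator (box c d) y * of_real (enn2real (conv a g y)))"])
    show "AE y in lborel. (\<lambda>n. indicator (box c d) y * (LBINT x. g x * K n (x - y)))
       \<longlonglongrightarrow> indicator (box c d) y * (LBINT x. g x * K0 (x - y))"
    proof -
      have "AE y in lborel. (\<lambda>n. LBINT x. g x * K n (x - y)) \<longlonglongrightarrow> (LBINT x. g x * K0 (x - y))"
        by (rule kernel_limit_AE[where C=C and a=a]) (use K Kb lim C g in auto)
      then show ?thesis by eventually_elim (intro tendsto_intros)
    qed
    show "AE y in lborel. norm (indicator (box c d) y * (LBINT x. g x * K n (x - y))) \<le> C * cmod (indicator (box c d) y * of_real (enn2real (conv a g y)))" for n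
      using Good_AE[OF g]
    proof eventually_elim
      fix y assume fin: "conv a g y < \<infinity>"
      have "ennreal (cmod (LBINT x. g x * K n (x - y))) \<le> ennreal C * conv a g y"
        by (rule kernel_pairing_integrable(4)[OF K(1) Kb C Good_meas[OF g] fin])
      also have "\<dots> = ennreal (C * enn2real (conv a g y))" using fin C by (simp add: ennreal_mult less_top)
      finally have "cmod (LBINT x. g x * K n (x - y)) \<le> C * enn2real (conv a g y)" using C by simp
      then show "norm (indicator (box c d) y * (LBINT x. g x * K n (x - y))) \<le> C * cmod (indicator (box c d) y * of_real (enn2real (conv a g y)))"
        by (simp add: norm_mult split: split_indicator)
    qed
    show "integrable lborel (\<lambda>y. C * cmod (indicator (box c d) y * of_real (enn2real (conv a g y))))"
      by (intro integrable_mult_right integrable_norm L2_mult_CS(1) BL cL)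
  qed measurable
qed

lemma Fd_bound': "0 < Re \<kappa> ==> z \<noteq> 0 ==> cmod (Fd \<kappa> \<delta> z) \<le> (1 + cmod \<kappa>) * Nk (Re \<kappa>) z"
  using Fd_bound(3)[of \<kappa> z \<delta>] mult_right_mono[of 1 "1 + cmod \<kappa>" "Nk (Re \<kappa>) z"] by simp

text \<open>The regularised identity is integrated over boxes, where every term has a limit as
  \<open>\<delta>\<close> tends to 0; square integrable functions with the same integrals over all
  boxes agree almost everywhere. This is the passage from weak gradients to integral
  kernels.\<close>

lemma H1_representation:
  assumes h: "H1_grad h D" and k: "0 < Re \<kappa>"
  shows "AE y in lborel. h y = (\<Sum>i\<in>UNIV. LBINT x. D i x * dFd \<kappa> 0 i (x - y)) + \<kappa>^2 * (LBINT x. h x * Fd \<kappa> 0 (x - y))"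
proof -
  have hL: "h \<in> L2" and DL: "\<And>i. D i \<in> L2" using h by (auto simp: H1_grad_def)
  note [measurable] = L2_meas[OF hL] L2_meas[OF DL]
  define C where "C = 1 + cmod \<kappa>"
  have C: "0 \<le> C" by (simp add: C_def)
  note Gh = Good_L2[OF k hL] and GD = Good_L2[OF k DL]
  define t where "t n = 1 / real (Suc n)" for n
  have t: "t \<longlonglongrightarrow> 0" "\<And>n. 0 < t n" "\<And>n. t n \<le> 1"
    unfolding t_def by (rule LIMSEQ_Suc[OF lim_1_over_n]) auto
  define E where "E n i y = (LBINT x. D i x * dFd \<kappa> (t n) i (x - y))" for n i y
  define E0 where "E0 i y = (LBINT x. D i x * dFd \<kappa> 0 i (x - y))" for i y
  define P where "P n y = (LBINT x. h x * Fd \<kappa> (t n) (x - y))" for n y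
  define P0 where "P0 y = (LBINT x. h x * Fd \<kappa> 0 (x - y))" for y
  have L: "E n i \<in> L2" "E0 i \<in> L2" "P n \<in> L2" "P0 \<in> L2" for n i
    unfolding E_def[abs_def] E0_def[abs_def] P_def[abs_def] P0_def[abs_def] 
    by (rule kernel_apply_L2(1)[OF _ _ C], measurable, auto simp: C_def intro!: dFd_bound Fd_bound' k Gh GD)+
  define w where "w y = (\<Sum>i\<in>UNIV. E0 i y) + \<kappa>^2 * P0 y - h y" for y
  have wL: "w \<in> L2" unfolding w_def[abs_def] by (intro L2_diff L2_add L2_sum L2_cmult L hL)
  have "AE y in lborel. w y = 0"
  proof (rule L2_box_zero[OF wL])
    fix a b :: pt
    let ?B = "\<lambda>y. indicator (box a b) y :: complex"
    have BL: "?B \<in> L2" by (rule indicator_L2) (auto simp: bounded_box)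
    have I: "integrable lborel (\<lambda>y. ?B y * f y)" if "f \<in> L2" for f by (rule L2_mult_CS(1)[OF BL that])
    have lin: "(LBINT y. ?B y * ((\<Sum>i\<in>UNIV. e i y) + \<kappa>^2 * p y)) = (\<Sum>i\<in>UNIV. LBINT y. ?B y * e i y) + \<kappa>^2 * (LBINT y. ?B y * p y)"
      if "\<And>i. e i \<in> L2" "p \<in> L2" for e :: "3 => cfun" and p
    proof -
      have "(LBINT y. ?B y * ((\<Sum>i\<in>UNIV. e i y) + \<kappa>^2 * p y)) = (LBINT y. (\<Sum>i\<in>UNIV. ?B y * e i y) + \<kappa>^2 * (?B y * p y))"
        by (simp add: distrib_left sum_distrib_left ac_simps)
      also have "\<dots> = (\<Sum>i\<in>UNIV. LBINT y. ?B y * e i y) + \<kappa>^2 * (LBINT y. ?B y * p y)"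
      proof -
        have "(LBINT y. (\<Sum>i\<in>UNIV. ?B y * e i y) + \<kappa>^2 * (?B y * p y)) = (LBINT y. (\<Sum>i\<in>UNIV. ?B y * e i y)) + (LBINT y. \<kappa>^2 * (?B y * p y))"
          by (rule Bochner_Integration.integral_add) (intro Bochner_Integration.integrable_sum integrable_mult_right I that)+
        moreover have "(LBINT y. (\<Sum>i\<in>UNIV. ?B y * e i y)) = (\<Sum>i\<in>UNIV. LBINT y. ?B y * e i y)"
          by (rule Bochner_Integration.integral_sum) (intro I that)
        ultimately show ?thesis by (simp only: integral_mult_right_zero)
      qed
      finally show ?thesis .
    qed
    have "(\<lambda>n. (\<Sum>i\<in>UNIV. LBINT y. ?B y * E n i y) + \<kappa>^2 * (LBINT y. ?B y * P n y)) \<longlonglongrightarrow>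
       (\<Sum>i\<in>UNIV. LBINT y. ?B y * E0 i y) + \<kappa>^2 * (LBINT y. ?B y * P0 y)"
    proof (intro tendsto_intros)
      show "(\<lambda>n. LBINT y. ?B y * E n i y) \<longlonglongrightarrow> (LBINT y. ?B y * E0 i y)" for i
        unfolding E_def E0_def
        by (rule kernel_limit_box[where C=C and a="Re \<kappa>"]) (auto simp: C_def intro!: dFd_bound Fd_tendsto t k GD)
      show "(\<lambda>n. LBINT y. ?B y * P n y) \<longlonglongrightarrow> (LBINT y. ?B y * P0 y)"
        unfolding P_def P0_def
        by (rule kernel_limit_box[where C=C and a="Re \<kappa>"]) (auto simp: C_def intro!: Fd_bound' Fd_tendsto t k Gh)
    qed
    moreover have "(\<lambda>n. (\<Sum>i\<in>UNIV. LBINT y. ?B y * E n i y) + \<kappa>^2 * (LBINT y. ?B y * P n y)) \<longlonglongrightarrow> (LBINT y. ?B y * h y)"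
    proof -
      have "(\<Sum>i\<in>UNIV. LBINT y. ?B y * E n i y) + \<kappa>^2 * (LBINT y. ?B y * P n y) = (LBINT y. ?B y * (LBINT x. h x * Jd \<kappa> (t n) (x - y)))" for n
        unfolding lin[OF L(1,3), symmetric] unfolding E_def P_def regularised_representation[OF h k t(2)] ..
      then show ?thesis using Jd_limit[OF k t hL, of a b] by simp
    qed
    ultimately have "(\<Sum>i\<in>UNIV. LBINT y. ?B y * E0 i y) + \<kappa>^2 * (LBINT y. ?B y * P0 y) = (LBINT y. ?B y * h y)"
      by (rule LIMSEQ_unique)
    then have "(LBINT y. ?B y * ((\<Sum>i\<in>UNIV. E0 i y) + \<kappa>^2 * P0 y)) = (LBINT y. ?B y * h y)"
      by (simp only: lin[OF L(2,4)])
    moreover have "(LBINT y. ?B y * w y) = (LBINT y. ?B y * ((\<Sum>i\<in>UNIV. E0 i y) + \<kappa>^2 * P0 y)) - (LBINT y. ?B y * h y)"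
      unfolding w_def right_diff_distrib
      by (rule Bochner_Integration.integral_diff) (intro I L2_add L2_sum L2_cmult L hL)+
    ultimately show "(LBINT y. ?B y * w y) = 0" by simp
  qed
  then show ?thesis by eventually_elim (simp add: w_def E0_def P0_def)
qed

section \<open>The free resolvent\<close>

definition Gop :: "complex => cfun => cfun" where
  "Gop \<kappa> b x = (LBINT y. Fd \<kappa> 0 (x - y) * b y)"

definition dGop :: "complex => cfun => 3 => cfun" where
  "dGop \<kappa> b i x = (LBINT y. dFd \<kappa> 0 i (x - y) * b y)"

text \<open>Absolute convergence comes from pairing \<open>conv a b\<close>, square integrable since
  \<open>b\<close> is \<open>Good\<close>, with \<open>g\<close>. No square integrability of
  \<open>b\<close> itself enters.\<close>

lemma pair_fubini:
  assumes K[measurable]: "K \<in> borel_measurable borel" and Kb: "\<And>z. z \<noteq> 0 ==> cmod (K z) \<le> C * Nk a z"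
    and C: "0 \<le> C" and b: "Good a b" and g: "g \<in> L2"
  shows "(LBINT y. b y * (LBINT x. g x * K (x - y))) = (LBINT x. (LBINT y. K (x - y) * b y) * g x)"
    and "integrable lborel (\<lambda>y. b y * (LBINT x. g x * K (x - y)))"
proof -
  note [measurable] = Good_meas[OF b] L2_meas[OF g] conv_meas[OF Good_meas[OF b], of a]
  define F where "F y x = b y * (g x * K (x - y))" for y x
  have [measurable]: "(\<lambda>(y, x). F y x) \<in> borel_measurable (lborel \<Otimes>\<^sub>M lborel)" unfolding F_def by measurable
  have "(NINT y. NINT x. ennreal (cmod (F y x))) = (NINT x. NINT y. ennreal (cmod (F y x)))"
    by (rule lborel_Tonelli) measurable
  also have "\<dots> \<le> (NINT x. ennreal C * (conv a b x * ennreal (cmod (g x))))"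
  proof (rule nn_integral_mono)
    fix x
    have "(NINT y. ennreal (cmod (F y x))) \<le> (NINT y. (ennreal C * ennreal (cmod (g x))) * ennreal (Nk a (x - y) * cmod (b y)))"
    proof (rule nn_integral_mono_AE, use AE_pt_neq[of x] in eventually_elim)
      fix y assume "y \<noteq> x"
      then have "cmod (b y) * (cmod (g x) * cmod (K (x - y))) \<le> cmod (b y) * (cmod (g x) * (C * Nk a (x - y)))"
        by (intro mult_left_mono Kb) auto
      then have "cmod (F y x) \<le> (C * cmod (g x)) * (Nk a (x - y) * cmod (b y))"
        by (simp add: F_def norm_mult ac_simps)
      then have "ennreal (cmod (F y x)) \<le> ennreal ((C * cmod (g x)) * (Nk a (x - y) * cmod (b y)))" by (rule ennreal_leI)
      then show "ennreal (cmod (F y x)) \<le> (ennreal C * ennreal (cmod (g x))) * ennreal (Nk a (x - y) * cmod (b y))"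
        using C by (simp add: ennreal_mult)
    qed
    also have "\<dots> = (ennreal C * ennreal (cmod (g x))) * conv a b x"
      unfolding conv_def by (rule nn_integral_cmult) measurable
    finally show "(NINT y. ennreal (cmod (F y x))) \<le> ennreal C * (conv a b x * ennreal (cmod (g x)))"
      by (simp add: ac_simps)
  qed
  also have "\<dots> = ennreal C * (NINT x. conv a b x * ennreal (cmod (g x)))"
    by (rule nn_integral_cmult) measurable
  also have "\<dots> < \<infinity>"
    using nn_CS_finite[of "conv a b" "\<lambda>x. ennreal (cmod (g x))"] b L2_n2[OF g]
    by (simp add: Good_def n2_def ennreal_mult_less_top)
  finally have fin: "(NINT y. NINT x. ennreal (cmod (F y x))) < \<infinity>" .
  have "(LBINT y. b y * (LBINT x. g x * K (x - y))) = (LBINT y. LBINT x. F y x)"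
    unfolding F_def by simp
  also have "\<dots> = (LBINT x. LBINT y. F y x)"
    by (rule lborel_Fubini(1)[OF _ fin]) measurable
  also have "\<dots> = (LBINT x. (LBINT y. K (x - y) * b y) * g x)"
    unfolding F_def by (subst integral_mult_left_zero[symmetric]) (simp add: ac_simps)
  finally show "(LBINT y. b y * (LBINT x. g x * K (x - y))) = (LBINT x. (LBINT y. K (x - y) * b y) * g x)" .
  have "integrable lborel (\<lambda>y. LBINT x. F y x)"
    by (rule lborel_Fubini(4)[OF _ fin]) measurable
  then show "integrable lborel (\<lambda>y. b y * (LBINT x. g x * K (x - y)))" unfolding F_def by simp
qed

lemma Gop_L2: assumes "0 < Re \<kappa>" "Good (Re \<kappa>) b" shows "Gop \<kappa> b \<in> L2" "dGop \<kappa> b i \<in> L2"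
  unfolding Gop_def[abs_def] dGop_def[abs_def]
  by (rule kernel_apply_L2(2)[where C="1 + cmod \<kappa>" and a="Re \<kappa>"], measurable, auto intro!: dFd_bound Fd_bound' assms)+

text \<open>For positive \<open>\<delta>\<close> the identity says that the integral of a derivative
  of a compactly supported product vanishes. The singular case follows by dominated convergence,
  since the majorants of the kernels are independent of \<open>\<delta>\<close>.\<close>

lemma kernel_weak_derivative:
  assumes k: "0 < Re \<kappa>" and tf: "test_fun \<phi>" "has_partial \<phi> i d"
  shows "AE y in lborel. (LBINT x. of_real (d x) * Fd \<kappa> 0 (x - y)) = - (LBINT x. of_real (\<phi> x) * dFd \<kappa> 0 i (x - y))"
proof -
  obtain R where R: "continuous_on UNIV \<phi>" "continuous_on UNIV d" "\<And>x. \<phi> x \<noteq> 0 ==> norm x \<le> R" "\<And>x. d x \<noteq> 0 ==> norm x \<le> R"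
    using test_fun_D[OF tf] by blast
  note L = test_fun_L2[OF tf]
  define t where "t n = 1 / real (Suc n)" for n
  have t: "t \<longlonglongrightarrow> 0" "\<And>n. 0 < t n"
    unfolding t_def by (rule LIMSEQ_Suc[OF lim_1_over_n]) auto
  have reg: "(LBINT x. of_real (d x) * Fd \<kappa> (t n) (x - y)) = - (LBINT x. of_real (\<phi> x) * dFd \<kappa> (t n) i (x - y))" for n y
  proof -
    have cF: "continuous_on UNIV (\<lambda>x. Fd \<kappa> (t n) (x - y))" "continuous_on UNIV (\<lambda>x. dFd \<kappa> (t n) i (x - y))"
      by (rule continuous_on_compose2[OF continuous_Fd[OF t(2)]], auto intro!: continuous_intros)
         (rule continuous_on_compose2[OF csmooth_cont[OF csmooth_dFd[OF t(2)]]], auto intro!: continuous_intros)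
    have cR: "continuous_on UNIV (\<lambda>x. complex_of_real (\<phi> x))" "continuous_on UNIV (\<lambda>x. complex_of_real (d x))"
      using R by (auto intro!: continuous_intros)
    have "(LBINT x. of_real (\<phi> x) * dFd \<kappa> (t n) i (x - y) + of_real (d x) * Fd \<kappa> (t n) (x - y)) = 0"
      by (rule integral_cpartial_eq_0[OF cpartial_mult[OF cpartial_of_real[OF tf(2)] cpartial_translate[OF cpartial_Fd[OF t(2)[of n]]]]])
         (use R in \<open>auto intro!: continuous_intros cF cR\<close>, use R in force)
    moreover have "integrable lborel (\<lambda>x. of_real (\<phi> x) * dFd \<kappa> (t n) i (x - y))" "integrable lborel (\<lambda>x. of_real (d x) * Fd \<kappa> (t n) (x - y))"
      by (intro L2_mult_CS(1) L L2_translate reg_kernel_L2 Fd_L2 k t)+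
    ultimately show ?thesis by (simp add: add_eq_0_iff2)
  qed
  have "AE y in lborel. (\<lambda>n. LBINT x. of_real (d x) * Fd \<kappa> (t n) (x - y)) \<longlonglongrightarrow> (LBINT x. of_real (d x) * Fd \<kappa> 0 (x - y))"
    by (rule kernel_limit_AE[where C="1 + cmod \<kappa>" and a="Re \<kappa>"]) (auto intro!: Fd_bound' Fd_tendsto t k Good_L2 L)
  moreover have "AE y in lborel. (\<lambda>n. LBINT x. of_real (\<phi> x) * dFd \<kappa> (t n) i (x - y)) \<longlonglongrightarrow> (LBINT x. of_real (\<phi> x) * dFd \<kappa> 0 i (x - y))"
    by (rule kernel_limit_AE[where C="1 + cmod \<kappa>" and a="Re \<kappa>"]) (auto intro!: dFd_bound Fd_tendsto t k Good_L2 L)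
  ultimately show ?thesis
  proof eventually_elim
    fix y assume 1: "(\<lambda>n. LBINT x. of_real (d x) * Fd \<kappa> (t n) (x - y)) \<longlonglongrightarrow> (LBINT x. of_real (d x) * Fd \<kappa> 0 (x - y))"
      and 2: "(\<lambda>n. LBINT x. of_real (\<phi> x) * dFd \<kappa> (t n) i (x - y)) \<longlonglongrightarrow> (LBINT x. of_real (\<phi> x) * dFd \<kappa> 0 i (x - y))"
    show "(LBINT x. of_real (d x) * Fd \<kappa> 0 (x - y)) = - (LBINT x. of_real (\<phi> x) * dFd \<kappa> 0 i (x - y))"
      by (rule LIMSEQ_unique[OF 1]) (use tendsto_minus[OF 2] in \<open>simp add: reg\<close>)
  qed
qed

text \<open>Fubini moves the kernel onto the test function, where its derivative may be shifted, and
  a second exchange moves the differentiated kernel back onto \<open>b\<close>.\<close>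

lemma Gop_H1:
  assumes k: "0 < Re \<kappa>" and b: "Good (Re \<kappa>) b"
  shows "H1_grad (Gop \<kappa> b) (dGop \<kappa> b)"
  unfolding H1_grad_def weak_grad_def
proof (intro conjI allI impI)
  show "Gop \<kappa> b \<in> L2" "dGop \<kappa> b i \<in> L2" for i by (rule Gop_L2[OF k b])+
  fix \<phi> d i assume tf: "test_fun \<phi>" "has_partial \<phi> i d"
  note L = test_fun_L2[OF tf]
  note PF = pair_fubini[where C="1 + cmod \<kappa>" and a="Re \<kappa>", OF _ _ _ b]
  have C: "0 \<le> 1 + cmod \<kappa>" by simp
  note [measurable] = Good_meas[OF b] L2_meas[OF L(1)] L2_meas[OF L(2)]
  have "(LBINT x. Gop \<kappa> b x * of_real (d x)) = (LBINT y. b y * (LBINT x. of_real (d x) * Fd \<kappa> 0 (x - y)))"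
    unfolding Gop_def by (rule PF(1)[symmetric]) (auto intro: Fd_bound' k L)
  also have "\<dots> = (LBINT y. - (b y * (LBINT x. of_real (\<phi> x) * dFd \<kappa> 0 i (x - y))))"
  proof (rule integral_cong_AE)
    show "AE y in lborel. b y * (LBINT x. of_real (d x) * Fd \<kappa> 0 (x - y)) = - (b y * (LBINT x. of_real (\<phi> x) * dFd \<kappa> 0 i (x - y)))"
      using kernel_weak_derivative[OF k tf] by eventually_elim simp
  qed measurable
  also have "\<dots> = - (LBINT y. b y * (LBINT x. of_real (\<phi> x) * dFd \<kappa> 0 i (x - y)))"
    by simp
  also have "(LBINT y. b y * (LBINT x. of_real (\<phi> x) * dFd \<kappa> 0 i (x - y))) = (LBINT x. dGop \<kappa> b i x * of_real (\<phi> x))"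
    unfolding dGop_def by (rule PF(1)) (auto intro: dFd_bound k L)
  finally show "(LBINT x. Gop \<kappa> b x * of_real (d x)) = - (LBINT x. dGop \<kappa> b i x * of_real (\<phi> x))" .
qed

lemma H1_grad_cnj: assumes "H1_grad h D" shows "H1_grad (\<lambda>x. cnj (h x)) (\<lambda>i x. cnj (D i x))"
  unfolding H1_grad_def weak_grad_def
proof (intro conjI allI impI)
  show "(\<lambda>x. cnj (h x)) \<in> L2" "(\<lambda>x. cnj (D i x)) \<in> L2" for i using assms by (auto simp: H1_grad_def L2_cnj)
  fix \<phi> d i assume tf: "test_fun \<phi>" "has_partial \<phi> i d"
  have "(LBINT x. h x * of_real (d x)) = - (LBINT x. D i x * of_real (\<phi> x))"
    using assms tf by (auto simp: H1_grad_def weak_grad_def)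
  then have "cnj (LBINT x. h x * of_real (d x)) = - cnj (LBINT x. D i x * of_real (\<phi> x))" by simp
  then show "(LBINT x. cnj (h x) * of_real (d x)) = - (LBINT x. cnj (D i x) * of_real (\<phi> x))"
    by (simp add: Bochner_Integration.integral_cnj[symmetric] del: Bochner_Integration.integral_cnj)
qed

text \<open>The conjugate of \<open>h\<close> is replaced by its Green representation and the
  exchange of integrals puts the kernels on \<open>b\<close>. The product of \<open>b\<close> and
  \<open>cnj h\<close> is integrable for the same reason, although \<open>b\<close> is merely
  \<open>Good\<close>.\<close>

lemma Gop_form:
  assumes k: "0 < Re \<kappa>" and b: "Good (Re \<kappa>) b" and h: "H1_grad h D"
  shows "(\<Sum>i\<in>UNIV. LBINT x. dGop \<kappa> b i x * cnj (D i x)) + \<kappa>^2 * (LBINT x. Gop \<kappa> b x * cnj (h x)) = (LBINT x. b x * cnj (h x))"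
    and "integrable lborel (\<lambda>x. b x * cnj (h x))"
proof -
  have hL: "h \<in> L2" and DL: "\<And>i. D i \<in> L2" using h by (auto simp: H1_grad_def)
  note PF = pair_fubini[where C="1 + cmod \<kappa>" and a="Re \<kappa>", OF _ _ _ b]
  note [measurable] = Good_meas[OF b] L2_meas[OF L2_cnj[OF hL]] L2_meas[OF L2_cnj[OF DL]]
  define S where "S y = (\<Sum>i\<in>UNIV. b y * (LBINT x. cnj (D i x) * dFd \<kappa> 0 i (x - y))) + \<kappa>^2 * (b y * (LBINT x. cnj (h x) * Fd \<kappa> 0 (x - y)))" for y
  have I: "integrable lborel (\<lambda>y. b y * (LBINT x. cnj (D i x) * dFd \<kappa> 0 i (x - y)))"
    "integrable lborel (\<lambda>y. b y * (LBINT x. cnj (h x) * Fd \<kappa> 0 (x - y)))" for i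
    by (rule PF(2); (auto intro!: dFd_bound Fd_bound' k L2_cnj hL DL))+
  have SI: "integrable lborel S" unfolding S_def using I by auto
  have AE: "AE y in lborel. b y * cnj (h y) = S y"
    using H1_representation[OF H1_grad_cnj[OF h] k]
    by eventually_elim (simp add: S_def sum_distrib_left distrib_left ac_simps)
  show "integrable lborel (\<lambda>x. b x * cnj (h x))"
    by (rule integrable_cong_AE[THEN iffD2, OF _ _ AE SI]) (use SI in auto)
  have "(LBINT x. b x * cnj (h x)) = (LBINT x. S x)"
    by (rule integral_cong_AE[OF _ _ AE]) (use SI in auto)
  also have "\<dots> = (\<Sum>i\<in>UNIV. LBINT y. b y * (LBINT x. cnj (D i x) * dFd \<kappa> 0 i (x - y))) + \<kappa>^2 * (LBINT y. b y * (LBINT x. cnj (h x) * Fd \<kappa> 0 (x - y)))"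
    unfolding S_def using I by (subst Bochner_Integration.integral_add) (auto simp: Bochner_Integration.integral_sum)
  also have "(LBINT y. b y * (LBINT x. cnj (h x) * Fd \<kappa> 0 (x - y))) = (LBINT x. Gop \<kappa> b x * cnj (h x))"
    unfolding Gop_def by (rule PF(1)) (auto intro!: Fd_bound' k L2_cnj hL)
  also have "(\<Sum>i\<in>UNIV. LBINT y. b y * (LBINT x. cnj (D i x) * dFd \<kappa> 0 i (x - y))) = (\<Sum>i\<in>UNIV. LBINT x. dGop \<kappa> b i x * cnj (D i x))"
    unfolding dGop_def by (intro sum.cong refl PF(1)) (auto intro!: dFd_bound k L2_cnj DL)
  finally show "(\<Sum>i\<in>UNIV. LBINT x. dGop \<kappa> b i x * cnj (D i x)) + \<kappa>^2 * (LBINT x. Gop \<kappa> b x * cnj (h x)) = (LBINT x. b x * cnj (h x))"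
    by simp
qed

section \<open>Rollnik potentials\<close>

lemma rollnik_meas: "rollnik W ==> W \<in> borel_measurable borel" by (simp add: rollnik_def)

lemma vfun_meas: "W \<in> borel_measurable borel ==> vfun W \<in> borel_measurable borel"
  "W \<in> borel_measurable borel ==> ufun W \<in> borel_measurable borel"
proof -
  assume [measurable]: "W \<in> borel_measurable borel"
  show "vfun W \<in> borel_measurable borel" unfolding vfun_def[abs_def] by measurable
  have "ufun W = (\<lambda>x. (if W x > 0 then 1 else if W x < 0 then -1 else 0) * sqrt \<bar>W x\<bar>)"
    by (auto simp: ufun_def[abs_def] sgn_if)
  also have "\<dots> \<in> borel_measurable borel" by measurable
  finally show "ufun W \<in> borel_measurable borel" .
qed

lemma vfun_nonneg[simp]: "0 \<le> vfun W x" by (simp add: vfun_def)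
lemma vfun_sq: "vfun W x * vfun W x = \<bar>W x\<bar>" by (simp add: vfun_def)
lemma abs_ufun: "\<bar>ufun W x\<bar> = vfun W x" by (simp add: ufun_def vfun_def abs_mult sgn_if)
lemma vu_eq: "vfun W x * ufun W x = W x"
  by (simp add: vfun_def ufun_def sgn_if)
lemma ufun_eq: "ufun W x = sgn (W x) * vfun W x" by (simp add: ufun_def vfun_def)
lemma sgn_ufun: "sgn (W x) * ufun W x = vfun W x" by (simp add: ufun_def vfun_def sgn_if)

lemma HSk_rollnik_bound:
  assumes W: "rollnik W" and m: "(\<lambda>(x, y). k x y) \<in> borel_measurable (lborel \<Otimes>\<^sub>M lborel)"
    and b: "\<And>x y. x \<noteq> y ==> cmod (k x y) \<le> vfun W x * vfun W y / dist x y"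
  shows "HSk k" and "hs k \<le> (NINT  x. NINT  y. ennreal (\<bar>W x\<bar> * \<bar>W y\<bar> / (dist x y)^2))"
proof -
  have pw: "(ennreal (cmod (k x y)))^2 \<le> ennreal (\<bar>W x\<bar> * \<bar>W y\<bar> / (dist x y)^2)" if "x \<noteq> y" for x y
  proof -
    have "(cmod (k x y))^2 \<le> (vfun W x * vfun W y / dist x y)^2" using b[OF that] by (intro power_mono) auto
    also have "\<dots> = (vfun W x * vfun W x) * (vfun W y * vfun W y) / (dist x y)^2" by (simp add: power_divide power2_eq_square)
    also have "\<dots> = \<bar>W x\<bar> * \<bar>W y\<bar> / (dist x y)^2" by (simp only: vfun_sq)
    finally show ?thesis by (simp add: ennreal_power ennreal_leI)
  qed
  show 1: "hs k \<le> (NINT  x. NINT  y. ennreal (\<bar>W x\<bar> * \<bar>W y\<bar> / (dist x y)^2))"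
    unfolding hs_def
  proof (rule nn_integral_mono)
    fix x
    show "(NINT  y. (ennreal (cmod (k x y)))^2) \<le> (NINT  y. ennreal (\<bar>W x\<bar> * \<bar>W y\<bar> / (dist x y)^2))"
      by (rule nn_integral_mono_AE, use AE_pt_neq[of x] in eventually_elim) (intro pw, simp)
  qed
  show "HSk k" unfolding HSk_def using m le_less_trans[OF 1] W by (auto simp: rollnik_def)
qed

definition kR :: "(pt => real) => pt => pt => complex" where
  "kR W x y = of_real (vfun W x * vfun W y / dist x y)"

lemma HSk_kR: assumes "rollnik W" shows "HSk (kR W)"
proof (rule HSk_rollnik_bound(1)[OF assms])
  note [measurable] = vfun_meas(1)[OF rollnik_meas[OF assms]]
  show "(\<lambda>(x, y). kR W x y) \<in> borel_measurable (lborel \<Otimes>\<^sub>M lborel)" unfolding kR_def dist_norm by measurable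
qed (simp add: kR_def norm_mult norm_divide)

text \<open>The composition constant of \<open>Nk\<close> times the Hilbert-Schmidt norm of the
  Rollnik kernel. It bounds the square of the operator norm of \<open>p -> Nk\<close> convolved with
  \<open>v p\<close>.\<close>

definition RB :: "real => (pt => real) => real" where
  "RB a W = (1 / a + 1)^2 * (32 * pi) * hsn (kR W)"

text \<open>Expanding the square and integrating in \<open>x\<close> first gives, by composition of
  the majorants, the quadratic form of \<open>vfun W y * vfun W y' / |y - y'|\<close> at
  \<open>|p|\<close>. The Rollnik condition says that this kernel is Hilbert-Schmidt.\<close>

lemma conv_vp:
  assumes W: "rollnik W" and a: "0 < a" and p: "p \<in> L2"
  shows "(NINT x. (conv a (\<lambda>y. of_real (vfun W y) * p y) x)^2) \<le> ennreal (RB a W) * n2 p"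
proof -
  note [measurable] = vfun_meas(1)[OF rollnik_meas[OF W]] L2_meas[OF p]
  define b where "b y = vfun W y * cmod (p y)" for y
  have [measurable]: "b \<in> borel_measurable borel" unfolding b_def[abs_def] by measurable
  have b0: "0 \<le> b y" for y by (simp add: b_def)
  define C where "C = (1 / a + 1)^2 * (32 * pi)"
  have C: "0 \<le> C" by (simp add: C_def)
  have cb: "conv a (\<lambda>y. of_real (vfun W y) * p y) x = (NINT y. ennreal (Nk a (x - y) * b y))" for x
    by (simp add: conv_def b_def norm_mult)
  have "(NINT x. (conv a (\<lambda>y. of_real (vfun W y) * p y) x)^2)
      = (NINT x. (NINT y. (NINT y'. ennreal (Nk a (x - y) * b y) * ennreal (Nk a (x - y') * b y'))))"
    unfolding cb by (simp add: power2_eq_square nn_integral_cmult nn_integral_multc)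
  also have "\<dots> = (NINT y. (NINT x. (NINT y'. ennreal (Nk a (x - y) * b y) * ennreal (Nk a (x - y') * b y'))))"
    by (rule lborel_Tonelli) measurable
  also have "\<dots> = (NINT y. (NINT y'. (NINT x. ennreal (Nk a (x - y) * b y) * ennreal (Nk a (x - y') * b y'))))"
    by (intro nn_integral_cong lborel_Tonelli) measurable
  also have "\<dots> \<le> (NINT y. (NINT y'. ennreal C * ennreal (cmod (kR W y y' * p y' * p y))))"
  proof (rule nn_integral_mono)
    fix y
    show "(NINT y'. (NINT x. ennreal (Nk a (x - y) * b y) * ennreal (Nk a (x - y') * b y')))
      \<le> (NINT y'. ennreal C * ennreal (cmod (kR W y y' * p y' * p y)))"
    proof (rule nn_integral_mono_AE, use AE_pt_neq[of y] in eventually_elim)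
      fix y' assume y': "y' \<noteq> y"
      have "(NINT x. ennreal (Nk a (x - y) * b y) * ennreal (Nk a (x - y') * b y'))
         = (NINT x. ennreal (b y * b y') * ennreal (Nk a (x - y) * Nk a (x - y')))"
        by (intro nn_integral_cong) (simp add: ennreal_mult[symmetric] b0 ac_simps)
      also have "\<dots> = ennreal (b y * b y') * (NINT x. ennreal (Nk a (x - y) * Nk a (x - y')))"
        by (rule nn_integral_cmult) measurable
      also have "\<dots> \<le> ennreal (b y * b y') * ennreal (C / norm (y - y'))"
        unfolding C_def using y' by (intro mult_left_mono Nk_composition a) auto
      also have "\<dots> = ennreal C * ennreal (cmod (kR W y y' * p y' * p y))"
        using C by (simp add: ennreal_mult[symmetric] b0 b_def kR_def norm_mult norm_divide dist_norm ac_simps)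
      finally show "(NINT x. ennreal (Nk a (x - y) * b y) * ennreal (Nk a (x - y') * b y')) \<le> ennreal C * ennreal (cmod (kR W y y' * p y' * p y))" .
    qed
  qed
  also have "\<dots> = ennreal C * (NINT y. (NINT y'. ennreal (cmod (kR W y y' * p y' * p y))))"
    using HSk_meas[OF HSk_kR[OF W], measurable] by (simp add: nn_integral_cmult)
  also have "\<dots> \<le> ennreal C * ennreal (hsn (kR W) * (L2norm p)^2)"
  proof (intro mult_left_mono ennreal_sq_le_imp_le)
    have "(NINT y. (NINT y'. ennreal (cmod (kR W y y' * p y' * p y))))^2 \<le> hs (kR W) * n2 p * n2 p"
      by (rule kop_triple_bound(1)[OF HSk_kR[OF W] p p])
    also have "\<dots> = (ennreal (hsn (kR W) * (L2norm p)^2))^2"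
      by (simp add: hs_eq[OF HSk_kR[OF W]] n2_eq[OF p] ennreal_mult[symmetric] ennreal_power power2_eq_square ac_simps)
    finally show "(NINT y. (NINT y'. ennreal (cmod (kR W y y' * p y' * p y))))^2 \<le> (ennreal (hsn (kR W) * (L2norm p)^2))^2" .
  qed (use C in auto)
  also have "\<dots> = ennreal (RB a W) * n2 p"
    using C by (simp add: RB_def C_def n2_eq[OF p] ennreal_mult[symmetric] ac_simps)
  finally show ?thesis .
qed

lemma Good_vp:
  assumes W: "rollnik W" and a: "0 < a" and p: "p \<in> L2"
  shows "Good a (\<lambda>y. of_real (vfun W y) * p y)"
proof -
  note [measurable] = vfun_meas(1)[OF rollnik_meas[OF W]] L2_meas[OF p]
  have "(NINT x. (conv a (\<lambda>y. of_real (vfun W y) * p y) x)^2) < \<infinity>"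
    using conv_vp[OF assms] L2_n2[OF p] by (auto simp: ennreal_mult_less_top intro: le_less_trans)
  then show ?thesis by (simp add: Good_def)
qed

text \<open>Dual to \<open>conv_vp\<close>: test against truncations of \<open>v (N * |g|)\<close>.\<close>

lemma v_conv_L2:
  assumes W: "rollnik W" and a: "0 < a" and g: "g \<in> L2"
  shows "(NINT y. (ennreal (vfun W y) * conv a g y)^2) < \<infinity>"
proof -
  note [measurable] = vfun_meas(1)[OF rollnik_meas[OF W]] L2_meas[OF g] conv_meas[OF L2_meas[OF g], of a]
  define T where "T y = ennreal (vfun W y) * conv a g y" for y
  have [measurable]: "T \<in> borel_measurable borel" unfolding T_def[abs_def] by measurable
  \<comment> \<open>Truncation to a ball and to height \<open>n\<close> puts the test function into
    \<open>L2\<close>; its norm is then finite and may be cancelled from the quadratic inequality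
    for \<open>X\<close>.\<close>
  define b where "b n y = indicator (cball 0 (real n)) y * enn2real (min (of_nat n) (T y))" for n y
  have [measurable]: "cball 0 (real n) \<in> sets (borel :: pt measure)" for n by simp
  have bm[measurable]: "b n \<in> borel_measurable borel" for n unfolding b_def[abs_def] by measurable
  have b0: "0 \<le> b n y" for n y by (simp add: b_def)
  have mt: "min (of_nat n) (T y) < top" for n y by (simp add: min_less_iff_disj ennreal_of_nat_eq_real_of_nat)
  have bT: "ennreal (b n y) \<le> T y" for n y
    unfolding b_def using mt[of n y] by (auto split: split_indicator simp: ennreal_enn2real)
  have bn: "b n y \<le> real n * indicator (cball 0 (real n)) y" for n y
  proof -
    have "enn2real (min (of_nat n) (T y)) \<le> enn2real (of_nat n)" by (intro enn2real_mono) (auto simp: ennreal_of_nat_eq_real_of_nat)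
    then show ?thesis by (simp add: b_def split: split_indicator)
  qed
  have bL: "(\<lambda>y. of_real (b n y)) \<in> L2" for n
  proof (rule L2_bound[OF L2_cmult[OF indicator_L2[of "cball 0 (real n)"], of "of_nat n"]])
    show "cmod (of_real (b n x)) \<le> cmod (of_nat n * indicator (cball 0 (real n)) x)" for x
      using bn[of n x] b0[of n x] by (simp add: norm_mult split: split_indicator split_indicator_asm)
  qed auto
  have n2b: "n2 (\<lambda>y. of_real (b n y)) \<le> ennreal (RB a W) * n2 g" for n
  proof -
    define X where "X = n2 (\<lambda>y. of_real (b n y))"
    have Xf: "X < top" using L2_n2[OF bL] by (simp add: X_def)
    have "X \<le> (NINT y. ennreal (b n y) * T y)"
      unfolding X_def n2_def by (intro nn_integral_mono) (auto simp: power2_eq_square b0 intro!: mult_left_mono bT)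
    also have "\<dots> = (NINT y. NINT x. ennreal (b n y * vfun W y * Nk a (y - x) * cmod (g x)))"
    proof (rule nn_integral_cong)
      fix y
      have "ennreal (b n y) * T y = ennreal (b n y * vfun W y) * (NINT x. ennreal (Nk a (y - x) * cmod (g x)))"
        by (simp add: T_def conv_def ennreal_mult b0 mult.assoc)
      also have "\<dots> = (NINT x. ennreal (b n y * vfun W y) * ennreal (Nk a (y - x) * cmod (g x)))"
        by (rule nn_integral_cmult[symmetric]) measurable
      also have "\<dots> = (NINT x. ennreal (b n y * vfun W y * Nk a (y - x) * cmod (g x)))"
        by (intro nn_integral_cong) (simp add: ennreal_mult[symmetric] b0 mult.assoc)
      finally show "ennreal (b n y) * T y = (NINT x. ennreal (b n y * vfun W y * Nk a (y - x) * cmod (g x)))" .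
    qed
    also have "\<dots> = (NINT x. NINT y. ennreal (b n y * vfun W y * Nk a (y - x) * cmod (g x)))"
      by (rule lborel_Tonelli) measurable
    also have "\<dots> = (NINT x. conv a (\<lambda>y. of_real (vfun W y) * of_real (b n y)) x * ennreal (cmod (g x)))"
      unfolding conv_def
      by (intro nn_integral_cong, subst nn_integral_multc[symmetric])
         (auto simp: ennreal_mult b0 norm_mult Nk_minus[of a] ac_simps)
    finally have "X^2 \<le> (NINT x. conv a (\<lambda>y. of_real (vfun W y) * of_real (b n y)) x * ennreal (cmod (g x)))^2"
      by (intro power_mono) auto
    also have "\<dots> \<le> (NINT x. (conv a (\<lambda>y. of_real (vfun W y) * of_real (b n y)) x)^2) * n2 g"
      unfolding n2_def by (rule Cauchy_Schwarz_nn_integral) (auto intro!: conv_meas)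
    also have "\<dots> \<le> (ennreal (RB a W) * X) * n2 g"
      unfolding X_def by (intro mult_right_mono conv_vp W a bL) auto
    finally have le: "X * X \<le> X * (ennreal (RB a W) * n2 g)" by (simp add: power2_eq_square ac_simps)
    have "X \<le> ennreal (RB a W) * n2 g"
    proof (cases "X = 0")
      case False
      then show ?thesis using le Xf by (simp add: ennreal_mult_le_mult_iff)
    qed simp
    then show ?thesis by (simp add: X_def)
  qed
  have "(NINT y. (T y)^2) = (NINT y. liminf (\<lambda>n. (ennreal (b n y))^2))"
  proof (rule nn_integral_cong_AE, use Good_AE[OF Good_L2[OF a g]] in eventually_elim)
    fix y assume "conv a g y < \<infinity>"
    then have "T y < top" by (simp add: T_def ennreal_mult_less_top)
    then obtain r where r: "T y = ennreal r" "0 \<le> r" by (cases "T y") auto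
    obtain m where m: "max r (norm y) \<le> real m" using real_arch_simple by blast
    have "(ennreal (b n y))^2 = (T y)^2" if "n \<ge> m" for n
    proof -
      have "r \<le> real n" "norm y \<le> real n" using m that by (auto simp: le_max_iff_disj)
      then have "min (of_nat n) (T y) = T y" using r by (simp add: min_def ennreal_of_nat_eq_real_of_nat)
      then show ?thesis using \<open>norm y \<le> real n\<close> r by (simp add: b_def)
    qed
    then have "(\<lambda>n. (ennreal (b n y))^2) \<longlonglongrightarrow> (T y)^2"
      by (intro tendsto_eventually eventually_sequentiallyI[of m])
    then show "(T y)^2 = liminf (\<lambda>n. (ennreal (b n y))^2)"
      by (intro lim_imp_Liminf[symmetric]) auto
  qed
  also have "\<dots> \<le> liminf (\<lambda>n. NINT y. (ennreal (b n y))^2)"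
    by (rule nn_integral_liminf) measurable
  also have "\<dots> \<le> liminf (\<lambda>n::nat. ennreal (RB a W) * n2 g)"
  proof (rule Liminf_mono, rule always_eventually, rule allI)
    show "(NINT y. (ennreal (b n y))^2) \<le> ennreal (RB a W) * n2 g" for n
      using n2b[of n] b0 by (simp add: n2_def)
  qed
  also have "\<dots> = ennreal (RB a W) * n2 g" by (simp add: Liminf_const)
  also have "\<dots> < \<infinity>" using L2_n2[OF g] by (simp add: ennreal_mult_less_top)
  finally show ?thesis by (simp add: T_def)
qed

text \<open>The Green representation at \<open>\<kappa> = 1\<close> bounds \<open>|h|\<close> by
  convolutions of its gradient and of itself, and multiplication by \<open>v\<close> after such a
  convolution stays in \<open>L2\<close>. Hence potential energies of Sobolev functions are finite.
  The factor 2 is \<open>1 + |\<kappa>|\<close>.\<close>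

lemma v_H1_L2:
  assumes W: "rollnik W" and h: "H1_grad h D"
  shows "(\<lambda>x. of_real (vfun W x) * h x) \<in> L2" "(\<lambda>x. of_real (ufun W x) * h x) \<in> L2"
proof -
  have hL: "h \<in> L2" and DL: "\<And>i. D i \<in> L2" using h by (auto simp: H1_grad_def)
  note [measurable] = vfun_meas[OF rollnik_meas[OF W]] L2_meas[OF hL] L2_meas[OF DL] conv_meas[of _ "1::real"]
  define B where "B g y = (of_real (enn2real (ennreal (vfun W y) * conv 1 g y)) :: complex)" for g y
  have BL: "B g \<in> L2" if g: "g \<in> L2" for g
  proof -
    have [measurable]: "conv 1 g \<in> borel_measurable borel" by (rule conv_meas[OF L2_meas[OF g]])
    have "n2 (B g) \<le> (NINT y. (ennreal (vfun W y) * conv 1 g y)^2)"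
      unfolding n2_def B_def by (intro nn_integral_mono power_mono) (auto simp: ennreal_enn2real_if)
    then show ?thesis using v_conv_L2[OF W _ g, of 1] unfolding L2_iff B_def[abs_def] by (auto intro: le_less_trans)
  qed
  have GL: "(\<lambda>y. 2 * ((\<Sum>i\<in>UNIV. B (D i) y) + B h y)) \<in> L2"
    by (intro L2_cmult L2_add L2_sum BL hL DL)
  have "AE y in lborel. \<forall>i. conv 1 (D i) y < \<infinity>"
    using Good_AE[OF Good_L2[OF _ DL]] by (simp add: AE_all_countable)
  moreover have "AE y in lborel. conv 1 h y < \<infinity>" using Good_AE[OF Good_L2[OF _ hL]] by simp
  moreover have "AE y in lborel. h y = (\<Sum>i\<in>UNIV. LBINT x. D i x * dFd 1 0 i (x - y)) + 1^2 * (LBINT x. h x * Fd 1 0 (x - y))"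
    by (rule H1_representation[OF h]) simp
  ultimately have AE: "AE y in lborel. cmod (of_real (vfun W y) * h y) \<le> cmod (2 * ((\<Sum>i\<in>UNIV. B (D i) y) + B h y))"
  proof eventually_elim
    fix y assume fD: "\<forall>i. conv 1 (D i) y < \<infinity>" and fh: "conv 1 h y < \<infinity>"
      and rep: "h y = (\<Sum>i\<in>UNIV. LBINT x. D i x * dFd 1 0 i (x - y)) + 1^2 * (LBINT x. h x * Fd 1 0 (x - y))"
    have e: "cmod (LBINT x. g x * K (x - y)) \<le> 2 * enn2real (conv 1 g y)"
      if "K \<in> borel_measurable borel" "\<And>z. z \<noteq> 0 ==> cmod (K z) \<le> 2 * Nk 1 z" "g \<in> borel_measurable borel" "conv 1 g y < \<infinity>" for g K
    proof -
      have "ennreal (cmod (LBINT x. g x * K (x - y))) \<le> ennreal 2 * conv 1 g y"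
        by (rule kernel_pairing_integrable(4)[OF that(1,2) _ that(3,4)]) auto
      also have "\<dots> = ennreal (2 * enn2real (conv 1 g y))" using that(4) by (simp add: ennreal_mult less_top)
      finally show ?thesis by simp
    qed
    have K1: "cmod (dFd 1 0 i z) \<le> 2 * Nk 1 z" "cmod (Fd 1 0 z) \<le> 2 * Nk 1 z" if "z \<noteq> 0" for i z
      using dFd_bound[of 1 z 0 i] Fd_bound'[of 1 z 0] that by auto
    have "cmod (h y) \<le> (\<Sum>i\<in>UNIV. cmod (LBINT x. D i x * dFd 1 0 i (x - y))) + cmod (LBINT x. h x * Fd 1 0 (x - y))"
      unfolding rep by (rule order_trans[OF norm_triangle_ineq]) (simp add: norm_sum)
    also have "\<dots> \<le> (\<Sum>i\<in>UNIV. 2 * enn2real (conv 1 (D i) y)) + 2 * enn2real (conv 1 h y)"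
      by (intro add_mono sum_mono e) (use fD fh K1 in auto)
    finally have "vfun W y * cmod (h y) \<le> vfun W y * ((\<Sum>i\<in>UNIV. 2 * enn2real (conv 1 (D i) y)) + 2 * enn2real (conv 1 h y))"
      by (rule mult_left_mono) simp
    also have "\<dots> = 2 * ((\<Sum>i\<in>UNIV. vfun W y * enn2real (conv 1 (D i) y)) + vfun W y * enn2real (conv 1 h y))"
      by (simp add: sum_distrib_left distrib_left ac_simps)
    also have "\<dots> = cmod (2 * ((\<Sum>i\<in>UNIV. B (D i) y) + B h y))"
    proof -
      have "2 * ((\<Sum>i\<in>UNIV. B (D i) y) + B h y) = of_real (2 * ((\<Sum>i\<in>UNIV. vfun W y * enn2real (conv 1 (D i) y)) + vfun W y * enn2real (conv 1 h y)))"
        by (simp add: B_def enn2real_mult)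
      then show ?thesis by (simp only: norm_of_real) (simp add: sum_nonneg)
    qed
    finally show "cmod (of_real (vfun W y) * h y) \<le> cmod (2 * ((\<Sum>i\<in>UNIV. B (D i) y) + B h y))"
      by (simp add: norm_mult)
  qed
  show "(\<lambda>x. of_real (vfun W x) * h x) \<in> L2"
    by (rule L2_bound_AE[OF GL _ AE]) measurable
  show "(\<lambda>x. of_real (ufun W x) * h x) \<in> L2"
    by (rule L2_bound_AE[OF GL]) (measurable, use AE in \<open>simp add: norm_mult abs_ufun\<close>)
qed

section \<open>Existence of the resolvent and the resolvent equation\<close>

lemma Fd_cnj: "Fd (cnj \<kappa>) 0 z = cnj (Fd \<kappa> 0 z)"
  by (simp add: Fd_def exp_cnj)

lemma Fd_even: "Fd \<kappa> 0 (x - y) = Fd \<kappa> 0 (y - x)"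
  by (simp add: Fd_def norm_minus_commute)

definition kK :: "(pt => real) => complex => pt => pt => complex" where
  "kK W \<kappa> x y = of_real (ufun W x) * Fd \<kappa> 0 (x - y) * of_real (vfun W y)"

text \<open>The boundary case \<open>Re \<kappa> = 0\<close> is included so that the zero-energy
  kernel at \<open>\<kappa> = 0\<close> shares its majorant with the others.\<close>

lemma cmod_Fd_le: assumes "0 \<le> Re \<kappa>" shows "cmod (Fd \<kappa> 0 z) \<le> 1 / norm z"
proof -
  have "cmod (Fd \<kappa> 0 z) = exp (- Re \<kappa> * norm z) / norm z / (4 * pi)"
    by (simp only: Fd_def norm_divide cmod_exp_kappa sd_0) (simp add: norm_mult)
  also have "\<dots> \<le> exp (- Re \<kappa> * norm z) / norm z" by (rule div_4pi) simp
  also have "\<dots> \<le> 1 / norm z" using assms by (intro divide_right_mono) auto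
  finally show ?thesis .
qed

lemma HSk_kK: assumes W: "rollnik W" and k: "0 \<le> Re \<kappa>" shows "HSk (kK W \<kappa>)"
proof (rule HSk_rollnik_bound(1)[OF W])
  note [measurable] = vfun_meas[OF rollnik_meas[OF W]]
  show "(\<lambda>(x, y). kK W \<kappa> x y) \<in> borel_measurable (lborel \<Otimes>\<^sub>M lborel)" unfolding kK_def by measurable
  show "cmod (kK W \<kappa> x y) \<le> vfun W x * vfun W y / dist x y" for x y
    using mult_left_mono[OF cmod_Fd_le[OF k, of "x - y"], of "vfun W x * vfun W y"]
    by (simp add: kK_def norm_mult abs_ufun dist_norm ac_simps)
qed

lemma kop_kK: "kop (kK W \<kappa>) p x = of_real (ufun W x) * Gop \<kappa> (\<lambda>y. of_real (vfun W y) * p y) x"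
  unfolding kop_def kK_def Gop_def by (subst integral_mult_right_zero[symmetric]) (simp add: ac_simps)

lemma H1_grad_diff:
  assumes f: "H1_grad f Df" and g: "H1_grad g Dg"
  shows "H1_grad (\<lambda>x. f x - g x) (\<lambda>i x. Df i x - Dg i x)"
  unfolding H1_grad_def weak_grad_def
proof (intro conjI allI impI)
  have L: "f \<in> L2" "g \<in> L2" "\<And>i. Df i \<in> L2" "\<And>i. Dg i \<in> L2" using assms by (auto simp: H1_grad_def)
  then show "(\<lambda>x. f x - g x) \<in> L2" "(\<lambda>x. Df i x - Dg i x) \<in> L2" for i by (auto intro: L2_diff)
  fix \<phi> d i assume tf: "test_fun \<phi>" "has_partial \<phi> i d"
  note T = test_fun_L2[OF tf]
  have "(LBINT x. f x * of_real (d x)) = - (LBINT x. Df i x * of_real (\<phi> x))"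
    "(LBINT x. g x * of_real (d x)) = - (LBINT x. Dg i x * of_real (\<phi> x))"
    using assms tf by (auto simp: H1_grad_def weak_grad_def)
  then show "(LBINT x. (f x - g x) * of_real (d x)) = - (LBINT x. (Df i x - Dg i x) * of_real (\<phi> x))"
    using L2_mult_CS(1)[OF L(1) T(2)] L2_mult_CS(1)[OF L(2) T(2)] L2_mult_CS(1)[OF L(3) T(1)] L2_mult_CS(1)[OF L(4) T(1)]
    by (simp add: left_diff_distrib)
qed

text \<open>The equation for \<open>p\<close> says that \<open>f = G g - G (v p)\<close> satisfies
  \<open>u f = p\<close>, hence \<open>W f = v p\<close>. Subtracting the form identities of the two
  Green potentials then gives the perturbed form equation.\<close>

lemma form_sol_of_BS:
  assumes W: "rollnik W" and k: "0 < Re \<kappa>" and g: "g \<in> L2" and p: "p \<in> L2"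
    and eq: "AE x in lborel. p x + kop (kK W \<kappa>) p x = of_real (ufun W x) * Gop \<kappa> g x"
  shows "form_resolvent_sol W (\<kappa>^2) g (\<lambda>x. Gop \<kappa> g x - Gop \<kappa> (\<lambda>y. of_real (vfun W y) * p y) x)"
    and "AE x in lborel. of_real (ufun W x) * (Gop \<kappa> g x - Gop \<kappa> (\<lambda>y. of_real (vfun W y) * p y) x) = p x"
proof -
  define b where "b = (\<lambda>y. of_real (vfun W y) * p y)"
  define f where "f = (\<lambda>x. Gop \<kappa> g x - Gop \<kappa> b x)"
  have Gb: "Good (Re \<kappa>) b" unfolding b_def by (rule Good_vp[OF W k p])
  have Gg: "Good (Re \<kappa>) g" by (rule Good_L2[OF k g])
  have H: "H1_grad f (\<lambda>i x. dGop \<kappa> g i x - dGop \<kappa> b i x)"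
    unfolding f_def by (intro H1_grad_diff Gop_H1 k Gb Gg)
  have uf: "AE x in lborel. of_real (ufun W x) * f x = p x"
    using eq by eventually_elim (simp add: kop_kK f_def b_def algebra_simps)
  then show "AE x in lborel. of_real (ufun W x) * (Gop \<kappa> g x - Gop \<kappa> (\<lambda>y. of_real (vfun W y) * p y) x) = p x"
    by (simp add: f_def b_def)
  have Wf: "AE x in lborel. of_real (W x) * f x = b x"
    using uf
  proof eventually_elim
    fix x assume "of_real (ufun W x) * f x = p x"
    then have "of_real (vfun W x) * (of_real (ufun W x) * f x) = b x" by (simp add: b_def)
    then show "of_real (W x) * f x = b x" by (simp only: mult.assoc[symmetric] of_real_mult[symmetric] vu_eq)
  qed
  note [measurable] = rollnik_meas[OF W] Good_meas[OF Gb]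
  show "form_resolvent_sol W (\<kappa>^2) g (\<lambda>x. Gop \<kappa> g x - Gop \<kappa> (\<lambda>y. of_real (vfun W y) * p y) x)"
    unfolding form_resolvent_sol_def b_def[symmetric] f_def[symmetric]
  proof (intro exI conjI allI impI, rule H)
    fix h Dh assume h: "H1_grad h Dh"
    have hL: "h \<in> L2" and DL: "\<And>i. Dh i \<in> L2" using h by (auto simp: H1_grad_def)
    have fL: "f \<in> L2" using H by (simp add: H1_grad_def)
    note [measurable] = L2_meas[OF L2_cnj[OF hL]] L2_meas[OF fL]
    note F1 = Gop_form[OF k Gg h] and F2 = Gop_form[OF k Gb h]
    have I1: "integrable lborel (\<lambda>x. dGop \<kappa> c i x * cnj (Dh i x))" "integrable lborel (\<lambda>x. Gop \<kappa> c x * cnj (h x))" if "Good (Re \<kappa>) c" for c i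
      by (intro L2_mult_cnj(1) Gop_L2 k that hL DL)+
    have a1: "(LBINT x. of_real (W x) * f x * cnj (h x)) = (LBINT x. b x * cnj (h x))"
      by (rule integral_cong_AE, measurable) (use Wf in eventually_elim, simp)
    have a2: "(LBINT x. (dGop \<kappa> g i x - dGop \<kappa> b i x) * cnj (Dh i x))
       = (LBINT x. dGop \<kappa> g i x * cnj (Dh i x)) - (LBINT x. dGop \<kappa> b i x * cnj (Dh i x))" for i
      using I1(1)[OF Gg, of i] I1(1)[OF Gb, of i] by (simp add: left_diff_distrib)
    have a3: "(LBINT x. f x * cnj (h x)) = (LBINT x. Gop \<kappa> g x * cnj (h x)) - (LBINT x. Gop \<kappa> b x * cnj (h x))"
      unfolding f_def using I1(2)[OF Gg] I1(2)[OF Gb] by (simp add: left_diff_distrib)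
    show "(\<Sum>i\<in>UNIV. LBINT x. (dGop \<kappa> g i x - dGop \<kappa> b i x) * cnj (Dh i x))
       + (LBINT x. of_real (W x) * f x * cnj (h x)) + \<kappa>^2 * (LBINT x. f x * cnj (h x)) = (LBINT x. g x * cnj (h x))"
      unfolding a1 a2 a3 sum_subtractf F1(1)[symmetric] F2(1)[symmetric] by (simp add: right_diff_distrib)
  qed
qed

text \<open>Tested with \<open>f\<close> itself, the gradient and potential terms are real, so the
  imaginary part isolates \<open>Im lam\<close> times the squared norm of \<open>f\<close>.\<close>

lemma form_sol_zero:
  assumes s: "form_resolvent_sol W lam (\<lambda>x. 0) f" and im: "Im lam \<noteq> 0"
  shows "AE x in lborel. f x = 0"
proof -
  obtain Df where H: "H1_grad f Df" and eq: "\<And>h Dh. H1_grad h Dh ==>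
           (\<Sum>i\<in>UNIV. integral\<^sup>L lborel (\<lambda>x. Df i x * cnj (Dh i x)))
           + integral\<^sup>L lborel (\<lambda>x. of_real (W x) * f x * cnj (h x))
           + lam * integral\<^sup>L lborel (\<lambda>x. f x * cnj (h x))
           = integral\<^sup>L lborel (\<lambda>x. 0 * cnj (h x))"
    using s unfolding form_resolvent_sol_def by blast
  have fL: "f \<in> L2" and DL: "\<And>i. Df i \<in> L2" using H by (auto simp: H1_grad_def)
  have "Im (LBINT x. of_real (W x) * f x * cnj (f x)) = 0"
  proof -
    have "of_real (W x) * f x * cnj (f x) = of_real (W x * (cmod (f x))^2)" for x
      by (simp only: mult.assoc of_real_mult complex_norm_square)
    then have "(LBINT x. of_real (W x) * f x * cnj (f x)) = (LBINT x. complex_of_real (W x * (cmod (f x))^2))" by (simp only:)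
    also have "\<dots> = of_real (LBINT x. W x * (cmod (f x))^2)" by (rule integral_bounded_linear'[OF bounded_linear_of_real bounded_linear_Re]) simp
    finally show ?thesis by simp
  qed
  then have "Im lam * (L2norm f)^2 = 0"
    using arg_cong[OF eq[OF H], of Im] L2_self[OF fL] L2_self[OF DL] by simp
  then show ?thesis using im L2norm_zero_iff[OF fL] by simp
qed

lemma BS_inj:
  assumes W: "rollnik W" and k: "0 < Re \<kappa>" "Im (\<kappa>^2) \<noteq> 0" and p: "p \<in> L2"
    and eq: "AE x in lborel. p x + kop (kK W \<kappa>) p x = 0"
  shows "AE x in lborel. p x = 0"
proof -
  have z: "Gop \<kappa> (\<lambda>x. 0) x = 0" for x by (simp add: Gop_def)
  have "AE x in lborel. p x + kop (kK W \<kappa>) p x = of_real (ufun W x) * Gop \<kappa> (\<lambda>x. 0) x"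
    using eq by (simp add: z)
  note R = form_sol_of_BS[OF W k(1) L2_zero p this]
  show ?thesis using form_sol_zero[OF R(1) k(2)] R(2) by eventually_elim simp
qed

text \<open>Injectivity of \<open>1 + K\<close> is uniqueness of the form solution. The adjoint
  kernel is \<open>v G u\<close> at the conjugate parameter, and multiplication by the sign of
  \<open>W\<close> carries it into the same family of operators, so uniqueness applies once
  more.\<close>

lemma resolvent_exists_kappa:
  assumes W: "rollnik W" and k: "0 < Re \<kappa>" "Im (\<kappa>^2) \<noteq> 0" and g: "g \<in> L2"
    and WI: "integrable lborel W"
  shows "\<exists>f. form_resolvent_sol W (\<kappa>^2) g f"
proof -
  note [measurable] = vfun_meas[OF rollnik_meas[OF W]] rollnik_meas[OF W]
  have HS: "HSk (kK W \<kappa>)" using HSk_kK[OF W] k by simp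
  have bL: "(\<lambda>x. of_real (ufun W x) * Gop \<kappa> g x) \<in> L2"
    by (rule v_H1_L2(2)[OF W Gop_H1[OF k(1) Good_L2[OF k(1) g]]])
  have "\<exists>p\<in>L2. AE x in lborel. p x + kop (kK W \<kappa>) p x = of_real (ufun W x) * Gop \<kappa> g x"
  proof (rule id_plus_kop_surj[OF HS bL])
    show "AE x in lborel. p x = 0" if "p \<in> L2" "AE x in lborel. p x + kop (kK W \<kappa>) p x = 0" for p
      by (rule BS_inj[OF W k that])
    fix p assume p: "p \<in> L2" and eq: "AE x in lborel. p x + kop (\<lambda>x y. cnj (kK W \<kappa> y x)) p x = 0"
    note [measurable] = L2_meas[OF p]
    define q where "q x = of_real (sgn (W x)) * p x" for x
    have [measurable]: "(\<lambda>x. sgn (W x)) \<in> borel_measurable borel"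
      by (simp add: sgn_if) measurable
    have qL: "q \<in> L2"
      by (rule L2_bound[OF p]) (auto simp: q_def[abs_def] norm_mult sgn_if)
    have vq: "of_real (vfun W y) * q y = of_real (ufun W y) * p y" for y
      by (simp add: q_def ufun_eq)
    have ka: "kop (\<lambda>x y. cnj (kK W \<kappa> y x)) p x = of_real (vfun W x) * Gop (cnj \<kappa>) (\<lambda>y. of_real (vfun W y) * q y) x" for x
      unfolding kop_def kK_def Gop_def vq
      by (subst integral_mult_right_zero[symmetric]) (simp add: ac_simps Fd_cnj Fd_even[of \<kappa> x])
    have "AE x in lborel. q x + kop (kK W (cnj \<kappa>)) q x = 0"
      using eq
    proof eventually_elim
      fix x assume "p x + kop (\<lambda>x y. cnj (kK W \<kappa> y x)) p x = 0"
      then have "of_real (sgn (W x)) * (p x + of_real (vfun W x) * Gop (cnj \<kappa>) (\<lambda>y. of_real (vfun W y) * q y) x) = 0"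
        by (simp add: ka)
      then show "q x + kop (kK W (cnj \<kappa>)) q x = 0"
        by (simp add: q_def kop_kK ufun_eq distrib_left mult.assoc)
    qed
    moreover have "Im ((cnj \<kappa>)^2) \<noteq> 0" using k(2) by (simp add: power2_eq_square)
    ultimately have q0: "AE x in lborel. q x = 0" using k by (intro BS_inj[OF W _ _ qL]) auto
    have "Gop (cnj \<kappa>) (\<lambda>y. of_real (vfun W y) * q y) x = 0" for x
    proof -
      note [measurable] = L2_meas[OF qL]
      have "Gop (cnj \<kappa>) (\<lambda>y. of_real (vfun W y) * q y) x = (\<integral>y. 0 \<partial>(lborel :: pt measure))"
        unfolding Gop_def by (rule integral_cong_AE, measurable) (use q0 in eventually_elim, simp)
      then show ?thesis by simp
    qed
    \<comment> \<open>Vanishing of \<open>q\<close> says nothing where \<open>W\<close> is 0;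
      \<open>p\<close> vanishes there because the operator term in its own equation does.\<close>
    then show "AE x in lborel. p x = 0" using eq by (simp add: ka)
  qed
  then show ?thesis using form_sol_of_BS(1)[OF W k(1) g] by blast
qed

lemma csqrt_props: assumes "Im lam \<noteq> 0" shows "0 < Re (csqrt lam)" "Im ((csqrt lam)^2) \<noteq> 0" "Im (csqrt lam) \<noteq> 0"
proof -
  have "csqrt lam \<noteq> 0" using assms by auto
  have sq: "(csqrt lam)^2 = lam" by (rule power2_csqrt)
  then show "Im ((csqrt lam)^2) \<noteq> 0" using assms by simp
  have "Im (w^2) = 2 * Re w * Im w" for w by (simp add: power2_eq_square)
  from this[of "csqrt lam"] have "2 * Re (csqrt lam) * Im (csqrt lam) = Im lam" by (simp only: sq)
  then have "Re (csqrt lam) \<noteq> 0" "Im (csqrt lam) \<noteq> 0" using assms by auto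
  then show "0 < Re (csqrt lam)" "Im (csqrt lam) \<noteq> 0" using csqrt_principal[of lam] by auto
qed

lemma resolvent_exists:
  assumes "rollnik W" "integrable lborel W" "Im lam \<noteq> 0" "g \<in> L2"
  shows "\<exists>f. form_resolvent_sol W lam g f"
  using resolvent_exists_kappa[OF assms(1) csqrt_props(1,2)[OF assms(3)] assms(4,2)] by simp

section \<open>Every form solution obeys the resolvent equation\<close>

lemma Gop_adjoint_pairing:
  assumes k: "0 < Re \<kappa>" and b: "Good (Re \<kappa>) b" and z: "z \<in> L2"
  shows "(LBINT y. b y * cnj (Gop (cnj \<kappa>) z y)) = (LBINT x. Gop \<kappa> b x * cnj (z x))"
proof -
  have "cnj (Gop (cnj \<kappa>) z y) = (LBINT x. cnj (z x) * Fd \<kappa> 0 (x - y))" for y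
    unfolding Gop_def by (subst Bochner_Integration.integral_cnj[symmetric]) (simp add: Fd_cnj Fd_even[of \<kappa> y] mult.commute)
  then have "(LBINT y. b y * cnj (Gop (cnj \<kappa>) z y)) = (LBINT y. b y * (LBINT x. cnj (z x) * Fd \<kappa> 0 (x - y)))" by simp
  also have "\<dots> = (LBINT x. Gop \<kappa> b x * cnj (z x))"
    unfolding Gop_def by (rule pair_fubini(1)[where C="1 + cmod \<kappa>" and a="Re \<kappa>"]) (auto intro!: Fd_bound' k b L2_cnj z)
  finally show ?thesis .
qed

text \<open>Let \<open>z\<close> be the residual of the claimed identity. The Green potential of
  \<open>z\<close> at the conjugate parameter is an admissible test function; inserting it and
  moving the Green operator across all pairings shows that the squared norm of \<open>z\<close> is
  0.\<close>

lemma resolvent_equation: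
  assumes W: "rollnik W" and im: "Im lam \<noteq> 0" and g: "g \<in> L2" and s: "form_resolvent_sol W lam g f"
  shows "AE x in lborel. f x = Gop (csqrt lam) g x - Gop (csqrt lam) (\<lambda>y. of_real (vfun W y) * (of_real (ufun W y) * f y)) x"
    and "(\<lambda>y. of_real (ufun W y) * f y) \<in> L2" "f \<in> L2"
proof -
  define \<kappa> where "\<kappa> = csqrt lam"
  have k: "0 < Re \<kappa>" using csqrt_props[OF im] by (simp add: \<kappa>_def)
  have k2: "\<kappa>^2 = lam" by (simp add: \<kappa>_def)
  obtain Df where H: "H1_grad f Df" and eq: "\<And>h Dh. H1_grad h Dh ==>
           (\<Sum>i\<in>UNIV. integral\<^sup>L lborel (\<lambda>x. Df i x * cnj (Dh i x)))
           + integral\<^sup>L lborel (\<lambda>x. of_real (W x) * f x * cnj (h x))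
           + lam * integral\<^sup>L lborel (\<lambda>x. f x * cnj (h x))
           = integral\<^sup>L lborel (\<lambda>x. g x * cnj (h x))"
    using s unfolding form_resolvent_sol_def by blast
  show fL: "f \<in> L2" using H by (auto simp: H1_grad_def)
  show uf: "(\<lambda>y. of_real (ufun W y) * f y) \<in> L2" by (rule v_H1_L2(2)[OF W H])
  define b where "b = (\<lambda>y. of_real (vfun W y) * (of_real (ufun W y) * f y))"
  have bW: "of_real (W y) * f y = b y" for y
    unfolding b_def by (simp only: mult.assoc[symmetric] of_real_mult[symmetric] vu_eq)
  have Gb: "Good (Re \<kappa>) b" unfolding b_def by (rule Good_vp[OF W k uf])
  have Gg: "Good (Re \<kappa>) g" by (rule Good_L2[OF k g])
  define z where "z x = f x - Gop \<kappa> g x + Gop \<kappa> b x" for x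
  have zL: "z \<in> L2" unfolding z_def[abs_def] by (intro L2_add L2_diff fL Gop_L2 k Gb Gg)
  have kc: "0 < Re (cnj \<kappa>)" using k by simp
  define h where "h = Gop (cnj \<kappa>) z"
  have Gz: "Good (Re (cnj \<kappa>)) z" by (rule Good_L2[OF kc zL])
  have hH: "H1_grad h (dGop (cnj \<kappa>) z)" unfolding h_def by (rule Gop_H1[OF kc Gz])
  have cp: "cnj (LBINT x. a x * cnj (c x)) = (LBINT x. c x * cnj (a x))" for a c :: cfun
    by (subst Bochner_Integration.integral_cnj[symmetric]) (simp add: mult.commute)
  have F: "(\<Sum>i\<in>UNIV. LBINT x. Df i x * cnj (dGop (cnj \<kappa>) z i x)) + lam * (LBINT x. f x * cnj (h x)) = (LBINT x. f x * cnj (z x))"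
    using arg_cong[OF Gop_form(1)[OF kc Gz H], of cnj] by (simp add: cp h_def k2 del: Bochner_Integration.integral_cnj)
  have "(LBINT x. f x * cnj (z x)) + (LBINT x. b x * cnj (h x)) = (LBINT x. g x * cnj (h x))"
    using eq[OF hH, unfolded bW] unfolding F[symmetric] by (simp only: add_ac)
  then have E: "(LBINT x. f x * cnj (z x)) + (LBINT x. Gop \<kappa> b x * cnj (z x)) = (LBINT x. Gop \<kappa> g x * cnj (z x))"
    by (simp only: h_def Gop_adjoint_pairing[OF k Gb zL] Gop_adjoint_pairing[OF k Gg zL])
  have I: "integrable lborel (\<lambda>x. f x * cnj (z x))" "integrable lborel (\<lambda>x. Gop \<kappa> b x * cnj (z x))" "integrable lborel (\<lambda>x. Gop \<kappa> g x * cnj (z x))"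
    by (intro L2_mult_cnj(1) zL fL Gop_L2 k Gb Gg)+
  have "(LBINT x. z x * cnj (z x)) = (LBINT x. f x * cnj (z x) - Gop \<kappa> g x * cnj (z x) + Gop \<kappa> b x * cnj (z x))"
    by (simp add: z_def algebra_simps)
  also have "\<dots> = (LBINT x. f x * cnj (z x)) - (LBINT x. Gop \<kappa> g x * cnj (z x)) + (LBINT x. Gop \<kappa> b x * cnj (z x))"
    using I by simp
  also have "\<dots> = 0" unfolding E[symmetric] by simp
  finally have "L2norm z = 0" using L2_self[OF zL] by simp
  then have "AE x in lborel. z x = 0" using L2norm_zero_iff[OF zL] by simp
  then show "AE x in lborel. f x = Gop (csqrt lam) g x - Gop (csqrt lam) (\<lambda>y. of_real (vfun W y) * (of_real (ufun W y) * f y)) x"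
    by eventually_elim (simp add: z_def \<kappa>_def b_def algebra_simps)
qed

section \<open>Scaling\<close>

lemma nn_integral_scale:
  assumes "f \<in> borel_measurable borel" "0 < eps"
  shows "(NINT x. f (x::pt)) = ennreal (eps^3) * (NINT x. f (eps *\<^sub>R x))"
  using nn_integral_lborel_affine[OF assms(1), of eps 0] assms(2) by (simp add: mult.commute)

text \<open>Two Jacobians \<open>eps^3\<close> meet \<open>eps^-2\<close> from the kernel, so the
  Rollnik integral is multiplied by \<open>c^2 eps^4\<close>.\<close>

lemma rollnik_scale:
  assumes V: "rollnik V" and c: "0 \<le> c" and e: "0 < eps"
  shows "rollnik (\<lambda>x. c * V ((1/eps) *\<^sub>R x))"
  unfolding rollnik_def
proof
  note [measurable] = rollnik_meas[OF V]
  show "(\<lambda>x. c * V ((1/eps) *\<^sub>R x)) \<in> borel_measurable lborel" by measurable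
  let ?I = "\<lambda>x y. ennreal (\<bar>c * V ((1/eps) *\<^sub>R x)\<bar> * \<bar>c * V ((1/eps) *\<^sub>R y)\<bar> / (dist x y)^2)"
  have [measurable]: "?I x \<in> borel_measurable borel" for x unfolding dist_norm by measurable
  have m1: "(\<lambda>x. NINT y. ?I x y) \<in> borel_measurable borel" unfolding dist_norm by measurable
  have sc: "?I (eps *\<^sub>R x) (eps *\<^sub>R y) = ennreal (c^2 / eps^2) * ennreal (\<bar>V x\<bar> * \<bar>V y\<bar> / (dist x y)^2)" for x y
    using e c by (simp add: dist_norm abs_mult power_mult_distrib ennreal_mult[symmetric] power2_eq_square
        flip: scaleR_diff_right) (simp add: field_simps)
  have m2: "(\<lambda>(x, y). ennreal (\<bar>V x\<bar> * \<bar>V y\<bar> / (dist x y)^2)) \<in> borel_measurable (lborel \<Otimes>\<^sub>M lborel)" unfolding dist_norm by measurable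
  have "(NINT x. NINT y. ?I x y) = ennreal (eps^3) * (NINT x. ennreal (eps^3) * (NINT y. ?I (eps *\<^sub>R x) (eps *\<^sub>R y)))"
    unfolding nn_integral_scale[OF m1 e] by (intro arg_cong2[where f="(*)"] refl nn_integral_cong nn_integral_scale e) measurable
  also have "\<dots> = ennreal (eps^3) * (ennreal (eps^3) * (ennreal (c^2 / eps^2) * (NINT x. NINT y. ennreal (\<bar>V x\<bar> * \<bar>V y\<bar> / (dist x y)^2))))"
    unfolding sc using m2 by (simp add: nn_integral_cmult dist_norm)
  also have "\<dots> < \<infinity>" using V by (simp add: rollnik_def ennreal_mult_less_top)
  finally show "(NINT x. NINT y. ?I x y) < \<infinity>" .
qed

lemma integrable_scale:
  fixes V :: "pt => real"
  assumes V: "integrable lborel V" and e: "0 < eps"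
  shows "integrable lborel (\<lambda>x. c * V ((1/eps) *\<^sub>R x))"
proof -
  have [measurable]: "V \<in> borel_measurable borel" using V by auto
  have "integrable lborel (\<lambda>x. V ((1/eps) *\<^sub>R x))"
  proof (rule integrableI_bounded)
    have "(NINT x. ennreal (norm (V ((1/eps) *\<^sub>R x)))) = ennreal (eps^3) * (NINT x. ennreal (norm (V ((1/eps) *\<^sub>R (eps *\<^sub>R x)))))"
      by (rule nn_integral_scale) (use e in measurable)
    also have "\<dots> < \<infinity>" using V e by (simp add: integrable_iff_bounded ennreal_mult_less_top)
    finally show "(NINT x. ennreal (norm (V ((1/eps) *\<^sub>R x)))) < \<infinity>" .
  qed measurable
  then show ?thesis by simp
qed

lemma ufun_scale:
  assumes "0 \<le> c"
  shows "vfun (\<lambda>x. c * V ((1/eps) *\<^sub>R x)) y = sqrt c * vfun V ((1/eps) *\<^sub>R y)"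
    and "ufun (\<lambda>x. c * V ((1/eps) *\<^sub>R x)) y = sqrt c * ufun V ((1/eps) *\<^sub>R y)"
  using assms by (auto simp: vfun_def ufun_def abs_mult real_sqrt_mult sgn_mult)

lemma Fd_scale: assumes "0 < eps"
  shows "Fd \<kappa> 0 (eps *\<^sub>R z) = Fd (of_real eps * \<kappa>) 0 z / of_real eps"
  using assms by (simp add: Fd_def ac_simps)

text \<open>\<open>kP\<close> carries a function of the rescaled variable back to the original
  scale, and \<open>kQ\<close> samples the free resolvent at \<open>eps y\<close>. At
  \<open>eps = 0\<close> both become products of a function of \<open>x\<close> and a function of
  \<open>y\<close>, which is the origin of the rank one term in the limit.\<close>

definition kP :: "(pt => real) => complex => real => pt => pt => complex" where
  "kP V \<kappa> eps x y = Fd \<kappa> 0 (x - eps *\<^sub>R y) * of_real (vfun V y)"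

definition kQ :: "(pt => real) => complex => real => pt => pt => complex" where
  "kQ V \<kappa> eps y x = of_real (ufun V y) * Fd \<kappa> 0 (eps *\<^sub>R y - x)"

lemma kop_kQ: "kop (kQ V \<kappa> eps) g y = of_real (ufun V y) * Gop \<kappa> g (eps *\<^sub>R y)"
  unfolding kop_def kQ_def Gop_def by (subst integral_mult_right_zero[symmetric]) (simp add: ac_simps)

text \<open>The substitution contributes the Jacobian \<open>eps^3\<close>. When the result is
  evaluated at \<open>eps y\<close> as well, homogeneity of the kernel gives back a factor
  \<open>1/eps\<close> and replaces \<open>\<kappa>\<close> by \<open>eps \<kappa>\<close>; hence
  the coefficient \<open>c eps^2\<close> in the equation for \<open>p\<close>.\<close>

lemma scaled_equations:
  assumes V: "rollnik V" and c: "0 < c" and e: "0 < eps" and im: "Im lam \<noteq> 0" and g: "g \<in> L2"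
    and s: "form_resolvent_sol (\<lambda>x. c * V ((1/eps) *\<^sub>R x)) lam g f"
  defines "\<kappa> \<equiv> csqrt lam"
  defines "p \<equiv> \<lambda>y. of_real (ufun V y) * f (eps *\<^sub>R y)"
  shows "AE x in lborel. f x = Gop \<kappa> g x - of_real (c * eps^3) * kop (kP V \<kappa> eps) p x"
    and "AE y in lborel. p y + of_real (c * eps^2) * kop (kK V (of_real eps * \<kappa>)) p y = kop (kQ V \<kappa> eps) g y"
    and "p \<in> L2" "f \<in> L2"
proof -
  define W where "W = (\<lambda>x. c * V ((1/eps) *\<^sub>R x))"
  have W: "rollnik W" unfolding W_def using rollnik_scale[OF V _ e, of c] c by simp
  note s' = s[folded W_def]
  note R = resolvent_equation[OF W im g s', folded \<kappa>_def]
  show fL: "f \<in> L2" by (rule R(3))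
  note [measurable] = rollnik_meas[OF V] vfun_meas[OF rollnik_meas[OF V]] L2_meas[OF fL]
  have c0: "0 \<le> c" using c by simp
  have bs: "of_real (vfun W (eps *\<^sub>R y)) * (of_real (ufun W (eps *\<^sub>R y)) * f (eps *\<^sub>R y)) = of_real c * (of_real (vfun V y) * p y)" for y
  proof -
    have "vfun W (eps *\<^sub>R y) * ufun W (eps *\<^sub>R y) = c * (vfun V y * ufun V y)"
      using e c by (simp add: W_def ufun_scale[OF c0])
    then have "of_real (vfun W (eps *\<^sub>R y)) * of_real (ufun W (eps *\<^sub>R y)) = (of_real (c * (vfun V y * ufun V y)) :: complex)"
      by (simp only: of_real_mult[symmetric])
    then show ?thesis by (simp add: p_def mult.assoc[symmetric])
  qed
  have G: "Gop \<kappa> (\<lambda>y. of_real (vfun W y) * (of_real (ufun W y) * f y)) x = of_real (c * eps^3) * kop (kP V \<kappa> eps) p x" for x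
  proof -
    have [measurable]: "vfun W \<in> borel_measurable borel" "ufun W \<in> borel_measurable borel" using vfun_meas rollnik_meas[OF W] by auto
    have "Gop \<kappa> (\<lambda>y. of_real (vfun W y) * (of_real (ufun W y) * f y)) x
       = of_real (\<bar>eps\<bar>^3) * (LBINT y. Fd \<kappa> 0 (x - (0 + eps *\<^sub>R y)) * (of_real (vfun W (0 + eps *\<^sub>R y)) * (of_real (ufun W (0 + eps *\<^sub>R y)) * f (0 + eps *\<^sub>R y))))"
      unfolding Gop_def by (rule integral_lborel_affine) (use e in auto)
    also have "\<dots> = of_real (eps^3) * (LBINT y. of_real c * (kP V \<kappa> eps x y * p y))"
      unfolding add_0_left bs using e by (simp add: kP_def ac_simps)
    also have "\<dots> = of_real (c * eps^3) * kop (kP V \<kappa> eps) p x"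
      by (simp add: kop_def)
    finally show ?thesis .
  qed
  show 1: "AE x in lborel. f x = Gop \<kappa> g x - of_real (c * eps^3) * kop (kP V \<kappa> eps) p x"
    using R(1) by eventually_elim (simp add: G)
  have "AE y in lborel. f (0 + eps *\<^sub>R y) = Gop \<kappa> g (0 + eps *\<^sub>R y) - of_real (c * eps^3) * kop (kP V \<kappa> eps) p (0 + eps *\<^sub>R y)"
    by (rule AE_lborel_affine[OF 1]) (use e in simp)
  then show "AE y in lborel. p y + of_real (c * eps^2) * kop (kK V (of_real eps * \<kappa>)) p y = kop (kQ V \<kappa> eps) g y"
  proof eventually_elim
    fix y assume "f (0 + eps *\<^sub>R y) = Gop \<kappa> g (0 + eps *\<^sub>R y) - of_real (c * eps^3) * kop (kP V \<kappa> eps) p (0 + eps *\<^sub>R y)"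
    then have f: "f (eps *\<^sub>R y) = Gop \<kappa> g (eps *\<^sub>R y) - of_real (c * eps^3) * kop (kP V \<kappa> eps) p (eps *\<^sub>R y)" by simp
    have k: "kop (kP V \<kappa> eps) p (eps *\<^sub>R y) = Gop (of_real eps * \<kappa>) (\<lambda>y. of_real (vfun V y) * p y) y / of_real eps"
    proof -
      have "kop (kP V \<kappa> eps) p (eps *\<^sub>R y) = (LBINT y'. Fd (of_real eps * \<kappa>) 0 (y - y') * (of_real (vfun V y') * p y') / of_real eps)"
        unfolding kop_def kP_def
        by (simp add: Fd_scale[OF e] mult.assoc flip: scaleR_diff_right)
      also have "\<dots> = Gop (of_real eps * \<kappa>) (\<lambda>y. of_real (vfun V y) * p y) y / of_real eps"
        by (simp add: Gop_def)
      finally show ?thesis .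
    qed
    have "of_real (c * eps^3) * (Gop (of_real eps * \<kappa>) (\<lambda>y. of_real (vfun V y) * p y) y / of_real eps)
        = of_real (c * eps^2) * Gop (of_real eps * \<kappa>) (\<lambda>y. of_real (vfun V y) * p y) y"
      using e by (simp add: power2_eq_square power3_eq_cube)
    then have f2: "f (eps *\<^sub>R y) = Gop \<kappa> g (eps *\<^sub>R y) - of_real (c * eps^2) * Gop (of_real eps * \<kappa>) (\<lambda>y. of_real (vfun V y) * p y) y"
      unfolding f k by simp
    have py: "p y = of_real (ufun V y) * f (eps *\<^sub>R y)" by (simp add: p_def)
    show "p y + of_real (c * eps^2) * kop (kK V (of_real eps * \<kappa>)) p y = kop (kQ V \<kappa> eps) g y"
      unfolding kop_kK kop_kQ py f2 by (simp add: algebra_simps)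
  qed
  show "p \<in> L2"
  proof -
    define F where "F y = of_real (ufun W y) * f y" for y
    have FL: "F \<in> L2" using R(2) by (simp add: F_def[abs_def])
    note [measurable] = L2_meas[OF FL]
    have "n2 F = ennreal (eps^3) * n2 (\<lambda>y. F (eps *\<^sub>R y))"
      unfolding n2_def by (rule nn_integral_scale[OF _ e]) measurable
    then have "n2 (\<lambda>y. F (eps *\<^sub>R y)) < \<infinity>"
      using L2_n2[OF FL] e by (auto simp: ennreal_mult_less_top)
    then have "(\<lambda>y. F (eps *\<^sub>R y)) \<in> L2" by (simp add: L2_iff)
    \<comment> \<open>The function \<open>ufun\<close> of the scaled potential carries a factor
      \<open>sqrt c\<close> that \<open>p\<close> does not have.\<close>
    from L2_cmult[OF this, of "of_real (1 / sqrt c)"]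
    have "(\<lambda>y. of_real (1 / sqrt c) * F (eps *\<^sub>R y)) \<in> L2" .
    moreover have "of_real (1 / sqrt c) * F (eps *\<^sub>R y) = p y" for y
      using c e by (simp add: F_def p_def W_def ufun_scale[OF c0])
    ultimately show ?thesis by simp
  qed
qed

section \<open>Hilbert--Schmidt convergence of the scaled kernels\<close>

lemma vfun_sq_nn: "(ennreal (vfun V y))^2 = ennreal \<bar>V y\<bar>"
  by (simp add: power2_eq_square ennreal_mult[symmetric] vfun_sq)

lemma vfun_L2: assumes "integrable lborel V" shows "(\<lambda>y. of_real (vfun V y)) \<in> L2" "(\<lambda>y. of_real (ufun V y)) \<in> L2"
proof -
  have [measurable]: "V \<in> borel_measurable borel" using assms by auto
  note [measurable] = vfun_meas[of V]
  show "(\<lambda>y. of_real (vfun V y)) \<in> L2" "(\<lambda>y. of_real (ufun V y)) \<in> L2"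
    using assms by (simp_all add: L2_iff n2_def abs_ufun vfun_sq_nn integrable_iff_bounded)
qed

text \<open>The squared \<open>L2\<close> modulus of continuity of the Green function under
  translation.\<close>

definition osc :: "complex => pt => ennreal" where
  "osc \<kappa> z = n2 (\<lambda>x. Fd \<kappa> 0 (x - z) - Fd \<kappa> 0 x)"

lemma n2_translate: "f \<in> borel_measurable borel ==> n2 (\<lambda>x. f (x - z)) = n2 f"
  unfolding n2_def by (rule nn_integral_translate(1)) measurable

lemma osc_le: assumes "0 < Re \<kappa>" shows "osc \<kappa> z \<le> 4 * n2 (Fd \<kappa> 0)"
proof -
  have "osc \<kappa> z \<le> (NINT x. 2 * (ennreal (cmod (Fd \<kappa> 0 (x - z))))^2 + 2 * (ennreal (cmod (Fd \<kappa> 0 x)))^2)"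
    unfolding osc_def n2_def
  proof (rule nn_integral_mono)
    fix x
    have "(ennreal (cmod (Fd \<kappa> 0 (x - z) - Fd \<kappa> 0 x)))^2 \<le> (ennreal (cmod (Fd \<kappa> 0 (x - z))) + ennreal (cmod (Fd \<kappa> 0 x)))^2"
      by (intro power_mono) (simp_all add: ennreal_plus[symmetric] norm_triangle_ineq4 del: ennreal_plus)
    then show "(ennreal (cmod (Fd \<kappa> 0 (x - z) - Fd \<kappa> 0 x)))^2 \<le> 2 * (ennreal (cmod (Fd \<kappa> 0 (x - z))))^2 + 2 * (ennreal (cmod (Fd \<kappa> 0 x)))^2"
      using ennreal_add_sq_le order_trans by blast
  qed
  also have "\<dots> = 2 * n2 (\<lambda>x. Fd \<kappa> 0 (x - z)) + 2 * n2 (Fd \<kappa> 0)"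
    by (simp add: nn_integral_add nn_integral_cmult n2_def)
  also have "\<dots> = 2 * n2 (Fd \<kappa> 0) + 2 * n2 (Fd \<kappa> 0)"
    by (subst n2_translate[of "Fd \<kappa> 0"]) measurable
  also have "\<dots> = 4 * n2 (Fd \<kappa> 0)" by (simp flip: distrib_right)
  finally show ?thesis .
qed

lemma Fd_isCont: assumes "z \<noteq> 0" shows "isCont (Fd \<kappa> 0) z"
  unfolding Fd_def[abs_def] sd_0 using assms by (intro continuous_intros) auto

text \<open>Fatou's lemma applied to \<open>2|F\<^sub>z|^2 + 2|F|^2 - |F\<^sub>z - F|^2\<close>, since the singularity of the translate
  moves and there is no common majorant.\<close>

lemma osc_tendsto_0:
  assumes k: "0 < Re \<kappa>" and z: "z \<longlonglongrightarrow> 0"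
  shows "(\<lambda>n. osc \<kappa> (z n)) \<longlonglongrightarrow> 0"
proof -
  define F where "F = Fd \<kappa> 0"
  have FL: "F \<in> L2" unfolding F_def by (rule Fd_L2[OF k])
  note [measurable] = L2_meas[OF FL]
  define I where "I = (L2norm F)^2"
  have I0: "0 \<le> I" by (simp add: I_def)
  have nI: "n2 F = ennreal I" using n2_eq[OF FL] by (simp add: I_def)
  define g where "g n x = 2 * (cmod (F (x - z n)))^2 + 2 * (cmod (F x))^2 - (cmod (F (x - z n) - F x))^2" for n x
  have g0: "0 \<le> g n x" for n x
  proof -
    have "(cmod (F (x - z n) - F x))^2 \<le> (cmod (F (x - z n)) + cmod (F x))^2" by (intro power_mono norm_triangle_ineq4) auto
    also have "\<dots> \<le> 2 * (cmod (F (x - z n)))^2 + 2 * (cmod (F x))^2"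
      using sum_squares_bound[of "cmod (F (x - z n))" "cmod (F x)"] by (simp add: power2_sum)
    finally show ?thesis by (simp add: g_def)
  qed
  have [measurable]: "g n \<in> borel_measurable borel" for n unfolding g_def[abs_def] by measurable
  define A where "A n = (NINT x. ennreal (g n x))" for n
  have sum: "A n + osc \<kappa> (z n) = ennreal (4 * I)" for n
  proof -
    have "A n + osc \<kappa> (z n) = (NINT x. ennreal (g n x) + ennreal ((cmod (F (x - z n) - F x))^2))"
      unfolding A_def osc_def n2_def F_def[symmetric] ennreal_power[OF norm_ge_zero] by (rule nn_integral_add[symmetric]) measurable
    also have "\<dots> = (NINT x. 2 * (ennreal (cmod (F (x - z n))))^2 + 2 * (ennreal (cmod (F x)))^2)"
    proof (rule nn_integral_cong)
      fix x
      have "ennreal (g n x) + ennreal ((cmod (F (x - z n) - F x))^2) = ennreal (2 * (cmod (F (x - z n)))^2 + 2 * (cmod (F x))^2)"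
      proof -
        have "g n x + (cmod (F (x - z n) - F x))^2 = 2 * (cmod (F (x - z n)))^2 + 2 * (cmod (F x))^2" by (simp add: g_def)
        then show ?thesis by (simp only: ennreal_plus[OF g0 zero_le_power2, symmetric])
      qed
      then show "ennreal (g n x) + ennreal ((cmod (F (x - z n) - F x))^2) = 2 * (ennreal (cmod (F (x - z n))))^2 + 2 * (ennreal (cmod (F x)))^2"
        by (simp add: ennreal_mult ennreal_power)
    qed
    also have "\<dots> = 2 * n2 (\<lambda>x. F (x - z n)) + 2 * n2 F"
      by (simp add: nn_integral_add nn_integral_cmult n2_def)
    also have "\<dots> = 2 * n2 F + 2 * n2 F" by (subst n2_translate[of F]) measurable
    also have "\<dots> = ennreal (4 * I)" using I0 by (simp add: nI ennreal_mult flip: distrib_right)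
    finally show ?thesis .
  qed
  \<comment> \<open>Fatou bounds \<open>A\<close> from below by the whole of \<open>4 I\<close>; as
    \<open>A\<close> and \<open>osc\<close> add up to that constant, nothing is left for
    \<open>osc\<close> in the limit.\<close>
  have low: "ennreal (4 * I) \<le> liminf A"
  proof -
    have "ennreal (4 * I) = (NINT x. 4 * (ennreal (cmod (F x)))^2)"
      using I0 by (simp add: nn_integral_cmult nI[unfolded n2_def] ennreal_mult)
    also have "\<dots> = (NINT x. liminf (\<lambda>n. ennreal (g n x)))"
    proof (rule nn_integral_cong_AE, use AE_pt_neq[of 0] in eventually_elim)
      fix x :: pt assume x: "x \<noteq> 0"
      have "(\<lambda>n. x - z n) \<longlonglongrightarrow> x - 0" by (intro tendsto_intros z)
      then have "(\<lambda>n. x - z n) \<longlonglongrightarrow> x" by simp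
      then have Fl: "(\<lambda>n. F (x - z n)) \<longlonglongrightarrow> F x" unfolding F_def by (rule isCont_tendsto_compose[OF Fd_isCont[OF x]])
      have "(\<lambda>n. ennreal (g n x)) \<longlonglongrightarrow> ennreal (2 * (cmod (F x))^2 + 2 * (cmod (F x))^2 - (cmod (F x - F x))^2)"
        unfolding g_def by (intro tendsto_intros Fl)
      then have "liminf (\<lambda>n. ennreal (g n x)) = ennreal (2 * (cmod (F x))^2 + 2 * (cmod (F x))^2 - (cmod (F x - F x))^2)"
        by (intro lim_imp_Liminf) auto
      also have "\<dots> = 4 * (ennreal (cmod (F x)))^2" by (simp add: ennreal_mult ennreal_power)
      finally show "4 * (ennreal (cmod (F x)))^2 = liminf (\<lambda>n. ennreal (g n x))" by simp
    qed
    also have "\<dots> \<le> liminf A" unfolding A_def by (rule nn_integral_liminf) measurable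
    finally show ?thesis .
  qed
  have up: "A n \<le> ennreal (4 * I)" for n using sum[of n] by (metis le_iff_add)
  have "limsup A \<le> ennreal (4 * I)"
    by (rule Limsup_bounded) (simp add: up)
  moreover have "liminf A \<le> limsup A" by (rule Liminf_le_Limsup) simp
  ultimately have "liminf A = ennreal (4 * I)" "limsup A = ennreal (4 * I)" using low by auto
  then have "A \<longlonglongrightarrow> ennreal (4 * I)" by (simp add: tendsto_iff_Liminf_eq_Limsup)
  moreover have "osc \<kappa> (z n) = ennreal (4 * I) - A n" for n
    using sum[of n] up[of n] by (metis ennreal_add_diff_cancel_left ennreal_neq_top neq_top_trans)
  moreover have "(\<lambda>n. ennreal (4 * I) - A n) \<longlonglongrightarrow> ennreal (4 * I) - ennreal (4 * I)" if "A \<longlonglongrightarrow> ennreal (4 * I)"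
    by (intro tendsto_diff_ennreal tendsto_const that) auto
  ultimately show ?thesis by simp
qed

lemma osc_meas: "osc \<kappa> \<in> borel_measurable borel"
  unfolding osc_def[abs_def] n2_def by measurable

text \<open>Integrating over the original variable first, translation invariance removes
  \<open>eps\<close>, so these norms are constant along the family.\<close>

lemma HSk_kP: assumes V: "integrable lborel V" and k: "0 < Re \<kappa>"
  shows "HSk (kP V \<kappa> eps)" and "hs (kP V \<kappa> eps) = n2 (Fd \<kappa> 0) * (NINT y. ennreal \<bar>V y\<bar>)"
    and "HSk (kQ V \<kappa> eps)" and "hs (kQ V \<kappa> eps) = n2 (Fd \<kappa> 0) * (NINT y. ennreal \<bar>V y\<bar>)"
proof -
  have [measurable]: "V \<in> borel_measurable borel" using V by auto
  note [measurable] = vfun_meas[of V]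
  have mP: "(\<lambda>(x, y). kP V \<kappa> eps x y) \<in> borel_measurable (lborel \<Otimes>\<^sub>M lborel)" unfolding kP_def by measurable
  have mQ: "(\<lambda>(x, y). kQ V \<kappa> eps x y) \<in> borel_measurable (lborel \<Otimes>\<^sub>M lborel)" unfolding kQ_def by measurable
  have fin: "n2 (Fd \<kappa> 0) * (NINT y. ennreal \<bar>V y\<bar>) < \<infinity>"
    using V L2_n2[OF Fd_L2[OF k]] by (simp add: integrable_iff_bounded ennreal_mult_less_top)
  have t1: "(NINT x. (ennreal (cmod (Fd \<kappa> 0 (x - w))))^2) = n2 (Fd \<kappa> 0)" for w
    unfolding n2_def by (rule nn_integral_translate(1)) measurable
  have "hs (kP V \<kappa> eps) = (NINT y. NINT x. (ennreal (cmod (kP V \<kappa> eps x y)))^2)"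
    unfolding hs_def by (rule lborel_Tonelli) (use mP in measurable)
  also have "\<dots> = (NINT y. n2 (Fd \<kappa> 0) * ennreal \<bar>V y\<bar>)"
    by (intro nn_integral_cong) (simp add: kP_def norm_mult ennreal_mult power_mult_distrib vfun_sq_nn nn_integral_multc t1)
  also have "\<dots> = n2 (Fd \<kappa> 0) * (NINT y. ennreal \<bar>V y\<bar>)" by (rule nn_integral_cmult) measurable
  finally show P: "hs (kP V \<kappa> eps) = n2 (Fd \<kappa> 0) * (NINT y. ennreal \<bar>V y\<bar>)" .
  have t2: "(NINT x. (ennreal (cmod (Fd \<kappa> 0 (w - x))))^2) = n2 (Fd \<kappa> 0)" for w
    unfolding n2_def by (rule nn_integral_translate(2)) measurable
  have "hs (kQ V \<kappa> eps) = (NINT y. n2 (Fd \<kappa> 0) * ennreal \<bar>V y\<bar>)"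
    unfolding hs_def
    by (intro nn_integral_cong) (simp add: kQ_def norm_mult abs_ufun ennreal_mult power_mult_distrib vfun_sq_nn nn_integral_cmult t2 mult.commute)
  also have "\<dots> = n2 (Fd \<kappa> 0) * (NINT y. ennreal \<bar>V y\<bar>)" by (rule nn_integral_cmult) measurable
  finally show Q: "hs (kQ V \<kappa> eps) = n2 (Fd \<kappa> 0) * (NINT y. ennreal \<bar>V y\<bar>)" .
  show "HSk (kP V \<kappa> eps)" "HSk (kQ V \<kappa> eps)" using mP mQ P Q fin by (simp_all add: HSk_def)
qed

definition HB :: "(pt => real) => complex => real" where
  "HB V \<kappa> = sqrt (enn2real (n2 (Fd \<kappa> 0) * (NINT y. ennreal \<bar>V y\<bar>)))"

lemma HB_nonneg: "0 \<le> HB V \<kappa>" by (simp add: HB_def)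

lemma hsn_kP: assumes "integrable lborel V" "0 < Re \<kappa>"
  shows "hsn (kP V \<kappa> eps) = HB V \<kappa>" "hsn (kQ V \<kappa> eps) = HB V \<kappa>"
  by (simp_all add: hsn_def HB_def HSk_kP[OF assms])

lemma tendsto_at_right_seqI:
  assumes "\<And>t. (\<And>n. 0 < t n) ==> t \<longlonglongrightarrow> (0::real) ==> (\<lambda>n. f (t n)) \<longlonglongrightarrow> L"
  shows "(f \<longlongrightarrow> L) (at_right 0)"
  unfolding tendsto_at_iff_sequentially using assms by (auto simp: o_def)

lemma hsn_tendsto_0I:
  assumes "((\<lambda>eps. hs (k eps)) \<longlongrightarrow> 0) F" shows "((\<lambda>eps. hsn (k eps)) \<longlongrightarrow> 0) F"
proof -
  have "((\<lambda>eps. enn2real (hs (k eps))) \<longlongrightarrow> 0) F" using assms by (intro tendsto_enn2real) simp_all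
  from tendsto_real_sqrt[OF this] show ?thesis by (simp add: hsn_def)
qed

text \<open>The squared norm of either difference is the integral of \<open>|V y|\<close> times
  \<open>osc\<close> at \<open>eps y\<close>; \<open>osc\<close> is bounded and tends to 0, and
  \<open>V\<close> is integrable.\<close>

lemma hsn_kP_diff_tendsto:
  assumes V: "integrable lborel V" and k: "0 < Re \<kappa>"
  shows "((\<lambda>eps. hsn (\<lambda>x y. kP V \<kappa> eps x y - kP V \<kappa> 0 x y)) \<longlongrightarrow> 0) (at_right 0)"
    and "((\<lambda>eps. hsn (\<lambda>x y. kQ V \<kappa> eps x y - kQ V \<kappa> 0 x y)) \<longlongrightarrow> 0) (at_right 0)"
proof -
  have [measurable]: "V \<in> borel_measurable borel" using V by auto
  note [measurable] = vfun_meas[of V] osc_meas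
  have lim: "((\<lambda>eps. NINT y. ennreal \<bar>V y\<bar> * osc \<kappa> (eps *\<^sub>R y)) \<longlongrightarrow> 0) (at_right 0)"
  proof (rule tendsto_at_right_seqI)
    fix t assume t: "\<And>n. 0 < t n" "t \<longlonglongrightarrow> (0::real)"
    have "(\<lambda>n. NINT y. ennreal \<bar>V y\<bar> * osc \<kappa> (t n *\<^sub>R y)) \<longlonglongrightarrow> (\<integral>\<^sup>+y. 0 \<partial>(lborel :: pt measure))"
    proof (rule nn_integral_dominated_convergence[where w="\<lambda>y. ennreal \<bar>V y\<bar> * (4 * n2 (Fd \<kappa> 0))"])
      show "AE y in lborel. ennreal \<bar>V y\<bar> * osc \<kappa> (t n *\<^sub>R y) \<le> ennreal \<bar>V y\<bar> * (4 * n2 (Fd \<kappa> 0))" for n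
        by (intro AE_I2 mult_left_mono osc_le k) auto
      show "(NINT y. ennreal \<bar>V y\<bar> * (4 * n2 (Fd \<kappa> 0))) < \<infinity>"
        using V L2_n2[OF Fd_L2[OF k], of 0] by (simp add: nn_integral_multc integrable_iff_bounded ennreal_mult_less_top)
      show "AE y in lborel. (\<lambda>n. ennreal \<bar>V y\<bar> * osc \<kappa> (t n *\<^sub>R y)) \<longlonglongrightarrow> 0"
      proof (rule AE_I2)
        fix y :: pt
        have "(\<lambda>n. t n *\<^sub>R y) \<longlonglongrightarrow> 0 *\<^sub>R y" by (intro tendsto_intros t)
        then have "(\<lambda>n. osc \<kappa> (t n *\<^sub>R y)) \<longlonglongrightarrow> 0" by (intro osc_tendsto_0 k) simp
        then have "(\<lambda>n. ennreal \<bar>V y\<bar> * osc \<kappa> (t n *\<^sub>R y)) \<longlonglongrightarrow> ennreal \<bar>V y\<bar> * 0"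
          by (intro tendsto_mult_ennreal tendsto_const) auto
        then show "(\<lambda>n. ennreal \<bar>V y\<bar> * osc \<kappa> (t n *\<^sub>R y)) \<longlonglongrightarrow> 0" by simp
      qed
    qed measurable
    then show "(\<lambda>n. NINT y. ennreal \<bar>V y\<bar> * osc \<kappa> (t n *\<^sub>R y)) \<longlonglongrightarrow> 0" by simp
  qed
  have mP: "(\<lambda>(x, y). kP V \<kappa> eps x y) \<in> borel_measurable (lborel \<Otimes>\<^sub>M lborel)" for eps unfolding kP_def by measurable
  have P: "hs (\<lambda>x y. kP V \<kappa> eps x y - kP V \<kappa> 0 x y) = (NINT y. ennreal \<bar>V y\<bar> * osc \<kappa> (eps *\<^sub>R y))" for eps
  proof -
    have "hs (\<lambda>x y. kP V \<kappa> eps x y - kP V \<kappa> 0 x y) = (NINT y. NINT x. (ennreal (cmod (kP V \<kappa> eps x y - kP V \<kappa> 0 x y)))^2)"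
      unfolding hs_def by (rule lborel_Tonelli) (use mP in measurable)
    also have "\<dots> = (NINT y. ennreal \<bar>V y\<bar> * osc \<kappa> (eps *\<^sub>R y))"
    proof (rule nn_integral_cong)
      fix y
      have "(ennreal (cmod (kP V \<kappa> eps x y - kP V \<kappa> 0 x y)))^2 = ennreal \<bar>V y\<bar> * (ennreal (cmod (Fd \<kappa> 0 (x - eps *\<^sub>R y) - Fd \<kappa> 0 x)))^2" for x
      proof -
        have "kP V \<kappa> eps x y - kP V \<kappa> 0 x y = (Fd \<kappa> 0 (x - eps *\<^sub>R y) - Fd \<kappa> 0 x) * of_real (vfun V y)"
          by (simp add: kP_def left_diff_distrib)
        then show ?thesis by (simp add: norm_mult ennreal_mult power_mult_distrib vfun_sq_nn mult.commute)
      qed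
      then show "(NINT x. (ennreal (cmod (kP V \<kappa> eps x y - kP V \<kappa> 0 x y)))^2) = ennreal \<bar>V y\<bar> * osc \<kappa> (eps *\<^sub>R y)"
        by (simp add: osc_def n2_def nn_integral_cmult)
    qed
    finally show ?thesis .
  qed
  show "((\<lambda>eps. hsn (\<lambda>x y. kP V \<kappa> eps x y - kP V \<kappa> 0 x y)) \<longlongrightarrow> 0) (at_right 0)"
    by (rule hsn_tendsto_0I) (simp only: P lim)
  have Q: "hs (\<lambda>x y. kQ V \<kappa> eps x y - kQ V \<kappa> 0 x y) = (NINT y. ennreal \<bar>V y\<bar> * osc \<kappa> (eps *\<^sub>R y))" for eps
    unfolding hs_def
    by (intro nn_integral_cong)
       (simp add: kQ_def osc_def n2_def norm_mult abs_ufun ennreal_mult power_mult_distrib vfun_sq_nn nn_integral_cmult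
          Fd_even[of \<kappa> "eps *\<^sub>R _"] Fd_even[of \<kappa> 0, simplified] flip: right_diff_distrib)
  show "((\<lambda>eps. hsn (\<lambda>x y. kQ V \<kappa> eps x y - kQ V \<kappa> 0 x y)) \<longlongrightarrow> 0) (at_right 0)"
    by (rule hsn_tendsto_0I) (simp only: Q lim)
qed

text \<open>Dominated convergence in \<open>y\<close> for almost every \<open>x\<close>, and then in
  \<open>x\<close>. The diagonal may be ignored because single points are null sets.\<close>

lemma hs_dominated_tendsto:
  assumes m: "\<And>eps. (\<lambda>(x, y). k eps x y) \<in> borel_measurable (lborel \<Otimes>\<^sub>M lborel)"
    and wm: "(\<lambda>(x, y). w x y) \<in> borel_measurable (lborel \<Otimes>\<^sub>M lborel)"
    and wf: "(NINT x. NINT y. w x y) < \<infinity>"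
    and b: "\<And>eps x y. 0 < eps ==> eps \<le> 1 ==> x \<noteq> y ==> (ennreal (cmod (k eps x y)))^2 \<le> w x y"
    and lim: "\<And>x y. x \<noteq> y ==> ((\<lambda>eps. k eps x y) \<longlongrightarrow> 0) (at_right (0::real))"
  shows "((\<lambda>eps. hsn (k eps)) \<longlongrightarrow> 0) (at_right 0)"
proof (rule hsn_tendsto_0I, rule tendsto_at_right_seqI)
  fix t' assume t': "\<And>n. 0 < t' n" "t' \<longlonglongrightarrow> (0::real)"
  \<comment> \<open>The majorant is assumed for parameters up to 1 only; capping alters finitely
    many terms of the sequence.\<close>
  define t where "t n = min 1 (t' n)" for n
  have t: "0 < t n" "t n \<le> 1" for n using t'(1) by (auto simp: t_def)
  have tl: "t \<longlonglongrightarrow> 0" unfolding t_def using tendsto_min[OF tendsto_const[of 1] t'(2)] by simp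
  note [measurable] = m wm meas_section[OF m] meas_section[OF wm]
  have ptl: "(\<lambda>n. (ennreal (cmod (k (t n) x y)))^2) \<longlonglongrightarrow> 0" if "x \<noteq> y" for x y
  proof -
    have "filterlim t (at_right 0) sequentially" using tl t(1) by (simp add: filterlim_at order_less_imp_not_eq2)
    from filterlim_compose[OF lim[OF that] this] have "(\<lambda>n. k (t n) x y) \<longlonglongrightarrow> 0" .
    then have "(\<lambda>n. ennreal ((cmod (k (t n) x y))^2)) \<longlonglongrightarrow> ennreal ((cmod 0)^2)" by (intro tendsto_intros)
    then show ?thesis by (simp add: ennreal_power)
  qed
  have bb: "(NINT y. (ennreal (cmod (k (t n) x y)))^2) \<le> (NINT y. w x y)" for n x
    by (rule nn_integral_mono_AE, use AE_pt_neq[of x] in eventually_elim) (auto intro!: b t)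
  have "AE x in lborel. (NINT y. w x y) \<noteq> \<infinity>"
    by (rule nn_integral_noteq_infinite) (use wf in auto)
  then have AE: "AE x in lborel. (\<lambda>n. NINT y. (ennreal (cmod (k (t n) x y)))^2) \<longlonglongrightarrow> 0"
  proof eventually_elim
    fix x assume fin: "(NINT y. w x y) \<noteq> \<infinity>"
    have "(\<lambda>n. NINT y. (ennreal (cmod (k (t n) x y)))^2) \<longlonglongrightarrow> (\<integral>\<^sup>+y. 0 \<partial>(lborel :: pt measure))"
    proof (rule nn_integral_dominated_convergence[where w="w x"])
      show "AE y in lborel. (ennreal (cmod (k (t n) x y)))^2 \<le> w x y" for n
        using AE_pt_neq[of x] by eventually_elim (auto intro!: b t)
      show "AE y in lborel. (\<lambda>n. (ennreal (cmod (k (t n) x y)))^2) \<longlonglongrightarrow> 0"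
        using AE_pt_neq[of x] by eventually_elim (auto intro!: ptl)
      show "(NINT y. w x y) < \<infinity>" using fin by (simp add: less_top)
    qed measurable
    then show "(\<lambda>n. NINT y. (ennreal (cmod (k (t n) x y)))^2) \<longlonglongrightarrow> 0" by simp
  qed
  have "(\<lambda>n. hs (k (t n))) \<longlonglongrightarrow> (\<integral>\<^sup>+y. 0 \<partial>(lborel :: pt measure))"
    unfolding hs_def
  proof (rule nn_integral_dominated_convergence[where w="\<lambda>x. NINT y. w x y"])
    show "AE x in lborel. (NINT y. (ennreal (cmod (k (t n) x y)))^2) \<le> (NINT y. w x y)" for n
      using bb by simp
  qed (use wf AE in auto)
  then have "(\<lambda>n. hs (k (t n))) \<longlonglongrightarrow> 0" by simp
  moreover have "eventually (\<lambda>n. hs (k (t n)) = hs (k (t' n))) sequentially"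
    using order_tendstoD(2)[OF t'(2), of 1] by (auto simp: t_def min_def elim!: eventually_mono)
  ultimately show "(\<lambda>n. hs (k (t' n))) \<longlonglongrightarrow> 0" by (rule Lim_transform_eventually)
qed

lemma rollnik_majorant_finite:
  assumes V: "rollnik V" and C: "0 \<le> C"
  shows "(NINT x. NINT y. ennreal (C * (\<bar>V x\<bar> * \<bar>V y\<bar> / (dist x y)^2))) < \<infinity>"
    and "(\<lambda>(x, y). ennreal (C * (\<bar>V x\<bar> * \<bar>V y\<bar> / (dist x y)^2))) \<in> borel_measurable (lborel \<Otimes>\<^sub>M lborel)"
proof -
  note [measurable] = rollnik_meas[OF V]
  show "(\<lambda>(x, y). ennreal (C * (\<bar>V x\<bar> * \<bar>V y\<bar> / (dist x y)^2))) \<in> borel_measurable (lborel \<Otimes>\<^sub>M lborel)"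
    unfolding dist_norm by measurable
  have "(NINT x. NINT y. ennreal (C * (\<bar>V x\<bar> * \<bar>V y\<bar> / (dist x y)^2)))
     = (NINT x. NINT y. ennreal C * ennreal (\<bar>V x\<bar> * \<bar>V y\<bar> / (dist x y)^2))"
    by (intro nn_integral_cong ennreal_mult C) simp
  also have "\<dots> = ennreal C * (NINT x. NINT y. ennreal (\<bar>V x\<bar> * \<bar>V y\<bar> / (dist x y)^2))"
    unfolding dist_norm by (simp add: nn_integral_cmult)
  also have "\<dots> < \<infinity>" using V by (simp add: rollnik_def ennreal_mult_less_top)
  finally show "(NINT x. NINT y. ennreal (C * (\<bar>V x\<bar> * \<bar>V y\<bar> / (dist x y)^2))) < \<infinity>" .
qed

lemma kK_meas: "rollnik V ==> (\<lambda>(x, y). kK V \<kappa> x y) \<in> borel_measurable (lborel \<Otimes>\<^sub>M lborel)"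
proof -
  assume V: "rollnik V"
  note [measurable] = vfun_meas[OF rollnik_meas[OF V]]
  show ?thesis unfolding kK_def by measurable
qed

lemma kK_bound: assumes "0 \<le> Re \<kappa>" shows "cmod (kK V \<kappa> x y) \<le> vfun V x * vfun V y / dist x y"
  using mult_left_mono[OF cmod_Fd_le[OF assms, of "x - y"], of "vfun V x * vfun V y"]
  by (simp add: kK_def norm_mult abs_ufun dist_norm ac_simps)

lemma vfun_prod_sq: "(C * (vfun V x * vfun V y / r))^2 = C^2 * (\<bar>V x\<bar> * \<bar>V y\<bar> / r^2)"
proof -
  have "(C * (vfun V x * vfun V y / r))^2 = C^2 * ((vfun V x * vfun V x) * (vfun V y * vfun V y) / r^2)"
    by (simp add: power_mult_distrib power_divide power2_eq_square)
  then show ?thesis by (simp only: vfun_sq)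
qed

lemma kK_tendsto: assumes "x \<noteq> y"
  shows "((\<lambda>eps. kK V (of_real eps * \<kappa>) x y) \<longlongrightarrow> kK V 0 x y) (at_right 0)"
proof -
  have "((\<lambda>eps. of_real (ufun V x) * (exp (- (of_real eps * \<kappa> * of_real (norm (x - y)))) / of_real (4 * pi * norm (x - y))) * of_real (vfun V y))
     \<longlongrightarrow> of_real (ufun V x) * (exp (- (of_real 0 * \<kappa> * of_real (norm (x - y)))) / of_real (4 * pi * norm (x - y))) * of_real (vfun V y)) (at_right 0)"
    using assms by (intro tendsto_intros) auto
  then show ?thesis by (simp add: kK_def Fd_def)
qed

text \<open>The kernels converge off the diagonal, and \<open>1 + B\<close> times the Rollnik kernel
  dominates all the differences.\<close>

lemma hsn_kK_tendsto:
  assumes V: "rollnik V" and k: "0 < Re \<kappa>" and \<eta>: "(\<eta> \<longlongrightarrow> 1) (at_right 0)" "\<And>eps. 0 < eps ==> eps \<le> 1 ==> \<bar>\<eta> eps\<bar> \<le> B"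
  shows "((\<lambda>eps. hsn (\<lambda>x y. kK V 0 x y - of_real (\<eta> eps) * kK V (of_real eps * \<kappa>) x y)) \<longlongrightarrow> 0) (at_right 0)"
proof (rule hs_dominated_tendsto[where w="\<lambda>x y. ennreal ((1 + B)^2 * (\<bar>V x\<bar> * \<bar>V y\<bar> / (dist x y)^2))"])
  note [measurable] = kK_meas[OF V]
  have B: "0 \<le> B" using order_trans[OF abs_ge_zero \<eta>(2)[of 1]] by simp
  show "(\<lambda>(x, y). kK V 0 x y - of_real (\<eta> eps) * kK V (of_real eps * \<kappa>) x y) \<in> borel_measurable (lborel \<Otimes>\<^sub>M lborel)" for eps
    by measurable
  show "(ennreal (cmod (kK V 0 x y - of_real (\<eta> eps) * kK V (of_real eps * \<kappa>) x y)))^2 \<le> ennreal ((1 + B)^2 * (\<bar>V x\<bar> * \<bar>V y\<bar> / (dist x y)^2))"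
    if "0 < eps" "eps \<le> 1" for eps x y
  proof -
    have "cmod (kK V 0 x y - of_real (\<eta> eps) * kK V (of_real eps * \<kappa>) x y) \<le> cmod (kK V 0 x y) + cmod (of_real (\<eta> eps) * kK V (of_real eps * \<kappa>) x y)"
      by (rule norm_triangle_ineq4)
    also have "\<dots> \<le> vfun V x * vfun V y / dist x y + B * (vfun V x * vfun V y / dist x y)"
      unfolding norm_mult norm_of_real using that k \<eta>(2)[OF that] B
      by (intro add_mono mult_mono kK_bound) auto
    finally have "cmod (kK V 0 x y - of_real (\<eta> eps) * kK V (of_real eps * \<kappa>) x y) \<le> (1 + B) * (vfun V x * vfun V y / dist x y)"
      by (simp only: distrib_right mult_1_left)
    then have "(cmod (kK V 0 x y - of_real (\<eta> eps) * kK V (of_real eps * \<kappa>) x y))^2 \<le> ((1 + B) * (vfun V x * vfun V y / dist x y))^2"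
      by (intro power_mono) auto
    then show ?thesis unfolding vfun_prod_sq by (simp add: ennreal_power ennreal_leI)
  qed
  show "((\<lambda>eps. kK V 0 x y - of_real (\<eta> eps) * kK V (of_real eps * \<kappa>) x y) \<longlongrightarrow> 0) (at_right 0)" if "x \<noteq> y" for x y
  proof -
    have "((\<lambda>eps. kK V 0 x y - of_real (\<eta> eps) * kK V (of_real eps * \<kappa>) x y) \<longlongrightarrow> kK V 0 x y - of_real 1 * kK V 0 x y) (at_right 0)"
      by (intro tendsto_intros \<eta> kK_tendsto that)
    then show ?thesis by simp
  qed
qed (intro rollnik_majorant_finite V; simp)+

section \<open>Convergence to the free Laplacian\<close>

lemma eventually_at_right_0_delta:
  assumes "eventually P (at_right (0::real))"
  shows "\<exists>\<delta>>0. \<forall>eps. 0 < eps \<and> eps < \<delta> \<and> eps \<le> 1 --> P eps"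
  using assms by (auto simp: eventually_at_right_field)

lemma eventually_at_right_le_1: "eventually (\<lambda>eps::real. 0 < eps \<and> eps \<le> 1) (at_right 0)"
  unfolding eventually_at_right_field by (auto intro!: exI[of _ 1])

section \<open>The family of scaled potentials and its resolvents\<close>

locale scaled_potential =
  fixes V :: "pt => real" and \<eta> :: "real => real" and d\<eta> :: "nat => real => real"
  assumes VR: "rollnik V" and VL1: "integrable lborel V"
    and eta_smooth: "smooth_01 \<eta> d\<eta>"
    and eta_nonneg: "\<forall>t\<in>{0..1}. \<eta> t \<ge> 0"
    and eta0: "\<eta> 0 = 1"
begin

lemma eta_deriv: "t \<in> {0..1} ==> (\<eta> has_real_derivative d\<eta> 1 t) (at t within {0..1})"
proof -
  assume t: "t \<in> {0..1}"
  have "(d\<eta> 0 has_real_derivative d\<eta> (Suc 0) t) (at t within {0..1})" using eta_smooth t by (auto simp: smooth_01_def)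
  then have "(\<eta> has_real_derivative d\<eta> (Suc 0) t) (at t within {0..1})"
    by (rule has_field_derivative_transform_within[where d=1]) (use eta_smooth t in \<open>auto simp: smooth_01_def\<close>)
  then show ?thesis by simp
qed

lemma at_0_within: "at (0::real) within {0..1} = at_right 0"
  by (rule at_within_Icc_at_right) simp

lemma eta_tendsto: "(\<eta> \<longlongrightarrow> 1) (at_right 0)"
  using DERIV_continuous[OF eta_deriv[of 0]] by (simp add: continuous_within at_0_within eta0)

lemma eta_quotient_tendsto: "((\<lambda>eps. (\<eta> eps - 1) / eps) \<longlongrightarrow> d\<eta> 1 0) (at_right 0)"
  using eta_deriv[of 0] unfolding has_field_derivative_iff at_0_within by (simp add: eta0)

lemma eta_bounded: "\<exists>B\<ge>0. \<forall>t\<in>{0..1}. \<bar>\<eta> t\<bar> \<le> B"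
proof -
  have "continuous_on {0..1} \<eta>"
    unfolding continuous_on_eq_continuous_within using DERIV_continuous[OF eta_deriv] by blast
  then have "bounded (\<eta> ` {0..1})" by (intro compact_imp_bounded compact_continuous_image) auto
  then obtain B where "\<forall>t\<in>{0..1}. \<bar>\<eta> t\<bar> \<le> B" by (auto simp: bounded_iff)
  then show ?thesis by (intro exI[of _ "max B 0"]) (auto simp: le_max_iff_disj)
qed

lemma eta_pos: "eventually (\<lambda>eps. 0 < \<eta> eps) (at_right 0)"
  using order_tendstoD(1)[OF eta_tendsto, of 0] by simp

definition cc :: "real => real => real" where "cc \<sigma> eps = \<eta> eps * eps powr (- \<sigma>)"

lemma Veps_eq: "Veps \<eta> \<sigma> V eps = (\<lambda>x. cc \<sigma> eps * V ((1/eps) *\<^sub>R x))"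
  by (simp add: Veps_def cc_def fun_eq_iff)

lemma cc_nonneg: "0 < eps ==> eps \<le> 1 ==> 0 \<le> cc \<sigma> eps"
  using eta_nonneg by (simp add: cc_def)

text \<open>\<open>eps^2\<close> belongs to the equation for \<open>p\<close>, \<open>eps^3\<close>
  to the formula for \<open>f\<close>. The second form displays the extra factor \<open>eps\<close>
  that is gained when \<open>\<sigma> \<le> 2\<close>; the third has an exponent that stays
  nonnegative up to \<open>\<sigma> = 3\<close>.\<close>

lemma cc_scale: assumes "0 < eps"
  shows "cc \<sigma> eps * eps^2 = \<eta> eps * eps powr (2 - \<sigma>)" "cc \<sigma> eps * eps^3 = \<eta> eps * eps powr (2 - \<sigma>) * eps"
    "cc \<sigma> eps * eps^3 = \<eta> eps * eps powr (3 - \<sigma>)"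
proof -
  have 1: "eps powr (- \<sigma>) * eps^2 = eps powr (2 - \<sigma>)" using assms by (simp add: powr_add[symmetric] flip: powr_numeral)
  have 2: "eps powr (- \<sigma>) * eps^3 = eps powr (3 - \<sigma>)" using assms by (simp add: powr_add[symmetric] flip: powr_numeral)
  show "cc \<sigma> eps * eps^2 = \<eta> eps * eps powr (2 - \<sigma>)" by (simp add: cc_def 1 mult.assoc)
  show "cc \<sigma> eps * eps^3 = \<eta> eps * eps powr (3 - \<sigma>)" by (simp add: cc_def 2 mult.assoc)
  have "cc \<sigma> eps * eps^3 = cc \<sigma> eps * eps^2 * eps" by (simp add: power2_eq_square power3_eq_cube)
  then show "cc \<sigma> eps * eps^3 = \<eta> eps * eps powr (2 - \<sigma>) * eps" by (simp add: cc_def 1 mult.assoc[of "\<eta> eps"])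
qed

lemma rollnik_Veps: "0 < eps ==> eps \<le> 1 ==> rollnik (Veps \<eta> \<sigma> V eps)"
  unfolding Veps_eq by (intro rollnik_scale VR cc_nonneg)

lemma Veps_resolvent_exists:
  "0 < eps ==> eps \<le> 1 ==> Im lam \<noteq> 0 ==> g \<in> L2 ==> \<exists>f. form_resolvent_sol (Veps \<eta> \<sigma> V eps) lam g f"
  using resolvent_exists[OF rollnik_Veps _ _ _] integrable_scale[OF VL1, of eps "cc \<sigma> eps", folded Veps_eq] by blast

lemma rollnik_0: "rollnik (\<lambda>x. 0)" by (simp add: rollnik_def)

lemma free_resolvent_exists: "Im lam \<noteq> 0 ==> g \<in> L2 ==> \<exists>f. free_resolvent_sol lam g f"
  unfolding free_resolvent_sol_def by (intro resolvent_exists rollnik_0) auto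

lemma free_resolvent_eq:
  assumes "Im lam \<noteq> 0" "g \<in> L2" "free_resolvent_sol lam g f"
  shows "AE x in lborel. f x = Gop (csqrt lam) g x" "f \<in> L2"
proof -
  note R = resolvent_equation[OF rollnik_0 assms(1,2) assms(3)[unfolded free_resolvent_sol_def]]
  show "f \<in> L2" by (rule R(3))
  show "AE x in lborel. f x = Gop (csqrt lam) g x"
    using R(1) by (simp add: vfun_def Gop_def)
qed

lemma hsn_kK_le: assumes "0 \<le> Re \<kappa>" shows "hsn (kK V \<kappa>) \<le> hsn (kR V)"
proof -
  have "hs (kK V \<kappa>) \<le> hs (kR V)"
    unfolding hs_def using kK_bound[OF assms, of V]
    by (intro nn_integral_mono power_mono ennreal_leI) (auto simp: kR_def norm_mult norm_divide)
  then have "enn2real (hs (kK V \<kappa>)) \<le> enn2real (hs (kR V))"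
    using HSk_kR[OF VR] by (intro enn2real_mono) (auto simp: HSk_def)
  then show ?thesis by (simp add: hsn_def)
qed

text \<open>For \<open>\<sigma> \<le> 2\<close> it suffices to bound the rescaled unknown \<open>p = u f(eps \<cdot>)\<close> uniformly, because it enters the
  resolvent difference with the extra factor \<open>eps\<close>.\<close>

lemma norm_conv_of_bounded:
  assumes \<sigma>: "\<sigma> \<le> 2"
    and bound: "\<And>lam. Im lam \<noteq> 0 ==> \<exists>C\<ge>0. eventually (\<lambda>eps. \<forall>g p. g \<in> L2 --> p \<in> L2 -->
       (AE y in lborel. p y + of_real (\<eta> eps * eps powr (2 - \<sigma>)) * kop (kK V (of_real eps * csqrt lam)) p y = kop (kQ V (csqrt lam) eps) g y)
       --> L2norm p \<le> C * L2norm g) (at_right 0)"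
  shows "norm_resolvent_conv (\<lambda>eps. form_resolvent_sol (Veps \<eta> \<sigma> V eps)) free_resolvent_sol"
  unfolding norm_resolvent_conv_def resolvents_exist_def
proof (intro conjI allI impI)
  show "\<exists>f. form_resolvent_sol (Veps \<eta> \<sigma> V eps) lam g f" if "Im lam \<noteq> 0" "g \<in> L2" "0 < eps \<and> eps \<le> 1" for lam g eps
    using that Veps_resolvent_exists by blast
  show "\<exists>f. free_resolvent_sol lam g f" if "Im lam \<noteq> 0" "g \<in> L2" for lam g
    using that free_resolvent_exists by blast
  fix lam and e :: real assume im: "Im lam \<noteq> 0" and e: "0 < e"
  define \<kappa> where "\<kappa> = csqrt lam"
  have k: "0 < Re \<kappa>" using csqrt_props[OF im] by (simp add: \<kappa>_def)
  obtain C where C: "0 \<le> C" and ev: "eventually (\<lambda>eps. \<forall>g p. g \<in> L2 --> p \<in> L2 -->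
       (AE y in lborel. p y + of_real (\<eta> eps * eps powr (2 - \<sigma>)) * kop (kK V (of_real eps * \<kappa>)) p y = kop (kQ V \<kappa> eps) g y)
       --> L2norm p \<le> C * L2norm g) (at_right 0)"
    using bound[OF im] unfolding \<kappa>_def by blast
  obtain B where B: "0 \<le> B" "\<And>t. t \<in> {0..1} ==> \<bar>\<eta> t\<bar> \<le> B" using eta_bounded by blast
  have "((\<lambda>eps. B * eps * (HB V \<kappa> * C)) \<longlongrightarrow> B * 0 * (HB V \<kappa> * C)) (at_right 0)"
    by (intro tendsto_intros)
  then have small: "eventually (\<lambda>eps. B * eps * (HB V \<kappa> * C) < e) (at_right 0)"
    using order_tendstoD(2)[of _ "B * 0 * (HB V \<kappa> * C)" _ e] e by simp
  have "eventually (\<lambda>eps. \<forall>g f f0. g \<in> L2 --> form_resolvent_sol (Veps \<eta> \<sigma> V eps) lam g f --> free_resolvent_sol lam g f0 -->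
            L2norm (\<lambda>x. f x - f0 x) \<le> e * L2norm g) (at_right 0)"
    using ev eta_pos eventually_at_right_le_1 small
  proof eventually_elim
    fix eps assume ev: "\<forall>g p. g \<in> L2 --> p \<in> L2 -->
       (AE y in lborel. p y + of_real (\<eta> eps * eps powr (2 - \<sigma>)) * kop (kK V (of_real eps * \<kappa>)) p y = kop (kQ V \<kappa> eps) g y)
       --> L2norm p \<le> C * L2norm g" and ep: "0 < \<eta> eps" and eps: "0 < eps \<and> eps \<le> 1"
      and sm: "B * eps * (HB V \<kappa> * C) < e"
    have cp: "0 < cc \<sigma> eps" using ep eps by (simp add: cc_def)
    show "\<forall>g f f0. g \<in> L2 --> form_resolvent_sol (Veps \<eta> \<sigma> V eps) lam g f --> free_resolvent_sol lam g f0 -->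
            L2norm (\<lambda>x. f x - f0 x) \<le> e * L2norm g"
    proof (intro allI impI)
      fix g f f0 assume g: "g \<in> L2" and s: "form_resolvent_sol (Veps \<eta> \<sigma> V eps) lam g f" and s0: "free_resolvent_sol lam g f0"
      define p where "p = (\<lambda>y. of_real (ufun V y) * f (eps *\<^sub>R y))"
      have eps0: "0 < eps" using eps by simp
      note SE = scaled_equations[OF VR cp eps0 im g s[unfolded Veps_eq], folded \<kappa>_def p_def]
      note F0 = free_resolvent_eq[OF im g s0, folded \<kappa>_def]
      have pC: "L2norm p \<le> C * L2norm g"
        by (rule ev[rule_format, OF g SE(3)]) (use SE(2)[unfolded cc_scale(1)[OF eps0]] in \<open>simp only: p_def\<close>)
      have kL: "kop (kP V \<kappa> eps) p \<in> L2" by (rule kop_L2[OF HSk_kP(1)[OF VL1 k] SE(3)])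
      have AE: "AE x in lborel. f x - f0 x = (- of_real (cc \<sigma> eps * eps^3)) * kop (kP V \<kappa> eps) p x"
        using SE(1) F0(1) by eventually_elim simp
      have "L2norm (\<lambda>x. f x - f0 x) = L2norm (\<lambda>x. (- of_real (cc \<sigma> eps * eps^3)) * kop (kP V \<kappa> eps) p x)"
        by (rule L2norm_cong_AE[OF AE]) (use L2_meas[OF SE(4)] L2_meas[OF F0(2)] L2_meas[OF kL] in auto)
      also have "\<dots> = cc \<sigma> eps * eps^3 * L2norm (kop (kP V \<kappa> eps) p)"
        using cp eps0 unfolding L2norm_cmult norm_minus_cancel norm_of_real by simp
      also have "\<dots> \<le> (B * eps) * (HB V \<kappa> * (C * L2norm g))"
      proof (rule mult_mono)
        have "eps powr (2 - \<sigma>) \<le> 1" using eps \<sigma> by (intro powr_le1) auto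
        moreover have "\<eta> eps \<le> B" using B(2)[of eps] eps by simp
        ultimately have "\<eta> eps * eps powr (2 - \<sigma>) * eps \<le> B * 1 * eps" using ep B eps0 by (intro mult_mono) auto
        then show "cc \<sigma> eps * eps^3 \<le> B * eps" using cc_scale(2)[OF eps0, of \<sigma>] by simp
        have "L2norm (kop (kP V \<kappa> eps) p) \<le> HB V \<kappa> * L2norm p"
          using L2norm_kop[OF HSk_kP(1)[OF VL1 k] SE(3), of eps] by (simp add: hsn_kP[OF VL1 k])
        also have "\<dots> \<le> HB V \<kappa> * (C * L2norm g)" by (intro mult_left_mono pC HB_nonneg)
        finally show "L2norm (kop (kP V \<kappa> eps) p) \<le> HB V \<kappa> * (C * L2norm g)" .
      qed (use B eps in auto)
      also have "\<dots> = B * eps * (HB V \<kappa> * C) * L2norm g" by simp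
      also have "\<dots> \<le> e * L2norm g" using sm by (intro mult_right_mono) auto
      finally show "L2norm (\<lambda>x. f x - f0 x) \<le> e * L2norm g" .
    qed
  qed
  then show "\<exists>\<delta>>0. \<forall>eps. 0 < eps \<and> eps < \<delta> \<and> eps \<le> 1 --> (\<forall>g f f0. g \<in> L2 --> form_resolvent_sol (Veps \<eta> \<sigma> V eps) lam g f --> free_resolvent_sol lam g f0 -->
            L2norm (\<lambda>x. f x - f0 x) \<le> e * L2norm g)"
    by (rule eventually_at_right_0_delta)
qed

lemma L2norm_kQ: assumes "0 < Re \<kappa>" "g \<in> L2" shows "L2norm (kop (kQ V \<kappa> eps) g) \<le> HB V \<kappa> * L2norm g"
  using L2norm_kop[OF HSk_kP(3)[OF VL1 assms(1)] assms(2), of eps] by (simp add: hsn_kP[OF VL1 assms(1)])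

text \<open>The coefficient \<open>eps powr (2 - \<sigma>)\<close> tends to 0 while the operators
  are bounded by the Hilbert-Schmidt norm of the Rollnik kernel. The operator term is eventually at
  most half the norm of \<open>p\<close> and is absorbed.\<close>

theorem norm_conv_subcritical:
  assumes \<sigma>: "\<sigma> < 2"
  shows "norm_resolvent_conv (\<lambda>eps. form_resolvent_sol (Veps \<eta> \<sigma> V eps)) free_resolvent_sol"
proof (rule norm_conv_of_bounded)
  fix lam assume im: "Im lam \<noteq> 0"
  define \<kappa> where "\<kappa> = csqrt lam"
  have k: "0 < Re \<kappa>" using csqrt_props[OF im] by (simp add: \<kappa>_def)
  have "((\<lambda>eps. \<eta> eps * eps powr (2 - \<sigma>) * hsn (kR V)) \<longlongrightarrow> 1 * 0 powr (2 - \<sigma>) * hsn (kR V)) (at_right 0)"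
    using \<sigma> eventually_at_right_less[of "0::real"]
    by (intro tendsto_mult tendsto_const eta_tendsto tendsto_powr' tendsto_ident_at) (auto elim!: eventually_mono)
  then have small: "eventually (\<lambda>eps. \<eta> eps * eps powr (2 - \<sigma>) * hsn (kR V) < 1/2) (at_right 0)"
    by (intro order_tendstoD(2)) auto
  have "eventually (\<lambda>eps. \<forall>g p. g \<in> L2 --> p \<in> L2 -->
       (AE y in lborel. p y + of_real (\<eta> eps * eps powr (2 - \<sigma>)) * kop (kK V (of_real eps * \<kappa>)) p y = kop (kQ V \<kappa> eps) g y)
       --> L2norm p \<le> (2 * HB V \<kappa>) * L2norm g) (at_right 0)"
    using small eta_pos eventually_at_right_le_1
  proof (eventually_elim, intro allI impI)
    fix eps g p assume sm: "\<eta> eps * eps powr (2 - \<sigma>) * hsn (kR V) < 1/2" and ep: "0 < \<eta> eps" and eps: "0 < eps \<and> eps \<le> 1"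
      and g: "g \<in> L2" and p: "p \<in> L2"
      and eq: "AE y in lborel. p y + of_real (\<eta> eps * eps powr (2 - \<sigma>)) * kop (kK V (of_real eps * \<kappa>)) p y = kop (kQ V \<kappa> eps) g y"
    define \<beta> where "\<beta> = \<eta> eps * eps powr (2 - \<sigma>)"
    have \<beta>: "0 \<le> \<beta>" using ep by (simp add: \<beta>_def)
    have k': "0 \<le> Re (of_real eps * \<kappa>)" using k eps by simp
    have KL: "kop (kK V (of_real eps * \<kappa>)) p \<in> L2" by (rule kop_L2[OF HSk_kK[OF VR k'] p])
    have QL: "kop (kQ V \<kappa> eps) g \<in> L2" by (rule kop_L2[OF HSk_kP(3)[OF VL1 k] g])
    have "L2norm p = L2norm (\<lambda>y. kop (kQ V \<kappa> eps) g y - of_real \<beta> * kop (kK V (of_real eps * \<kappa>)) p y)"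
      by (rule L2norm_cong_AE) (use eq L2_meas[OF p] L2_meas[OF KL] L2_meas[OF QL] in \<open>auto simp: \<beta>_def algebra_simps elim!: eventually_mono\<close>)
    also have "\<dots> \<le> L2norm (kop (kQ V \<kappa> eps) g) + L2norm (\<lambda>y. of_real \<beta> * kop (kK V (of_real eps * \<kappa>)) p y)"
      by (intro L2norm_triangle_diff QL L2_cmult KL)
    also have "\<dots> \<le> HB V \<kappa> * L2norm g + \<beta> * (hsn (kR V) * L2norm p)"
      unfolding L2norm_cmult norm_of_real abs_of_nonneg[OF \<beta>]
      by (intro add_mono L2norm_kQ k g mult_left_mono \<beta> order_trans[OF L2norm_kop[OF HSk_kK[OF VR k'] p]] mult_right_mono hsn_kK_le k') auto
    also have "\<dots> \<le> HB V \<kappa> * L2norm g + 1/2 * L2norm p"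
      using sm mult_right_mono[of "\<beta> * hsn (kR V)" "1/2" "L2norm p"] by (simp add: \<beta>_def mult.assoc)
    finally show "L2norm p \<le> (2 * HB V \<kappa>) * L2norm g" by simp
  qed
  then show "\<exists>C\<ge>0. eventually (\<lambda>eps. \<forall>g p. g \<in> L2 --> p \<in> L2 -->
       (AE y in lborel. p y + of_real (\<eta> eps * eps powr (2 - \<sigma>)) * kop (kK V (of_real eps * csqrt lam)) p y = kop (kQ V (csqrt lam) eps) g y)
       --> L2norm p \<le> C * L2norm g) (at_right 0)"
    unfolding \<kappa>_def[symmetric] using HB_nonneg by (intro exI[of _ "2 * HB V \<kappa>"]) auto
qed (use \<sigma> in simp)

section \<open>Critical scaling without a resonance\<close>

lemma kop_kK_0: "kop (kK V 0) p x = of_real (ufun V x) * inv_lap_v V p x"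
proof -
  have "Gop 0 (\<lambda>y. of_real (vfun V y) * p y) x = inv_lap_v V p x"
    by (simp add: Gop_def inv_lap_v_def Fd_def dist_norm)
  then show ?thesis by (simp add: kop_kK)
qed

lemma BS_eigfun_iff: "BS_eigfun V p \<longleftrightarrow> p \<in> L2 \<and> \<not> (AE x in lborel. p x = 0) \<and> (AE x in lborel. p x + kop (kK V 0) p x = 0)"
proof -
  have "(AE x in lborel. of_real (ufun V x) * inv_lap_v V p x = - p x) \<longleftrightarrow> (AE x in lborel. p x + kop (kK V 0) p x = 0)"
    by (intro eventually_subst always_eventually allI) (auto simp: kop_kK_0 add_eq_0_iff)
  then show ?thesis by (simp add: BS_eigfun_def)
qed

text \<open>Lower bounds are available for \<open>1 + K\<close> at zero energy. Replacing the actual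
  operator by that limit costs the Hilbert-Schmidt norm of the difference times the norm of
  \<open>p\<close>, a term that can later be absorbed.\<close>

lemma kK_0_defect:
  assumes k: "0 < Re \<kappa>" and eps: "0 < eps" and p: "p \<in> L2"
    and eq: "AE y in lborel. p y + of_real \<beta> * kop (kK V (of_real eps * \<kappa>)) p y = b y" and b: "b \<in> L2"
  shows "L2norm (\<lambda>y. p y + kop (kK V 0) p y) \<le> L2norm b + hsn (\<lambda>x y. kK V 0 x y - of_real \<beta> * kK V (of_real eps * \<kappa>) x y) * L2norm p"
proof -
  define \<kappa>' where "\<kappa>' = of_real eps * \<kappa>"
  note eq = eq[folded \<kappa>'_def]
  have k': "0 \<le> Re \<kappa>'" using k eps by (simp add: \<kappa>'_def)
  have H0: "HSk (kK V 0)" by (rule HSk_kK[OF VR]) simp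
  have H1: "HSk (\<lambda>x y. of_real \<beta> * kK V \<kappa>' x y)" by (rule HSk_cmult[OF HSk_kK[OF VR k']])
  note HD = HSk_diff[OF H0 H1]
  have m: "kop (\<lambda>x y. of_real \<beta> * kK V \<kappa>' x y) p x = of_real \<beta> * kop (kK V \<kappa>') p x" for x
    by (simp add: kop_def mult.assoc)
  have alg: "a1 + a2 = a3 ==> d = k0 - a2 ==> a1 + k0 = a3 + d" for a1 a2 a3 d k0 :: complex by auto
  have "AE y in lborel. p y + kop (kK V 0) p y = b y + kop (\<lambda>x y. kK V 0 x y - of_real \<beta> * kK V \<kappa>' x y) p y"
    using eq kop_kernel_diff[OF H0 H1 p] unfolding m by eventually_elim (rule alg)
  then have "L2norm (\<lambda>y. p y + kop (kK V 0) p y) = L2norm (\<lambda>y. b y + kop (\<lambda>x y. kK V 0 x y - of_real \<beta> * kK V \<kappa>' x y) p y)"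
    by (rule L2norm_cong_AE) (intro L2_meas L2_add p b kop_L2 H0 HD)+
  also have "\<dots> \<le> L2norm b + L2norm (kop (\<lambda>x y. kK V 0 x y - of_real \<beta> * kK V \<kappa>' x y) p)"
    by (intro L2norm_triangle b kop_L2 HD p)
  also have "\<dots> \<le> L2norm b + hsn (\<lambda>x y. kK V 0 x y - of_real \<beta> * kK V \<kappa>' x y) * L2norm p"
    by (intro add_left_mono L2norm_kop HD p)
  finally show ?thesis unfolding \<kappa>'_def .
qed

text \<open>Without an eigenfunction the lower bound holds on the whole space, which is the case of
  zero weight; half of it survives the perturbation for small \<open>eps\<close>, and
  \<open>p\<close> is bounded uniformly.\<close>

theorem norm_conv_nonresonant:
  assumes nores: "\<not> (\<exists>\<phi>. BS_eigfun V \<phi>)"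
  shows "norm_resolvent_conv (\<lambda>eps. form_resolvent_sol (Veps \<eta> 2 V eps)) free_resolvent_sol"
proof (rule norm_conv_of_bounded)
  fix lam assume im: "Im lam \<noteq> 0"
  define \<kappa> where "\<kappa> = csqrt lam"
  have k: "0 < Re \<kappa>" using csqrt_props[OF im] by (simp add: \<kappa>_def)
  obtain B where B: "0 \<le> B" "\<And>t. t \<in> {0..1} ==> \<bar>\<eta> t\<bar> \<le> B" using eta_bounded by blast
  have H0: "HSk (kK V 0)" by (rule HSk_kK[OF VR]) simp
  have "\<exists>c>0. \<forall>p\<in>L2. (LBINT x. 0 * p x) = 0 --> c * L2norm p \<le> L2norm (\<lambda>x. p x + kop (kK V 0) p x)"
    by (rule id_plus_kop_bounded_below[OF H0 L2_zero]) (use nores BS_eigfun_iff in blast)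
  then obtain c where c: "0 < c" "\<And>p. p \<in> L2 ==> c * L2norm p \<le> L2norm (\<lambda>x. p x + kop (kK V 0) p x)" by auto
  define \<tau> where "\<tau> eps = hsn (\<lambda>x y. kK V 0 x y - of_real (\<eta> eps) * kK V (of_real eps * \<kappa>) x y)" for eps
  have "(\<tau> \<longlongrightarrow> 0) (at_right 0)"
    unfolding \<tau>_def by (rule hsn_kK_tendsto[OF VR k eta_tendsto, of B]) (use B in auto)
  then have small: "eventually (\<lambda>eps. \<tau> eps < c / 2) (at_right 0)"
    using c(1) by (intro order_tendstoD(2)) auto
  have "eventually (\<lambda>eps. \<forall>g p. g \<in> L2 --> p \<in> L2 -->
       (AE y in lborel. p y + of_real (\<eta> eps * eps powr (2 - 2)) * kop (kK V (of_real eps * \<kappa>)) p y = kop (kQ V \<kappa> eps) g y)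
       --> L2norm p \<le> (2 * HB V \<kappa> / c) * L2norm g) (at_right 0)"
    using small eventually_at_right_le_1
  proof (eventually_elim, intro allI impI)
    fix eps g p assume sm: "\<tau> eps < c / 2" and eps: "0 < eps \<and> eps \<le> 1" and g: "g \<in> L2" and p: "p \<in> L2"
      and eq: "AE y in lborel. p y + of_real (\<eta> eps * eps powr (2 - 2)) * kop (kK V (of_real eps * \<kappa>)) p y = kop (kQ V \<kappa> eps) g y"
    have eps0: "0 < eps" using eps by simp
    have QL: "kop (kQ V \<kappa> eps) g \<in> L2" by (rule kop_L2[OF HSk_kP(3)[OF VL1 k] g])
    have "AE y in lborel. p y + of_real (\<eta> eps) * kop (kK V (of_real eps * \<kappa>)) p y = kop (kQ V \<kappa> eps) g y"
      using eq eps0 by simp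
    from kK_0_defect[OF k eps0 p this QL]
    have "c * L2norm p \<le> L2norm (kop (kQ V \<kappa> eps) g) + \<tau> eps * L2norm p"
      using c(2)[OF p] by (simp add: \<tau>_def)
    also have "\<dots> \<le> HB V \<kappa> * L2norm g + c / 2 * L2norm p"
      using sm by (intro add_mono L2norm_kQ k g mult_right_mono) auto
    finally have "c * L2norm p \<le> 2 * HB V \<kappa> * L2norm g" by simp
    then show "L2norm p \<le> (2 * HB V \<kappa> / c) * L2norm g" using c(1) by (simp add: field_simps)
  qed
  then show "\<exists>C\<ge>0. eventually (\<lambda>eps. \<forall>g p. g \<in> L2 --> p \<in> L2 -->
       (AE y in lborel. p y + of_real (\<eta> eps * eps powr (2 - 2)) * kop (kK V (of_real eps * csqrt lam)) p y = kop (kQ V (csqrt lam) eps) g y)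
       --> L2norm p \<le> C * L2norm g) (at_right 0)"
    unfolding \<kappa>_def[symmetric] using HB_nonneg[of V \<kappa>] c(1) by (intro exI[of _ "2 * HB V \<kappa> / c"]) auto
qed simp

end

section \<open>Strong convergence for positive potentials\<close>

lemma smooth_fun_imp_Ck: "smooth_fun f ==> Ck n f"
proof (induction n arbitrary: f)
  case 0
  then show ?case by (auto elim: smooth_fun.cases)
next
  case (Suc n)
  from Suc.prems obtain d where c: "continuous_on UNIV f" and d: "\<And>i. has_partial f i (d i) \<and> smooth_fun (d i)"
    by (auto elim!: smooth_fun.cases dest!: choice)
  show ?case by (rule Ck_Suc_I[OF c, of d]) (use d Suc.IH in auto)
qed

lemma test_fun_mult:
  assumes "\<And>n. Ck n z" "test_fun \<phi>" shows "test_fun (\<lambda>x. z x * \<phi> x)"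
  using assms smooth_fun_imp_Ck unfolding test_fun_def
  by (auto intro!: smooth_fun_Ck Ck_mult elim!: bounded_subset)

lemma has_partial_mult: "has_partial f i d ==> has_partial g i e ==> has_partial (\<lambda>x. f x * g x) i (\<lambda>x. d x * g x + e x * f x)"
  unfolding has_partial_def using DERIV_mult by fastforce

lemma L2_bounded_mult:
  assumes "f \<in> L2" "z \<in> borel_measurable borel" "\<And>x. \<bar>z x\<bar> \<le> B"
  shows "(\<lambda>x. of_real (z x) * f x) \<in> L2"
proof (rule L2_bound[OF L2_cmult[OF assms(1), of "of_real B"]])
  note [measurable] = L2_meas[OF assms(1)] assms(2)
  show "(\<lambda>x. of_real (z x) * f x) \<in> borel_measurable borel" by measurable
  show "cmod (of_real (z x) * f x) \<le> cmod (of_real B * f x)" for x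
    unfolding norm_mult using assms(3)[of x] by (intro mult_right_mono) auto
qed

text \<open>The multiplier times a test function is again a test function, and the product rule
  redistributes the terms. Boundedness of the multiplier and of its partial derivatives keeps all
  products in \<open>L2\<close>.\<close>

lemma H1_grad_mult:
  assumes f: "H1_grad f D" and z: "\<And>n. Ck n z" "\<And>i. has_partial z i (dz i)" "\<And>i. continuous_on UNIV (dz i)"
    and b: "\<And>x. \<bar>z x\<bar> \<le> B" "\<And>i x. \<bar>dz i x\<bar> \<le> B"
  shows "H1_grad (\<lambda>x. of_real (z x) * f x) (\<lambda>i x. of_real (z x) * D i x + of_real (dz i x) * f x)"
  unfolding H1_grad_def weak_grad_def
proof (intro conjI allI impI)
  have fL: "f \<in> L2" and DL: "\<And>i. D i \<in> L2" using f by (auto simp: H1_grad_def)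
  have zm: "z \<in> borel_measurable borel" "dz i \<in> borel_measurable borel" for i
    by (auto intro!: borel_measurable_continuous_onI z(3) Ck_cont[OF z(1)])
  show zf: "(\<lambda>x. of_real (z x) * f x) \<in> L2" by (rule L2_bounded_mult[OF fL zm(1) b(1)])
  have dzf: "(\<lambda>x. of_real (dz i x) * f x) \<in> L2" for i by (rule L2_bounded_mult[OF fL zm(2) b(2)])
  have zD: "(\<lambda>x. of_real (z x) * D i x) \<in> L2" for i by (rule L2_bounded_mult[OF DL zm(1) b(1)])
  show "(\<lambda>x. of_real (z x) * D i x + of_real (dz i x) * f x) \<in> L2" for i
    by (intro L2_add zD dzf)
  fix \<phi> d i assume tf: "test_fun \<phi>" "has_partial \<phi> i d"
  note T = test_fun_L2[OF tf]
  have "(LBINT x. f x * of_real (dz i x * \<phi> x + d x * z x)) = - (LBINT x. D i x * of_real (z x * \<phi> x))"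
    using f test_fun_mult[OF z(1) tf(1)] has_partial_mult[OF z(2) tf(2)] unfolding H1_grad_def weak_grad_def by blast
  also have "(LBINT x. D i x * of_real (z x * \<phi> x)) = (LBINT x. of_real (z x) * D i x * of_real (\<phi> x))"
    by (simp add: ac_simps)
  also have "(LBINT x. f x * of_real (dz i x * \<phi> x + d x * z x))
     = (LBINT x. of_real (dz i x) * f x * of_real (\<phi> x) + of_real (z x) * f x * of_real (d x))"
    by (simp add: algebra_simps)
  also have "\<dots> = (LBINT x. of_real (dz i x) * f x * of_real (\<phi> x)) + (LBINT x. of_real (z x) * f x * of_real (d x))"
    by (intro Bochner_Integration.integral_add L2_mult_CS(1) zf dzf T)
  finally have E: "(LBINT x. of_real (dz i x) * f x * of_real (\<phi> x)) + (LBINT x. of_real (z x) * f x * of_real (d x))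
     = - (LBINT x. of_real (z x) * D i x * of_real (\<phi> x))" .
  have E2: "(LBINT x. (of_real (z x) * D i x + of_real (dz i x) * f x) * of_real (\<phi> x))
     = (LBINT x. of_real (z x) * D i x * of_real (\<phi> x)) + (LBINT x. of_real (dz i x) * f x * of_real (\<phi> x))"
    unfolding distrib_right by (intro Bochner_Integration.integral_add L2_mult_CS(1) zD dzf T)
  have alg: "P + Q = - Z ==> Q = - (Z + P)" for P Q Z :: complex by (metis add.commute add_diff_cancel diff_conv_add_uminus minus_add_distrib)
  show "(LBINT x. of_real (z x) * f x * of_real (d x))
     = - (LBINT x. (of_real (z x) * D i x + of_real (dz i x) * f x) * of_real (\<phi> x))"
    unfolding E2 by (rule alg[OF E])
qed

text \<open>The difference \<open>f - F\<close> need not have small potential energy, so the form equation is tested with \<open>f - k\<close>,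
  where \<open>k\<close> agrees with \<open>F\<close> except near the origin.\<close>

lemma form_energy_estimate:
  assumes W: "rollnik W" "AE x in lborel. 0 \<le> W x" and im: "Im lam \<noteq> 0"
    and s: "form_resolvent_sol W lam g f"
    and F: "H1_grad F DF" "\<And>h Dh. H1_grad h Dh ==> (\<Sum>i\<in>UNIV. LBINT x. DF i x * cnj (Dh i x))
       + lam * (LBINT x. F x * cnj (h x)) = (LBINT x. g x * cnj (h x))"
    and m: "H1_grad m Dm"
  shows "L2norm (\<lambda>x. f x - F x) \<le> (1 + (cmod lam + 1) / \<bar>Im lam\<bar>) *
     ((\<Sum>i\<in>UNIV. L2norm (Dm i)) + cmod lam * L2norm m + L2norm (\<lambda>x. of_real (vfun W x) * (F x - m x)))"
proof -
  obtain Df where H: "H1_grad f Df" and eq: "\<And>h Dh. H1_grad h Dh ==>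
           (\<Sum>i\<in>UNIV. LBINT x. Df i x * cnj (Dh i x)) + (LBINT x. of_real (W x) * f x * cnj (h x))
           + lam * (LBINT x. f x * cnj (h x)) = (LBINT x. g x * cnj (h x))"
    using s unfolding form_resolvent_sol_def by blast
  note [measurable] = vfun_meas[OF rollnik_meas[OF W(1)]] rollnik_meas[OF W(1)]
  define w where "w = (\<lambda>x. f x - F x)"
  define Dw where "Dw = (\<lambda>i x. Df i x - DF i x)"
  define k where "k = (\<lambda>x. F x - m x)"
  define Dk where "Dk = (\<lambda>i x. DF i x - Dm i x)"
  define h where "h = (\<lambda>x. f x - k x)"
  define Dh where "Dh = (\<lambda>i x. Df i x - Dk i x)"
  have Hk: "H1_grad k Dk" unfolding k_def Dk_def by (rule H1_grad_diff[OF F(1) m])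
  have Hh: "H1_grad h Dh" unfolding h_def Dh_def by (rule H1_grad_diff[OF H Hk])
  have Hw: "H1_grad w Dw" unfolding w_def Dw_def by (rule H1_grad_diff[OF H F(1)])
  have L: "f \<in> L2" "F \<in> L2" "w \<in> L2" "m \<in> L2" "k \<in> L2" "h \<in> L2"
    and DL: "\<And>i. Df i \<in> L2" "\<And>i. DF i \<in> L2" "\<And>i. Dw i \<in> L2" "\<And>i. Dm i \<in> L2" "\<And>i. Dh i \<in> L2"
    using H F(1) Hw m Hk Hh by (auto simp: H1_grad_def)
  note [measurable] = L2_meas[OF L(1)] L2_meas[OF L(5)]
  define vf where "vf = (\<lambda>x. of_real (vfun W x) * f x)"
  define vk where "vk = (\<lambda>x. of_real (vfun W x) * k x)"
  have vL: "vf \<in> L2" "vk \<in> L2" unfolding vf_def vk_def by (rule v_H1_L2[OF W(1) H] v_H1_L2[OF W(1) Hk])+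
  have hw: "h x = w x + m x" "Dh i x = Dw i x + Dm i x" for x i by (simp_all add: h_def k_def w_def Dh_def Dk_def Dw_def)
  have Weq: "(LBINT x. of_real (W x) * f x * cnj (h x)) = (LBINT x. vf x * cnj (vf x) - vf x * cnj (vk x))"
  proof (rule integral_cong_AE)
    show "AE x in lborel. of_real (W x) * f x * cnj (h x) = vf x * cnj (vf x) - vf x * cnj (vk x)"
      using W(2)
    proof eventually_elim
      fix x assume "0 \<le> W x"
      then have "of_real (W x) = (of_real (vfun W x) * of_real (vfun W x) :: complex)"
        using vfun_sq[of W x] by (simp flip: of_real_mult)
      then show "of_real (W x) * f x * cnj (h x) = vf x * cnj (vf x) - vf x * cnj (vk x)"
        by (simp add: vf_def vk_def h_def algebra_simps)
    qed
  qed (use L2_meas[OF L2_cnj[OF L(6)]] L2_meas[OF vL(1)] L2_meas[OF L2_cnj[OF vL(1)]] L2_meas[OF L2_cnj[OF vL(2)]] in measurable)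
  have Weq': "(LBINT x. of_real (W x) * f x * cnj (h x)) = of_real ((L2norm vf)^2) - (LBINT x. vf x * cnj (vk x))"
    unfolding Weq L2_self[OF vL(1), symmetric] by (intro Bochner_Integration.integral_diff L2_mult_cnj vL)
  have Dd: "(LBINT x. Df i x * cnj (Dh i x)) - (LBINT x. DF i x * cnj (Dh i x))
    = of_real ((L2norm (Dw i))^2) + (LBINT x. Dw i x * cnj (Dm i x))" for i
  proof -
    have "(LBINT x. Df i x * cnj (Dh i x)) - (LBINT x. DF i x * cnj (Dh i x)) = (LBINT x. Df i x * cnj (Dh i x) - DF i x * cnj (Dh i x))"
      by (intro Bochner_Integration.integral_diff[symmetric] L2_mult_cnj DL)
    also have "\<dots> = (LBINT x. Dw i x * cnj (Dw i x) + Dw i x * cnj (Dm i x))"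
      by (simp add: hw Dw_def algebra_simps)
    also have "\<dots> = (LBINT x. Dw i x * cnj (Dw i x)) + (LBINT x. Dw i x * cnj (Dm i x))"
      by (intro Bochner_Integration.integral_add L2_mult_cnj DL)
    finally show ?thesis by (simp only: L2_self[OF DL(3)])
  qed
  have dd: "(LBINT x. f x * cnj (h x)) - (LBINT x. F x * cnj (h x))
    = of_real ((L2norm w)^2) + (LBINT x. w x * cnj (m x))"
  proof -
    have "(LBINT x. f x * cnj (h x)) - (LBINT x. F x * cnj (h x)) = (LBINT x. f x * cnj (h x) - F x * cnj (h x))"
      by (intro Bochner_Integration.integral_diff[symmetric] L2_mult_cnj L)
    also have "\<dots> = (LBINT x. w x * cnj (w x) + w x * cnj (m x))"
      by (simp add: hw w_def algebra_simps)
    also have "\<dots> = (LBINT x. w x * cnj (w x)) + (LBINT x. w x * cnj (m x))"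
      by (intro Bochner_Integration.integral_add L2_mult_cnj L)
    finally show ?thesis by (simp only: L2_self[OF L(3)])
  qed
  define X where "X = (\<Sum>i\<in>UNIV. (L2norm (Dw i))^2) + (L2norm vf)^2"
  define Y where "Y = (L2norm w)^2"
  define B where "B = (LBINT x. vf x * cnj (vk x)) - (\<Sum>i\<in>UNIV. LBINT x. Dw i x * cnj (Dm i x)) - lam * (LBINT x. w x * cnj (m x))"
  define S where "S = (\<Sum>i\<in>UNIV. L2norm (Dm i)) + cmod lam * L2norm m + L2norm vk"
  define R where "R = sqrt (X + Y)"
  have X0: "0 \<le> X" and Y0: "0 \<le> Y" by (auto simp: X_def Y_def intro!: sum_nonneg add_nonneg_nonneg)
  have S0: "0 \<le> S" by (auto simp: S_def intro!: sum_nonneg add_nonneg_nonneg)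
  \<comment> \<open>The difference of the form equations for \<open>f\<close> and \<open>F\<close>,
    both tested with \<open>h = w + m\<close>. Squares are collected on the left; \<open>B\<close>
    contains the cross terms with \<open>m\<close>, its gradient and \<open>vk\<close>.\<close>
  have E: "of_real X + lam * of_real Y = B"
  proof -
    have "(\<Sum>i\<in>UNIV. LBINT x. Df i x * cnj (Dh i x)) - (\<Sum>i\<in>UNIV. LBINT x. DF i x * cnj (Dh i x))
      + (LBINT x. of_real (W x) * f x * cnj (h x))
      + lam * ((LBINT x. f x * cnj (h x)) - (LBINT x. F x * cnj (h x))) = 0"
      using eq[OF Hh] F(2)[OF Hh] by (simp add: algebra_simps)
    then show ?thesis
      unfolding sum_subtractf[symmetric] Dd Weq' dd
      by (simp add: X_def Y_def B_def sum.distrib algebra_simps)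
  qed
  have RR: "R^2 = X + Y" "0 \<le> R" using X0 Y0 by (simp_all add: R_def)
  have le: "a \<le> R" if "a^2 \<le> X + Y" for a using that RR by (simp add: R_def real_le_rsqrt)
  have "(L2norm (Dw i))^2 \<le> (\<Sum>i\<in>UNIV. (L2norm (Dw i))^2)" for i by (rule member_le_sum) auto
  then have Dwl: "L2norm (Dw i) \<le> R" for i by (intro le) (auto simp: X_def Y_def intro!: add_increasing2)
  have "0 \<le> (\<Sum>i\<in>UNIV. (L2norm (Dw i))^2)" by (simp add: sum_nonneg)
  then have vfl: "L2norm vf \<le> R" and wl: "L2norm w \<le> R" by (simp_all add: le X_def Y_def)
  have "cmod B \<le> cmod (LBINT x. vf x * cnj (vk x)) + cmod (\<Sum>i\<in>UNIV. LBINT x. Dw i x * cnj (Dm i x)) + cmod (lam * (LBINT x. w x * cnj (m x)))"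
    unfolding B_def by (rule order_trans[OF norm_triangle_ineq4] add_right_mono norm_triangle_ineq4)+
  also have "\<dots> \<le> R * L2norm vk + (\<Sum>i\<in>UNIV. R * L2norm (Dm i)) + cmod lam * (R * L2norm m)"
    unfolding norm_mult
    by (intro add_mono mult_left_mono sum_norm_le order_trans[OF L2_mult_cnj(2)] L vL DL mult_right_mono vfl wl Dwl) auto
  also have "\<dots> = R * S" by (simp add: S_def sum_distrib_left algebra_simps)
  finally have BS: "cmod B \<le> R * S" .
  define a where "a = \<bar>Im lam\<bar>"
  have a: "0 < a" using im by (simp add: a_def)
  have "\<bar>Im B\<bar> \<le> cmod B" by (rule abs_Im_le_cmod)
  \<comment> \<open>The imaginary part sees only \<open>lam Y\<close> and bounds \<open>Y\<close>.
    As \<open>Re lam\<close> may be negative, the real part bounds \<open>X\<close> only after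
    this.\<close>
  then have "a * Y \<le> cmod B" using Y0 by (simp add: E[symmetric] a_def abs_mult)
  then have YB: "Y \<le> cmod B / a" using a by (simp add: field_simps)
  have "X = Re B - Re lam * Y" by (simp add: E[symmetric])
  also have "\<dots> \<le> cmod B + cmod lam * Y"
    using complex_Re_le_cmod[of B] mult_right_mono[OF abs_Re_le_cmod[of lam] Y0] abs_ge_minus_self[of "Re lam * Y"] Y0
    by (simp add: abs_mult)
  finally have "X + Y \<le> cmod B + (cmod lam + 1) * Y" by (simp add: algebra_simps)
  also have "\<dots> \<le> cmod B + (cmod lam + 1) * (cmod B / a)" by (intro add_left_mono mult_left_mono YB) auto
  also have "\<dots> = (1 + (cmod lam + 1) / a) * cmod B" by (simp add: algebra_simps)
  also have "\<dots> \<le> (1 + (cmod lam + 1) / a) * (R * S)" using a by (intro mult_left_mono BS) auto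
  finally have "R * R \<le> R * ((1 + (cmod lam + 1) / a) * S)" by (simp add: RR(1)[unfolded power2_eq_square] ac_simps)
  moreover have "0 \<le> (1 + (cmod lam + 1) / a) * S" using a S0 by simp
  ultimately have "R \<le> (1 + (cmod lam + 1) / a) * S" using RR(2) by (cases "R = 0") auto
  then show ?thesis using wl by (simp add: w_def S_def a_def vk_def k_def)
qed

text \<open>The Green function is square integrable in three dimensions and its translates have the
  same norm, so Cauchy-Schwarz applies at every point. In particular the value at the origin, which
  appears in the resonant limit, is controlled by the norm of \<open>g\<close>.\<close>

lemma Gop_bounded: assumes k: "0 < Re \<kappa>" and g: "g \<in> L2"
  shows "cmod (Gop \<kappa> g x) \<le> L2norm (Fd \<kappa> 0) * L2norm g"
proof -
  note FL = L2_translate(2)[OF Fd_L2[OF k, of 0], of x]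
  have "n2 (\<lambda>y. Fd \<kappa> 0 (x - y)) = n2 (Fd \<kappa> 0)"
    unfolding n2_def by (rule nn_integral_translate(2)[of "\<lambda>z. (ennreal (cmod (Fd \<kappa> 0 z)))^2"]) measurable
  then have "(L2norm (\<lambda>y. Fd \<kappa> 0 (x - y)))^2 = (L2norm (Fd \<kappa> 0))^2"
    using n2_eq[OF FL] n2_eq[OF Fd_L2[OF k, of 0]] by simp
  then have "L2norm (\<lambda>y. Fd \<kappa> 0 (x - y)) = L2norm (Fd \<kappa> 0)" by (simp add: power2_eq_iff_nonneg)
  then show ?thesis using L2_mult_CS(3)[OF FL g] by (simp add: Gop_def)
qed

lemma L2norm_tendsto_0I:
  assumes "\<And>n. f n \<in> L2" "(\<lambda>n. n2 (f n)) \<longlonglongrightarrow> 0" shows "(\<lambda>n. L2norm (f n)) \<longlonglongrightarrow> 0"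
proof -
  have "(\<lambda>n. enn2real (n2 (f n))) \<longlonglongrightarrow> enn2real 0" using assms(2) by (intro tendsto_enn2real) simp_all
  then have "(\<lambda>n. (L2norm (f n))^2) \<longlonglongrightarrow> 0" using n2_eq[OF assms(1)] by simp
  from tendsto_real_sqrt[OF this] show ?thesis by simp
qed

text \<open>The supports have radius \<open>1 / sqrt (n + 1)\<close> and shrink to the origin, a
  null set; \<open>f\<close> itself is the majorant.\<close>

lemma bump_cutoff_tendsto:
  assumes f: "f \<in> L2"
  shows "(\<lambda>n. L2norm (\<lambda>x. of_real (bump (real (Suc n)) x) * f x)) \<longlonglongrightarrow> 0"
proof (rule L2norm_tendsto_0I)
  note [measurable] = L2_meas[OF f] borel_measurable_continuous_onI[OF Ck_cont[OF Ck_bump]]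
  have b: "0 \<le> bump (real (Suc n)) x" "bump (real (Suc n)) x \<le> 1" for n x by (rule bump_bounds; simp)+
  show "(\<lambda>x. of_real (bump (real (Suc n)) x) * f x) \<in> L2" for n
    by (rule L2_bounded_mult[OF f, where B=1]) (use b in auto)
  have "(\<lambda>n. n2 (\<lambda>x. of_real (bump (real (Suc n)) x) * f x)) \<longlonglongrightarrow> (\<integral>\<^sup>+x. 0 \<partial>(lborel :: pt measure))"
    unfolding n2_def
  proof (rule nn_integral_dominated_convergence[where w="\<lambda>x. (ennreal (cmod (f x)))^2"])
    show "(NINT x. (ennreal (cmod (f x)))^2) < \<infinity>" using L2_n2[OF f] by (simp add: n2_def)
    show "AE x in lborel. (ennreal (cmod (of_real (bump (real (Suc n)) x) * f x)))^2 \<le> (ennreal (cmod (f x)))^2" for n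
      using b by (intro AE_I2 power_mono ennreal_leI) (auto simp: norm_mult intro!: mult_left_le_one_le)
    show "AE x in lborel. (\<lambda>n. (ennreal (cmod (of_real (bump (real (Suc n)) x) * f x)))^2) \<longlonglongrightarrow> 0"
      using AE_pt_neq[of 0]
    proof eventually_elim
      fix x :: pt assume x: "x \<noteq> 0"
      obtain N where N: "(1 / norm x)^2 < real N" using reals_Archimedean2 by blast
      have "bump (real (Suc n)) x = 0" if "n \<ge> N" for n
      proof (rule ccontr)
        assume "bump (real (Suc n)) x \<noteq> 0"
        then have "norm x < 1 / sqrt (real (Suc n))" by (intro bump_support) auto
        then have "sqrt (real (Suc n)) < 1 / norm x" using x by (simp add: field_simps)
        then have "real (Suc n) < (1 / norm x)^2"
          by (metis power_strict_mono real_sqrt_ge_0_iff of_nat_0_le_iff real_sqrt_pow2 pos2)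
        then show False using N that by linarith
      qed
      then have "eventually (\<lambda>n. (ennreal (cmod (of_real (bump (real (Suc n)) x) * f x)))^2 = 0) sequentially"
        by (intro eventually_mono[OF eventually_ge_at_top[of N]]) simp
      then show "(\<lambda>n. (ennreal (cmod (of_real (bump (real (Suc n)) x) * f x)))^2) \<longlonglongrightarrow> 0"
        by (rule tendsto_eventually)
    qed
  qed measurable
  then show "(\<lambda>n. n2 (\<lambda>x. of_real (bump (real (Suc n)) x) * f x)) \<longlonglongrightarrow> 0" by simp
qed

text \<open>In three dimensions points have zero capacity.\<close>

lemma dbump_cutoff_tendsto:
  assumes f: "f \<in> borel_measurable borel" "\<And>x. cmod (f x) \<le> M"
  shows "(\<lambda>n. L2norm (\<lambda>x. of_real (dbump (real (Suc n)) i x) * f x)) \<longlonglongrightarrow> 0"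
proof (rule L2norm_tendsto_0I)
  note [measurable] = f(1) borel_measurable_continuous_onI[OF Ck_cont[OF Ck_dbump]]
  have M: "0 \<le> M" using order_trans[OF norm_ge_zero f(2)[of 0]] .
  \<comment> \<open>The gradient of the cutoff has size \<open>sqrt c\<close> on a ball whose volume
    is proportional to \<open>c powr (-3/2)\<close>, so its squared norm is of order
    \<open>1 / sqrt c\<close>.\<close>
  define C where "C = (4 * exp 1 * M)^2 * unit_ball_vol 3"
  have C: "0 \<le> C" by (simp add: C_def)
  have bd: "n2 (\<lambda>x. of_real (dbump (real (Suc n)) i x) * f x) \<le> ennreal (C / sqrt (real (Suc n)))" for n
  proof -
    define c where "c = real (Suc n)"
    have c: "0 < c" by (simp add: c_def)
    define r where "r = 1 / sqrt c"
    have r: "0 \<le> r" by (simp add: r_def c_def)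
    have "n2 (\<lambda>x. of_real (dbump c i x) * f x) \<le> (NINT x. ennreal ((4 * exp 1 * sqrt c * M)^2) * indicator (cball (0::pt) r) x)"
      unfolding n2_def
    proof (rule nn_integral_mono)
      fix x :: pt
      show "(ennreal (cmod (of_real (dbump c i x) * f x)))^2 \<le> ennreal ((4 * exp 1 * sqrt c * M)^2) * indicator (cball (0::pt) r) x"
      proof (cases "dbump c i x = 0")
        case False
        then have "norm x < r" unfolding r_def using bump_support[OF c] by blast
        moreover have "cmod (of_real (dbump c i x) * f x) \<le> 4 * exp 1 * sqrt c * M"
          unfolding norm_mult norm_of_real using c by (intro mult_mono dbump_bound f(2)) auto
        ultimately show ?thesis by (simp add: ennreal_power power_mono)
      qed simp
    qed
    also have "\<dots> = ennreal ((4 * exp 1 * sqrt c * M)^2) * emeasure lborel (cball (0::pt) r)"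
      by (rule nn_integral_cmult_indicator) simp
    also have "\<dots> = ennreal ((4 * exp 1 * sqrt c * M)^2) * ennreal (unit_ball_vol 3 * r ^ 3)"
      using emeasure_cball[OF r, of "0::pt"] by simp
    also have "\<dots> = ennreal ((4 * exp 1 * sqrt c * M)^2 * (unit_ball_vol 3 * r ^ 3))"
      using r by (intro ennreal_mult[symmetric]) auto
    also have "(4 * exp 1 * sqrt c * M)^2 * (unit_ball_vol 3 * r ^ 3) = C / sqrt c"
      using c by (simp add: C_def r_def power_mult_distrib power_divide power3_eq_cube)
    finally show ?thesis by (simp add: c_def)
  qed
  show "(\<lambda>x. of_real (dbump (real (Suc n)) i x) * f x) \<in> L2" for n
    using le_less_trans[OF bd[of n]] by (simp add: L2_iff)
  have "filterlim (\<lambda>n. sqrt (real (Suc n))) at_top sequentially"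
    by (intro filterlim_compose[OF sqrt_at_top] filterlim_compose[OF filterlim_real_sequentially] filterlim_Suc)
  then have "(\<lambda>n. C / sqrt (real (Suc n))) \<longlonglongrightarrow> 0"
    by (intro tendsto_divide_0[OF tendsto_const] filterlim_at_top_imp_at_infinity)
  then have "(\<lambda>n. ennreal (C / sqrt (real (Suc n)))) \<longlonglongrightarrow> ennreal 0" by (rule tendsto_ennrealI)
  then have "(\<lambda>n. ennreal (C / sqrt (real (Suc n)))) \<longlonglongrightarrow> 0" by simp
  then show "(\<lambda>n. n2 (\<lambda>x. of_real (dbump (real (Suc n)) i x) * f x)) \<longlonglongrightarrow> 0"
    by (rule tendsto_sandwich[OF _ _ tendsto_const, rotated 2]) (use bd in auto)
qed

section \<open>Strong convergence of the scaled family\<close>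

context scaled_potential
begin

text \<open>Under \<open>x = eps y\<close> the prefactor becomes \<open>eps^3\<close> times
  \<open>cc \<sigma> eps\<close>, bounded because \<open>\<sigma> \<le> 3\<close>, and the potential
  concentrates at the origin, where \<open>1 - bump c\<close> vanishes.\<close>

lemma potential_energy_tendsto:
  assumes \<sigma>: "\<sigma> \<le> 3" and F: "F \<in> borel_measurable borel" "\<And>x. cmod (F x) \<le> M" and c: "0 < c"
  shows "((\<lambda>eps. L2norm (\<lambda>x. of_real (vfun (Veps \<eta> \<sigma> V eps) x) * (F x - of_real (bump c x) * F x))) \<longlongrightarrow> 0) (at_right 0)"
proof -
  have [measurable]: "V \<in> borel_measurable borel" using VL1 by auto
  note [measurable] = vfun_meas[of V] F(1) borel_measurable_continuous_onI[OF Ck_cont[OF Ck_bump]]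
  have M: "0 \<le> M" using order_trans[OF norm_ge_zero F(2)[of 0]] .
  obtain B where B: "0 \<le> B" "\<And>t. t \<in> {0..1} ==> \<bar>\<eta> t\<bar> \<le> B" using eta_bounded by blast
  have b: "0 \<le> bump c x" "bump c x \<le> 1" for x using bump_bounds(1,2)[of c x] c by auto
  have b0: "bump c 0 = 1" using bump_bounds(3) c by auto
  define I where "I eps = (LBINT y. \<bar>V y\<bar> * (1 - bump c (eps *\<^sub>R y))^2)" for eps
  have Ii: "integrable lborel (\<lambda>y. \<bar>V y\<bar> * (1 - bump c (eps *\<^sub>R y))^2)" for eps
    by (rule Bochner_Integration.integrable_bound[OF VL1], measurable)
       (use b in \<open>auto simp: abs_mult intro!: AE_I2 mult_right_le_one_le power_le_one\<close>)
  have I0: "0 \<le> I eps" for eps by (simp add: I_def integral_nonneg)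
  have "(I \<longlongrightarrow> 0) (at_right 0)"
  proof (rule tendsto_at_right_seqI)
    fix t :: "nat => real" assume t: "\<And>n. 0 < t n" "t \<longlonglongrightarrow> 0"
    have "(\<lambda>n. I (t n)) \<longlonglongrightarrow> (\<integral>y. 0 \<partial>(lborel :: pt measure))"
      unfolding I_def
    proof (rule integral_dominated_convergence[where w="\<lambda>y. \<bar>V y\<bar>"])
      show "integrable lborel (\<lambda>y. \<bar>V y\<bar>)" using VL1 by simp
      show "AE y in lborel. norm (\<bar>V y\<bar> * (1 - bump c (t n *\<^sub>R y))^2) \<le> \<bar>V y\<bar>" for n
        using b by (auto simp: abs_mult intro!: AE_I2 mult_right_le_one_le power_le_one)
      show "AE y in lborel. (\<lambda>n. \<bar>V y\<bar> * (1 - bump c (t n *\<^sub>R y))^2) \<longlonglongrightarrow> 0"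
      proof (rule AE_I2)
        fix y :: pt
        have "isCont (bump c) 0" using Ck_cont[OF Ck_bump, of c] by (simp add: continuous_on_eq_continuous_at)
        moreover have "(\<lambda>n. t n *\<^sub>R y) \<longlonglongrightarrow> 0" using tendsto_scaleR[OF t(2) tendsto_const[of y]] by simp
        ultimately have "(\<lambda>n. bump c (t n *\<^sub>R y)) \<longlonglongrightarrow> bump c 0" by (rule isCont_tendsto_compose)
        then have "(\<lambda>n. \<bar>V y\<bar> * (1 - bump c (t n *\<^sub>R y))^2) \<longlonglongrightarrow> \<bar>V y\<bar> * (1 - bump c 0)^2" by (intro tendsto_intros)
        then show "(\<lambda>n. \<bar>V y\<bar> * (1 - bump c (t n *\<^sub>R y))^2) \<longlonglongrightarrow> 0" by (simp add: b0)
      qed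
    qed measurable
    then show "(\<lambda>n. I (t n)) \<longlonglongrightarrow> 0" by simp
  qed
  then have "((\<lambda>eps. sqrt (B * M^2 * I eps)) \<longlongrightarrow> sqrt (B * M^2 * 0)) (at_right 0)" by (intro tendsto_intros)
  then have lim: "((\<lambda>eps. sqrt (B * M^2 * I eps)) \<longlongrightarrow> 0) (at_right 0)" by simp
  have "eventually (\<lambda>eps. L2norm (\<lambda>x. of_real (vfun (Veps \<eta> \<sigma> V eps) x) * (F x - of_real (bump c x) * F x)) \<le> sqrt (B * M^2 * I eps)) (at_right 0)"
    using eventually_at_right_le_1
  proof eventually_elim
    fix eps :: real assume eps: "0 < eps \<and> eps \<le> 1"
    then have eps0: "0 < eps" by simp
    have c0: "0 \<le> cc \<sigma> eps" using cc_nonneg eps by blast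
    have [measurable]: "Veps \<eta> \<sigma> V eps \<in> borel_measurable borel" unfolding Veps_eq by measurable
    note [measurable] = vfun_meas[of "Veps \<eta> \<sigma> V eps"]
    let ?k = "\<lambda>x. F x - of_real (bump c x) * F x"
    let ?v = "\<lambda>x. of_real (vfun (Veps \<eta> \<sigma> V eps) x) * ?k x"
    have kb: "(cmod (?k x))^2 \<le> M^2 * (1 - bump c x)^2" for x
    proof -
      have "?k x = of_real (1 - bump c x) * F x" by (simp add: algebra_simps)
      moreover have "\<bar>1 - bump c x\<bar> = 1 - bump c x" using b[of x] by simp
      ultimately have "cmod (?k x) = (1 - bump c x) * cmod (F x)" by (simp only: norm_mult norm_of_real)
      also have "\<dots> \<le> (1 - bump c x) * M" using b[of x] by (intro mult_left_mono F(2)) simp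
      finally have "(cmod (?k x))^2 \<le> ((1 - bump c x) * M)^2" by (intro power_mono) auto
      then show ?thesis by (simp add: power_mult_distrib mult.commute)
    qed
    have e3: "eps^3 * cc \<sigma> eps \<le> B"
    proof -
      have "eps powr (3 - \<sigma>) \<le> 1" using eps \<sigma> by (intro powr_le1) auto
      moreover have "\<eta> eps \<le> B" using B(2)[of eps] eps by simp
      ultimately have "\<eta> eps * eps powr (3 - \<sigma>) \<le> B * 1" using B by (intro mult_mono) auto
      then show ?thesis using cc_scale(3)[OF eps0, of \<sigma>] by (simp add: mult.commute)
    qed
    have "n2 ?v = (NINT x. ennreal (\<bar>Veps \<eta> \<sigma> V eps x\<bar> * (cmod (?k x))^2))"
      unfolding n2_def by (intro nn_integral_cong) (simp add: norm_mult ennreal_power power_mult_distrib vfun_def)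
    also have "\<dots> = ennreal (eps^3) * (NINT y. ennreal (\<bar>Veps \<eta> \<sigma> V eps (eps *\<^sub>R y)\<bar> * (cmod (?k (eps *\<^sub>R y)))^2))"
      by (rule nn_integral_scale[OF _ eps0]) measurable
    also have "\<dots> = (NINT y. ennreal (eps^3) * ennreal (\<bar>Veps \<eta> \<sigma> V eps (eps *\<^sub>R y)\<bar> * (cmod (?k (eps *\<^sub>R y)))^2))"
      by (intro nn_integral_cmult[symmetric]) measurable
    also have "\<dots> \<le> (NINT y. ennreal (B * M^2 * (\<bar>V y\<bar> * (1 - bump c (eps *\<^sub>R y))^2)))"
    proof (rule nn_integral_mono)
      fix y
      have "eps^3 * (\<bar>Veps \<eta> \<sigma> V eps (eps *\<^sub>R y)\<bar> * (cmod (?k (eps *\<^sub>R y)))^2) = (eps^3 * cc \<sigma> eps) * (\<bar>V y\<bar> * (cmod (?k (eps *\<^sub>R y)))^2)"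
        using eps0 c0 by (simp add: Veps_eq abs_mult)
      also have "\<dots> \<le> B * (\<bar>V y\<bar> * (M^2 * (1 - bump c (eps *\<^sub>R y))^2))"
        by (intro mult_mono e3 mult_left_mono kb) (auto simp: B)
      finally have "eps^3 * (\<bar>Veps \<eta> \<sigma> V eps (eps *\<^sub>R y)\<bar> * (cmod (?k (eps *\<^sub>R y)))^2) \<le> B * M^2 * (\<bar>V y\<bar> * (1 - bump c (eps *\<^sub>R y))^2)"
        by (simp add: ac_simps)
      then show "ennreal (eps^3) * ennreal (\<bar>Veps \<eta> \<sigma> V eps (eps *\<^sub>R y)\<bar> * (cmod (?k (eps *\<^sub>R y)))^2) \<le> ennreal (B * M^2 * (\<bar>V y\<bar> * (1 - bump c (eps *\<^sub>R y))^2))"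
        using eps0 by (subst ennreal_mult[symmetric]) (auto intro: ennreal_leI)
    qed
    also have "\<dots> = ennreal (B * M^2 * I eps)"
      unfolding I_def using Ii[of eps] B by (subst nn_integral_eq_integral) auto
    finally have nle: "n2 ?v \<le> ennreal ((sqrt (B * M^2 * I eps))^2)" using B I0 by simp
    have "?v \<in> L2" using le_less_trans[OF nle] by (simp add: L2_iff)
    then show "L2norm ?v \<le> sqrt (B * M^2 * I eps)" by (rule L2norm_le[OF _ nle]) (use B I0 in simp)
  qed
  then show ?thesis
    by (intro tendsto_sandwich[OF _ _ tendsto_const lim]) (auto intro: always_eventually)
qed

text \<open>The piece \<open>m n\<close> of the free solution near the origin is made small in the
  Sobolev norm by the choice of \<open>n\<close>, which depends on \<open>g\<close>. Only then is
  \<open>eps\<close> sent to 0 to remove the potential energy of the rest. This order of choices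
  yields strong convergence.\<close>

theorem strong_conv:
  assumes \<sigma>: "\<sigma> \<le> 3" and pos: "AE x in lborel. V x > 0"
  shows "strong_resolvent_conv (\<lambda>eps. form_resolvent_sol (Veps \<eta> \<sigma> V eps)) free_resolvent_sol"
  unfolding strong_resolvent_conv_def resolvents_exist_def
proof (intro conjI allI impI)
  show "\<exists>f. form_resolvent_sol (Veps \<eta> \<sigma> V eps) lam g f" if "Im lam \<noteq> 0" "g \<in> L2" "0 < eps \<and> eps \<le> 1" for lam g eps
    using that Veps_resolvent_exists by blast
  show "\<exists>f. free_resolvent_sol lam g f" if "Im lam \<noteq> 0" "g \<in> L2" for lam g
    using that free_resolvent_exists by blast
  fix lam g and e :: real assume im: "Im lam \<noteq> 0" and g: "g \<in> L2" and e: "0 < e"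
  define \<kappa> where "\<kappa> = csqrt lam"
  have k: "0 < Re \<kappa>" and k2: "\<kappa>^2 = lam" using csqrt_props[OF im] by (simp_all add: \<kappa>_def)
  define F where "F = Gop \<kappa> g"
  define DF where "DF = dGop \<kappa> g"
  define M where "M = L2norm (Fd \<kappa> 0) * L2norm g"
  have FH: "H1_grad F DF" unfolding F_def DF_def by (rule Gop_H1[OF k Good_L2[OF k g]])
  have Feq: "(\<Sum>i\<in>UNIV. LBINT x. DF i x * cnj (Dh i x)) + lam * (LBINT x. F x * cnj (h x)) = (LBINT x. g x * cnj (h x))"
    if "H1_grad h Dh" for h Dh
    using Gop_form(1)[OF k Good_L2[OF k g] that] by (simp add: F_def DF_def k2)
  have FL: "F \<in> L2" and DL: "\<And>i. DF i \<in> L2" using FH by (auto simp: H1_grad_def)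
  have FM: "cmod (F x) \<le> M" for x unfolding F_def M_def by (rule Gop_bounded[OF k g])
  define m where "m n x = of_real (bump (real (Suc n)) x) * F x" for n x
  define Dm where "Dm n i x = of_real (bump (real (Suc n)) x) * DF i x + of_real (dbump (real (Suc n)) i x) * F x" for n i x
  have mH: "H1_grad (m n) (Dm n)" for n
    unfolding m_def Dm_def
  proof (rule H1_grad_mult[OF FH Ck_bump has_partial_bump Ck_cont[OF Ck_dbump], where B="1 + 4 * exp 1 * sqrt (real (Suc n))"])
    show "\<bar>bump (real (Suc n)) x\<bar> \<le> 1 + 4 * exp 1 * sqrt (real (Suc n))" for x
      using bump_bounds(1,2)[of "real (Suc n)" x] by (simp add: add_increasing2)
    show "\<bar>dbump (real (Suc n)) i x\<bar> \<le> 1 + 4 * exp 1 * sqrt (real (Suc n))" for i x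
      using dbump_bound[of "real (Suc n)" i x] by simp
  qed
  define C where "C = 1 + (cmod lam + 1) / \<bar>Im lam\<bar>"
  have C: "0 < C" by (simp add: C_def add_pos_nonneg)
  note b1 = bump_cutoff_tendsto[OF DL] and b2 = dbump_cutoff_tendsto[OF L2_meas[OF FL] FM]
  have cutL: "(\<lambda>x. of_real (bump (real (Suc n)) x) * DF i x) \<in> L2" for n i
    by (rule L2_bounded_mult[OF DL, where B=1])
       (use bump_bounds(1,2)[of "real (Suc n)"] borel_measurable_continuous_onI[OF Ck_cont[OF Ck_bump]] in auto)
  have dcutL: "(\<lambda>x. of_real (dbump (real (Suc n)) i x) * F x) \<in> L2" for n i
    by (rule L2_bounded_mult[OF FL, where B="4 * exp 1 * sqrt (real (Suc n))"])
       (use dbump_bound[of "real (Suc n)"] borel_measurable_continuous_onI[OF Ck_cont[OF Ck_dbump]] in auto)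
  have Dm0: "(\<lambda>n. L2norm (Dm n i)) \<longlonglongrightarrow> 0" for i
  proof (rule tendsto_sandwich[OF _ _ tendsto_const tendsto_add_zero[OF b1[of i] b2[of i]]])
    show "eventually (\<lambda>n. L2norm (Dm n i) \<le> L2norm (\<lambda>x. of_real (bump (real (Suc n)) x) * DF i x) + L2norm (\<lambda>x. of_real (dbump (real (Suc n)) i x) * F x)) sequentially"
      unfolding Dm_def by (intro always_eventually allI L2norm_triangle cutL dcutL)
  qed simp
  have "(\<lambda>n. (\<Sum>i\<in>UNIV. L2norm (Dm n i)) + cmod lam * L2norm (m n)) \<longlonglongrightarrow> (\<Sum>i\<in>(UNIV::3 set). 0) + cmod lam * 0"
    unfolding m_def by (intro tendsto_add tendsto_sum tendsto_mult tendsto_const Dm0 bump_cutoff_tendsto FL)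
  then have "eventually (\<lambda>n. (\<Sum>i\<in>UNIV. L2norm (Dm n i)) + cmod lam * L2norm (m n) < e / (2 * C)) sequentially"
    using e C by (intro order_tendstoD(2)) auto
  from eventually_happens'[OF sequentially_bot this] obtain n where n: "(\<Sum>i\<in>UNIV. L2norm (Dm n i)) + cmod lam * L2norm (m n) < e / (2 * C)"
    by blast
  have "eventually (\<lambda>eps. L2norm (\<lambda>x. of_real (vfun (Veps \<eta> \<sigma> V eps) x) * (F x - m n x)) < e / (2 * C)) (at_right 0)"
    unfolding m_def by (rule order_tendstoD(2)[OF potential_energy_tendsto[OF \<sigma> L2_meas[OF FL] FM]]) (use e C in auto)
  then have "eventually (\<lambda>eps. \<forall>f f0. form_resolvent_sol (Veps \<eta> \<sigma> V eps) lam g f --> free_resolvent_sol lam g f0 --> L2norm (\<lambda>x. f x - f0 x) \<le> e) (at_right 0)"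
    using eventually_at_right_le_1
  proof (eventually_elim, intro allI impI)
    fix eps f f0 assume v: "L2norm (\<lambda>x. of_real (vfun (Veps \<eta> \<sigma> V eps) x) * (F x - m n x)) < e / (2 * C)" and eps: "0 < eps \<and> eps \<le> 1"
      and s: "form_resolvent_sol (Veps \<eta> \<sigma> V eps) lam g f" and s0: "free_resolvent_sol lam g f0"
    have RV: "rollnik (Veps \<eta> \<sigma> V eps)" using rollnik_Veps eps by blast
    have p: "AE x in lborel. 0 \<le> Veps \<eta> \<sigma> V eps x"
      using AE_lborel_affine[OF pos, of "1 / eps" 0] eps
      by (auto simp: Veps_eq intro!: mult_nonneg_nonneg cc_nonneg elim!: eventually_mono)
    have fL: "f \<in> L2" using s by (auto simp: form_resolvent_sol_def H1_grad_def)
    note F0 = free_resolvent_eq[OF im g s0, folded \<kappa>_def F_def]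
    have "L2norm (\<lambda>x. f x - f0 x) = L2norm (\<lambda>x. f x - F x)"
    proof (rule L2norm_cong_AE)
      show "AE x in lborel. f x - f0 x = f x - F x" using F0(1) by eventually_elim (simp add: F_def)
    qed (use L2_meas[OF fL] L2_meas[OF F0(2)] L2_meas[OF FL] in measurable)
    also have "\<dots> \<le> C * ((\<Sum>i\<in>UNIV. L2norm (Dm n i)) + cmod lam * L2norm (m n) + L2norm (\<lambda>x. of_real (vfun (Veps \<eta> \<sigma> V eps) x) * (F x - m n x)))"
      unfolding C_def by (rule form_energy_estimate[OF RV p im s FH Feq mH])
    also have "\<dots> \<le> C * (e / (2 * C) + e / (2 * C))" using n v C by (intro mult_left_mono add_mono) auto
    also have "\<dots> = e" using C by (simp add: field_simps)
    finally show "L2norm (\<lambda>x. f x - f0 x) \<le> e" .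
  qed
  then show "\<exists>\<delta>>0. \<forall>eps. 0 < eps \<and> eps < \<delta> \<and> eps \<le> 1 -->
    (\<forall>f f0. form_resolvent_sol (Veps \<eta> \<sigma> V eps) lam g f --> free_resolvent_sol lam g f0 --> L2norm (\<lambda>x. f x - f0 x) \<le> e)"
    by (rule eventually_at_right_0_delta)
qed

end

section \<open>The zero-energy resonance\<close>

text \<open>The mean value inequality on the convex half-plane where \<open>|exp|\<close> is at most
  1.\<close>

lemma cmod_exp_minus_1_le: assumes "0 \<le> Re z" shows "cmod (exp (- z) - 1) \<le> cmod z"
proof -
  have "cmod (exp (- z) - exp 0) \<le> 1 * cmod (- z - 0)"
  proof (rule field_differentiable_bound[where S="{w. Re w \<le> 0}" and f'=exp])
    show "convex {w. Re w \<le> 0}" by (rule convex_halfspace_Re_le)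
    show "(exp has_field_derivative exp w) (at w within {w. Re w \<le> 0})" for w :: complex
      by (rule DERIV_exp[THEN DERIV_subset]) auto
    show "cmod (exp w) \<le> 1" if "w \<in> {w. Re w \<le> 0}" for w using that by (simp add: norm_exp_eq_Re)
  qed (use assms in auto)
  then show ?thesis by simp
qed

text \<open>The difference quotient of the kernel in \<open>eps\<close> at zero energy, minus its
  pointwise limit \<open>- \<kappa> / (4 \<pi>)\<close> times \<open>u x v y\<close>. It is the
  remainder of the first-order expansion of the operator.\<close>

definition kD :: "(pt => real) => complex => real => pt => pt => complex" where
  "kD V \<kappa> eps x y = (kK V (of_real eps * \<kappa>) x y - kK V 0 x y) / of_real eps
     + \<kappa> / of_real (4 * pi) * (of_real (ufun V x) * of_real (vfun V y))"

lemma hs_rank_one: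
  assumes "a \<in> borel_measurable borel" "b \<in> borel_measurable borel"
  shows "hs (\<lambda>x y. a x * b y) = n2 a * n2 b"
proof -
  note [measurable] = assms
  have "(NINT y. (ennreal (cmod (a x * b y)))^2) = (ennreal (cmod (a x)))^2 * n2 b" for x
    unfolding n2_def by (subst nn_integral_cmult[symmetric]) (auto simp: norm_mult ennreal_mult power_mult_distrib)
  then show ?thesis unfolding hs_def by (simp add: n2_def nn_integral_multc)
qed

lemma HSk_rank_one: assumes "a \<in> L2" "b \<in> L2" shows "HSk (\<lambda>x y. a x * b y)"
proof -
  note [measurable] = L2_meas[OF assms(1)] L2_meas[OF assms(2)]
  have "hs (\<lambda>x y. a x * b y) < \<infinity>"
    using L2_n2[OF assms(1)] L2_n2[OF assms(2)] by (simp add: hs_rank_one ennreal_mult_less_top)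
  then show ?thesis by (simp add: HSk_def)
qed

lemma kD_eq: assumes "x \<noteq> y"
  shows "kD V \<kappa> eps x y = of_real (ufun V x * vfun V y) / of_real (4 * pi) *
     ((exp (- (of_real eps * \<kappa> * of_real (norm (x - y)))) - 1) / (of_real eps * of_real (norm (x - y))) + \<kappa>)"
  using assms by (cases "eps = 0") (simp_all add: kD_def kK_def Fd_def field_simps)

text \<open>The factor beside \<open>u x v y\<close> is bounded by a multiple of
  \<open>|\<kappa>|\<close> and tends to 0 off the diagonal. The majorant is a multiple of
  \<open>|V x| |V y|\<close>, whose double integral is finite by integrability of
  \<open>V\<close>.\<close>

lemma hsn_kD_tendsto:
  assumes V: "rollnik V" "integrable lborel V" and k: "0 < Re \<kappa>"
  shows "((\<lambda>eps. hsn (kD V \<kappa> eps)) \<longlongrightarrow> 0) (at_right 0)"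
proof (rule hs_dominated_tendsto[where w="\<lambda>x y. ennreal ((cmod \<kappa>)^2) * (ennreal \<bar>V x\<bar> * ennreal \<bar>V y\<bar>)"])
  note [measurable] = kK_meas[OF V(1)] rollnik_meas[OF V(1)] vfun_meas[OF rollnik_meas[OF V(1)]]
  show "(\<lambda>(x, y). kD V \<kappa> eps x y) \<in> borel_measurable (lborel \<Otimes>\<^sub>M lborel)" for eps
    unfolding kD_def by measurable
  show "(\<lambda>(x, y). ennreal ((cmod \<kappa>)^2) * (ennreal \<bar>V x\<bar> * ennreal \<bar>V y\<bar>)) \<in> borel_measurable (lborel \<Otimes>\<^sub>M lborel)"
    by measurable
  have "(NINT x. NINT y. ennreal ((cmod \<kappa>)^2) * (ennreal \<bar>V x\<bar> * ennreal \<bar>V y\<bar>))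
    = ennreal ((cmod \<kappa>)^2) * ((NINT x. ennreal \<bar>V x\<bar>) * (NINT y. ennreal \<bar>V y\<bar>))"
    by (simp add: nn_integral_cmult nn_integral_multc)
  also have "\<dots> < \<infinity>" using V(2) by (simp add: integrable_iff_bounded ennreal_mult_less_top)
  finally show "(NINT x. NINT y. ennreal ((cmod \<kappa>)^2) * (ennreal \<bar>V x\<bar> * ennreal \<bar>V y\<bar>)) < \<infinity>" .
next
  fix eps :: real and x y :: pt assume eps: "0 < eps" "eps \<le> 1" and xy: "x \<noteq> y"
  define r where "r = norm (x - y)"
  have r: "0 < r" using xy by (simp add: r_def)
  have "cmod (exp (- (of_real eps * \<kappa> * of_real r)) - 1) \<le> cmod (of_real eps * \<kappa> * of_real r)"
    by (rule cmod_exp_minus_1_le) (use eps k r in simp)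
  then have "cmod ((exp (- (of_real eps * \<kappa> * of_real r)) - 1) / (of_real eps * of_real r)) \<le> cmod \<kappa>"
    using eps r by (simp add: norm_divide norm_mult field_simps)
  then have e: "cmod ((exp (- (of_real eps * \<kappa> * of_real r)) - 1) / (of_real eps * of_real r) + \<kappa>) \<le> cmod \<kappa> + cmod \<kappa>"
    by (intro order_trans[OF norm_triangle_ineq] add_mono) auto
  have "cmod (kD V \<kappa> eps x y) = (vfun V x * vfun V y) / (4 * pi) * cmod ((exp (- (of_real eps * \<kappa> * of_real r)) - 1) / (of_real eps * of_real r) + \<kappa>)"
    unfolding kD_eq[OF xy] r_def[symmetric] norm_mult norm_divide norm_of_real abs_mult abs_ufun by (simp add: vfun_nonneg)
  also have "\<dots> \<le> (vfun V x * vfun V y) / (4 * pi) * (cmod \<kappa> + cmod \<kappa>)"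
    using e by (intro mult_left_mono) (auto simp: vfun_nonneg)
  also have "\<dots> = (cmod \<kappa> * (vfun V x * vfun V y)) * (2 / (4 * pi))" by simp
  also have "\<dots> \<le> (cmod \<kappa> * (vfun V x * vfun V y)) * 1"
    using pi_gt3 by (intro mult_left_mono) (auto simp: vfun_nonneg)
  finally have "(ennreal (cmod (kD V \<kappa> eps x y)))^2 \<le> (ennreal (cmod \<kappa> * (vfun V x * vfun V y)))^2"
    by (intro power_mono ennreal_leI) auto
  also have "\<dots> = ennreal ((cmod \<kappa>)^2) * (ennreal \<bar>V x\<bar> * ennreal \<bar>V y\<bar>)"
    by (simp add: ennreal_mult vfun_nonneg power_mult_distrib vfun_sq_nn ennreal_power)
  finally show "(ennreal (cmod (kD V \<kappa> eps x y)))^2 \<le> ennreal ((cmod \<kappa>)^2) * (ennreal \<bar>V x\<bar> * ennreal \<bar>V y\<bar>)" .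
next
  fix x y :: pt assume xy: "x \<noteq> y"
  define r where "r = norm (x - y)"
  have r: "0 < r" using xy by (simp add: r_def)
  have "((\<lambda>h. (exp (0 + h) - exp 0) / h) \<longlongrightarrow> exp (0::complex)) (at 0)"
    using DERIV_exp[of "0::complex"] by (simp add: DERIV_def)
  then have d: "((\<lambda>h. (exp h - 1) / h) \<longlongrightarrow> (1::complex)) (at 0)" by simp
  have k0: "\<kappa> \<noteq> 0" using k by auto
  have "filterlim (\<lambda>eps. - (of_real eps * \<kappa> * of_real r)) (at 0) (at_right 0)"
  proof (rule filterlim_atI)
    have "((\<lambda>eps. - (of_real eps * \<kappa> * of_real r)) \<longlongrightarrow> - (of_real 0 * \<kappa> * of_real r)) (at_right 0)"
      by (intro tendsto_intros)
    then show "((\<lambda>eps. - (of_real eps * \<kappa> * of_real r)) \<longlongrightarrow> 0) (at_right 0)" by simp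
    show "eventually (\<lambda>eps. - (of_real eps * \<kappa> * of_real r) \<noteq> 0) (at_right 0)"
      using eventually_at_right_less[of "0::real"] by eventually_elim (use r k0 in auto)
  qed
  from filterlim_compose[OF d this]
  have "((\<lambda>eps. (exp (- (of_real eps * \<kappa> * of_real r)) - 1) / - (of_real eps * \<kappa> * of_real r)) \<longlongrightarrow> 1) (at_right 0)" .
  from tendsto_mult[OF tendsto_const[of "of_real (ufun V x * vfun V y) / of_real (4 * pi)"] tendsto_add[OF tendsto_mult[OF this tendsto_const[of "- \<kappa>"]] tendsto_const[of \<kappa>]]]
  have "((\<lambda>eps. of_real (ufun V x * vfun V y) / of_real (4 * pi) *
     ((exp (- (of_real eps * \<kappa> * of_real r)) - 1) / - (of_real eps * \<kappa> * of_real r) * (- \<kappa>) + \<kappa>)) \<longlongrightarrow> 0) (at_right 0)" by simp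
  moreover have "(exp (- (of_real eps * \<kappa> * of_real r)) - 1) / - (of_real eps * \<kappa> * of_real r) * (- \<kappa>)
      = (exp (- (of_real eps * \<kappa> * of_real r)) - 1) / (of_real eps * of_real r)" for eps
    using k0 by (simp add: divide_simps)
  ultimately show "((\<lambda>eps. kD V \<kappa> eps x y) \<longlongrightarrow> 0) (at_right 0)"
    unfolding kD_eq[OF xy] r_def[symmetric] by simp
qed

lemma HSk_kD: assumes "rollnik V" "integrable lborel V" "0 < Re \<kappa>" "0 < eps"
  shows "HSk (kD V \<kappa> eps)"
proof -
  have "HSk (\<lambda>x y. 1 / of_real eps * (kK V (of_real eps * \<kappa>) x y - kK V 0 x y) - (- \<kappa> / of_real (4 * pi)) * (of_real (ufun V x) * of_real (vfun V y)))"
    by (intro HSk_diff HSk_cmult HSk_kK HSk_rank_one vfun_L2 assms) (use assms in simp_all)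
  then show ?thesis by (simp add: kD_def[abs_def])
qed

text \<open>If the integral vanishes, \<open>1/|x|\<close> may be subtracted from the kernel of \<open>\<psi>\<close>, which then becomes square integrable.\<close>

lemma resonance_integral_nonzero:
  assumes V: "rollnik V" "integrable lborel V" "integrable lborel (\<lambda>x. (1 + norm x) * V x)"
    and \<phi>: "\<phi> \<in> L2" and \<psi>: "inv_lap_v V \<phi> \<in> L2loc" "inv_lap_v V \<phi> \<notin> L2"
  shows "(LBINT y. of_real (vfun V y) * \<phi> y) \<noteq> 0"
proof
  assume 0: "(LBINT y. of_real (vfun V y) * \<phi> y) = 0"
  note [measurable] = rollnik_meas[OF V(1)] vfun_meas[OF rollnik_meas[OF V(1)]] L2_meas[OF \<phi>]
  define s where "s x y = 1 / norm (x - y) - 1 / norm x" for x y :: pt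
  define M where "M x y = (of_real (vfun V y * s x y / (4 * pi)) :: complex)" for x y
  have mM[measurable]: "(\<lambda>(x, y). M x y) \<in> borel_measurable (lborel \<Otimes>\<^sub>M lborel)" unfolding M_def s_def by measurable
  have Mb: "(NINT x. (ennreal (cmod (M x y)))^2) \<le> ennreal (32 * pi * ((1 + norm y) * \<bar>V y\<bar>))" for y
  proof (cases "y = 0")
    case True
    then show ?thesis by (simp add: M_def s_def)
  next
    case False
    have "(NINT x. (ennreal (cmod (M x y)))^2) \<le> (NINT x. ennreal (\<bar>V y\<bar> * (norm y)^2) * ennreal (1 / ((norm x)^2 * (norm (x - y))^2)))"
    proof (rule nn_integral_mono_AE)
      show "AE x in lborel. (ennreal (cmod (M x y)))^2 \<le> ennreal (\<bar>V y\<bar> * (norm y)^2) * ennreal (1 / ((norm x)^2 * (norm (x - y))^2))"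
        using AE_pt_neq[of 0] AE_pt_neq[of y]
      proof eventually_elim
        fix x assume x: "x \<noteq> 0" "x \<noteq> y"
        have "\<bar>s x y\<bar> = \<bar>norm x - norm (x - y)\<bar> / (norm x * norm (x - y))"
          using x by (simp add: s_def field_simps abs_divide abs_mult)
        also have "\<dots> \<le> norm y / (norm x * norm (x - y))"
          using norm_triangle_ineq3[of x "x - y"] by (intro divide_right_mono) auto
        finally have "\<bar>s x y\<bar> \<le> norm y / (norm x * norm (x - y))" .
        then have "(s x y)^2 \<le> (norm y / (norm x * norm (x - y)))^2" by (metis abs_ge_zero power2_abs power_mono)
        then have "\<bar>V y\<bar> * (s x y)^2 \<le> \<bar>V y\<bar> * (norm y)^2 * (1 / ((norm x)^2 * (norm (x - y))^2))"
          using mult_left_mono[of "(s x y)^2" "(norm y / (norm x * norm (x - y)))^2" "\<bar>V y\<bar>"]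
          by (simp add: power_divide power_mult_distrib)
        moreover have "(cmod (M x y))^2 \<le> \<bar>V y\<bar> * (s x y)^2"
        proof -
          have "cmod (M x y) \<le> vfun V y * \<bar>s x y\<bar>"
            unfolding M_def norm_of_real using div_4pi[of "vfun V y * \<bar>s x y\<bar>"] by (simp add: abs_mult vfun_nonneg)
          then have "(cmod (M x y))^2 \<le> (vfun V y * \<bar>s x y\<bar>)^2" by (intro power_mono) auto
          then show ?thesis by (simp add: power_mult_distrib vfun_def)
        qed
        ultimately show "(ennreal (cmod (M x y)))^2 \<le> ennreal (\<bar>V y\<bar> * (norm y)^2) * ennreal (1 / ((norm x)^2 * (norm (x - y))^2))"
          by (simp add: ennreal_power ennreal_mult[symmetric])
      qed
    qed
    also have "\<dots> = ennreal (\<bar>V y\<bar> * (norm y)^2) * (NINT x. ennreal (1 / ((norm x)^2 * (norm (x - y))^2)))"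
      by (rule nn_integral_cmult) measurable
    \<comment> \<open>The composition estimate cancels one power of \<open>|y|\<close>; what remains
      is integrable because \<open>V\<close> is integrable with the weight
      \<open>1 + |y|\<close>.\<close>
    also have "\<dots> \<le> ennreal (\<bar>V y\<bar> * (norm y)^2) * ennreal (32 * pi / norm y)"
      by (intro mult_left_mono riesz_composition False) simp
    also have "\<dots> = ennreal (32 * pi * (norm y * \<bar>V y\<bar>))"
      using False by (simp add: ennreal_mult[symmetric] power2_eq_square)
    also have "\<dots> \<le> ennreal (32 * pi * ((1 + norm y) * \<bar>V y\<bar>))" by (intro ennreal_leI mult_left_mono mult_right_mono) auto
    finally show ?thesis .
  qed
  have "hs M = (NINT y. NINT x. (ennreal (cmod (M x y)))^2)"
    unfolding hs_def by (rule lborel_Tonelli) measurable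
  also have "\<dots> \<le> (NINT y. ennreal (32 * pi * ((1 + norm y) * \<bar>V y\<bar>)))" by (intro nn_integral_mono Mb)
  also have "\<dots> = (NINT y. ennreal (32 * pi) * ennreal (norm ((1 + norm y) * V y)))"
    by (intro nn_integral_cong) (simp add: ennreal_mult[symmetric] abs_mult)
  also have "\<dots> = ennreal (32 * pi) * (NINT y. ennreal (norm ((1 + norm y) * V y)))" by (rule nn_integral_cmult) measurable
  also have "\<dots> < \<infinity>" using V(3) by (simp add: integrable_iff_bounded ennreal_mult_less_top)
  finally have HM: "HSk M" by (simp add: HSk_def)
  have I: "integrable lborel (\<lambda>y. of_real (vfun V y) * \<phi> y)" by (intro L2_mult_CS(1) vfun_L2 V \<phi>)
  have "AE x in lborel. kop M \<phi> x = inv_lap_v V \<phi> x"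
    using kop_integrable[OF HM \<phi>] AE_pt_neq[of 0]
  proof eventually_elim
    fix x :: pt assume i: "integrable lborel (\<lambda>y. M x y * \<phi> y)" and "x \<noteq> 0"
    have "inv_lap_v V \<phi> x = (LBINT y. M x y * \<phi> y + 1 / of_real (4 * pi * norm x) * (of_real (vfun V y) * \<phi> y))"
      unfolding inv_lap_v_def
    proof (rule Bochner_Integration.integral_cong[OF refl])
      fix y
      have e: "vfun V y / (4 * pi * dist x y) = vfun V y * s x y / (4 * pi) + 1 / (4 * pi * norm x) * vfun V y"
        by (simp add: s_def dist_norm field_simps)
      have "of_real (vfun V y) * \<phi> y / of_real (4 * pi * dist x y) = of_real (vfun V y / (4 * pi * dist x y)) * \<phi> y" by simp
      also have "\<dots> = M x y * \<phi> y + 1 / of_real (4 * pi * norm x) * (of_real (vfun V y) * \<phi> y)"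
        unfolding e M_def by (simp add: distrib_right)
      finally show "of_real (vfun V y) * \<phi> y / of_real (4 * pi * dist x y) = M x y * \<phi> y + 1 / of_real (4 * pi * norm x) * (of_real (vfun V y) * \<phi> y)" .
    qed
    also have "\<dots> = kop M \<phi> x"
      by (subst Bochner_Integration.integral_add[OF i]) (use I 0 in \<open>auto simp: kop_def\<close>)
    finally show "kop M \<phi> x = inv_lap_v V \<phi> x" by simp
  qed
  then have "inv_lap_v V \<phi> \<in> L2"
    by (rule L2_cong_AE[OF kop_L2[OF HM \<phi>], rotated]) (use \<psi>(1) in \<open>simp add: L2loc_def\<close>)
  then show False using \<psi>(2) by simp
qed

section \<open>The eigenfunction, its dual and the constant \<open>A\<close>\<close>

locale resonance = scaled_potential +
  fixes \<phi> :: cfun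
  assumes VL1': "integrable lborel (\<lambda>x. (1 + norm x) * V x)"
    and eigfun: "BS_eigfun V \<phi>"
    and simple: "\<And>\<phi>'. BS_eigfun V \<phi>' ==> \<exists>c. AE x in lborel. \<phi>' x = c * \<phi> x"
    and \<psi>: "inv_lap_v V \<phi> \<in> L2loc" "inv_lap_v V \<phi> \<notin> L2"
    and normalised: "(LBINT x. sgn (V x) * (cmod (\<phi> x))^2) = -1"
begin

text \<open>The conjugate of \<open>sign(V) \<phi>\<close>, which is the eigenfunction of the
  adjoint zero-energy operator. With the conjugation included, all pairings below are
  bilinear.\<close>

definition \<phi>d :: cfun where "\<phi>d x = of_real (sgn (V x)) * cnj (\<phi> x)"
definition A :: complex where "A = (LBINT x. of_real (vfun V x) * \<phi> x)"

lemma \<phi>_L2: "\<phi> \<in> L2" and \<phi>_eq: "AE x in lborel. \<phi> x + kop (kK V 0) \<phi> x = 0"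
  using eigfun by (auto simp: BS_eigfun_iff)

lemma V_meas: "V \<in> borel_measurable borel" by (rule rollnik_meas[OF VR])

lemma \<phi>d_L2: "\<phi>d \<in> L2"
  unfolding \<phi>d_def[abs_def]
  by (rule L2_bounded_mult[OF L2_cnj[OF \<phi>_L2], where B=1]) (use V_meas in \<open>auto simp: sgn_if\<close>)

lemma A_nonzero: "A \<noteq> 0"
  unfolding A_def by (rule resonance_integral_nonzero[OF VR VL1 VL1' \<phi>_L2 \<psi>])

lemma \<phi>d_\<phi>: "(LBINT x. \<phi>d x * \<phi> x) = -1"
proof -
  have "(LBINT x. \<phi>d x * \<phi> x) = (LBINT x. of_real (sgn (V x) * (cmod (\<phi> x))^2))"
    by (intro Bochner_Integration.integral_cong refl) (simp add: \<phi>d_def complex_norm_square mult.assoc mult.commute[of "cnj _"] del: of_real_power)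
  then show ?thesis by (simp only: integral_complex_of_real normalised) simp
qed

lemma \<phi>d_u: "(LBINT x. \<phi>d x * of_real (ufun V x)) = cnj A"
proof -
  have e: "\<phi>d x * of_real (ufun V x) = cnj (of_real (vfun V x) * \<phi> x)" for x
  proof -
    have "\<phi>d x * of_real (ufun V x) = of_real (sgn (V x) * ufun V x) * cnj (\<phi> x)" by (simp add: \<phi>d_def)
    then show ?thesis unfolding sgn_ufun by simp
  qed
  show ?thesis unfolding e A_def by (rule Bochner_Integration.integral_cnj)
qed

text \<open>By the eigenvalue equation \<open>u \<psi> = - \<phi>\<close>, hence
  \<open>V \<psi> = - v \<phi>\<close> almost everywhere.\<close>

lemma integral_V_\<psi>: "(LBINT x. of_real (V x) * inv_lap_v V \<phi> x) = - A"
proof -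
  have "(LBINT x. of_real (V x) * inv_lap_v V \<phi> x) = (LBINT x. - (of_real (vfun V x) * \<phi> x))"
  proof (rule integral_cong_AE)
    show "AE x in lborel. of_real (V x) * inv_lap_v V \<phi> x = - (of_real (vfun V x) * \<phi> x)"
      using \<phi>_eq
    proof eventually_elim
      fix x assume "\<phi> x + kop (kK V 0) \<phi> x = 0"
      then have e: "of_real (ufun V x) * inv_lap_v V \<phi> x = - \<phi> x" by (simp add: kop_kK_0 add_eq_0_iff)
      have "of_real (V x) * inv_lap_v V \<phi> x = of_real (vfun V x * ufun V x) * inv_lap_v V \<phi> x" by (simp only: vu_eq)
      also have "\<dots> = of_real (vfun V x) * (of_real (ufun V x) * inv_lap_v V \<phi> x)" by simp
      finally show "of_real (V x) * inv_lap_v V \<phi> x = - (of_real (vfun V x) * \<phi> x)" unfolding e by simp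
    qed
  qed (use V_meas vfun_meas[OF V_meas] L2_meas[OF \<phi>_L2] \<psi>(1) in \<open>auto simp: L2loc_def\<close>)
  then show ?thesis by (simp add: A_def)
qed

lemma HSk_K0: "HSk (kK V 0)" by (rule HSk_kK[OF VR]) simp

text \<open>Since \<open>u = sign(V) v\<close> and the zero-energy Green kernel is real and
  symmetric, the adjoint maps \<open>sign(V) \<phi>\<close> to \<open>sign(V)\<close> times the
  image of \<open>\<phi>\<close> under \<open>K\<close>, which is \<open>- sign(V) \<phi>\<close>.
  So \<open>\<phi>d\<close> annihilates the range of \<open>1 + K\<close>.\<close>

lemma \<phi>d_kop:
  assumes p: "p \<in> L2" shows "(LBINT x. \<phi>d x * kop (kK V 0) p x) = - (LBINT x. \<phi>d x * p x)"
proof -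
  define q where "q x = cnj (\<phi>d x)" for x
  have qL: "q \<in> L2" unfolding q_def[abs_def] by (rule L2_cnj[OF \<phi>d_L2])
  have adj: "kop (\<lambda>x y. cnj (kK V 0 y x)) q x = of_real (sgn (V x)) * kop (kK V 0) \<phi> x" for x
  proof -
    have "cnj (kK V 0 y x) * q y = of_real (sgn (V x)) * (kK V 0 x y * \<phi> y)" for y
    proof -
      have "cnj (kK V 0 y x) * q y = of_real (sgn (V y) * ufun V y) * Fd 0 0 (y - x) * of_real (vfun V x) * \<phi> y"
        by (simp add: kK_def q_def \<phi>d_def Fd_cnj[symmetric])
      also have "\<dots> = of_real (sgn (V x) * ufun V x) * Fd 0 0 (x - y) * of_real (vfun V y) * \<phi> y"
        unfolding sgn_ufun Fd_even[of 0 y x] by simp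
      finally show ?thesis by (simp add: kK_def)
    qed
    then show ?thesis by (simp add: kop_def)
  qed
  have "(LBINT x. kop (kK V 0) p x * cnj (q x)) = (LBINT x. p x * cnj (of_real (sgn (V x)) * kop (kK V 0) \<phi> x))"
    unfolding kop_adjoint[OF HSk_K0 p qL] adj ..
  also have "\<dots> = (LBINT x. - (\<phi>d x * p x))"
  proof (rule integral_cong_AE)
    show "AE x in lborel. p x * cnj (of_real (sgn (V x)) * kop (kK V 0) \<phi> x) = - (\<phi>d x * p x)"
      using \<phi>_eq
    proof eventually_elim
      fix x assume "\<phi> x + kop (kK V 0) \<phi> x = 0"
      then have "kop (kK V 0) \<phi> x = - \<phi> x" by (simp add: add_eq_0_iff)
      then show "p x * cnj (of_real (sgn (V x)) * kop (kK V 0) \<phi> x) = - (\<phi>d x * p x)" by (simp add: \<phi>d_def)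
    qed
  qed (use V_meas L2_meas[OF L2_cnj[OF kop_L2[OF HSk_K0 \<phi>_L2]]] L2_meas[OF p] L2_meas[OF \<phi>d_L2] in \<open>simp_all add: borel_measurable_sgn\<close>)
  finally show ?thesis by (simp add: q_def mult.commute)
qed

text \<open>By simplicity an element of the kernel of \<open>1 + K\<close> is a multiple of
  \<open>\<phi>\<close>. The normalisation gives \<open>\<phi>\<close> the pairing -1 with
  \<open>\<phi>d\<close>, so the side condition leaves only 0.\<close>

lemma K0_bounded_below:
  "\<exists>c>0. \<forall>p\<in>L2. (LBINT x. \<phi>d x * p x) = 0 --> c * L2norm p \<le> L2norm (\<lambda>x. p x + kop (kK V 0) p x)"
proof (rule id_plus_kop_bounded_below[OF HSk_K0 \<phi>d_L2])
  fix p assume p: "p \<in> L2" and o: "(LBINT x. \<phi>d x * p x) = 0" and eq: "AE x in lborel. p x + kop (kK V 0) p x = 0"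
  show "AE x in lborel. p x = 0"
  proof (rule ccontr)
    assume n: "\<not> (AE x in lborel. p x = 0)"
    then have "BS_eigfun V p" using p eq by (simp add: BS_eigfun_iff)
    then obtain c where c: "AE x in lborel. p x = c * \<phi> x" using simple by blast
    have "(LBINT x. \<phi>d x * p x) = (LBINT x. c * (\<phi>d x * \<phi> x))"
    proof (rule integral_cong_AE)
      show "AE x in lborel. \<phi>d x * p x = c * (\<phi>d x * \<phi> x)" using c by eventually_elim simp
    qed (use L2_meas[OF p] L2_meas[OF \<phi>_L2] L2_meas[OF \<phi>d_L2] in simp_all)
    then have "c = 0" using o \<phi>d_\<phi> by simp
    then show False using c n by simp
  qed
qed

end

text \<open>The expansion of the operator to first order in \<open>eps\<close>: the zero-energy
  operator, a rank one correction along \<open>u\<close>, and a remainder of vanishing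
  Hilbert-Schmidt norm.\<close>

lemma kop_kD:
  assumes V: "rollnik V" "integrable lborel V" and k: "0 < Re \<kappa>" and eps: "0 < eps" and q: "q \<in> L2"
  shows "AE x in lborel. kop (kK V (of_real eps * \<kappa>)) q x = kop (kK V 0) q x + of_real eps * kop (kD V \<kappa> eps) q x
    - of_real eps * (\<kappa> / of_real (4 * pi)) * (of_real (ufun V x) * (LBINT y. of_real (vfun V y) * q y))"
proof -
  define \<kappa>' where "\<kappa>' = of_real eps * \<kappa>"
  define t where "t = \<kappa> / of_real (4 * pi)"
  have H: "HSk (kK V \<kappa>')" "HSk (kK V 0)" using eps k by (auto intro!: HSk_kK V simp: \<kappa>'_def)
  have I: "integrable lborel (\<lambda>y. of_real (vfun V y) * q y)" by (intro L2_mult_CS(1) vfun_L2 V q)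
  show ?thesis
    unfolding \<kappa>'_def[symmetric] t_def[symmetric]
    using kop_integrable[OF H(1) q] kop_integrable[OF H(2) q]
  proof eventually_elim
    fix x assume i: "integrable lborel (\<lambda>y. kK V \<kappa>' x y * q y)" "integrable lborel (\<lambda>y. kK V 0 x y * q y)"
    have "kop (kD V \<kappa> eps) q x = (LBINT y. 1 / of_real eps * (kK V \<kappa>' x y * q y - kK V 0 x y * q y) + t * of_real (ufun V x) * (of_real (vfun V y) * q y))"
      unfolding kop_def kD_def \<kappa>'_def[symmetric] t_def[symmetric] by (intro Bochner_Integration.integral_cong refl) (simp add: algebra_simps diff_divide_distrib)
    also have "\<dots> = 1 / of_real eps * ((LBINT y. kK V \<kappa>' x y * q y) - (LBINT y. kK V 0 x y * q y))
       + t * of_real (ufun V x) * (LBINT y. of_real (vfun V y) * q y)"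
      by (simp only: Bochner_Integration.integral_add Bochner_Integration.integral_diff integral_mult_right_zero integrable_mult_right Bochner_Integration.integrable_diff i I)
    finally have "of_real eps * kop (kD V \<kappa> eps) q x = kop (kK V \<kappa>') q x - kop (kK V 0) q x
       + of_real eps * (t * of_real (ufun V x) * (LBINT y. of_real (vfun V y) * q y))"
      using eps by (simp add: kop_def field_simps)
    then show "kop (kK V \<kappa>') q x = kop (kK V 0) q x + of_real eps * kop (kD V \<kappa> eps) q x
      - of_real eps * t * (of_real (ufun V x) * (LBINT y. of_real (vfun V y) * q y))" by (simp add: algebra_simps)
  qed
qed

text \<open>The left-hand function need not be measurable; the norm is then the junk value 0.\<close>

lemma L2norm_le_of_AE_eq:
  assumes "AE x in lborel. f x = g x" "g \<in> L2" shows "L2norm f \<le> L2norm g"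
proof (cases "integrable lborel (\<lambda>x. (cmod (f x))^2)")
  case True
  then have "(LBINT x. (cmod (f x))^2) = (LBINT x. (cmod (g x))^2)"
    using assms L2_sq_integrable[OF assms(2)] by (intro integral_cong_AE) auto
  then show ?thesis by (simp add: L2norm_def)
qed (simp add: L2norm_def not_integrable_integral_eq)

section \<open>Asymptotics of the rescaled unknown at a resonance\<close>

context resonance
begin

definition J :: "cfun => complex" where "J q = (LBINT y. of_real (vfun V y) * q y)"

text \<open>This equals \<open>- |A|^2\<close> times \<open>\<alpha> + \<kappa> / (4 \<pi>)\<close>
  for \<open>\<alpha> = - \<eta>'(0) / |A|^2\<close>, that is, up to a factor, the denominator of
  the point interaction resolvent.\<close>

definition Mc :: "complex => complex" where
  "Mc \<kappa> = of_real (d\<eta> 1 0) - \<kappa> / of_real (4 * pi) * (A * cnj A)"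

text \<open>Projecting the rescaled equation onto \<open>\<phi>\<close> kills its leading part, so that after division by \<open>eps\<close> the next
  order determines the component of \<open>q\<close> along \<open>\<phi>\<close>.\<close>

lemma projected_equation:
  assumes k: "0 < Re \<kappa>" and eps: "0 < eps" and g: "g \<in> L2" and q: "q \<in> L2"
    and eq: "AE y in lborel. q y + of_real h * kop (kK V (of_real eps * \<kappa>)) q y = of_real eps * kop (kQ V \<kappa> eps) g y"
  defines "c \<equiv> - (LBINT x. \<phi>d x * q x)"
  shows "c * (of_real ((h - 1) / eps)) + of_real h * (LBINT x. \<phi>d x * kop (kD V \<kappa> eps) q x)
    - of_real h * (\<kappa> / of_real (4 * pi)) * cnj A * J q = (LBINT x. \<phi>d x * kop (kQ V \<kappa> eps) g x)"
proof -
  define t where "t = \<kappa> / of_real (4 * pi)"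
  have L: "kop (kD V \<kappa> eps) q \<in> L2" "kop (kQ V \<kappa> eps) g \<in> L2" "kop (kK V 0) q \<in> L2"
    by (intro kop_L2 HSk_kD[OF VR VL1 k eps] HSk_kP(3)[OF VL1 k] HSk_K0 q g)+
  note I = L2_mult_CS(1)[OF \<phi>d_L2 q] L2_mult_CS(1)[OF \<phi>d_L2 L(1)] L2_mult_CS(1)[OF \<phi>d_L2 L(2)] L2_mult_CS(1)[OF \<phi>d_L2 L(3)]
    L2_mult_CS(1)[OF \<phi>d_L2 vfun_L2(2)[OF VL1]]
  define X where "X = (LBINT x. \<phi>d x * q x)"
  define Y where "Y = (LBINT x. \<phi>d x * kop (kD V \<kappa> eps) q x)"
  have "(LBINT x. of_real eps * (\<phi>d x * kop (kQ V \<kappa> eps) g x)) = (LBINT x. \<phi>d x * q x + of_real h * (\<phi>d x * kop (kK V 0) q x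
     + of_real eps * (\<phi>d x * kop (kD V \<kappa> eps) q x) - of_real eps * t * J q * (\<phi>d x * of_real (ufun V x))))"
  proof (rule integral_cong_AE)
    show "AE x in lborel. of_real eps * (\<phi>d x * kop (kQ V \<kappa> eps) g x) = \<phi>d x * q x + of_real h * (\<phi>d x * kop (kK V 0) q x
     + of_real eps * (\<phi>d x * kop (kD V \<kappa> eps) q x) - of_real eps * t * J q * (\<phi>d x * of_real (ufun V x)))"
      using eq kop_kD[OF VR VL1 k eps q]
    proof eventually_elim
      fix x
      assume a: "q x + of_real h * kop (kK V (of_real eps * \<kappa>)) q x = of_real eps * kop (kQ V \<kappa> eps) g x"
        and b: "kop (kK V (of_real eps * \<kappa>)) q x = kop (kK V 0) q x + of_real eps * kop (kD V \<kappa> eps) q x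
          - of_real eps * (\<kappa> / of_real (4 * pi)) * (of_real (ufun V x) * (LBINT y. of_real (vfun V y) * q y))"
      have "of_real eps * (\<phi>d x * kop (kQ V \<kappa> eps) g x) = \<phi>d x * (of_real eps * kop (kQ V \<kappa> eps) g x)" by simp
      also have "\<dots> = \<phi>d x * q x + of_real h * (\<phi>d x * kop (kK V 0) q x
         + of_real eps * (\<phi>d x * kop (kD V \<kappa> eps) q x) - of_real eps * t * J q * (\<phi>d x * of_real (ufun V x)))"
        unfolding a[symmetric] b J_def[symmetric] t_def[symmetric] by (simp add: algebra_simps)
      finally show "of_real eps * (\<phi>d x * kop (kQ V \<kappa> eps) g x) = \<phi>d x * q x + of_real h * (\<phi>d x * kop (kK V 0) q x
         + of_real eps * (\<phi>d x * kop (kD V \<kappa> eps) q x) - of_real eps * t * J q * (\<phi>d x * of_real (ufun V x)))" .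
    qed
  qed (use L2_meas[OF \<phi>d_L2] L2_meas[OF q] L2_meas[OF L(1)] L2_meas[OF L(2)] L2_meas[OF L(3)] L2_meas[OF vfun_L2(2)[OF VL1]] in measurable)
  also have "\<dots> = X + of_real h * ((LBINT x. \<phi>d x * kop (kK V 0) q x) + of_real eps * Y - of_real eps * t * J q * (LBINT x. \<phi>d x * of_real (ufun V x)))"
    unfolding X_def Y_def
    by (simp only: Bochner_Integration.integral_add Bochner_Integration.integral_diff integral_mult_right_zero
        integrable_mult_right Bochner_Integration.integrable_diff Bochner_Integration.integrable_add I)
  also have "\<dots> = X + of_real h * (- X + of_real eps * Y - of_real eps * t * J q * cnj A)"
    by (simp only: \<phi>d_kop[OF q] \<phi>d_u X_def)
  finally have "of_real eps * (LBINT x. \<phi>d x * kop (kQ V \<kappa> eps) g x) = X + of_real h * (- X + of_real eps * Y - of_real eps * t * J q * cnj A)"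
    by (simp only: integral_mult_right_zero)
  then show ?thesis using eps unfolding c_def X_def[symmetric] Y_def[symmetric] t_def[symmetric]
    by (simp add: field_simps)
qed

lemma J_bound: assumes "q \<in> L2" shows "cmod (J q) \<le> L2norm (\<lambda>y. of_real (vfun V y)) * L2norm q"
  unfolding J_def by (rule L2_mult_CS(3)[OF vfun_L2(1)[OF VL1] assms])

text \<open>Here \<open>q\<close> plays the role of \<open>eps p\<close>, which stays bounded. It is
  split as \<open>c \<phi> + r\<close> with \<open>r\<close> annihilated by \<open>\<phi>d\<close>:
  the lower bound controls \<open>r\<close> and the projected equation controls \<open>c\<close>.
  Every error is a vanishing multiple of \<open>N + S\<close>, with \<open>N\<close> the norm of
  \<open>g\<close> and \<open>S\<close> the size of the pair \<open>c\<close>, \<open>r\<close>, so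
  the part with \<open>S\<close> is absorbed. All rates are independent of \<open>g\<close>, as norm
  convergence demands.\<close>

lemma rescaled_limit:
  assumes k: "0 < Re \<kappa>" and M0: "Mc \<kappa> \<noteq> 0"
  shows "\<exists>C a. 0 \<le> C \<and> (a \<longlongrightarrow> 0) (at_right 0) \<and> eventually (\<lambda>eps. 0 \<le> a eps \<and> (\<forall>g q. g \<in> L2 --> q \<in> L2 -->
     (AE y in lborel. q y + of_real (\<eta> eps) * kop (kK V (of_real eps * \<kappa>)) q y = of_real eps * kop (kQ V \<kappa> eps) g y) -->
     L2norm q \<le> C * L2norm g \<and> cmod (J q - A * cnj A * Gop \<kappa> g 0 / Mc \<kappa>) \<le> a eps * L2norm g)) (at_right 0)"
proof -
  obtain B where B: "0 \<le> B" "\<And>t. t \<in> {0..1} ==> \<bar>\<eta> t\<bar> \<le> B" using eta_bounded by blast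
  obtain c0 where c0: "0 < c0" "\<And>p. p \<in> L2 ==> (LBINT x. \<phi>d x * p x) = 0 ==> c0 * L2norm p \<le> L2norm (\<lambda>x. p x + kop (kK V 0) p x)"
    using K0_bounded_below by blast
  define M where "M = Mc \<kappa>"
  define m where "m = cmod M"
  have m: "0 < m" using M0 by (simp add: m_def M_def)
  define t where "t = \<kappa> / of_real (4 * pi)"
  define \<Phi> where "\<Phi> = L2norm \<phi>"
  define D where "D = L2norm \<phi>d"
  define vn where "vn = L2norm (\<lambda>y. of_real (vfun V y))"
  define H where "H = HB V \<kappa>"
  define G where "G = L2norm (Fd \<kappa> 0)"
  define \<tau> where "\<tau> eps = hsn (\<lambda>x y. kK V 0 x y - of_real (\<eta> eps) * kK V (of_real eps * \<kappa>) x y)" for eps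
  define \<delta> where "\<delta> eps = hsn (kD V \<kappa> eps)" for eps
  define \<rho> where "\<rho> eps = hsn (\<lambda>x y. kQ V \<kappa> eps x y - kQ V \<kappa> 0 x y)" for eps
  define \<mu> where "\<mu> eps = cmod (M - (of_real ((\<eta> eps - 1) / eps) - of_real (\<eta> eps) * t * (A * cnj A)))" for eps
  have nn: "0 \<le> \<Phi>" "0 \<le> D" "0 \<le> vn" "0 \<le> H" "0 \<le> G" by (simp_all add: \<Phi>_def D_def vn_def H_def G_def HB_nonneg)
  have nf: "0 \<le> \<tau> eps" "0 \<le> \<delta> eps" "0 \<le> \<rho> eps" "0 \<le> \<mu> eps" for eps by (simp_all add: \<tau>_def \<delta>_def \<rho>_def \<mu>_def)
  have \<tau>: "(\<tau> \<longlongrightarrow> 0) (at_right 0)"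
    unfolding \<tau>_def by (rule hsn_kK_tendsto[OF VR k eta_tendsto, of B]) (use B in auto)
  have \<delta>: "(\<delta> \<longlongrightarrow> 0) (at_right 0)" unfolding \<delta>_def by (rule hsn_kD_tendsto[OF VR VL1 k])
  have \<rho>: "(\<rho> \<longlongrightarrow> 0) (at_right 0)" unfolding \<rho>_def by (rule hsn_kP_diff_tendsto(2)[OF VL1 k])
  have \<mu>: "(\<mu> \<longlongrightarrow> 0) (at_right 0)"
  proof -
    have "(\<mu> \<longlongrightarrow> cmod (M - (of_real (d\<eta> 1 0) - of_real 1 * t * (A * cnj A)))) (at_right 0)"
      unfolding \<mu>_def by (intro tendsto_intros eta_quotient_tendsto eta_tendsto)
    then show ?thesis by (simp add: M_def Mc_def t_def)
  qed
  define C2 where "C2 = 2 * cmod t * cmod A * vn"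
  define C3 where "C3 = cmod A * G"
  \<comment> \<open>Obtained by solving \<open>S \<le> C3 / m * N + 1 / 2 * (N + S)\<close> for
    \<open>S\<close>.\<close>
  define C4 where "C4 = 2 * (C3 / m) + 1"
  \<comment> \<open>\<open>a1\<close>, \<open>a2\<close> and \<open>a\<close> are the error rates
    for \<open>r\<close>, for the equation \<open>c M = cnj A I\<close> and for
    \<open>J q\<close>.\<close>
  define a1 where "a1 eps = (eps * H + \<tau> eps * (1 + \<Phi>)) / c0" for eps
  define a2 where "a2 eps = \<mu> eps + 2 * D * \<delta> eps * (1 + \<Phi>) + D * \<rho> eps + C2 * a1 eps" for eps
  define a where "a eps = (cmod A * a2 eps / m + vn * a1 eps) * (1 + C4)" for eps
  have CC: "0 \<le> C2" "0 \<le> C3" "0 \<le> C4" using nn m by (simp_all add: C2_def C3_def C4_def)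
  have a1l: "(a1 \<longlongrightarrow> 0) (at_right 0)"
  proof -
    have "(a1 \<longlongrightarrow> (0 * H + 0 * (1 + \<Phi>)) / c0) (at_right 0)" unfolding a1_def using c0(1) by (intro tendsto_intros \<tau>) auto
    then show ?thesis by simp
  qed
  have a2l: "(a2 \<longlongrightarrow> 0) (at_right 0)"
  proof -
    have "(a2 \<longlongrightarrow> 0 + 2 * D * 0 * (1 + \<Phi>) + D * 0 + C2 * 0) (at_right 0)" unfolding a2_def by (intro tendsto_intros \<mu> \<delta> \<rho> a1l)
    then show ?thesis by simp
  qed
  have al: "(a \<longlongrightarrow> 0) (at_right 0)"
  proof -
    have "(a \<longlongrightarrow> (cmod A * 0 / m + vn * 0) * (1 + C4)) (at_right 0)" unfolding a_def using m by (intro tendsto_intros a1l a2l) auto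
    then show ?thesis by simp
  qed
  have "((\<lambda>eps. a2 eps / m + a1 eps) \<longlongrightarrow> 0 / m + 0) (at_right 0)" using m by (intro tendsto_intros a1l a2l) auto
  then have small: "eventually (\<lambda>eps. a2 eps / m + a1 eps < 1 / 2) (at_right 0)" by (rule order_tendstoD(2)) simp
  have eta2: "eventually (\<lambda>eps. \<eta> eps < 2) (at_right 0)" using order_tendstoD(2)[OF eta_tendsto, of 2] by simp
  have "eventually (\<lambda>eps. 0 \<le> a eps \<and> (\<forall>g q. g \<in> L2 --> q \<in> L2 -->
     (AE y in lborel. q y + of_real (\<eta> eps) * kop (kK V (of_real eps * \<kappa>)) q y = of_real eps * kop (kQ V \<kappa> eps) g y) -->
     L2norm q \<le> ((1 + \<Phi>) * C4) * L2norm g \<and> cmod (J q - A * cnj A * Gop \<kappa> g 0 / M) \<le> a eps * L2norm g)) (at_right 0)"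
    using small eta2 eta_pos eventually_at_right_le_1
  proof eventually_elim
    fix eps :: real
    assume sm: "a2 eps / m + a1 eps < 1 / 2" and h2: "\<eta> eps < 2" and h0: "0 < \<eta> eps" and eps: "0 < eps \<and> eps \<le> 1"
    have eps0: "0 < eps" using eps by simp
    have a1n: "0 \<le> a1 eps" using nn nf eps0 c0 by (simp add: a1_def)
    have a2n: "0 \<le> a2 eps" using nn nf CC a1n by (simp add: a2_def)
    have an: "0 \<le> a eps" using nn m CC a1n a2n by (simp add: a_def)
    have "L2norm q \<le> ((1 + \<Phi>) * C4) * L2norm g \<and> cmod (J q - A * cnj A * Gop \<kappa> g 0 / M) \<le> a eps * L2norm g"
      if g: "g \<in> L2" and q: "q \<in> L2"
        and eq: "AE y in lborel. q y + of_real (\<eta> eps) * kop (kK V (of_real eps * \<kappa>)) q y = of_real eps * kop (kQ V \<kappa> eps) g y" for g q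
    proof -
      define N where "N = L2norm g"
      \<comment> \<open>The sign compensates for the pairing of \<open>\<phi>d\<close> with
        \<open>\<phi>\<close>, which is -1, and makes \<open>c\<close> the coefficient of
        \<open>\<phi>\<close> in \<open>q\<close>.\<close>
      define c where "c = - (LBINT x. \<phi>d x * q x)"
      define r where "r = (\<lambda>x. q x - c * \<phi> x)"
      define S where "S = cmod c + L2norm r"
      define I where "I = Gop \<kappa> g 0"
      have N0: "0 \<le> N" and S0: "0 \<le> S" by (simp_all add: N_def S_def)
      have rL: "r \<in> L2" unfolding r_def by (intro L2_diff L2_cmult q \<phi>_L2)
      have "(LBINT x. \<phi>d x * r x) = (LBINT x. \<phi>d x * q x - c * (\<phi>d x * \<phi> x))" by (simp add: r_def algebra_simps)
      also have "\<dots> = - c - c * (LBINT x. \<phi>d x * \<phi> x)"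
        by (subst Bochner_Integration.integral_diff[OF L2_mult_CS(1)[OF \<phi>d_L2 q] integrable_mult_right[OF L2_mult_CS(1)[OF \<phi>d_L2 \<phi>_L2]]])
          (simp add: c_def)
      finally have ro: "(LBINT x. \<phi>d x * r x) = 0" by (simp add: \<phi>d_\<phi>)
      have qr: "q = (\<lambda>x. c * \<phi> x + r x)" by (simp add: r_def)
      have "L2norm q \<le> L2norm (\<lambda>x. c * \<phi> x) + L2norm r" by (subst qr) (intro L2norm_triangle L2_cmult \<phi>_L2 rL)
      also have "\<dots> = cmod c * \<Phi> + L2norm r" by (simp add: L2norm_cmult \<Phi>_def)
      also have "\<dots> \<le> (1 + \<Phi>) * S" using nn(1) by (simp add: S_def algebra_simps)
      finally have qS: "L2norm q \<le> (1 + \<Phi>) * S" .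
      have QL: "kop (kQ V \<kappa> eps) g \<in> L2" by (rule kop_L2[OF HSk_kP(3)[OF VL1 k] g])
      have rS: "L2norm r \<le> a1 eps * (N + S)"
      proof -
        have "c0 * L2norm r \<le> L2norm (\<lambda>x. r x + kop (kK V 0) r x)" by (rule c0(2)[OF rL ro])
        also have "\<dots> = L2norm (\<lambda>x. q x + kop (kK V 0) q x)"
        proof (rule L2norm_cong_AE)
          show "AE x in lborel. r x + kop (kK V 0) r x = q x + kop (kK V 0) q x"
            using kop_diff[OF HSk_K0 q L2_cmult[OF \<phi>_L2, of c]] \<phi>_eq
          proof eventually_elim
            fix x assume 1: "kop (kK V 0) (\<lambda>y. q y - c * \<phi> y) x = kop (kK V 0) q x - kop (kK V 0) (\<lambda>y. c * \<phi> y) x"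
              and 2: "\<phi> x + kop (kK V 0) \<phi> x = 0"
            have "kop (kK V 0) \<phi> x = - \<phi> x" using 2 by (simp add: add_eq_0_iff)
            then show "r x + kop (kK V 0) r x = q x + kop (kK V 0) q x" using 1 by (simp add: r_def kop_cmult)
          qed
        qed (intro L2_meas L2_add rL q kop_L2 HSk_K0)+
        also have "\<dots> \<le> L2norm (\<lambda>y. of_real eps * kop (kQ V \<kappa> eps) g y) + \<tau> eps * L2norm q"
          unfolding \<tau>_def by (rule kK_0_defect[OF k eps0 q eq L2_cmult[OF QL]])
        also have "\<dots> \<le> eps * (H * N) + \<tau> eps * ((1 + \<Phi>) * S)"
          unfolding L2norm_cmult H_def N_def using eps0 by (intro add_mono mult_mono L2norm_kQ k g qS nf) auto
        also have "\<dots> \<le> eps * (H * (N + S)) + \<tau> eps * ((1 + \<Phi>) * (N + S))"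
          using N0 S0 nn nf[of eps] eps0 by (intro add_mono mult_left_mono) auto
        finally show ?thesis using c0(1) by (simp add: a1_def field_simps)
      qed
      define Y where "Y = (LBINT x. \<phi>d x * kop (kD V \<kappa> eps) q x)"
      define Z where "Z = (LBINT x. \<phi>d x * kop (kQ V \<kappa> eps) g x)"
      have Jq: "J q = c * A + J r"
      proof -
        have "J q = (LBINT y. c * (of_real (vfun V y) * \<phi> y) + of_real (vfun V y) * r y)"
          unfolding J_def by (subst qr) (simp add: algebra_simps)
        also have "\<dots> = c * A + J r"
          unfolding J_def A_def by (subst Bochner_Integration.integral_add[OF integrable_mult_right L2_mult_CS(1)])
            (auto intro!: L2_mult_CS(1) vfun_L2 VL1 rL \<phi>_L2)
        finally show ?thesis .
      qed
      have E: "c * of_real ((\<eta> eps - 1) / eps) + of_real (\<eta> eps) * Y - of_real (\<eta> eps) * t * cnj A * (c * A + J r) = Z"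
        using projected_equation[OF k eps0 g q eq] unfolding c_def[symmetric] Y_def[symmetric] Z_def[symmetric] t_def[symmetric] Jq .
      have ZI: "cmod (Z - cnj A * I) \<le> D * (\<rho> eps * N)"
      proof -
        note HQ = HSk_kP(3)[OF VL1 k]
        have "cnj A * I = (LBINT x. \<phi>d x * kop (kQ V \<kappa> 0) g x)"
        proof -
          have "(LBINT x. \<phi>d x * kop (kQ V \<kappa> 0) g x) = (LBINT x. \<phi>d x * of_real (ufun V x) * I)"
            by (simp add: kop_kQ I_def mult.assoc)
          also have "\<dots> = cnj A * I" by (simp only: integral_mult_left_zero \<phi>d_u)
          finally show ?thesis by simp
        qed
        then have "Z - cnj A * I = (LBINT x. \<phi>d x * kop (kQ V \<kappa> eps) g x - \<phi>d x * kop (kQ V \<kappa> 0) g x)"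
          unfolding Z_def by (simp only:) (intro Bochner_Integration.integral_diff[symmetric] L2_mult_CS(1) \<phi>d_L2 kop_L2 HQ g)
        also have "\<dots> = (LBINT x. \<phi>d x * kop (\<lambda>x y. kQ V \<kappa> eps x y - kQ V \<kappa> 0 x y) g x)"
        proof (rule integral_cong_AE)
          show "AE x in lborel. \<phi>d x * kop (kQ V \<kappa> eps) g x - \<phi>d x * kop (kQ V \<kappa> 0) g x = \<phi>d x * kop (\<lambda>x y. kQ V \<kappa> eps x y - kQ V \<kappa> 0 x y) g x"
            using kop_kernel_diff[OF HQ[of eps] HQ[of 0] g] by eventually_elim (simp add: right_diff_distrib)
        qed (use L2_meas[OF \<phi>d_L2] kop_meas[OF HQ[of eps] g] kop_meas[OF HQ[of 0] g] kop_meas[OF HSk_diff[OF HQ[of eps] HQ[of 0]] g] in simp_all)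
        finally have "cmod (Z - cnj A * I) \<le> D * L2norm (kop (\<lambda>x y. kQ V \<kappa> eps x y - kQ V \<kappa> 0 x y) g)"
          unfolding D_def by (simp only:) (intro L2_mult_CS(3) \<phi>d_L2 kop_L2 HSk_diff HQ g)
        also have "\<dots> \<le> D * (\<rho> eps * N)"
          unfolding \<rho>_def N_def by (intro mult_left_mono L2norm_kop HSk_diff HQ g nn)
        finally show ?thesis .
      qed
      have "cmod Y \<le> D * L2norm (kop (kD V \<kappa> eps) q)"
        unfolding Y_def D_def by (intro L2_mult_CS(3) \<phi>d_L2 kop_L2 HSk_kD[OF VR VL1 k eps0] q)
      also have "\<dots> \<le> D * (\<delta> eps * L2norm q)"
        unfolding \<delta>_def by (intro mult_left_mono L2norm_kop HSk_kD[OF VR VL1 k eps0] q nn)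
      also have "\<dots> \<le> D * (\<delta> eps * ((1 + \<Phi>) * S))" by (intro mult_left_mono qS nn nf)
      finally have YS: "cmod Y \<le> D * (\<delta> eps * ((1 + \<Phi>) * S))" .
      have JR: "cmod (J r) \<le> vn * (a1 eps * (N + S))"
        using J_bound[OF rL] mult_left_mono[OF rS nn(3)] by (simp add: vn_def)
      define m' where "m' = of_real ((\<eta> eps - 1) / eps) - of_real (\<eta> eps) * t * (A * cnj A)"
      have cM: "cmod (c * M - cnj A * I) \<le> a2 eps * (N + S)"
      proof -
        \<comment> \<open>\<open>E\<close> is substituted for \<open>Z\<close> so that the four
          sources of error stand apart: the coefficient, the data at the origin, the remainder
          kernel and the component \<open>r\<close>.\<close>
        have "c * M - cnj A * I = c * (M - m') + (Z - cnj A * I) + (- of_real (\<eta> eps) * Y) + of_real (\<eta> eps) * t * cnj A * J r"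
          unfolding E[symmetric] m'_def by (simp add: algebra_simps)
        also have "cmod \<dots> \<le> cmod (c * (M - m')) + cmod (Z - cnj A * I) + cmod (- of_real (\<eta> eps) * Y) + cmod (of_real (\<eta> eps) * t * cnj A * J r)"
          by (intro norm_triangle_le add_mono order_refl)
        also have "\<dots> = cmod c * \<mu> eps + cmod (Z - cnj A * I) + \<eta> eps * cmod Y + \<eta> eps * cmod t * cmod A * cmod (J r)"
          using h0 by (simp add: norm_mult \<mu>_def m'_def)
        also have "\<dots> \<le> (N + S) * \<mu> eps + D * (\<rho> eps * (N + S)) + 2 * (D * (\<delta> eps * ((1 + \<Phi>) * (N + S)))) + 2 * cmod t * cmod A * (vn * (a1 eps * (N + S)))"
        proof (intro add_mono)
          show "cmod c * \<mu> eps \<le> (N + S) * \<mu> eps" using N0 nf by (intro mult_right_mono) (auto simp: S_def)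
          show "cmod (Z - cnj A * I) \<le> D * (\<rho> eps * (N + S))"
            by (rule order_trans[OF ZI]) (use S0 nn nf[of eps] in \<open>intro mult_left_mono; simp\<close>)
          show "\<eta> eps * cmod Y \<le> 2 * (D * (\<delta> eps * ((1 + \<Phi>) * (N + S))))"
            using h2 by (intro mult_mono order_trans[OF YS] mult_left_mono) (use N0 S0 nn nf[of eps] in auto)
          show "\<eta> eps * cmod t * cmod A * cmod (J r) \<le> 2 * cmod t * cmod A * (vn * (a1 eps * (N + S)))"
            using h2 h0 JR by (intro mult_mono) auto
        qed
        also have "\<dots> = a2 eps * (N + S)" by (simp add: a2_def C2_def algebra_simps)
        finally show ?thesis .
      qed
      have I: "cmod I \<le> G * N" unfolding I_def G_def N_def by (rule Gop_bounded[OF k g])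
      have "cmod c = cmod (c * M - cnj A * I + cnj A * I) / m" using m by (simp add: norm_mult m_def)
      also have "\<dots> \<le> (a2 eps * (N + S) + C3 * N) / m"
        using cM mult_left_mono[OF I, of "cmod A"] m by (intro divide_right_mono norm_triangle_le) (auto simp: norm_mult C3_def mult.assoc)
      finally have "S \<le> C3 / m * N + (a2 eps / m + a1 eps) * (N + S)"
        using rS by (simp add: S_def add_divide_distrib algebra_simps)
      also have "\<dots> \<le> C3 / m * N + 1 / 2 * (N + S)" using sm N0 S0 by (intro add_left_mono mult_right_mono) auto
      finally have half: "S \<le> C3 / m * N + 1 / 2 * (N + S)" .
      have "s \<le> x + 1 / 2 * (n + s) ==> s \<le> 2 * x + n" for s x n :: real by argo
      from this[OF half] have "S \<le> 2 * (C3 / m * N) + N" .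
      then have SN: "S \<le> C4 * N" by (simp add: C4_def distrib_right)
      have "J q - A * cnj A * I / M = A * ((c * M - cnj A * I) / M) + J r"
        using M0 unfolding Jq by (simp add: M_def field_simps)
      also have "cmod \<dots> \<le> cmod A * (cmod (c * M - cnj A * I) / m) + cmod (J r)"
        by (rule order_trans[OF norm_triangle_ineq]) (simp add: norm_mult norm_divide m_def)
      also have "\<dots> \<le> cmod A * (a2 eps * (N + S) / m) + vn * (a1 eps * (N + S))"
        using cM JR m by (intro add_mono mult_left_mono divide_right_mono) auto
      also have "\<dots> = (cmod A * a2 eps / m + vn * a1 eps) * (N + S)" by (simp add: algebra_simps)
      also have "\<dots> \<le> (cmod A * a2 eps / m + vn * a1 eps) * ((1 + C4) * N)"
        using SN a1n a2n nn m by (intro mult_left_mono) (auto simp: algebra_simps)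
      finally have 2: "cmod (J q - A * cnj A * I / M) \<le> a eps * N" by (simp add: a_def ac_simps)
      have "L2norm q \<le> (1 + \<Phi>) * (C4 * N)" using qS mult_left_mono[OF SN, of "1 + \<Phi>"] nn by linarith
      then show ?thesis using 2 by (simp add: N_def I_def mult.assoc)
    qed
    then show "0 \<le> a eps \<and> (\<forall>g q. g \<in> L2 --> q \<in> L2 -->
     (AE y in lborel. q y + of_real (\<eta> eps) * kop (kK V (of_real eps * \<kappa>)) q y = of_real eps * kop (kQ V \<kappa> eps) g y) -->
     L2norm q \<le> ((1 + \<Phi>) * C4) * L2norm g \<and> cmod (J q - A * cnj A * Gop \<kappa> g 0 / M) \<le> a eps * L2norm g)" using an by blast
  qed
  moreover have "0 \<le> (1 + \<Phi>) * C4" using nn CC by simp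
  ultimately show ?thesis using al unfolding M_def by blast
qed

text \<open>The solution is the free one minus \<open>\<eta> eps\<close> times \<open>P q\<close>,
  and at \<open>eps = 0\<close> the operator \<open>P\<close> is the Green function times the
  functional \<open>J\<close>. The limit of \<open>J q\<close> turns this into the rank one term of
  the point interaction; what is left is the drift of \<open>P\<close> and the error
  \<open>w\<close> of the coefficient.\<close>

theorem norm_conv_resonant:
  "norm_resolvent_conv (\<lambda>eps. form_resolvent_sol (Veps \<eta> 2 V eps)) (point_resolvent_sol (- d\<eta> 1 0 / (cmod A)^2))"
  unfolding norm_resolvent_conv_def resolvents_exist_def
proof (intro conjI allI impI)
  show "\<exists>f. form_resolvent_sol (Veps \<eta> 2 V eps) lam g f" if "Im lam \<noteq> 0" "g \<in> L2" "0 < eps \<and> eps \<le> 1" for lam g eps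
    using that Veps_resolvent_exists by blast
  show "\<exists>f. point_resolvent_sol (- d\<eta> 1 0 / (cmod A)^2) lam g f" if im: "Im lam \<noteq> 0" and g: "g \<in> L2" for lam g
  proof -
    obtain f1 where f1: "free_resolvent_sol lam g f1" using free_resolvent_exists[OF im g] by blast
    show ?thesis unfolding point_resolvent_sol_def
      by (rule exI, rule exI[of _ f1], rule conjI[OF f1], rule AE_I2, rule refl)
  qed
  fix lam and e :: real assume im: "Im lam \<noteq> 0" and e: "0 < e"
  define \<kappa> where "\<kappa> = csqrt lam"
  have k: "0 < Re \<kappa>" and kim: "Im \<kappa> \<noteq> 0" using csqrt_props[OF im] by (simp_all add: \<kappa>_def)
  have AA: "A * cnj A = of_real ((cmod A)^2)" by (rule complex_norm_square[symmetric])
  have A2: "0 < (cmod A)^2" using A_nonzero by simp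
  define M where "M = Mc \<kappa>"
  \<comment> \<open>A non-real \<open>lam\<close> has a square root with non-zero imaginary part.
    This keeps \<open>M\<close>, and with it the denominator of the limiting resolvent, away from 0
    whatever the value of \<open>\<eta>'(0)\<close>.\<close>
  have "Im M = - (Im \<kappa> / (4 * pi) * (cmod A)^2)"
    unfolding M_def Mc_def AA by (simp add: Im_divide_of_real)
  then have M0: "M \<noteq> 0" using kim A2 by auto
  have den: "of_real (- d\<eta> 1 0 / (cmod A)^2) + csqrt lam / of_real (4 * pi) = - M / of_real ((cmod A)^2)"
    using A_nonzero unfolding M_def Mc_def AA \<kappa>_def[symmetric] by (simp add: field_simps)
  have Gk: "Gk lam x = Fd \<kappa> 0 x" for x by (simp add: Gk_def Fd_def \<kappa>_def mult.commute)
  obtain C a where C: "0 \<le> C" and a: "(a \<longlongrightarrow> 0) (at_right 0)" and ev: "eventually (\<lambda>eps. 0 \<le> a eps \<and> (\<forall>g q. g \<in> L2 --> q \<in> L2 -->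
     (AE y in lborel. q y + of_real (\<eta> eps) * kop (kK V (of_real eps * \<kappa>)) q y = of_real eps * kop (kQ V \<kappa> eps) g y) -->
     L2norm q \<le> C * L2norm g \<and> cmod (J q - A * cnj A * Gop \<kappa> g 0 / M) \<le> a eps * L2norm g)) (at_right 0)"
    using rescaled_limit[OF k] M0 unfolding M_def by blast
  define \<rho> where "\<rho> eps = hsn (\<lambda>x y. kP V \<kappa> eps x y - kP V \<kappa> 0 x y)" for eps
  have \<rho>: "(\<rho> \<longlongrightarrow> 0) (at_right 0)" unfolding \<rho>_def by (rule hsn_kP_diff_tendsto(1)[OF VL1 k])
  have \<rho>0: "0 \<le> \<rho> eps" for eps by (simp add: \<rho>_def)
  define G where "G = L2norm (Fd \<kappa> 0)"
  have G0: "0 \<le> G" by (simp add: G_def)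
  define b where "b eps = 2 * \<rho> eps * C + G * (2 * a eps + \<bar>\<eta> eps - 1\<bar> * ((cmod A)^2 * G / cmod M))" for eps
  have "(b \<longlongrightarrow> 2 * 0 * C + G * (2 * 0 + \<bar>1 - 1\<bar> * ((cmod A)^2 * G / cmod M))) (at_right 0)"
    unfolding b_def by (intro tendsto_intros \<rho> a eta_tendsto)
  then have small: "eventually (\<lambda>eps. b eps < e) (at_right 0)" using e by (intro order_tendstoD(2)) auto
  have eta2: "eventually (\<lambda>eps. \<eta> eps < 2) (at_right 0)" using order_tendstoD(2)[OF eta_tendsto, of 2] by simp
  have "eventually (\<lambda>eps. \<forall>g f f0. g \<in> L2 --> form_resolvent_sol (Veps \<eta> 2 V eps) lam g f -->
      point_resolvent_sol (- d\<eta> 1 0 / (cmod A)^2) lam g f0 --> L2norm (\<lambda>x. f x - f0 x) \<le> e * L2norm g) (at_right 0)"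
    using small eta2 ev eta_pos eventually_at_right_le_1
  proof (eventually_elim, intro allI impI)
    fix eps g f f0
    assume sm: "b eps < e" and h2: "\<eta> eps < 2" and ep: "0 < \<eta> eps" and eps: "0 < eps \<and> eps \<le> 1"
      and ev: "0 \<le> a eps \<and> (\<forall>g q. g \<in> L2 --> q \<in> L2 -->
       (AE y in lborel. q y + of_real (\<eta> eps) * kop (kK V (of_real eps * \<kappa>)) q y = of_real eps * kop (kQ V \<kappa> eps) g y) -->
       L2norm q \<le> C * L2norm g \<and> cmod (J q - A * cnj A * Gop \<kappa> g 0 / M) \<le> a eps * L2norm g)"
      and g: "g \<in> L2" and s: "form_resolvent_sol (Veps \<eta> 2 V eps) lam g f"
      and s0: "point_resolvent_sol (- d\<eta> 1 0 / (cmod A)^2) lam g f0"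
    have eps0: "0 < eps" using eps by simp
    have cp: "0 < cc 2 eps" using ep eps0 by (simp add: cc_def)
    define p where "p = (\<lambda>y. of_real (ufun V y) * f (eps *\<^sub>R y))"
    define q where "q = (\<lambda>y. of_real eps * p y)"
    define N where "N = L2norm g"
    define I where "I = Gop \<kappa> g 0"
    note SE = scaled_equations[OF VR cp eps0 im g s[unfolded Veps_eq], folded \<kappa>_def p_def]
    have qL: "q \<in> L2" unfolding q_def by (rule L2_cmult[OF SE(3)])
    have c2: "cc 2 eps * eps^2 = \<eta> eps" "cc 2 eps * eps^3 = \<eta> eps * eps" using cc_scale(1,2)[OF eps0, of 2] eps0 by simp_all
    have kq: "kop K q x = of_real eps * kop K p x" for K x unfolding q_def by (rule kop_cmult)
    have "AE y in lborel. q y + of_real (\<eta> eps) * kop (kK V (of_real eps * \<kappa>)) q y = of_real eps * kop (kQ V \<kappa> eps) g y"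
      using SE(2)[unfolded c2(1)]
    proof eventually_elim
      fix y assume h: "of_real (ufun V y) * f (eps *\<^sub>R y) + of_real (\<eta> eps) * kop (kK V (of_real eps * \<kappa>)) p y = kop (kQ V \<kappa> eps) g y"
      show "q y + of_real (\<eta> eps) * kop (kK V (of_real eps * \<kappa>)) q y = of_real eps * kop (kQ V \<kappa> eps) g y"
        unfolding kq h[symmetric] by (simp add: q_def p_def algebra_simps)
    qed
    with ev g qL have qC: "L2norm q \<le> C * N" and Jb: "cmod (J q - A * cnj A * I / M) \<le> a eps * N"
      by (auto simp: N_def I_def)
    obtain f1 where f1: "free_resolvent_sol lam g f1" and f0: "AE x in lborel. f0 x = f1 x + Gk lam x * integral\<^sup>L lborel (\<lambda>y. Gk lam y * g y)
        / (of_real (- d\<eta> 1 0 / (cmod A)^2) + csqrt lam / of_real (4 * pi))"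
      using s0 unfolding point_resolvent_sol_def by blast
    have Ieq: "integral\<^sup>L lborel (\<lambda>y. Gk lam y * g y) = I"
      unfolding I_def Gop_def Gk using Fd_even[of \<kappa> 0] by simp
    define w where "w = of_real (\<eta> eps) * J q - of_real ((cmod A)^2) * I / M"
    let ?d = "\<lambda>x y. kP V \<kappa> eps x y - kP V \<kappa> 0 x y"
    have Hd: "HSk ?d" by (intro HSk_diff HSk_kP(1)[OF VL1 k])
    have P0: "kop (kP V \<kappa> 0) q x = Fd \<kappa> 0 x * J q" for x
      unfolding kop_def J_def integral_mult_right_zero[symmetric] by (simp add: kP_def mult.assoc)
    have AE: "AE x in lborel. f x - f0 x = (- of_real (\<eta> eps)) * kop ?d q x - w * Fd \<kappa> 0 x"
      using SE(1) f0 free_resolvent_eq(1)[OF im g f1, folded \<kappa>_def] kop_kernel_diff[OF HSk_kP(1)[OF VL1 k, of eps] HSk_kP(1)[OF VL1 k, of 0] qL]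
    proof eventually_elim
      fix x assume 1: "f x = Gop \<kappa> g x - of_real (cc 2 eps * eps^3) * kop (kP V \<kappa> eps) p x"
        and 2: "f0 x = f1 x + Gk lam x * integral\<^sup>L lborel (\<lambda>y. Gk lam y * g y) / (of_real (- d\<eta> 1 0 / (cmod A)^2) + csqrt lam / of_real (4 * pi))"
        and 3: "f1 x = Gop \<kappa> g x" and 4: "kop ?d q x = kop (kP V \<kappa> eps) q x - kop (kP V \<kappa> 0) q x"
      have 5: "f0 x = Gop \<kappa> g x - Fd \<kappa> 0 x * (of_real ((cmod A)^2) * I / M)"
        unfolding 2 3 den Gk Ieq[unfolded Gk] by simp
      have 6: "f x = Gop \<kappa> g x - of_real (\<eta> eps) * kop (kP V \<kappa> eps) q x" unfolding 1 c2 kq by simp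
      show "f x - f0 x = (- of_real (\<eta> eps)) * kop ?d q x - w * Fd \<kappa> 0 x"
        unfolding 4 5 6 P0 w_def by (simp add: algebra_simps)
    qed
    have FL: "Fd \<kappa> 0 \<in> L2" by (rule Fd_L2[OF k])
    have rL: "(\<lambda>x. (- of_real (\<eta> eps)) * kop ?d q x - w * Fd \<kappa> 0 x) \<in> L2" by (intro L2_diff L2_cmult kop_L2 Hd qL FL)
    have I: "cmod I \<le> G * N" unfolding I_def G_def N_def by (rule Gop_bounded[OF k g])
    have "w = of_real (\<eta> eps) * (J q - A * cnj A * I / M) + of_real (\<eta> eps - 1) * (of_real ((cmod A)^2) * I / M)"
      unfolding w_def AA by (simp add: algebra_simps diff_divide_distrib)
    also have "cmod \<dots> \<le> \<eta> eps * cmod (J q - A * cnj A * I / M) + \<bar>\<eta> eps - 1\<bar> * ((cmod A)^2 * cmod I / cmod M)"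
      using ep by (intro norm_triangle_le) (simp only: norm_mult norm_divide norm_of_real, simp)
    also have "\<dots> \<le> 2 * (a eps * N) + \<bar>\<eta> eps - 1\<bar> * ((cmod A)^2 * (G * N) / cmod M)"
      using h2 Jb ep by (intro add_mono mult_mono mult_left_mono divide_right_mono I) auto
    finally have w: "cmod w \<le> 2 * (a eps * N) + \<bar>\<eta> eps - 1\<bar> * ((cmod A)^2 * (G * N) / cmod M)" .
    \<comment> \<open>\<open>f0\<close> is tied to an explicit function only almost everywhere, so
      its measurability is open and the comparison is an inequality.\<close>
    have "L2norm (\<lambda>x. f x - f0 x) \<le> L2norm (\<lambda>x. (- of_real (\<eta> eps)) * kop ?d q x - w * Fd \<kappa> 0 x)"
      by (rule L2norm_le_of_AE_eq[OF AE rL])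
    also have "\<dots> \<le> \<eta> eps * L2norm (kop ?d q) + cmod w * G"
      using L2norm_triangle_diff[OF L2_cmult[OF kop_L2[OF Hd qL]] L2_cmult[OF FL], of "- of_real (\<eta> eps)" w] ep
      unfolding L2norm_cmult G_def by simp
    also have "\<dots> \<le> 2 * (\<rho> eps * (C * N)) + (2 * (a eps * N) + \<bar>\<eta> eps - 1\<bar> * ((cmod A)^2 * (G * N) / cmod M)) * G"
    proof (intro add_mono mult_mono w)
      show "L2norm (kop ?d q) \<le> \<rho> eps * (C * N)"
        using L2norm_kop[OF Hd qL] mult_left_mono[OF qC \<rho>0[of eps]] by (simp add: \<rho>_def)
    qed (use h2 G0 ev C in \<open>auto simp: N_def\<close>)
    also have "\<dots> = b eps * N" by (simp add: b_def algebra_simps)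
    also have "\<dots> \<le> e * N" using sm by (intro mult_right_mono) (auto simp: N_def)
    finally show "L2norm (\<lambda>x. f x - f0 x) \<le> e * L2norm g" by (simp add: N_def)
  qed
  then show "\<exists>\<delta>>0. \<forall>eps. 0 < eps \<and> eps < \<delta> \<and> eps \<le> 1 --> (\<forall>g f f0. g \<in> L2 --> form_resolvent_sol (Veps \<eta> 2 V eps) lam g f -->
      point_resolvent_sol (- d\<eta> 1 0 / (cmod A)^2) lam g f0 --> L2norm (\<lambda>x. f x - f0 x) \<le> e * L2norm g)"
    by (rule eventually_at_right_0_delta)
qed

end

theorem theorem3p1:
  fixes V :: "real^3 \<Rightarrow> real" and \<sigma> :: real and \<eta> :: "real \<Rightarrow> real"
    and d\<eta> :: "nat \<Rightarrow> real \<Rightarrow> real"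
  assumes VR: "rollnik V" and VL1: "integrable lborel V"
    and eta_smooth: "smooth_01 \<eta> d\<eta>"
    and eta_nonneg: "\<forall>t\<in>{0..1}. \<eta> t \<ge> 0"
    and eta0: "\<eta> 0 = 1" and eta1: "\<eta> 1 = 1"
  shows
   "(0 \<le> \<sigma> \<and> \<sigma> \<le> 3 \<and>
     (\<sigma> = 2 \<longrightarrow> \<not> (\<exists>\<phi>. BS_eigfun V \<phi>)) \<and>
     (2 < \<sigma> \<longrightarrow> (AE x in lborel. V x > 0))
     \<longrightarrow>
     (if \<sigma> \<le> 2
      then norm_resolvent_conv (\<lambda>\<epsilon>. form_resolvent_sol (Veps \<eta> \<sigma> V \<epsilon>)) free_resolvent_sol
      else strong_resolvent_conv (\<lambda>\<epsilon>. form_resolvent_sol (Veps \<eta> \<sigma> V \<epsilon>)) free_resolvent_sol))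
    \<and>
    (\<forall>\<phi>. \<sigma> = 2 \<and> integrable lborel (\<lambda>x. (1 + norm x) * V x) \<and>
       BS_eigfun V \<phi> \<and>
       (\<forall>\<phi>'. BS_eigfun V \<phi>' \<longrightarrow> (\<exists>c. AE x in lborel. \<phi>' x = c * \<phi> x)) \<and>
       inv_lap_v V \<phi> \<in> L2loc \<and> inv_lap_v V \<phi> \<notin> L2 \<and>
       integral\<^sup>L lborel (\<lambda>x. sgn (V x) * (cmod (\<phi> x))^2) = -1
     \<longrightarrow>
     norm_resolvent_conv (\<lambda>\<epsilon>. form_resolvent_sol (Veps \<eta> \<sigma> V \<epsilon>))
       (point_resolvent_sol
          (- d\<eta> 1 0 / (cmod (integral\<^sup>L lborel (\<lambda>x. of_real (V x) * inv_lap_v V \<phi> x)))^2)))"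
proof (intro conjI impI allI)
  interpret scaled_potential V \<eta> d\<eta>
    by unfold_locales (use VR VL1 eta_smooth eta_nonneg eta0 in auto)
  assume h: "0 \<le> \<sigma> \<and> \<sigma> \<le> 3 \<and> (\<sigma> = 2 --> \<not> (\<exists>\<phi>. BS_eigfun V \<phi>)) \<and> (2 < \<sigma> --> (AE x in lborel. V x > 0))"
  consider "\<sigma> < 2" | "\<sigma> = 2" | "2 < \<sigma>" by linarith
  then show "if \<sigma> \<le> 2 then norm_resolvent_conv (\<lambda>eps. form_resolvent_sol (Veps \<eta> \<sigma> V eps)) free_resolvent_sol
      else strong_resolvent_conv (\<lambda>eps. form_resolvent_sol (Veps \<eta> \<sigma> V eps)) free_resolvent_sol"
  proof cases
    case 1
    then show ?thesis using norm_conv_subcritical by simp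
  next
    case 2
    then show ?thesis using norm_conv_nonresonant h by simp
  next
    case 3
    then show ?thesis using strong_conv h by simp
  qed
next
  fix \<phi>
  assume h: "\<sigma> = 2 \<and> integrable lborel (\<lambda>x. (1 + norm x) * V x) \<and> BS_eigfun V \<phi> \<and>
       (\<forall>\<phi>'. BS_eigfun V \<phi>' --> (\<exists>c. AE x in lborel. \<phi>' x = c * \<phi> x)) \<and>
       inv_lap_v V \<phi> \<in> L2loc \<and> inv_lap_v V \<phi> \<notin> L2 \<and>
       integral\<^sup>L lborel (\<lambda>x. sgn (V x) * (cmod (\<phi> x))^2) = -1"
  interpret resonance V \<eta> d\<eta> \<phi>
    by unfold_locales (use VR VL1 eta_smooth eta_nonneg eta0 h in auto)
  \<comment> \<open>The integral of \<open>V \<psi>\<close> is \<open>- A\<close>, and the coupling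
    constant contains its modulus only.\<close>
  show "norm_resolvent_conv (\<lambda>eps. form_resolvent_sol (Veps \<eta> \<sigma> V eps))
       (point_resolvent_sol (- d\<eta> 1 0 / (cmod (integral\<^sup>L lborel (\<lambda>x. of_real (V x) * inv_lap_v V \<phi> x)))^2))"
    using norm_conv_resonant h by (simp add: integral_V_\<psi>)
qed

end
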